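(* For any $0<c_0<\delta\le1$ there exists a constant $c_1>0$ (depending only on $c_0,\delta$) such that the following holds. Let $n\ge1$ be an integer, let $Q\in M_n(\mathbb R)$ be a bistochastic matrix with $d\ge2$, let $\sigma$ be a uniformly distributed random permutation in $\mathbb S_n$ with permutation matrix $M$, and let $P=MQ$. Then for any integer $\ell\ge1$, $$\mathbb P\Big(\|(P^\ell)_{|\mathbf 1^\perp}\|\ge e^{c_1\sqrt{\log n}}\rho^\ell\Big)\le d^{\,\ell+50\sqrt{\log n}}\,n^{-c_0}.$$
   Context: $[n]=\{1,\dots,n\}$ and $\mathbf 1=(1,\dots,1)\in\mathbb R^n$. A matrix is bistochastic if its entries are non-negative and all its row sums and column sums equal $1$. The permutation matrix of $\sigma$ is $M_{xy}=1$ if $\sigma(x)=y$ and $0$ otherwise. The norm on the orthogonal complement of $\mathbf 1$ is $$\|(P^\ell)_{|\mathbf 1^\perp}\|=\max_{v\ne0,\ \langle v,\mathbf 1\rangle=0}\frac{\|P^\ell v\|_2}{\|v\|_2}.$$ For $A\in M_n(\mathbb C)$: $\|A\|_{\mathrm{HS}}=\sqrt{\frac1n\sum_{x,y}|A_{xy}|^2}$; for $0<\delta\le1$, $\|A\|^{(\delta)}_{1\to\infty}=\inf_{\mathcal E\subset[n],|\mathcal E|<n^{1-\delta}}\max_{x\notin\mathcal E,\,y}|A_{yx}|$; $\|A\|_{1\to0}=\max_x|\{y:A_{xy}\ne0\}|$. Set $d=\|Q^\intercal Q\|_{1\to0}$ and $\rho=\max(\|Q\|_{\mathrm{HS}},\|Q\|^{(\delta)}_{1\to\infty})$.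 *)

theory Defs
  imports "HOL-Probability.Probability" "Jordan_Normal_Form.Matrix"
begin

no_notation vec_nth (infixl \<open>$\<close> 90)
no_notation inner (infix \<open>\<bullet>\<close> 70)

(* The dimension n varies inside the statement, so M_n is the carrier carrier_mat n n, with
   indices 0, ..., n - 1 in place of 1, ..., n. *)

definition bistochastic :: "real mat \<Rightarrow> bool" where
  "bistochastic A \<longleftrightarrow>
     square_mat A \<and>
     (\<forall>x<dim_row A. \<forall>y<dim_row A. 0 \<le> A $$ (x, y)) \<and>
     (\<forall>x<dim_row A. (\<Sum>y<dim_row A. A $$ (x, y)) = 1) \<and>
     (\<forall>y<dim_row A. (\<Sum>x<dim_row A. A $$ (x, y)) = 1)"

definition perm_mat :: "nat \<Rightarrow> (nat \<Rightarrow> nat) \<Rightarrow> real mat" where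
  "perm_mat n \<sigma> = mat n n (\<lambda>(x, y). if \<sigma> x = y then 1 else 0)"

definition norm2 :: "real vec \<Rightarrow> real" where
  "norm2 v = L2_set (\<lambda>i. v $ i) {..<dim_vec v}"

definition ones :: "nat \<Rightarrow> real vec" where
  "ones n = vec n (\<lambda>_. 1)"

(* The norm of a square matrix A restricted to the orthogonal complement of the vector ones.  In
   dimension at least 2 the set is nonempty and the supremum is attained, hence it is the maximum;
   in dimension 1 the complement is zero and there is nothing to maximise over. *)
definition norm_ones_perp :: "real mat \<Rightarrow> real" where
  "norm_ones_perp A =
     Sup {norm2 (A *\<^sub>v v) / norm2 v | v.
            v \<in> carrier_vec (dim_row A) \<and> v \<noteq> 0\<^sub>v (dim_row A) \<and> v \<bullet> ones (dim_row A) = 0}"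

(* The three norms below are for square matrices of positive dimension, over any normed space of
   entries (real and complex in particular). *)

definition hs_norm :: "'a::real_normed_vector mat \<Rightarrow> real" where
  "hs_norm A =
     sqrt (1 / real (dim_row A) * (\<Sum>x<dim_row A. \<Sum>y<dim_row A. (norm (A $$ (x, y)))\<^sup>2))"

(* For 0 < \<delta> every admissible E satisfies card E < n, so the maximum is over a nonempty set; E = {}
   is always admissible, and the infimum is over a finite nonempty set. *)
definition norm_1_to_inf :: "real \<Rightarrow> 'a::real_normed_vector mat \<Rightarrow> real" where
  "norm_1_to_inf \<delta> A =
     Inf {Max {norm (A $$ (y, x)) | x y. x \<in> {..<dim_row A} - E \<and> y \<in> {..<dim_row A}} | E.
            E \<subseteq> {..<dim_row A} \<and> real (card E) < real (dim_row A) powr (1 - \<delta>)}"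

definition norm_1_to_0 :: "'a::zero mat \<Rightarrow> nat" where
  "norm_1_to_0 A =
     Max {card {y. y < dim_row A \<and> A $$ (x, y) \<noteq> 0} | x. x < dim_row A}"

end

theory Submission
 imports Defs "HOL-Real_Asymp.Real_Asymp"
begin

text \<open>
 Write \<open>P\<close> for the random matrix, \<open>J/n\<close> for the projection on constants, and let \<open>L\<close> be a small
 multiple of \<open>log n / log d\<close>. Since \<open>\<rho> \<ge> d powr (-1/2)\<close>, the bound is trivial unless \<open>l\<close> is at most a
 constant times \<open>L\<close>; cutting \<open>P^l\<close> into blocks of length at most \<open>L\<close>, it suffices to bound
 \<open>P^s - J/n\<close> by \<open>exp (c sqrt (log n)) \<rho>^s\<close> for all \<open>s \<le> L\<close> simultaneously, with probability
 \<open>1 - n powr (-c0)\<close>. Let \<open>E\<close> be an exceptional set that attains the \<open>1 \<rightarrow> \<infinity>\<close> norm.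

 The paths of length \<open>s\<close> that are simple and avoid \<open>E\<close> give, after centring each permutation entry by
 \<open>1/n\<close>, a matrix whose norm is controlled by a trace moment of order about \<open>sqrt (log n)\<close>: an expected
 product of centred entries is small for every entry that occurs only once, and the remaining label
 patterns are encoded by few changes. The error of the centring is positive and has small expected
 mass, so its Frobenius norm is negligible.

 Non-simple paths are recovered deterministically. With high probability there are no two cycles close
 to each other (no tangle), so a non-simple path that avoids \<open>E\<close> is a simple path, a loop determined by
 its base point and length, and a simple path; the base points form a small set, on which \<open>J/n\<close> is
 small. With high probability no short cycle meets \<open>E\<close> and no short simple path visits \<open>E\<close> more than a
 constant number of times, so splitting at the visits to \<open>E\<close> costs only a constant number of factors.
\<close>

section \<open>Label patterns of a family of walks\<close>

text \<open>The obstacle is that \<open>\<rho>\<close> bounds entries of \<open>Q\<close> only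
  outside \<open>E\<close>, and all of them only in mean square. In the moment, a generic link used
  once is therefore summed with the total mass \<open>n\<close> of \<open>Q\<close>, one used more
  often with the sum of squares. The factor \<open>\<rho>\<close> that a link of the first kind does
  not give is supplied by the centring, since the position that leads to it is used once too. Only
  simple paths are centred: a piece without repeated labels changes its behaviour in the pattern
  graph a bounded number of times per independent cycle, which keeps the number of codes small. With
  \<open>4 * m\<close> pieces and \<open>m\<close> about sqrt (log n), the codes and the fixed power
  of \<open>n\<close> cost exp (O (sqrt (log n))) after a root of order \<open>4 * m\<close>, while
  each independent cycle still gains a factor 1/2. Visits to \<open>E\<close> and blocks of
  \<open>P^l\<close> cost factors of the same size, and both are bounded in number. The term
  \<open>50 * sqrt (ln n)\<close> in the exponent of \<open>d\<close> is what allows assuming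
  \<open>ln d \<le> sqrt (ln n)\<close>.\<close>

lemma card_fibre_sum:
 assumes "finite A" "finite B" "f ` A \<subseteq> B"
 shows "card A = (\<Sum>b\<in>B. card {a\<in>A. f a = b})"
 using sum.group[OF assms, of "\<lambda>_. 1::nat"] by simp

text \<open>Fibrewise: a fibre of size 1 contributes nothing, and one of size
  \<open>k \<ge> 2\<close> contributes \<open>k \<le> 2 * (k - 1)\<close>.\<close>

lemma card_collisions_le:
 assumes "finite F"
 shows "card {x\<in>F. \<exists>y\<in>F. y \<noteq> x \<and> h y = h x} + 2 * card (h ` F) \<le> 2 * card F"
proof -
 let ?fib = "\<lambda>b. {x\<in>F. h x = b}"
 let ?S = "{x\<in>F. \<exists>y\<in>F. y \<noteq> x \<and> h y = h x}"
 have 1: "card F = (\<Sum>b\<in>h`F. card (?fib b))"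
  using assms by (intro card_fibre_sum) auto
 have 2: "card ?S = (\<Sum>b\<in>h`F. card {x\<in>?S. h x = b})"
  using assms by (intro card_fibre_sum) auto
 have 3: "card {x\<in>?S. h x = b} + 2 \<le> 2 * card (?fib b)" if b: "b \<in> h`F" for b
 proof -
  from b obtain x where x: "x \<in> F" "h x = b" by auto
  have fin: "finite (?fib b)" using assms by auto
  have pos: "card (?fib b) \<ge> 1" using x fin by (metis (mono_tags, lifting) card_0_eq empty_iff less_one mem_Collect_eq not_le)
  show ?thesis
  proof (cases "card (?fib b) \<ge> 2")
   case True
   have "card {x\<in>?S. h x = b} \<le> card (?fib b)" using fin by (intro card_mono) auto
   with True show ?thesis by linarith
  next
   case False
   with pos have "card (?fib b) = 1" by linarith
   then obtain z where z: "?fib b = {z}" using card_1_singletonE by blast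
   have "{x\<in>?S. h x = b} = {}"
   proof (intro equals0I)
    fix v assume v: "v \<in> {x\<in>?S. h x = b}"
    then obtain y where y: "y \<in> F" "y \<noteq> v" "h y = h v" by auto
    have "v \<in> ?fib b" "y \<in> ?fib b" using v y by auto
    then show False using z y by auto
   qed
   then show ?thesis using pos by (simp only: card.empty)
  qed
 qed
 have "card ?S + 2 * card (h`F) = (\<Sum>b\<in>h`F. card {x\<in>?S. h x = b} + 2)"
  unfolding 2 by (simp only: sum.distrib sum_constant) simp
 also have "\<dots> \<le> (\<Sum>b\<in>h`F. 2 * card (?fib b))" using 3 by (intro sum_mono) auto
 also have "\<dots> = 2 * card F" by (simp add: 1 sum_distrib_left)
 finally show ?thesis .
qed

text \<open>Draw \<open>q\<close> times, each time an element of \<open>A\<close> or nothing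
  (\<open>None\<close>).\<close>

lemma card_small_subsets_le:
 assumes "finite A"
 shows "card {S. S \<subseteq> A \<and> card S \<le> q} \<le> (card A + 1) ^ q"
proof (induction q)
 case 0
 have "{S. S \<subseteq> A \<and> card S \<le> 0} \<subseteq> {{}}"
  using assms by (auto dest: finite_subset)
 then have "card {S. S \<subseteq> A \<and> card S \<le> 0} \<le> card {{} :: 'a set}" by (intro card_mono) auto
 then show ?case by simp
next
 case (Suc q)
 let ?P = "\<lambda>q. {S. S \<subseteq> A \<and> card S \<le> q}"
 let ?f = "\<lambda>(S, x). case x of None \<Rightarrow> S | Some a \<Rightarrow> insert a S"
 have fin: "finite (?P q)" using assms by auto
 have "?P (Suc q) \<subseteq> ?f ` (?P q \<times> (insert None (Some ` A)))"
 proof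
  fix S assume S: "S \<in> ?P (Suc q)"
  show "S \<in> ?f ` (?P q \<times> (insert None (Some ` A)))"
  proof (cases "card S \<le> q")
   case True
   then show ?thesis using S by (intro image_eqI[of _ _ "(S, None)"]) auto
  next
   case False
   then have "card S = Suc q" using S by auto
   then obtain a where a: "a \<in> S" by fastforce
   have fS: "finite S" using S assms finite_subset by auto
   have "card (S - {a}) = q" using a fS \<open>card S = Suc q\<close> by simp
   then show ?thesis using S a by (intro image_eqI[of _ _ "(S - {a}, Some a)"]) auto
  qed
 qed
 then have "card (?P (Suc q)) \<le> card (?P q \<times> (insert None (Some ` A)))"
  using fin assms by (meson card_image_le card_mono dual_order.trans finite_SigmaI finite_imageI finite_insert)
 also have "\<dots> = card (?P q) * (card A + 1)"
  using assms by (simp add: card_cartesian_product card_image)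
 also have "\<dots> \<le> (card A + 1) ^ q * (card A + 1)" using Suc by (intro mult_right_mono) auto
 finally show ?case by (simp only: power_Suc mult.commute)
qed

lemma least_eq_iff:
 fixes R :: "(nat \<times> nat) set"
 assumes "equiv UNIV R"
 shows "(LEAST j. (i, j) \<in> R) = (LEAST j. (i', j) \<in> R) \<longleftrightarrow> (i, i') \<in> R"
proof
 have r: "(i, i) \<in> R" for i using assms by (meson UNIV_I equivE refl_onD)
 have s: "(i, j) \<in> R \<Longrightarrow> (j, i) \<in> R" for i j using assms by (meson equivE symD)
 have t: "(i, j) \<in> R \<Longrightarrow> (j, k) \<in> R \<Longrightarrow> (i, k) \<in> R" for i j k using assms by (meson equivE transD)
 have l: "(i, LEAST j. (i, j) \<in> R) \<in> R" for i using LeastI[of "\<lambda>j. (i,j) \<in> R", OF r] .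
 {
  assume "(LEAST j. (i, j) \<in> R) = (LEAST j. (i', j) \<in> R)"
  then show "(i, i') \<in> R" using l[of i] l[of i'] s t by metis
 }
 {
  assume "(i, i') \<in> R"
  then have "(i, j) \<in> R \<longleftrightarrow> (i', j) \<in> R" for j using s t by blast
  then show "(LEAST j. (i, j) \<in> R) = (LEAST j. (i', j) \<in> R)" by simp
 }
qed

section \<open>The pattern graph of a walk and its code\<close>

locale walk =
 fixes T s b :: nat and e :: "nat \<Rightarrow> nat \<times> nat"
 assumes T_eq: "T = b * s" and s_pos: "0 < s"
  and piece_inj: "\<And>t u. t < T \<Longrightarrow> u < T \<Longrightarrow> t div s = u div s \<Longrightarrow> t \<noteq> u \<Longrightarrow>
     fst (e t) \<noteq> fst (e u) \<and> snd (e t) \<noteq> snd (e u)"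
begin

text \<open>Positions \<open>2 * t\<close> and \<open>2 * t + 1\<close> are the two ends of step
  \<open>t\<close> in the order of traversal. The flag keeps second coordinates of
  \<open>e t\<close> apart from first ones. The direction of traversal alternates from piece to
  piece, whence the parity of \<open>k div 2 div s\<close>.\<close>

definition lab :: "nat \<Rightarrow> bool \<times> nat" where
 "lab k = (if even (k div 2 div s) = even k then (True, snd (e (k div 2))) else (False, fst (e (k div 2))))"

definition eqr :: "(nat \<times> nat) set" where
 "eqr = {(k, l). k = l \<or> (k < 2 * T \<and> l < 2 * T \<and> lab k = lab l)}"

definition lnk :: "(nat \<times> nat) set" where
 "lnk = {(2 * t + 1, 2 * t + 2) | t. Suc t < T}"

text \<open>The classes of \<open>conn\<close> are the vertices of the pattern graph, and the
  distinct values of \<open>e\<close> are its edges. The end of a step and the beginning of the next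
  one lie in the same vertex even where their labels differ.\<close>

definition conn :: "(nat \<times> nat) set" where
 "conn = (eqr \<union> lnk \<union> lnk\<inverse>)\<^sup>*"

definition lid :: "nat \<Rightarrow> nat" where "lid k = (LEAST l. (k, l) \<in> eqr)"
definition nd :: "nat \<Rightarrow> nat" where "nd k = (LEAST l. (k, l) \<in> conn)"

text \<open>The steps that discover a vertex span a tree with root 0. Every other step follows a
  tree edge towards the root (\<open>upw\<close>), follows it again away from the root
  (\<open>dnw\<close>), or uses an edge outside the tree (\<open>exc\<close>).\<close>

definition free :: "nat \<Rightarrow> bool" where "free t \<longleftrightarrow> nd (2 * t + 1) = 2 * t + 1"
definition old :: "nat \<Rightarrow> nat \<Rightarrow> bool" where "old t u \<longleftrightarrow> u < t \<and> free u \<and> e t = e u"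
definition upw :: "nat \<Rightarrow> bool" where
 "upw t \<longleftrightarrow> \<not> free t \<and> (\<exists>u. old t u \<and> lab (2 * t) = lab (2 * u + 1))"
definition dnw :: "nat \<Rightarrow> bool" where
 "dnw t \<longleftrightarrow> \<not> free t \<and> \<not> upw t \<and> (\<exists>u. old t u)"
definition exc :: "nat \<Rightarrow> bool" where
 "exc t \<longleftrightarrow> \<not> free t \<and> (\<nexists>u. old t u)"

definition inter :: "nat \<Rightarrow> bool" where "inter t \<longleftrightarrow> Suc t < T \<and> Suc t div s = t div s"

text \<open>A descent in a tree is determined by its last vertex. Recording that vertex
  (\<open>wend\<close>) instead of the single steps keeps the code constant along the
  descent.\<close>

definition run :: "nat \<Rightarrow> nat set" where
 "run t = {u. t \<le> u \<and> u < T \<and> u div s = t div s \<and> (\<forall>v\<in>{t..u}. dnw v)}"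
definition wend :: "nat \<Rightarrow> nat" where "wend t = nd (2 * Max (run t) + 1)"

text \<open>An ascent needs no data, because the edge to the parent is unique. A free step says
  whether its first label is new (0) or which earlier label it repeats, shifted by
  \<open>Suc\<close>; its other end is new anyway. An excess step records everything.\<close>

definition code :: "nat \<Rightarrow> nat \<times> nat \<times> nat \<times> nat" where
 "code t = (if free t then (3, (if lid (2 * t) = 2 * t then 0 else Suc (lid (2 * t))), 0, 0)
      else if upw t then (1, 0, 0, 0)
      else if dnw t then (2, wend t, 0, 0)
      else (0, lid (2 * t), lid (2 * t + 1), nd (2 * t + 1)))"

definition codes :: "(nat \<times> (nat \<times> nat \<times> nat \<times> nat)) set" where
 "codes = {(t, code t) | t. t < T \<and> (t mod s = 0 \<or> code t \<noteq> code (t - 1))}"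

definition xedges :: "(nat \<times> nat) set" where "xedges = e ` {t. t < T \<and> exc t}"

lemma equiv_eqr: "equiv UNIV eqr"
 unfolding equiv_def refl_on_def sym_def trans_def eqr_def by auto

lemma equiv_conn: "equiv UNIV conn"
proof -
 have "sym (eqr \<union> lnk \<union> lnk\<inverse>)" using equiv_eqr unfolding equiv_def sym_def by auto
 then have "sym conn" unfolding conn_def by (rule sym_rtrancl)
 then show ?thesis unfolding equiv_def conn_def using refl_rtrancl trans_rtrancl by auto
qed

lemma lid_eq_iff: "lid k = lid l \<longleftrightarrow> (k, l) \<in> eqr"
 unfolding lid_def by (rule least_eq_iff[OF equiv_eqr])

lemma nd_eq_iff: "nd k = nd l \<longleftrightarrow> (k, l) \<in> conn"
 unfolding nd_def by (rule least_eq_iff[OF equiv_conn])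

lemma lid_eq_lab: "k < 2 * T \<Longrightarrow> l < 2 * T \<Longrightarrow> lid k = lid l \<longleftrightarrow> lab k = lab l"
 unfolding lid_eq_iff eqr_def by auto

lemma lid_in: "(k, lid k) \<in> eqr"
 unfolding lid_def by (rule LeastI[of _ k]) (simp add: eqr_def)

lemma lid_le: "lid k \<le> k"
 unfolding lid_def by (rule Least_le) (simp add: eqr_def)

lemma nd_in: "(k, nd k) \<in> conn"
 unfolding nd_def by (rule LeastI[of _ k]) (simp add: conn_def)

lemma nd_le: "nd k \<le> k"
 unfolding nd_def by (rule Least_le) (simp add: conn_def)

lemma nd_nd [simp]: "nd (nd k) = nd k"
 using nd_in nd_eq_iff by metis

lemma lid_lid [simp]: "lid (lid k) = lid k"
 using lid_in lid_eq_iff by metis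

lemma lab_lid [simp]: "k < 2 * T \<Longrightarrow> lab (lid k) = lab k"
 using lid_in[of k] unfolding eqr_def by auto

lemma nd_lid [simp]: "nd (lid k) = nd k"
proof -
 have "(k, lid k) \<in> conn" using lid_in unfolding conn_def by blast
 then show ?thesis using nd_eq_iff by metis
qed

lemma nd_le_lid: "nd k \<le> lid k"
 using nd_le[of "lid k"] by simp

lemma nd_cong_lab: "k < 2 * T \<Longrightarrow> l < 2 * T \<Longrightarrow> lab k = lab l \<Longrightarrow> nd k = nd l"
 using lid_eq_lab nd_lid by metis

lemma nd_link: "Suc t < T \<Longrightarrow> nd (2 * t + 1) = nd (2 * t + 2)"
 unfolding nd_eq_iff conn_def lnk_def by (rule r_into_rtrancl) auto

lemma nd_even: "0 < t \<Longrightarrow> t < T \<Longrightarrow> nd (2 * t) = nd (2 * (t - 1) + 1)"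
 using nd_link[of "t - 1"] by (cases t) auto

lemma nd_0 [simp]: "nd 0 = 0" using nd_le[of 0] by simp

text \<open>An even position \<open>2 * u\<close> with \<open>0 < u\<close> is linked to the earlier
  end of step \<open>u - 1\<close>, so 0 is the only even representative.\<close>

lemma nd_cases:
 assumes "k < 2 * T"
 obtains "nd k = 0" | u where "nd k = 2 * u + 1" "u < T" "free u"
proof -
 let ?c = "nd k"
 have c: "nd ?c = ?c" "?c < 2 * T" using assms nd_le[of k] by auto
 show thesis
 proof (cases "even ?c")
  case True
  then obtain u where u: "?c = 2 * u" by blast
  show thesis
  proof (cases "u = 0")
   case True then show thesis using u that(1) by simp
  next
   case False
   then have "nd ?c = nd (2 * (u - 1) + 1)" using u c nd_even[of u] by simp
   also have "\<dots> \<le> 2 * (u - 1) + 1" by (rule nd_le)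
   also have "\<dots> < ?c" using False u by auto
   finally show thesis using c by simp
  qed
 next
  case False
  then obtain u where "?c = 2 * u + 1" using oddE by blast
  then show thesis using that(2)[of u] c unfolding free_def by auto
 qed
qed

lemma lab_even: "lab (2 * t) = (if even (t div s) then (True, snd (e t)) else (False, fst (e t)))"
 unfolding lab_def by simp
lemma lab_odd: "lab (2 * t + 1) = (if even (t div s) then (False, fst (e t)) else (True, snd (e t)))"
 unfolding lab_def by simp

lemma e_eq_straight:
 "even (t div s) = even (u div s) \<Longrightarrow> e t = e u \<longleftrightarrow> lab (2 * t) = lab (2 * u) \<and> lab (2 * t + 1) = lab (2 * u + 1)"
 unfolding lab_even lab_odd by (auto simp: prod_eq_iff)
lemma e_eq_cross:
 "even (t div s) \<noteq> even (u div s) \<Longrightarrow> e t = e u \<longleftrightarrow> lab (2 * t) = lab (2 * u + 1) \<and> lab (2 * t + 1) = lab (2 * u)"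
 unfolding lab_even lab_odd by (auto simp: prod_eq_iff)

lemma inter_types: "inter t \<Longrightarrow> fst (lab (2 * t + 1)) \<noteq> fst (lab (2 * t + 2))"
 using lab_odd[of t] lab_even[of "Suc t"] unfolding inter_def by auto

lemma upwD:
 assumes "upw t" "t < T"
 obtains u where "u < t" "free u" "nd (2 * t) = 2 * u + 1" "e t = e u"
  "lab (2 * t) = lab (2 * u + 1)" "lab (2 * t + 1) = lab (2 * u)" "nd (2 * t + 1) = nd (2 * u)"
proof -
 from assms obtain u where u: "u < t" "free u" "e t = e u" "lab (2 * t) = lab (2 * u + 1)"
  unfolding upw_def old_def by auto
 have par: "even (t div s) \<noteq> even (u div s)"
  using u(4) unfolding lab_even lab_odd by (auto split: if_splits)
 then have l: "lab (2 * t + 1) = lab (2 * u)" using e_eq_cross u by blast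
 have "nd (2 * t) = nd (2 * u + 1)" using nd_cong_lab u assms by simp
 then have "nd (2 * t) = 2 * u + 1" using u unfolding free_def by simp
 moreover have "nd (2 * t + 1) = nd (2 * u)" using nd_cong_lab[OF _ _ l] u assms by simp
 ultimately show thesis using that u l by blast
qed

lemma dnwD:
 assumes "dnw t" "t < T"
 obtains u where "u < t" "free u" "nd (2 * t + 1) = 2 * u + 1" "e t = e u"
  "lab (2 * t) = lab (2 * u)" "lab (2 * t + 1) = lab (2 * u + 1)" "nd (2 * t) = nd (2 * u)"
proof -
 from assms obtain u where u: "u < t" "free u" "e t = e u" "lab (2 * t) \<noteq> lab (2 * u + 1)"
  unfolding dnw_def upw_def old_def by auto
 have par: "even (t div s) = even (u div s)"
  using u e_eq_cross by blast
 then have l: "lab (2 * t) = lab (2 * u)" "lab (2 * t + 1) = lab (2 * u + 1)" using e_eq_straight u by blast+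
 have "nd (2 * t + 1) = nd (2 * u + 1)" using nd_cong_lab[OF _ _ l(2)] u assms by simp
 then have "nd (2 * t + 1) = 2 * u + 1" using u unfolding free_def by simp
 moreover have "nd (2 * t) = nd (2 * u)" using nd_cong_lab[OF _ _ l(1)] u assms by simp
 ultimately show thesis using that u l by blast
qed

lemma step_cases:
 obtains "free t" "\<not> upw t" "\<not> dnw t" "\<not> exc t" | "upw t" "\<not> free t" "\<not> dnw t" "\<not> exc t"
 | "dnw t" "\<not> free t" "\<not> upw t" "\<not> exc t" | "exc t" "\<not> free t" "\<not> upw t" "\<not> dnw t"
 unfolding upw_def dnw_def exc_def by blast

lemma runD: "u \<in> run t \<Longrightarrow> t \<le> u \<and> u < T \<and> dnw u \<and> (\<forall>v. t \<le> v \<longrightarrow> v \<le> u \<longrightarrow> dnw v)"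
 unfolding run_def by auto

lemma run_props:
 assumes "dnw t" "t < T"
 shows "finite (run t)" "t \<in> run t" "Max (run t) \<in> run t" "t \<le> Max (run t)"
proof -
 show f: "finite (run t)" unfolding run_def by (rule finite_subset[of _ "{..<T}"]) auto
 show t: "t \<in> run t" using assms unfolding run_def by auto
 show "Max (run t) \<in> run t" using f t Max_in by blast
 show "t \<le> Max (run t)" using f t by simp
qed

lemma wend_Suc:
 assumes "dnw t" "dnw (Suc t)" "Suc t < T" "Suc t div s = t div s"
 shows "wend (Suc t) = wend t"
proof -
 have sub: "run (Suc t) \<subseteq> run t"
  using assms unfolding run_def by (auto simp: le_Suc_eq atLeastAtMost_insertL[symmetric])
 have "Max (run t) = Max (run (Suc t))"
 proof (rule antisym)
  have st: "Suc t \<in> run (Suc t)" "finite (run (Suc t))" using run_props assms by auto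
  then have "Suc t \<in> run t" using sub by auto
  then have "Suc t \<le> Max (run t)" using run_props[of t] assms by simp
  moreover have "Max (run t) \<in> run t" using run_props[of t] assms by simp
  moreover have "u \<in> run (Suc t)" if "u \<in> run t" "Suc t \<le> u" for u
   using that assms(4) unfolding run_def by auto
  ultimately have "Max (run t) \<in> run (Suc t)" by blast
  then show "Max (run t) \<le> Max (run (Suc t))" using st by simp
  show "Max (run (Suc t)) \<le> Max (run t)"
   using sub st run_props[of t] assms by (intro Max_mono) auto
 qed
 then show ?thesis unfolding wend_def by simp
qed

text \<open>A node other than the root is entered for the first time by a free step; the node this
 step started from is its parent.\<close>

definition par :: "nat \<Rightarrow> nat" where "par c = (if c = 0 then 0 else nd (c - 1))"

lemma par_less: "c \<noteq> 0 \<Longrightarrow> par c < c"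
 unfolding par_def using nd_le[of "c - 1"] by auto

lemma par_le: "par c \<le> c"
 using par_less[of c] unfolding par_def by (cases "c = 0") auto

lemma dnw_par:
 assumes "dnw t" "t < T"
 shows "par (nd (2 * t + 1)) = nd (2 * t)" "nd (2 * t + 1) \<noteq> 0"
 using dnwD[OF assms] unfolding par_def by (metis add_diff_cancel_right' add_is_0 one_neq_zero)+

lemma run_chain:
 assumes "dnw t" "t < T" "u \<in> run t"
 shows "\<exists>i. (par ^^ i) (nd (2 * u + 1)) = nd (2 * t + 1)"
proof -
 have "t \<le> u" using assms unfolding run_def by auto
 then show ?thesis using assms(3)
 proof (induction u rule: dec_induct)
  case base
  show ?case by (rule exI[of _ 0]) simp
 next
  case (step u)
  have u: "u \<in> run t"
  proof -
   have "u div s = t div s"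
    using step.hyps step.prems div_le_mono[of t u s] div_le_mono[of u "Suc u" s] unfolding run_def by simp
   then show ?thesis using step.hyps step.prems unfolding run_def by simp
  qed
  then obtain i where i: "(par ^^ i) (nd (2 * u + 1)) = nd (2 * t + 1)" using step.IH by blast
  have su: "dnw (Suc u)" "Suc u < T" using step.hyps step.prems unfolding run_def by simp_all
  have "par (nd (2 * Suc u + 1)) = nd (2 * u + 1)"
   using dnw_par(1)[OF su] nd_link[of u] su by simp
  then have "(par ^^ Suc i) (nd (2 * Suc u + 1)) = nd (2 * t + 1)"
   using i by (simp only: funpow_Suc_right o_def)
  then show ?case by blast
 qed
qed

text \<open>All steps of a run are descents, so its last vertex was discovered before the run began.
  Hence \<open>wend\<close> refers to a part of the pattern that is already known when the code is
  decoded.\<close>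

lemma wend_props:
 assumes "dnw t" "t < T"
 shows "\<exists>i. (par ^^ i) (wend t) = nd (2 * t + 1)" "wend t < 2 * t"
proof -
 let ?u = "Max (run t)"
 have u: "?u \<in> run t" using run_props assms by blast
 show "\<exists>i. (par ^^ i) (wend t) = nd (2 * t + 1)" unfolding wend_def using run_chain[OF assms u] .
 have "dnw ?u" "?u < T" using runD[OF u] by blast+
 then obtain v where v: "v < ?u" "free v" "nd (2 * ?u + 1) = 2 * v + 1" using dnwD by metis
 have "\<not> (t \<le> v)"
 proof
  assume "t \<le> v"
  then have "dnw v" using v(1) runD[OF u] by simp
  then show False using v unfolding dnw_def by simp
 qed
 then show "wend t < 2 * t" unfolding wend_def using v by simp
qed

text \<open>Both nodes are ancestors of \<open>w\<close>, so one is an ancestor of the other.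
  Parents strictly decrease, so a proper ancestor cannot have the same parent.\<close>

lemma chain_unique:
 assumes "(par ^^ i) w = z" "(par ^^ j) w = z'" "par z = par z'" "z \<noteq> 0" "z' \<noteq> 0"
 shows "z = z'"
proof -
 have aux: "z = z'" if h: "i \<le> j" "(par ^^ i) w = z" "(par ^^ j) w = z'" "par z = par z'" "z \<noteq> 0" "z' \<noteq> 0"
  for i j z z'
 proof (cases "i = j")
  case False
  then obtain k where k: "j = Suc k + i" using h(1) by (metis Suc_diff_Suc add.commute le_add_diff_inverse nat_less_le add_Suc)
  have mono: "(par ^^ k) c \<le> c" for k c
  proof (induction k)
   case (Suc k)
   then show ?case using par_le[of "(par ^^ k) c"] by simp
  qed simp
  have "z' = (par ^^ k) (par z)" using h k by (simp add: funpow_add funpow_swap1)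
  then have "z' \<le> par z" using mono by simp
  moreover have "par z' < z'" using h par_less by simp
  ultimately have False using h(4) by simp
  then show ?thesis ..
 qed (use h in auto)
 show ?thesis using aux[of i j z z'] aux[of j i z' z] assms by (cases "i \<le> j") auto
qed

lemma exc_edge_inj:
 assumes "l = k * s" "k < b"
 shows "card {t \<in> {l..<l + s}. exc t} \<le> card xedges"
proof -
 have lT: "l + s \<le> T" using assms T_eq by (metis Suc_leI add.commute mult_Suc mult_le_mono1)
 have dv: "t div s = k" if "t \<in> {l..<l + s}" for t
  using that assms(1) by (intro div_nat_eqI) (auto simp: algebra_simps)
 have "inj_on e {t \<in> {l..<l + s}. exc t}"
 proof (rule inj_onI)
  fix t u assume h: "t \<in> {t \<in> {l..<l + s}. exc t}" "u \<in> {t \<in> {l..<l + s}. exc t}" "e t = e u"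
  show "t = u"
  proof (rule ccontr)
   assume "t \<noteq> u"
   then show False using piece_inj[of t u] h lT dv[of t] dv[of u] by auto
  qed
 qed
 moreover have "e ` {t \<in> {l..<l + s}. exc t} \<subseteq> xedges" unfolding xedges_def using lT by auto
 moreover have "finite xedges" unfolding xedges_def by auto
 ultimately show ?thesis by (rule card_inj_on_le)
qed

text \<open>The phases of a piece between two excess steps in their forced order: ascent, descent,
  discovery from an old label, discovery from a new label.\<close>

definition rk :: "nat \<Rightarrow> nat" where
 "rk t = (if upw t then 0 else if dnw t then 1 else if free t \<and> lid (2 * t) \<noteq> 2 * t then 2 else 3)"

lemma rk_mono:
 assumes "Suc t < T" "Suc t div s = t div s" "\<not> exc t" "\<not> exc (Suc t)"
 shows "rk t \<le> rk (Suc t)" "code t \<noteq> code (Suc t) \<Longrightarrow> rk t < rk (Suc t)"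
proof -
 have ne: "e t \<noteq> e (Suc t)" using piece_inj[of t "Suc t"] assms by auto
 have lnk: "nd (2 * t + 1) = nd (2 * Suc t)" using nd_link[of t] assms by simp
 have it: "inter t" using assms unfolding inter_def by simp
 \<comment> \<open>An ascent right after a descent or a discovery would go back along the tree edge
   just used, and a piece uses no position twice.\<close>
 have A: "\<not> upw (Suc t)" if d: "dnw t \<or> free t"
 proof
  assume "upw (Suc t)"
  then obtain u where u: "free u" "nd (2 * Suc t) = 2 * u + 1" "e (Suc t) = e u"
   using upwD[of "Suc t"] assms by metis
  from d show False
  proof
   assume "dnw t"
   then obtain v where "nd (2 * t + 1) = 2 * v + 1" "e t = e v" using dnwD[of t] assms by (metis Suc_lessD)
   then show False using u lnk ne by simp
  next
   assume "free t"
   then show False using u lnk ne unfolding free_def by simp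
  qed
 qed
 \<comment> \<open>A vertex just discovered has no children yet, so the next step cannot be a
   descent; and its only label so far is of the other kind, so the next label is new.\<close>
 have B: "free (Suc t) \<and> lid (2 * Suc t) = 2 * Suc t" if f: "free t"
 proof -
  have n: "nd (2 * Suc t) = 2 * t + 1" using lnk f unfolding free_def by simp
  have "\<not> dnw (Suc t)"
  proof
   assume "dnw (Suc t)"
   then obtain u where u: "u < Suc t" "nd (2 * Suc t) = nd (2 * u)" using dnwD[of "Suc t"] assms by metis
   have "nd (2 * u) \<le> 2 * u" by (rule nd_le)
   then show False using u n by simp
  qed
  then have fr: "free (Suc t)" using A f assms step_cases[of "Suc t"] by blast
  have "2 * t + 1 \<le> lid (2 * Suc t)" using nd_le_lid[of "2 * Suc t"] n by simp
  moreover have "lid (2 * Suc t) \<le> 2 * Suc t" by (rule lid_le)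
  moreover have "lid (2 * Suc t) \<noteq> 2 * t + 1"
  proof
   assume "lid (2 * Suc t) = 2 * t + 1"
   then have "lab (2 * t + 1) = lab (2 * t + 2)" using lab_lid[of "2 * Suc t"] assms by simp
   then show False using inter_types[OF it] by simp
  qed
  ultimately have "lid (2 * Suc t) = 2 * Suc t" by arith
  then show ?thesis using fr by simp
 qed
 show "rk t \<le> rk (Suc t)" 
 proof (rule step_cases[of t])
  assume "upw t"
  then show ?thesis unfolding rk_def by simp
 next
  assume h: "dnw t" "\<not> upw t"
  then have "\<not> upw (Suc t)" using A by blast
  then show ?thesis using h unfolding rk_def by simp
 next
  assume h: "free t"
  then have f2: "free (Suc t)" "lid (2 * Suc t) = 2 * Suc t" using B by auto
  then have "\<not> upw (Suc t)" "\<not> dnw (Suc t)" unfolding upw_def dnw_def by auto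
  then show ?thesis using f2 unfolding rk_def by simp
 qed (use assms in auto)
 show "rk t < rk (Suc t)" if c: "code t \<noteq> code (Suc t)"
 proof (rule step_cases[of t])
  assume h: "free t" "\<not> upw t" "\<not> dnw t" "\<not> exc t"
  have f2: "free (Suc t)" "lid (2 * Suc t) = 2 * Suc t" using B h by auto
  then have "lid (2 * t) \<noteq> 2 * t" using c h unfolding code_def by auto
  moreover have "\<not> upw (Suc t)" "\<not> dnw (Suc t)" using f2 unfolding upw_def dnw_def by auto
  ultimately show ?thesis using h f2 unfolding rk_def by auto
 next
  assume h: "upw t" "\<not> free t" "\<not> dnw t" "\<not> exc t"
  have "code t = (1, 0, 0, 0)" using h unfolding code_def by simp
  moreover have "upw (Suc t) \<Longrightarrow> code (Suc t) = (1, 0, 0, 0)"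
   using upw_def[of "Suc t"] unfolding code_def by simp
  ultimately have "\<not> upw (Suc t)" using c by metis
  then show ?thesis using h unfolding rk_def by auto
 next
  assume h: "dnw t" "\<not> free t" "\<not> upw t" "\<not> exc t"
  have "\<not> dnw (Suc t)"
  proof
   assume "dnw (Suc t)"
   then show False using c h wend_Suc[of t] assms unfolding code_def dnw_def by auto
  qed
  then show ?thesis using h A unfolding rk_def by auto
 qed (use assms in auto)
qed

text \<open>Amortised count with potential \<open>rk\<close>. The five units charged to an excess
  step pay for up to three increases of \<open>rk\<close> before it, for the change into it, and for
  the change out of it, which is kept in reserve on the left.\<close>

lemma changes_le:
 assumes "l = k * s" "k < b" "j < s"
 shows "card {t \<in> {l<..l + j}. code t \<noteq> code (t - 1)} + (if exc (l + j) then 1 else 0)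
  \<le> 5 * card {t \<in> {l..l + j}. exc t} + (if exc (l + j) then 0 else rk (l + j))"
 using assms(3)
proof (induction j)
 case 0
 have "{t \<in> {l..l + 0}. exc t} = (if exc l then {l} else {})" by auto
 then show ?case by (auto simp: card_gt_0_iff)
next
 case (Suc j)
 let ?C = "\<lambda>j. {t \<in> {l<..l + j}. code t \<noteq> code (t - 1)}" and ?X = "\<lambda>j. {t \<in> {l..l + j}. exc t}"
 have lT: "l + s \<le> T" using assms T_eq by (metis Suc_leI add.commute mult_Suc mult_le_mono1)
 have dv: "t div s = k" if "l \<le> t" "t < l + s" for t
  using that assms(1) by (intro div_nat_eqI) (auto simp: algebra_simps)
 have C: "?C (Suc j) = (if code (Suc (l + j)) \<noteq> code (l + j) then insert (Suc (l + j)) (?C j) else ?C j)"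
  by (auto simp: le_Suc_eq)
 have cC: "card (?C (Suc j)) = card (?C j) + (if code (Suc (l + j)) \<noteq> code (l + j) then 1 else 0)"
  unfolding C by auto
 have X: "?X (Suc j) = (if exc (Suc (l + j)) then insert (Suc (l + j)) (?X j) else ?X j)"
  by (auto simp: le_Suc_eq)
 have cX: "card (?X (Suc j)) = card (?X j) + (if exc (Suc (l + j)) then 1 else 0)"
  unfolding X by auto
 have IH: "card (?C j) + (if exc (l + j) then 1 else 0) \<le> 5 * card (?X j) + (if exc (l + j) then 0 else rk (l + j))"
  using Suc by simp
 have r3: "rk t \<le> 3" for t unfolding rk_def by auto
 have m: "\<not> exc (l + j) \<Longrightarrow> \<not> exc (Suc (l + j)) \<Longrightarrow> rk (l + j) + (if code (Suc (l + j)) \<noteq> code (l + j) then 1 else 0) \<le> rk (Suc (l + j))"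
  using rk_mono[of "l + j"] Suc.prems lT dv[of "l + j"] dv[of "Suc (l + j)"] by (auto simp: Suc_le_eq)
 have lS: "l + Suc j = Suc (l + j)" by simp
 show ?case unfolding cC cX unfolding lS
  using IH m r3[of "l + j"] by (cases "exc (l + j)"; cases "exc (Suc (l + j))") (auto split: if_splits)
qed

text \<open>The 4 counts, for each piece, its first step and three increases of \<open>rk\<close>
  that no excess step pays for.\<close>

lemma card_codes_le: "card codes \<le> b * (5 * card xedges + 4)"
proof -
 let ?J = "{t. t < T \<and> (t mod s = 0 \<or> code t \<noteq> code (t - 1))}"
 have fin: "finite ?J" by auto
 have "codes = (\<lambda>t. (t, code t)) ` ?J" unfolding codes_def by auto
 then have "card codes \<le> card ?J" using card_image_le[OF fin] by simp
 also have "\<dots> = (\<Sum>k\<in>{..<b}. card {t\<in>?J. t div s = k})"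
  using fin T_eq s_pos by (intro card_fibre_sum) (auto simp: less_mult_imp_div_less)
 also have "\<dots> \<le> (\<Sum>k\<in>{..<b}. 5 * card xedges + 4)"
 proof (rule sum_mono)
  fix k assume k: "k \<in> {..<b}"
  let ?l = "k * s"
  obtain j where j: "s = Suc j" using s_pos gr0_implies_Suc by blast
  let ?C = "{t \<in> {?l<..?l + j}. code t \<noteq> code (t - 1)}"
  have "{t\<in>?J. t div s = k} \<subseteq> insert ?l ?C"
  proof
   fix t assume t: "t \<in> {t\<in>?J. t div s = k}"
   then have "t = k * s + t mod s" by (metis (mono_tags, lifting) div_mult_mod_eq mem_Collect_eq)
   moreover have "t mod s \<le> j" using s_pos j by (metis Suc_leI less_Suc_eq_le mod_less_divisor)
   ultimately show "t \<in> insert ?l ?C" using t by (cases "t mod s = 0") auto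
  qed
  then have "card {t\<in>?J. t div s = k} \<le> card (insert ?l ?C)" by (intro card_mono) auto
  also have "\<dots> \<le> card ?C + 1" by (simp add: card_insert_if)
  also have "card ?C \<le> 5 * card {t \<in> {?l..?l + j}. exc t} + 3"
   using changes_le[of ?l k j] k j unfolding rk_def by (auto split: if_splits)
  also have "card {t \<in> {?l..?l + j}. exc t} \<le> card xedges"
   using exc_edge_inj[of ?l k] k j by (simp add: atLeastLessThanSuc_atLeastAtMost)
  finally show "card {t\<in>?J. t div s = k} \<le> 5 * card xedges + 4" by simp
 qed
 also have "\<dots> = b * (5 * card xedges + 4)" by simp
 finally show ?thesis .
qed

lemma codes_subset: "codes \<subseteq> {..<T} \<times> ({..3} \<times> {..2 * T} \<times> {..2 * T} \<times> {..2 * T})"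
proof -
 have "code t \<in> {..3} \<times> {..2 * T} \<times> {..2 * T} \<times> {..2 * T}" if t: "t < T" for t
 proof -
  have "lid (2 * t) \<le> 2 * t" "lid (2 * t + 1) \<le> 2 * t + 1" "nd (2 * t + 1) \<le> 2 * t + 1"
   using lid_le nd_le by auto
  moreover have "dnw t \<Longrightarrow> wend t < 2 * t" using wend_props t by blast
  ultimately show ?thesis using t unfolding code_def by auto
 qed
 then have "(t, code t) \<in> {..<T} \<times> ({..3} \<times> {..2 * T} \<times> {..2 * T} \<times> {..2 * T})" if "t < T" for t
  using that by blast
 then show ?thesis unfolding codes_def by blast
qed

end

text \<open>At a time that is not recorded the code repeats the previous one.\<close>

lemma code_eq_of_codes:
 assumes "walk T s b e" "walk T s b e'" "walk.codes T s e = walk.codes T s e'" "t < T"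
 shows "walk.code T s e t = walk.code T s e' t"
proof -
 interpret A: walk T s b e by fact
 interpret B: walk T s b e' by fact
 have key: "A.code t = B.code t" if eq: "A.codes = B.codes" and t: "t < T" for t
  using t
 proof (induction t)
  case 0
  have "(0, A.code 0) \<in> A.codes" using 0 unfolding A.codes_def by auto
  then show ?case using eq unfolding B.codes_def by auto
 next
  case (Suc t)
  then have IH: "A.code t = B.code t" by simp
  show ?case
  proof (cases "(Suc t, A.code (Suc t)) \<in> A.codes")
   case True
   then show ?thesis using eq unfolding B.codes_def by auto
  next
   case False
   then have a: "A.code (Suc t) = A.code t" "Suc t mod s \<noteq> 0" using Suc.prems unfolding A.codes_def by auto
   show ?thesis
   proof (rule ccontr)
    assume "A.code (Suc t) \<noteq> B.code (Suc t)"
    then have "B.code (Suc t) \<noteq> B.code t" using a IH by simp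
    then have "(Suc t, B.code (Suc t)) \<in> B.codes" using Suc.prems unfolding B.codes_def by auto
    then have "(Suc t, B.code (Suc t)) \<in> A.codes" using eq by simp
    then have "B.code (Suc t) = A.code (Suc t)" unfolding A.codes_def by auto
    then show False using \<open>A.code (Suc t) \<noteq> B.code (Suc t)\<close> by simp
   qed
  qed
 qed
 show ?thesis using key assms(3,4) by simp
qed

text \<open>Decoding runs along the walk. The current node is the end of the previous step. An
  ascent must use the edge by which this node was discovered; a descent goes to the unique ancestor
  of the recorded end whose parent is the current node.\<close>

lemma pattern_of_codes:
 assumes W: "walk T s b e" "walk T s b e'" and C: "walk.codes T s e = walk.codes T s e'"
  and k: "k < 2 * T"
 shows "walk.lid T s e k = walk.lid T s e' k \<and> walk.nd T s e k = walk.nd T s e' k"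
proof -
 interpret A: walk T s b e by fact
 interpret B: walk T s b e' by fact
 have c: "A.code t = B.code t" if "t < T" for t using code_eq_of_codes[OF W C that] .
 have "t \<le> T \<Longrightarrow> \<forall>k<2 * t. A.lid k = B.lid k \<and> A.nd k = B.nd k" for t
 proof (induction t)
  case (Suc t)
  then have IH: "k < 2 * t \<Longrightarrow> A.lid k = B.lid k" "k < 2 * t \<Longrightarrow> A.nd k = B.nd k" for k by auto
  have t: "t < T" using Suc.prems by simp
  have n0: "A.nd (2 * t) = B.nd (2 * t)"
  proof (cases "t = 0")
   case False
   then show ?thesis using A.nd_even[of t] B.nd_even[of t] t IH(2)[of "2 * (t - 1) + 1"] by auto
  qed simp
  have parAB: "A.par c = B.par c" if "c < 2 * t" for c
   using IH(2) that unfolding A.par_def B.par_def by auto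
  have "A.lid (2 * t) = B.lid (2 * t) \<and> A.lid (2 * t + 1) = B.lid (2 * t + 1) \<and> A.nd (2 * t + 1) = B.nd (2 * t + 1)"
  proof (rule A.step_cases[of t])
   assume h: "A.free t" "\<not> A.upw t" "\<not> A.dnw t" "\<not> A.exc t"
   then have f: "B.free t" using c[OF t] unfolding A.code_def B.code_def by (auto split: if_splits)
   have "A.lid (2 * t + 1) = 2 * t + 1" "B.lid (2 * t + 1) = 2 * t + 1"
    using A.nd_le_lid[of "2 * t + 1"] A.lid_le[of "2 * t + 1"] B.nd_le_lid[of "2 * t + 1"] B.lid_le[of "2 * t + 1"]
     h f unfolding A.free_def B.free_def by auto
   moreover have "A.lid (2 * t) = B.lid (2 * t)"
    using c[OF t] h f unfolding A.code_def B.code_def by (auto split: if_splits)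
   ultimately show ?thesis using h f unfolding A.free_def B.free_def by auto
  next
   assume h: "A.exc t" "\<not> A.free t" "\<not> A.upw t" "\<not> A.dnw t"
   then show ?thesis using c[OF t] unfolding A.code_def B.code_def by (auto split: if_splits)
  next
   assume h: "A.upw t" "\<not> A.free t" "\<not> A.dnw t" "\<not> A.exc t"
   then have hB: "B.upw t" using c[OF t] unfolding A.code_def B.code_def by (auto split: if_splits)
   obtain u where u: "u < t" "A.nd (2 * t) = 2 * u + 1" "A.lab (2 * t) = A.lab (2 * u + 1)"
     "A.lab (2 * t + 1) = A.lab (2 * u)" "A.nd (2 * t + 1) = A.nd (2 * u)" using A.upwD[OF h(1) t] by metis
   obtain v where v: "v < t" "B.nd (2 * t) = 2 * v + 1" "B.lab (2 * t) = B.lab (2 * v + 1)"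
     "B.lab (2 * t + 1) = B.lab (2 * v)" "B.nd (2 * t + 1) = B.nd (2 * v)" using B.upwD[OF hB t] by metis
   have uv: "u = v" using u(2) v(2) n0 by simp
   have a: "A.lid (2 * t) = A.lid (2 * u + 1)" "A.lid (2 * t + 1) = A.lid (2 * u)"
    using A.lid_eq_lab u t by auto
   have b: "B.lid (2 * t) = B.lid (2 * u + 1)" "B.lid (2 * t + 1) = B.lid (2 * u)"
    using B.lid_eq_lab v t uv by auto
   have i: "A.lid (2 * u) = B.lid (2 * u)" "A.lid (2 * u + 1) = B.lid (2 * u + 1)" "A.nd (2 * u) = B.nd (2 * u)"
    using IH[of "2 * u + 1"] IH[of "2 * u"] u(1) by auto
   show ?thesis unfolding a b u(5) v(5) uv[symmetric] using i by blast
  next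
   assume h: "A.dnw t" "\<not> A.free t" "\<not> A.upw t" "\<not> A.exc t"
   then have hB: "B.dnw t" and w: "A.wend t = B.wend t"
    using c[OF t] unfolding A.code_def B.code_def by (auto split: if_splits)
   obtain u where u: "u < t" "A.nd (2 * t + 1) = 2 * u + 1" "A.lab (2 * t + 1) = A.lab (2 * u + 1)"
     "A.lab (2 * t) = A.lab (2 * u)" using A.dnwD[OF h(1) t] by metis
   obtain v where v: "v < t" "B.nd (2 * t + 1) = 2 * v + 1" "B.lab (2 * t + 1) = B.lab (2 * v + 1)"
     "B.lab (2 * t) = B.lab (2 * v)" using B.dnwD[OF hB t] by metis
   obtain i where i: "(A.par ^^ i) (A.wend t) = A.nd (2 * t + 1)" using A.wend_props[OF h(1) t] by blast
   obtain j where j: "(B.par ^^ j) (B.wend t) = B.nd (2 * t + 1)" using B.wend_props[OF hB t] by blast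
   have w2: "A.wend t < 2 * t" using A.wend_props[OF h(1) t] by blast
   \<comment> \<open>The whole chain of ancestors lies below \<open>2 * t\<close>, where both parent
     functions agree by induction.\<close>
   have chain: "(A.par ^^ k) (A.wend t) = (B.par ^^ k) (A.wend t) \<and> (A.par ^^ k) (A.wend t) < 2 * t" for k
   proof (induction k)
    case (Suc k)
    have "A.par ((A.par ^^ k) (A.wend t)) = B.par ((B.par ^^ k) (A.wend t))" using Suc parAB by simp
    moreover have "A.par ((A.par ^^ k) (A.wend t)) < 2 * t" using Suc A.par_le le_less_trans by blast
    ultimately show ?case by simp
   qed (use w2 in auto)
   have j': "(A.par ^^ j) (A.wend t) = B.nd (2 * t + 1)" using j w chain by simp
   have "B.nd (2 * t + 1) < 2 * t" using j' chain by metis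
   then have "A.par (B.nd (2 * t + 1)) = B.par (B.nd (2 * t + 1))" using parAB by simp
   also have "\<dots> = A.par (A.nd (2 * t + 1))" using A.dnw_par[OF h(1) t] B.dnw_par[OF hB t] n0 by simp
   finally have "A.nd (2 * t + 1) = B.nd (2 * t + 1)"
    using A.chain_unique[OF i j'] A.dnw_par[OF h(1) t] B.dnw_par[OF hB t] by simp
   then have uv: "u = v" using u(2) v(2) by simp
   have a: "A.lid (2 * t) = A.lid (2 * u)" "A.lid (2 * t + 1) = A.lid (2 * u + 1)"
    using A.lid_eq_lab u t by auto
   have b: "B.lid (2 * t) = B.lid (2 * u)" "B.lid (2 * t + 1) = B.lid (2 * u + 1)"
    using B.lid_eq_lab v t uv by auto
   have i: "A.lid (2 * u) = B.lid (2 * u)" "A.lid (2 * u + 1) = B.lid (2 * u + 1)"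
    using IH[of "2 * u + 1"] IH[of "2 * u"] u(1) by auto
   show ?thesis unfolding a b u(2) v(2) uv[symmetric] using i by blast
  qed
  note new = this
  show ?case
  proof (intro allI impI)
   fix k assume "k < 2 * Suc t"
   then have "k < 2 * t \<or> k = 2 * t \<or> k = 2 * t + 1" by arith
   then show "A.lid k = B.lid k \<and> A.nd k = B.nd k"
    by (elim disjE) (use IH n0 new in blast)+
  qed
 qed simp
 then show ?thesis using k by blast
qed

section \<open>Generic vertices and the number of the others\<close>

definition qlab :: "(nat \<Rightarrow> nat \<Rightarrow> real) \<Rightarrow> bool \<times> nat \<Rightarrow> bool \<times> nat \<Rightarrow> real" where
 "qlab Q u v = (if fst u then Q (snd u) (snd v) else Q (snd v) (snd u))"

lemma qlab_sym: "fst u \<noteq> fst v \<Longrightarrow> qlab Q u v = qlab Q v u"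
 unfolding qlab_def by auto

definition multi1 :: "nat \<Rightarrow> (nat \<Rightarrow> 'a) \<Rightarrow> 'a set" where
 "multi1 T e = {f \<in> e ` {..<T}. \<forall>t<T. \<forall>u<T. e t = f \<longrightarrow> e u = f \<longrightarrow> t = u}"

definition shared :: "nat \<Rightarrow> (nat \<Rightarrow> 'a \<times> 'b) \<Rightarrow> ('a \<times> 'b) set" where
 "shared T e = {f \<in> e ` {..<T}. \<exists>f'\<in>e ` {..<T}. f' \<noteq> f \<and> (fst f' = fst f \<or> snd f' = snd f)}"

context walk
begin

definition Phi :: "nat set" where "Phi = {t. t < T \<and> free t}"
definition reps :: "nat set" where "reps = {k. k < 2 * T \<and> lid k = k}"
definition comps :: "nat set" where "comps = {k. k < 2 * T \<and> nd k = k}"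
definition rc :: "nat \<Rightarrow> nat set" where "rc c = {k \<in> reps. nd k = c}"
definition trn :: "nat set" where "trn = {t. t < T \<and> \<not> inter t}"
text \<open>Generic vertices: discovered inside a piece, with no labels but the two of the
  discovering link, and not reached by the last step of any piece. Every passage through such a
  vertex uses the same entry of \<open>Q\<close>. In \<open>Gen1\<close> there is only one passage.
  \<open>SR\<close> collects the remaining vertices and \<open>SN\<close> their labels other than
  the root label.\<close>

definition Gen :: "nat set" where
 "Gen = {t. t < T \<and> free t \<and> inter t \<and>
  (\<forall>k<2*T. nd k = 2 * t + 1 \<longrightarrow> lid k = 2 * t + 1 \<or> lid k = 2 * t + 2) \<and>
  (\<forall>u<T. \<not> inter u \<longrightarrow> nd (2 * u + 1) \<noteq> 2 * t + 1)}"
definition Gen1 :: "nat set" where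
 "Gen1 = {t \<in> Gen. \<forall>u<T. inter u \<longrightarrow> nd (2 * u + 1) = 2 * t + 1 \<longrightarrow> u = t}"
definition SR :: "nat set" where "SR = comps - (\<lambda>t. 2 * t + 1) ` Gen"
definition SN :: "nat set" where "SN = {k \<in> reps. k \<noteq> nd k \<and> nd k \<in> SR}"

lemma finite_sets [simp]: "finite Phi" "finite reps" "finite comps" "finite trn" "finite Gen" "finite Gen1" "finite SR" "finite SN"
 "finite (rc c)" "finite xedges"
 unfolding Phi_def reps_def comps_def trn_def Gen_def Gen1_def SR_def SN_def rc_def xedges_def by auto

lemma free_new:
 assumes "free u" "t < u" "u < T" shows "e t \<noteq> e u"
proof
 assume eq: "e t = e u"
 have n: "nd (2 * u + 1) = 2 * u + 1" using assms unfolding free_def by simp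
 show False
 proof (cases "even (t div s) = even (u div s)")
  case True
  then have "lab (2 * t + 1) = lab (2 * u + 1)" using eq e_eq_straight by blast
  then have "nd (2 * u + 1) = nd (2 * t + 1)" using assms by (intro nd_cong_lab) auto
  then show False using n nd_le[of "2 * t + 1"] assms by simp
 next
  case False
  then have "lab (2 * t) = lab (2 * u + 1)" using eq e_eq_cross by blast
  then have "nd (2 * u + 1) = nd (2 * t)" using assms by (intro nd_cong_lab) auto
  then show False using n nd_le[of "2 * t"] assms by simp
 qed
qed

text \<open>Tree edges plus excess edges. Together with \<open>card_comps\<close> this identifies
  \<open>card xedges\<close> as the number of independent cycles of the connected pattern
  graph.\<close>

lemma card_edges: "card (e ` {..<T}) = card Phi + card xedges"
proof -
 have inj: "inj_on e Phi"
  by (rule inj_onI) (metis (no_types, lifting) Phi_def free_new linorder_neqE_nat mem_Collect_eq)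
 have dj: "e ` Phi \<inter> xedges = {}"
 proof (intro equals0I)
  fix f assume "f \<in> e ` Phi \<inter> xedges"
  then obtain t u where h: "t < T" "exc t" "u < T" "free u" "e t = e u" unfolding Phi_def xedges_def by auto
  have "\<not> u < t" using h unfolding exc_def old_def by auto
  moreover have "\<not> t < u" using h free_new by blast
  ultimately have "t = u" by simp
  then show False using h unfolding exc_def by simp
 qed
 have "e ` {..<T} = e ` Phi \<union> xedges"
 proof (intro equalityI subsetI)
  fix f assume "f \<in> e ` {..<T}"
  then obtain t where t: "t < T" "f = e t" by auto
  show "f \<in> e ` Phi \<union> xedges"
  proof (cases "free t \<or> exc t")
   case True then show ?thesis using t unfolding Phi_def xedges_def by auto
  next
   case False
   then obtain u where "old t u" unfolding exc_def by auto
   then show ?thesis using t unfolding old_def Phi_def by auto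
  qed
 qed (auto simp: Phi_def xedges_def)
 then have "card (e ` {..<T}) = card (e ` Phi) + card xedges"
  using card_Un_disjoint[OF _ _ dj] by simp
 then show ?thesis using card_image[OF inj] by simp
qed

lemma comps_eq: "0 < T \<Longrightarrow> comps = insert 0 ((\<lambda>t. 2 * t + 1) ` Phi)"
proof (intro equalityI subsetI)
 fix k assume T: "0 < T" and k: "k \<in> comps"
 then have k': "k < 2 * T" "nd k = k" unfolding comps_def by auto
 show "k \<in> insert 0 ((\<lambda>t. 2 * t + 1) ` Phi)"
  using nd_cases[OF k'(1)] k'(2) unfolding Phi_def by auto
qed (auto simp: comps_def Phi_def free_def)

lemma card_comps: "0 < T \<Longrightarrow> card comps = Suc (card Phi)"
 unfolding comps_eq by (subst card_insert_disjoint) (auto simp: card_image inj_on_def)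

lemma lab_image: "lab ` {..<2 * T} = Pair False ` (fst ` e ` {..<T}) \<union> Pair True ` (snd ` e ` {..<T})"
proof (intro equalityI subsetI)
 fix u assume "u \<in> lab ` {..<2 * T}"
 then obtain k where k: "k < 2 * T" "u = lab k" by auto
 then have "k div 2 < T" by auto
 then show "u \<in> Pair False ` (fst ` e ` {..<T}) \<union> Pair True ` (snd ` e ` {..<T})"
  using k unfolding lab_def by auto
next
 fix u assume "u \<in> Pair False ` (fst ` e ` {..<T}) \<union> Pair True ` (snd ` e ` {..<T})"
 then obtain t where t: "t < T" "u = (False, fst (e t)) \<or> u = (True, snd (e t))" by auto
 then have "u = lab (2 * t) \<or> u = lab (2 * t + 1)" unfolding lab_even lab_odd by auto
 then show "u \<in> lab ` {..<2 * T}" using t(1) by auto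
qed

lemma card_reps: "card reps = card (fst ` e ` {..<T}) + card (snd ` e ` {..<T})"
proof -
 have "bij_betw lab reps (lab ` {..<2 * T})"
  unfolding bij_betw_def
 proof
  show "inj_on lab reps"
   unfolding reps_def by (rule inj_onI) (metis (mono_tags, lifting) lid_eq_lab mem_Collect_eq)
  show "lab ` reps = lab ` {..<2 * T}"
  proof (intro equalityI subsetI)
   fix u assume "u \<in> lab ` {..<2 * T}"
   then obtain k where k: "k < 2 * T" "u = lab k" by auto
   have "lid k \<in> reps" "lab (lid k) = u" using k lid_le[of k] unfolding reps_def by auto
   then show "u \<in> lab ` reps" by blast
  qed (auto simp: reps_def)
 qed
 then have "card reps = card (lab ` {..<2 * T})" by (rule bij_betw_same_card)
 also have "\<dots> = card (Pair False ` (fst ` e ` {..<T})) + card (Pair True ` (snd ` e ` {..<T}))"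
  unfolding lab_image by (rule card_Un_disjoint) auto
 also have "\<dots> = card (fst ` e ` {..<T}) + card (snd ` e ` {..<T})"
  by (simp add: card_image inj_on_def)
 finally show ?thesis .
qed

lemma card_reps_le: "card reps \<le> 2 * card (e ` {..<T})"
 unfolding card_reps using card_image_le[of "e ` {..<T}" fst] card_image_le[of "e ` {..<T}" snd] by simp

lemma finite_shared [simp]: "finite (shared T e)" unfolding shared_def by auto

lemma card_shared: "card (shared T e) + 2 * card reps \<le> 4 * card (e ` {..<T})"
proof -
 let ?F = "e ` {..<T}"
 let ?A = "{x\<in>?F. \<exists>y\<in>?F. y \<noteq> x \<and> fst y = fst x}" and ?B = "{x\<in>?F. \<exists>y\<in>?F. y \<noteq> x \<and> snd y = snd x}"
 have "shared T e \<subseteq> ?A \<union> ?B" unfolding shared_def by auto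
 then have "card (shared T e) \<le> card (?A \<union> ?B)" by (intro card_mono) auto
 also have "\<dots> \<le> card ?A + card ?B" by (rule card_Un_le)
 finally show ?thesis
  using card_collisions_le[of ?F fst] card_collisions_le[of ?F snd] unfolding card_reps by simp
qed

lemma card_trn: "card trn \<le> b"
proof -
 have "inj_on (\<lambda>t. t div s) trn"
 proof (rule inj_onI)
  have aux: "False" if h: "t \<in> trn" "u \<in> trn" "t div s = u div s" "t < u" for t u
  proof -
   have "Suc t div s = t div s" using h div_le_mono[of t "Suc t" s] div_le_mono[of "Suc t" u s] by simp
   then have "inter t" using h unfolding inter_def trn_def by auto
   then show False using h unfolding trn_def by simp
  qed
  fix t u assume "t \<in> trn" "u \<in> trn" "t div s = u div s"
  then show "t = u" using aux[of t u] aux[of u t] by (metis linorder_neqE_nat)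
 qed
 moreover have "(\<lambda>t. t div s) ` trn \<subseteq> {..<b}" unfolding trn_def using T_eq by (auto simp: less_mult_imp_div_less)
 ultimately show ?thesis using card_inj_on_le[of _ trn "{..<b}"] by simp
qed

lemma free_inter_reps:
 assumes "t < T" "free t" "inter t"
 shows "2 * t + 1 \<in> rc (2 * t + 1)" "2 * t + 2 \<in> rc (2 * t + 1)"
proof -
 have st: "Suc t < T" using assms unfolding inter_def by simp
 have n: "nd (2 * t + 1) = 2 * t + 1" "nd (2 * t + 2) = 2 * t + 1"
  using assms nd_link[OF st] unfolding free_def by auto
 have "lid (2 * t + 1) = 2 * t + 1" using n nd_le_lid[of "2 * t + 1"] lid_le[of "2 * t + 1"] by simp
 moreover have "lid (2 * t + 2) = 2 * t + 2"
 proof -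
  have "lid (2 * t + 2) \<noteq> 2 * t + 1"
  proof
   assume "lid (2 * t + 2) = 2 * t + 1"
   then have "lab (2 * t + 1) = lab (2 * t + 2)" using lab_lid[of "2 * t + 2"] st by simp
   then show False using inter_types[OF assms(3)] by simp
  qed
  then show ?thesis using n nd_le_lid[of "2 * t + 2"] lid_le[of "2 * t + 2"] by simp
 qed
 ultimately show "2 * t + 1 \<in> rc (2 * t + 1)" "2 * t + 2 \<in> rc (2 * t + 1)"
  using n st assms unfolding rc_def reps_def by auto
qed

lemma comp_rep: "c \<in> comps \<Longrightarrow> c \<in> rc c"
 using lid_le[of c] nd_le_lid[of c] unfolding comps_def rc_def reps_def by auto

lemma nd_comps: "k < 2 * T \<Longrightarrow> nd k \<in> comps"
 using nd_le[of k] unfolding comps_def by auto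

lemma sum_rc: "card reps = (\<Sum>c\<in>comps. card (rc c))"
 unfolding rc_def by (rule card_fibre_sum) (use nd_comps in \<open>auto simp: reps_def\<close>)

text \<open>A vertex has at least two labels unless it is the root or was discovered by the last
  step of a piece, which allows \<open>1 + b\<close> exceptions.\<close>

lemma card_n3:
 assumes "0 < T"
 shows "card {c\<in>comps. card (rc c) \<ge> 3} + 2 * card comps \<le> card reps + (1 + b)"
proof -
 let ?n1 = "{c\<in>comps. card (rc c) = 1}" and ?n3 = "{c\<in>comps. card (rc c) \<ge> 3}"
 have pos: "card (rc c) \<ge> 1" if "c \<in> comps" for c
  using comp_rep[OF that] by (metis One_nat_def Suc_leI card_gt_0_iff empty_iff finite_sets(9))
 have "card ?n3 + 2 * card comps = (\<Sum>c\<in>comps. (if card (rc c) \<ge> 3 then 1 else 0) + 2)"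
 proof -
  have "(\<Sum>c\<in>comps. (if card (rc c) \<ge> 3 then 1 else 0::nat)) = card ?n3"
   by (simp add: sum.If_cases Int_def)
  then show ?thesis unfolding sum.distrib by simp
 qed
 also have "\<dots> \<le> (\<Sum>c\<in>comps. card (rc c) + (if card (rc c) = 1 then 1 else 0))"
  by (rule sum_mono) (use pos in fastforce)
 also have "\<dots> = card reps + card ?n1"
  unfolding sum_rc by (simp add: sum.distrib sum.If_cases Int_def)
 also have "card ?n1 \<le> card (insert 0 ((\<lambda>t. 2 * t + 1) ` trn))"
 proof (rule card_mono)
  show "?n1 \<subseteq> insert 0 ((\<lambda>t. 2 * t + 1) ` trn)"
  proof
   fix c assume c: "c \<in> ?n1"
   show "c \<in> insert 0 ((\<lambda>t. 2 * t + 1) ` trn)"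
   proof (cases "c = 0")
    case False
    then obtain t where t: "c = 2 * t + 1" "t < T" "free t"
     using c comps_eq[OF assms] unfolding Phi_def by auto
    have "\<not> inter t"
    proof
     assume "inter t"
     then have "{2 * t + 1, 2 * t + 2} \<subseteq> rc c" using free_inter_reps t by auto
     then have "card {2 * t + 1, 2 * t + 2} \<le> card (rc c)" by (intro card_mono) auto
     then show False using c by simp
    qed
    then show ?thesis using t unfolding trn_def by auto
   qed simp
  qed
 qed auto
 also have "\<dots> \<le> 1 + card trn" 
  using card_image_le[of trn "\<lambda>t. 2 * t + 1"] by (simp add: card_insert_if)
 also have "\<dots> \<le> 1 + b" using card_trn by simp
 finally show ?thesis by simp
qed

text \<open>A discovered vertex that is not generic is reached by the last step of a piece or has a
  third label.\<close>

lemma card_Phi_Gen: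
 assumes "0 < T"
 shows "card Phi \<le> card Gen + b + card {c\<in>comps. card (rc c) \<ge> 3}"
proof -
 let ?n3 = "{c\<in>comps. card (rc c) \<ge> 3}"
 let ?A = "{t\<in>Phi. \<exists>u\<in>trn. nd (2 * u + 1) = 2 * t + 1}"
 let ?B = "{t\<in>Phi. 2 * t + 1 \<in> ?n3}"
 have "Phi \<subseteq> Gen \<union> ?A \<union> ?B"
 proof
  fix t assume t: "t \<in> Phi"
  then have t': "t < T" "free t" "nd (2 * t + 1) = 2 * t + 1" unfolding Phi_def free_def by auto
  show "t \<in> Gen \<union> ?A \<union> ?B"
  proof (rule ccontr)
   assume n: "t \<notin> Gen \<union> ?A \<union> ?B"
   then have nA: "\<forall>u<T. \<not> inter u \<longrightarrow> nd (2 * u + 1) \<noteq> 2 * t + 1" using t unfolding trn_def by auto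
   then have it: "inter t" using t' by auto
   then obtain k where k: "k < 2 * T" "nd k = 2 * t + 1" "lid k \<noteq> 2 * t + 1" "lid k \<noteq> 2 * t + 2"
    using n t' nA unfolding Gen_def by auto
   have "lid k \<in> rc (2 * t + 1)" using k lid_le[of k] unfolding rc_def reps_def by auto
   then have "{2 * t + 1, 2 * t + 2, lid k} \<subseteq> rc (2 * t + 1)" using free_inter_reps t' it by auto
   then have "card {2 * t + 1, 2 * t + 2, lid k} \<le> card (rc (2 * t + 1))" by (intro card_mono) auto
   then have "3 \<le> card (rc (2 * t + 1))" using k by simp
   then have "t \<in> ?B" using t t' unfolding comps_def by auto
   then show False using n by simp
  qed
 qed
 then have "card Phi \<le> card (Gen \<union> ?A \<union> ?B)" by (intro card_mono) auto
 also have "\<dots> \<le> card Gen + card ?A + card ?B"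
  by (meson add_le_mono1 card_Un_le le_trans)
 also have "card ?A \<le> card ((\<lambda>u. (nd (2 * u + 1) - 1) div 2) ` trn)"
  by (intro card_mono) force+
 also have "\<dots> \<le> card trn" by (rule card_image_le) simp
 also have "\<dots> \<le> b" by (rule card_trn)
 also have "card ?B \<le> card ?n3"
  by (rule card_inj_on_le[of "\<lambda>t. 2 * t + 1"]) (auto simp: inj_on_def)
 finally show ?thesis by simp
qed

text \<open>There are at most two labels per edge, nearly all vertices have two labels, and the
  edges outnumber the vertices by only \<open>card xedges - 1\<close>. This leaves room for few
  third labels, few edges with a common label, and few vertices that are not generic.\<close>

lemma gen_bounds:
 assumes "0 < T"
 shows "card SN \<le> 4 * card xedges + 2 * b" "card (shared T e) \<le> 4 * card xedges + 2 * b"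
  "card Gen + card SR = Suc (card Phi)"
proof -
 have GP: "(\<lambda>t. 2 * t + 1) ` Gen \<subseteq> comps" "card ((\<lambda>t. 2 * t + 1) ` Gen) = card Gen"
  unfolding Gen_def comps_def free_def by (auto simp: card_image inj_on_def)
 show gs: "card Gen + card SR = Suc (card Phi)"
  unfolding SR_def using GP card_Diff_subset[OF _ GP(1)] card_mono[OF _ GP(1)] card_comps[OF assms] by simp
 have n3: "card {c\<in>comps. card (rc c) \<ge> 3} + 2 * Suc (card Phi) \<le> card reps + (1 + b)"
  using card_n3[OF assms] card_comps[OF assms] by simp
 have F: "card (e ` {..<T}) = card Phi + card xedges" by (rule card_edges)
 show "card (shared T e) \<le> 4 * card xedges + 2 * b"
  using card_shared n3 unfolding F by arith
 \<comment> \<open>The variables stand for the cardinalities of \<open>SN\<close>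
   (\<open>x\<close>), \<open>Gen\<close> (\<open>y\<close>), \<open>SR\<close> (\<open>r\<close>),
   \<open>reps\<close> (\<open>p\<close>), \<open>Phi\<close> (\<open>f\<close>), the vertices with
   three labels (\<open>m\<close>) and \<open>xedges\<close> (\<open>g\<close>).\<close>
 have ar: "x \<le> 4 * g + 2 * b" if "x + (r + 2 * y) \<le> p" "y + r = Suc f" "m + 2 * Suc f \<le> p + (1 + b)"
  "p \<le> 2 * (f + g)" "f \<le> y + b + m" for x y r p f m g :: nat
  using that by simp
 have "card SN + (card SR + 2 * card Gen) \<le> card reps"
 proof -
  let ?G = "(\<lambda>t. 2 * t + 1) ` Gen \<union> (\<lambda>t. 2 * t + 2) ` Gen"
  have r: "k \<in> reps" if "k \<in> SR \<union> ?G" for k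
  proof -
   from that consider "k \<in> SR" | t where "t \<in> Gen" "k = 2 * t + 1 \<or> k = 2 * t + 2" by auto
   then show ?thesis
   proof cases
    case 1 then show ?thesis using comp_rep[of k] unfolding SR_def rc_def by auto
   next
    case 2 then show ?thesis using free_inter_reps[of t] unfolding Gen_def rc_def by auto
   qed
  qed
  have gnd: "nd k \<in> (\<lambda>t. 2 * t + 1) ` Gen" if "k \<in> ?G" for k
   using that free_inter_reps unfolding Gen_def rc_def by (auto simp: free_def)
  have c1: "card ?G = 2 * card Gen"
  proof -
   have "(\<lambda>t. 2 * t + 1) ` Gen \<inter> (\<lambda>t. 2 * t + 2) ` Gen = {}"
   proof (intro equals0I)
    fix x assume "x \<in> (\<lambda>t. 2 * t + 1) ` Gen \<inter> (\<lambda>t. 2 * t + 2) ` Gen"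
    then obtain t u where "x = 2 * t + 1" "x = 2 * u + 2" by blast
    then show False by arith
   qed
   then have "card ?G = card ((\<lambda>t. 2 * t + 1) ` Gen) + card ((\<lambda>t. 2 * t + 2) ` Gen)"
    by (intro card_Un_disjoint) auto
   then show ?thesis by (simp add: card_image inj_on_def)
  qed
  have "card (SN \<union> (SR \<union> ?G)) \<le> card reps"
   using r by (intro card_mono) (auto simp: SN_def)
  moreover have "SN \<inter> (SR \<union> ?G) = {}"
   using gnd unfolding SN_def SR_def comps_def by auto
  moreover have "SR \<inter> ?G = {}"
   using gnd unfolding SR_def comps_def by fastforce
  ultimately show ?thesis using c1 by (simp add: card_Un_disjoint)
 qed
 then show "card SN \<le> 4 * card xedges + 2 * b"
  using ar[OF _ gs n3 card_reps_le[unfolded F] card_Phi_Gen[OF assms]] by blast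
qed

lemma Gen1_touch:
 assumes "t \<in> Gen1" "u < T" "k = 2 * u \<or> k = 2 * u + 1" "lab k = lab (2 * t + 1)"
 shows "u = t"
proof -
 have t: "t < T" "free t" "inter t" "\<And>u. u < T \<Longrightarrow> nd (2 * u + 1) = 2 * t + 1 \<Longrightarrow> inter u"
  "\<And>u. u < T \<Longrightarrow> inter u \<Longrightarrow> nd (2 * u + 1) = 2 * t + 1 \<Longrightarrow> u = t"
  using assms(1) unfolding Gen1_def Gen_def by auto
 have n: "nd k = 2 * t + 1"
  using nd_cong_lab[OF _ _ assms(4)] assms t unfolding free_def by auto
 from assms(3) show ?thesis
 proof
  assume "k = 2 * u + 1"
  then show ?thesis using t n assms by simp
 next
  assume k: "k = 2 * u"
  then have u0: "0 < u" using n by (cases u) auto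
  then have "nd (2 * (u - 1) + 1) = 2 * t + 1" using nd_even[of u] k n assms by simp
  then have "u - 1 = t" using t(4)[of "u - 1"] t(5)[of "u - 1"] assms by simp
  then have "k = 2 * t + 2" using k u0 by simp
  then show ?thesis using inter_types[OF t(3)] assms(4) by simp
 qed
qed

text \<open>The position that discovers a vertex of \<open>Gen1\<close> is used once: any other use
  would pass through the vertex a second time.\<close>

lemma card_Gen1: "card Gen1 \<le> card (multi1 T e - shared T e) + card (shared T e)"
proof -
 have only: "u = t" if t: "t \<in> Gen1" and u: "u < T" "e u = e t" for t u
 proof (cases "even (u div s) = even (t div s)")
  case True
  then have "lab (2 * u + 1) = lab (2 * t + 1)" using e_eq_straight u by blast
  then show ?thesis using Gen1_touch[OF t u(1)] by blast
 next
  case False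
  then have "lab (2 * u) = lab (2 * t + 1)" using e_eq_cross u by blast
  then show ?thesis using Gen1_touch[OF t u(1)] by blast
 qed
 have T: "t < T" if "t \<in> Gen1" for t using that unfolding Gen1_def Gen_def by auto
 have "inj_on e Gen1" by (rule inj_onI) (use only T in metis)
 moreover have "e ` Gen1 \<subseteq> (multi1 T e - shared T e) \<union> shared T e"
 proof
  fix f assume "f \<in> e ` Gen1"
  then obtain t where t: "t \<in> Gen1" "f = e t" by auto
  have "e t \<in> multi1 T e" unfolding multi1_def using only[OF t(1)] T[OF t(1)] by auto
  then show "f \<in> (multi1 T e - shared T e) \<union> shared T e" using t by auto
 qed
 moreover have "finite (multi1 T e)" unfolding multi1_def by auto
 ultimately have "card Gen1 \<le> card ((multi1 T e - shared T e) \<union> shared T e)"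
  by (intro card_inj_on_le[of e]) auto
 then show ?thesis using card_Un_le le_trans by blast
qed

text \<open>A second inner link at a generic vertex joins the same two labels, of different kinds,
  so it carries the same entry of \<open>Q\<close>.\<close>

lemma Gen2_second:
 assumes t: "t \<in> Gen - Gen1"
 shows "\<exists>u<T. inter u \<and> u \<notin> Gen \<and> nd (2 * u + 1) = 2 * t + 1 \<and>
  qlab Q (lab (2 * u + 1)) (lab (2 * u + 2)) = qlab Q (lab (2 * t + 1)) (lab (2 * t + 2))"
proof -
 from t obtain u where u: "u < T" "inter u" "nd (2 * u + 1) = 2 * t + 1" "u \<noteq> t" unfolding Gen1_def by auto
 have tg: "t < T" "free t" "inter t" "\<And>k. k < 2 * T \<Longrightarrow> nd k = 2 * t + 1 \<Longrightarrow> lid k = 2 * t + 1 \<or> lid k = 2 * t + 2"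
  using t unfolding Gen_def by auto
 have su: "Suc u < T" "Suc t < T" using u tg unfolding inter_def by auto
 have nG: "u \<notin> Gen" using u unfolding Gen_def free_def by auto
 have r: "lid (2 * t + 1) = 2 * t + 1" "lid (2 * t + 2) = 2 * t + 2"
  using free_inter_reps[OF tg(1-3)] unfolding rc_def reps_def by auto
 have L: "lab k = lab (2 * t + 1) \<or> lab k = lab (2 * t + 2)" if "k < 2 * T" "nd k = 2 * t + 1" for k
  using tg(4)[OF that] lab_lid[OF that(1)] by metis
 have "nd (2 * u + 2) = 2 * t + 1" using nd_link[OF su(1)] u by simp
 then have a: "lab (2 * u + 1) = lab (2 * t + 1) \<or> lab (2 * u + 1) = lab (2 * t + 2)"
  "lab (2 * u + 2) = lab (2 * t + 1) \<or> lab (2 * u + 2) = lab (2 * t + 2)"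
  using L[of "2 * u + 1"] L[of "2 * u + 2"] u su by auto
 have "qlab Q (lab (2 * u + 1)) (lab (2 * u + 2)) = qlab Q (lab (2 * t + 1)) (lab (2 * t + 2))"
  using a inter_types[OF u(2)] inter_types[OF tg(3)] qlab_sym[of "lab (2 * t + 1)" "lab (2 * t + 2)"] by metis
 then show ?thesis using u nG by blast
qed

abbreviation ql :: "(nat \<Rightarrow> nat \<Rightarrow> real) \<Rightarrow> nat \<Rightarrow> real" where
 "ql Q t \<equiv> qlab Q (lab (2 * t + 1)) (lab (2 * t + 2))"

text \<open>The entry of \<open>Q\<close> is kept once for each vertex of \<open>Gen1\<close> and
  twice for every other generic vertex, where it occurs at least twice; all remaining links are
  bounded by \<open>\<rho>\<close>. The exponent on the left counts the links that are kept.\<close>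

lemma prod_links_le:
 fixes \<rho> :: real
 assumes q: "\<And>t. t < T \<Longrightarrow> inter t \<Longrightarrow> 0 \<le> ql Q t \<and> ql Q t \<le> \<rho>" and r: "0 < \<rho>"
 shows "(\<Prod>t\<in>{t. t < T \<and> inter t}. ql Q t) * \<rho> ^ (card Gen + card (Gen - Gen1))
  \<le> \<rho> ^ card {t. t < T \<and> inter t} * (\<Prod>t\<in>Gen1. ql Q t) * (\<Prod>t\<in>Gen - Gen1. (ql Q t)\<^sup>2)"
proof -
 let ?I = "{t. t < T \<and> inter t}" and ?G2 = "Gen - Gen1"
 define sec where "sec t = (SOME u. u < T \<and> inter u \<and> u \<notin> Gen \<and> nd (2 * u + 1) = 2 * t + 1 \<and> ql Q u = ql Q t)" for t
 have sec: "sec t < T \<and> inter (sec t) \<and> sec t \<notin> Gen \<and> nd (2 * sec t + 1) = 2 * t + 1 \<and> ql Q (sec t) = ql Q t"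
  if "t \<in> ?G2" for t
  unfolding sec_def by (rule someI_ex) (use Gen2_second[OF that] in blast)
 have inj: "inj_on sec ?G2"
 proof (rule inj_onI)
  fix t u assume "t \<in> ?G2" "u \<in> ?G2" "sec t = sec u"
  then show "t = u" using sec[of t] sec[of u] by simp
 qed
 have GI: "Gen \<subseteq> ?I" "Gen1 \<subseteq> Gen" unfolding Gen_def Gen1_def by auto
 have SI: "sec ` ?G2 \<subseteq> ?I" "Gen \<inter> sec ` ?G2 = {}" using sec by auto
 let ?U = "Gen \<union> sec ` ?G2"
 have cU: "card ?U = card Gen + card ?G2" using SI card_image[OF inj] by (subst card_Un_disjoint) auto
 have "(\<Prod>t\<in>?I. ql Q t) = (\<Prod>t\<in>?U. ql Q t) * (\<Prod>t\<in>?I - ?U. ql Q t)"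
  using GI SI prod.subset_diff[of ?U ?I "ql Q"] by (simp add: mult.commute)
 also have "(\<Prod>t\<in>?U. ql Q t) = (\<Prod>t\<in>Gen. ql Q t) * (\<Prod>t\<in>sec ` ?G2. ql Q t)"
  using SI by (intro prod.union_disjoint) auto
 also have "(\<Prod>t\<in>sec ` ?G2. ql Q t) = (\<Prod>t\<in>?G2. ql Q t)"
  by (rule prod.reindex_cong[OF inj refl]) (use sec in blast)
 also have "(\<Prod>t\<in>Gen. ql Q t) = (\<Prod>t\<in>?G2. ql Q t) * (\<Prod>t\<in>Gen1. ql Q t)"
  using GI by (intro prod.subset_diff) auto
 finally have eq: "(\<Prod>t\<in>?I. ql Q t) = (\<Prod>t\<in>Gen1. ql Q t) * (\<Prod>t\<in>?G2. (ql Q t)\<^sup>2) * (\<Prod>t\<in>?I - ?U. ql Q t)"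
  by (simp add: power2_eq_square prod.distrib mult_ac)
 have "(\<Prod>t\<in>?I - ?U. ql Q t) \<le> (\<Prod>t\<in>?I - ?U. \<rho>)" using q by (intro prod_mono) auto
 also have "\<dots> = \<rho> ^ (card ?I - card ?U)" using GI SI by (simp add: card_Diff_subset)
 finally have "(\<Prod>t\<in>?I - ?U. ql Q t) * \<rho> ^ card ?U \<le> \<rho> ^ (card ?I - card ?U) * \<rho> ^ card ?U"
  using r by (intro mult_right_mono) auto
 also have "\<dots> = \<rho> ^ card ?I"
 proof -
  have "card ?U \<le> card ?I" using GI SI by (intro card_mono) auto
  then show ?thesis by (simp flip: power_add)
 qed
 finally have le: "(\<Prod>t\<in>?I - ?U. ql Q t) * \<rho> ^ card ?U \<le> \<rho> ^ card ?I" .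
 have pos: "0 \<le> (\<Prod>t\<in>Gen1. ql Q t) * (\<Prod>t\<in>?G2. (ql Q t)\<^sup>2)"
  using q GI by (intro mult_nonneg_nonneg prod_nonneg) auto
 show ?thesis unfolding eq cU[symmetric] using mult_left_mono[OF le pos] by (simp add: mult_ac)
qed

text \<open>Keeping the entry of \<open>Q\<close> at a vertex of \<open>Gen1\<close> loses one
  factor \<open>\<rho>\<close>. The factor \<open>\<theta> \<le> \<rho>\<close> of the position that
  discovers it gives this back, except when the position shares a coordinate with another one; these
  exceptions make up the power of \<open>2 / \<rho>\<close>.\<close>

lemma weight_le:
 fixes \<rho> \<theta> n :: real
 assumes q: "\<And>t. t < T \<Longrightarrow> inter t \<Longrightarrow> 0 \<le> ql Q t \<and> ql Q t \<le> \<rho>"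
  and r: "0 < \<rho>" "\<rho> \<le> 1" and th: "0 \<le> \<theta>" "\<theta> \<le> \<rho>" and n: "0 < n" and T0: "0 < T"
 shows "(\<Prod>t\<in>{t. t < T \<and> inter t}. ql Q t) *
  ((1 / n) ^ card (e ` {..<T}) * \<theta> ^ card (multi1 T e - shared T e) * 2 ^ card (multi1 T e \<inter> shared T e))
  \<le> \<rho> ^ card {t. t < T \<and> inter t} * (1 / n) ^ (card Phi + card xedges) * (2 / \<rho>) ^ (4 * card xedges + 2 * b)
   * ((\<Prod>t\<in>Gen1. ql Q t) * (\<Prod>t\<in>Gen - Gen1. (ql Q t / \<rho>)\<^sup>2))"
proof -
 let ?I = "{t. t < T \<and> inter t}" and ?G2 = "Gen - Gen1"
 let ?R = "card (multi1 T e - shared T e)" and ?S = "card (shared T e)"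
 let ?P1 = "\<Prod>t\<in>Gen1. ql Q t" and ?P2 = "\<Prod>t\<in>?G2. (ql Q t)\<^sup>2" and ?PI = "\<Prod>t\<in>?I. ql Q t"
 have sub: "Gen1 \<subseteq> Gen" "Gen \<subseteq> ?I" unfolding Gen1_def Gen_def by auto
 have cG: "card Gen = card Gen1 + card ?G2" using sub card_mono[of Gen Gen1] by (simp add: card_Diff_subset)
 have nn: "0 \<le> ?P1" "0 \<le> ?P2" "0 \<le> ?PI" using q sub by (auto intro!: prod_nonneg)
 have a: "?PI * \<rho> ^ (card Gen + card ?G2) \<le> \<rho> ^ card ?I * ?P1 * ?P2" by (rule prod_links_le[OF q r(1)])
 have b: "\<theta> ^ ?R * \<rho> ^ ?S \<le> \<rho> ^ card Gen1"
 proof -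
  have "\<theta> ^ ?R * \<rho> ^ ?S \<le> \<rho> ^ ?R * \<rho> ^ ?S" using th r by (intro mult_right_mono power_mono) auto
  also have "\<dots> = \<rho> ^ (?R + ?S)" by (simp add: power_add)
  also have "\<dots> \<le> \<rho> ^ card Gen1" using card_Gen1 r by (intro power_decreasing) auto
  finally show ?thesis .
 qed
 have c: "(2::real) ^ card (multi1 T e \<inter> shared T e) \<le> 2 ^ ?S"
  by (intro power_increasing card_mono) auto
 have P2: "(\<Prod>t\<in>?G2. (ql Q t / \<rho>)\<^sup>2) = ?P2 / \<rho> ^ (2 * card ?G2)"
  by (simp add: power_divide prod_dividef power_mult)
 have "?PI * (\<theta> ^ ?R * 2 ^ card (multi1 T e \<inter> shared T e)) * (\<rho> ^ (card Gen + card ?G2) * \<rho> ^ ?S)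
   = (?PI * \<rho> ^ (card Gen + card ?G2)) * (\<theta> ^ ?R * \<rho> ^ ?S) * 2 ^ card (multi1 T e \<inter> shared T e)"
  by (simp add: mult_ac)
 also have "\<dots> \<le> (\<rho> ^ card ?I * ?P1 * ?P2) * \<rho> ^ card Gen1 * 2 ^ ?S"
  by (rule mult_mono[OF mult_mono[OF a b] c]) (use nn r th in auto)
 finally have d: "?PI * (\<theta> ^ ?R * 2 ^ card (multi1 T e \<inter> shared T e)) * (\<rho> ^ (card Gen + card ?G2) * \<rho> ^ ?S)
   \<le> (\<rho> ^ card ?I * ?P1 * ?P2) * \<rho> ^ card Gen1 * 2 ^ ?S" .
 have pw: "\<rho> ^ (card Gen + card ?G2) * \<rho> ^ ?S = \<rho> ^ card Gen1 * \<rho> ^ (2 * card ?G2) * \<rho> ^ ?S"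
  unfolding cG by (simp add: power_add[symmetric] mult_2 add_ac)
 have "?PI * (\<theta> ^ ?R * 2 ^ card (multi1 T e \<inter> shared T e))
   \<le> (\<rho> ^ card ?I * ?P1 * ?P2) * \<rho> ^ card Gen1 * 2 ^ ?S / (\<rho> ^ (card Gen + card ?G2) * \<rho> ^ ?S)"
  using d r by (subst pos_le_divide_eq) auto
 also have "\<dots> = \<rho> ^ card ?I * (2 / \<rho>) ^ ?S * (?P1 * (?P2 / \<rho> ^ (2 * card ?G2)))"
  unfolding pw using r by (simp add: power_divide field_simps)
 also have "\<dots> \<le> \<rho> ^ card ?I * (2 / \<rho>) ^ (4 * card xedges + 2 * b) * (?P1 * (?P2 / \<rho> ^ (2 * card ?G2)))"
 proof (intro mult_right_mono mult_left_mono power_increasing)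
  show "?S \<le> 4 * card xedges + 2 * b" using gen_bounds[OF T0] by simp
  show "1 \<le> 2 / \<rho>" using r by simp
 qed (use nn r in auto)
 finally have "?PI * (\<theta> ^ ?R * 2 ^ card (multi1 T e \<inter> shared T e)) * (1 / n) ^ (card Phi + card xedges)
  \<le> \<rho> ^ card ?I * (2 / \<rho>) ^ (4 * card xedges + 2 * b) * (?P1 * (?P2 / \<rho> ^ (2 * card ?G2))) * (1 / n) ^ (card Phi + card xedges)"
  using n by (intro mult_right_mono) auto
 then show ?thesis unfolding P2 card_edges by (simp add: mult_ac)
qed

definition LR :: "(nat \<times> nat) set" where
 "LR = {(lid (2 * t + 1), lid (2 * t + 2)) | t. Suc t < T} \<union> {(lid (2 * t + 2), lid (2 * t + 1)) | t. Suc t < T}"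

lemma LR_connected: "k \<in> reps \<Longrightarrow> (k, nd k) \<in> LR\<^sup>*"
proof -
 assume k: "k \<in> reps"
 have *: "(lid x, lid y) \<in> LR\<^sup>*" if "(x, y) \<in> eqr \<union> lnk \<union> lnk\<inverse>" for x y
 proof -
  from that consider "(x, y) \<in> eqr" | "(x, y) \<in> lnk" | "(y, x) \<in> lnk" by auto
  then show ?thesis
  proof cases
   case 1
   then have "lid x = lid y" using lid_eq_iff by blast
   then show ?thesis by simp
  next
   case 2 then show ?thesis unfolding LR_def lnk_def by (intro r_into_rtrancl) auto
  next
   case 3 then show ?thesis unfolding LR_def lnk_def by (intro r_into_rtrancl) auto
  qed
 qed
 have "(x, y) \<in> conn \<Longrightarrow> (lid x, lid y) \<in> LR\<^sup>*" for x y
  unfolding conn_def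
 proof (induction rule: rtrancl_induct)
  case (step y z)
  have "(lid y, lid z) \<in> LR\<^sup>*" by (rule *) (fact step.hyps(2))
  then show ?case using step.IH by (rule rtrancl_trans[rotated])
 qed simp
 from this[OF nd_in[of k]] have "(lid k, lid (nd k)) \<in> LR\<^sup>*" .
 moreover have "lid (nd k) = nd k" using lid_le[of "nd k"] nd_le_lid[of "nd k"] by simp
 ultimately show ?thesis using k unfolding reps_def by simp
qed

text \<open>Distance to the root label along links. Labels of a non-generic vertex are later
  enumerated outwards from the root label, each as a neighbour of one that is nearer.\<close>

definition dst :: "nat \<Rightarrow> nat" where "dst k = (LEAST i. (k, nd k) \<in> LR ^^ i)"

lemma LR_reps:
 assumes "(k, l) \<in> LR" shows "k \<in> reps" "l \<in> reps" "nd k = nd l"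
proof -
 have "lid (2 * t + 1) \<in> reps" "lid (2 * t + 2) \<in> reps" "nd (lid (2 * t + 1)) = nd (lid (2 * t + 2))" if "Suc t < T" for t
  using that lid_le[of "2 * t + 1"] lid_le[of "2 * t + 2"] nd_link[OF that] unfolding reps_def by auto
 then show "k \<in> reps" "l \<in> reps" "nd k = nd l" using assms unfolding LR_def by auto
qed

lemma dst_parent:
 assumes "k \<in> reps" "k \<noteq> nd k"
 shows "\<exists>l. (k, l) \<in> LR \<and> dst l < dst k"
proof -
 obtain i where "(k, nd k) \<in> LR ^^ i" using LR_connected[OF assms(1)] rtrancl_imp_relpow by blast
 then have d: "(k, nd k) \<in> LR ^^ dst k" unfolding dst_def by (rule LeastI)
 then obtain j where j: "dst k = Suc j" using assms(2) by (cases "dst k") auto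
 then obtain l where l: "(k, l) \<in> LR" "(l, nd k) \<in> LR ^^ j" using d relpow_Suc_D2[of k "nd k" j LR] by auto
 then have "(l, nd l) \<in> LR ^^ j" using LR_reps[OF l(1)] by simp
 then have "dst l \<le> j" unfolding dst_def by (rule Least_le)
 then show ?thesis using l j by auto
qed

end

lemma sum_prod_fst: "(\<Sum>h\<in>A \<times> B. f (fst h)) = (\<Sum>x\<in>A. f x) * real (card B)"
 by (simp add: sum.cartesian_product' sum_distrib_right mult.commute)

section \<open>Summation over all walks of a family\<close>

locale walk_family =
 fixes n D T s b :: nat and Q :: "nat \<Rightarrow> nat \<Rightarrow> real" and \<rho> \<theta> :: real
  and \<Gamma> :: "'a set" and ed :: "'a \<Rightarrow> nat \<Rightarrow> nat \<times> nat" and adj :: "bool \<times> nat \<Rightarrow> bool \<times> nat \<Rightarrow> bool"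
 assumes finG: "finite \<Gamma>" and wlk: "\<And>\<gamma>. \<gamma> \<in> \<Gamma> \<Longrightarrow> walk T s b (ed \<gamma>)"
  and ed_inj: "\<And>\<gamma> \<gamma>'. \<gamma> \<in> \<Gamma> \<Longrightarrow> \<gamma>' \<in> \<Gamma> \<Longrightarrow> (\<And>t. t < T \<Longrightarrow> ed \<gamma> t = ed \<gamma>' t) \<Longrightarrow> \<gamma> = \<gamma>'"
  and rng: "\<And>\<gamma> t. \<gamma> \<in> \<Gamma> \<Longrightarrow> t < T \<Longrightarrow> fst (ed \<gamma> t) < n \<and> snd (ed \<gamma> t) < n"
  and adj: "\<And>\<gamma> t. \<gamma> \<in> \<Gamma> \<Longrightarrow> Suc t < T \<Longrightarrow> adj (walk.lab s (ed \<gamma>) (2 * t + 1)) (walk.lab s (ed \<gamma>) (2 * t + 2))"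
  and adj_sym: "\<And>u v. adj u v \<Longrightarrow> adj v u"
  and adj_fin: "\<And>u. finite {v. adj u v}" and adj_card: "\<And>u. card {v. adj u v} \<le> D"
  and qlink: "\<And>\<gamma> t. \<gamma> \<in> \<Gamma> \<Longrightarrow> t < T \<Longrightarrow> walk.inter T s t \<Longrightarrow>
    qlab Q (walk.lab s (ed \<gamma>) (2 * t + 1)) (walk.lab s (ed \<gamma>) (2 * t + 2)) \<le> \<rho>"
  and Q_nonneg: "\<And>y x. 0 \<le> Q y x"
  and Q_sum: "(\<Sum>y<n. \<Sum>x<n. Q y x) \<le> real n"
  and Q_sum2: "(\<Sum>y<n. \<Sum>x<n. (Q y x)\<^sup>2) \<le> real n * \<rho>\<^sup>2"
  and rho: "0 < \<rho>" "\<rho> \<le> 1" and theta: "0 \<le> \<theta>" "\<theta> \<le> \<rho>"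
  and pos: "0 < n" "0 < T" "0 < D"
begin

abbreviation LB :: "'a \<Rightarrow> nat \<Rightarrow> bool \<times> nat" where "LB \<gamma> k \<equiv> walk.lab s (ed \<gamma>) k"

definition lnkw :: "'a \<Rightarrow> nat \<Rightarrow> real" where "lnkw \<gamma> t = qlab Q (LB \<gamma> (2 * t + 1)) (LB \<gamma> (2 * t + 2))"

text \<open>The entries of \<open>Q\<close> on the inner links, times the bound that
  \<open>centred_product_bound\<close> gives for the expected product of the centred entries,
  without its constant.\<close>

definition weight :: "'a \<Rightarrow> real" where
 "weight \<gamma> = (\<Prod>t\<in>{t. t < T \<and> walk.inter T s t}. lnkw \<gamma> t) *
  ((1 / n) ^ card (ed \<gamma> ` {..<T}) * \<theta> ^ card (multi1 T (ed \<gamma>) - shared T (ed \<gamma>)) *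
   2 ^ card (multi1 T (ed \<gamma>) \<inter> shared T (ed \<gamma>)))"

definition links :: nat where "links = card {t. t < T \<and> walk.inter T s t}"

lemma lnkw_nonneg: "0 \<le> lnkw \<gamma> t" unfolding lnkw_def qlab_def using Q_nonneg by simp

lemma lab_type: "\<gamma> \<in> \<Gamma> \<Longrightarrow> fst (LB \<gamma> k) \<longleftrightarrow> even (k div 2 div s) = even k"
 unfolding walk.lab_def[OF wlk] by (simp only: if_distrib[of fst] fst_conv if_bool_eq_conj) blast

lemma LB_less:
 assumes "\<gamma> \<in> \<Gamma>" "k < 2 * T"
 shows "snd (LB \<gamma> k) < n"
proof -
 have "k div 2 < T" using assms(2) by auto
 then have r: "fst (ed \<gamma> (k div 2)) < n" "snd (ed \<gamma> (k div 2)) < n" using rng[OF assms(1)] by auto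
 show ?thesis unfolding walk.lab_def[OF wlk[OF assms(1)]]
  by (rule if_split[where P = "\<lambda>z. snd z < n", THEN iffD2]) (simp only: snd_conv r implies_True_equals simp_thms)
qed

text \<open>For a fixed pattern a walk is given by a pair of labels for each generic vertex, a root
  label for every other vertex, and one of \<open>D\<close> neighbours for each further label. A
  weighted sum over a pair is at most \<open>n\<close>, as is the number of root labels. This gives
  \<open>n ^ Suc (card Phi)\<close> against one factor \<open>1 / n\<close> for each of the
  \<open>card Phi + g\<close> edges.\<close>

lemma class_sum:
 assumes C: "\<C> \<subseteq> \<Gamma>" "\<gamma>0 \<in> \<C>"
  and same: "\<And>\<gamma>. \<gamma> \<in> \<C> \<Longrightarrow> walk.codes T s (ed \<gamma>) = walk.codes T s (ed \<gamma>0)"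
  and g: "\<And>\<gamma>. \<gamma> \<in> \<C> \<Longrightarrow> card (walk.xedges T s (ed \<gamma>)) = g"
 shows "(\<Sum>\<gamma>\<in>\<C>. weight \<gamma>) \<le> n * (1 / n) ^ g * \<rho> ^ links * (2 * D / \<rho>) ^ (4 * g + 2 * b)"
proof -
 have C0: "\<gamma>0 \<in> \<Gamma>" using C by blast
 have finC: "finite \<C>" by (rule finite_subset[OF C(1) finG])
 have CG: "\<gamma> \<in> \<Gamma>" if "\<gamma> \<in> \<C>" for \<gamma> using that C by blast
 interpret A: walk T s b "ed \<gamma>0" by (rule wlk[OF C0])
 have pat: "walk.lid T s (ed \<gamma>) k = A.lid k" "walk.nd T s (ed \<gamma>) k = A.nd k" if "\<gamma> \<in> \<C>" "k < 2 * T" for \<gamma> k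
  using pattern_of_codes[OF wlk[OF CG] wlk[OF C0] same] that by blast+
 have Phi: "walk.Phi T s (ed \<gamma>) = A.Phi" and Gen: "walk.Gen T s (ed \<gamma>) = A.Gen" and Gen1: "walk.Gen1 T s (ed \<gamma>) = A.Gen1"
  if gC: "\<gamma> \<in> \<C>" for \<gamma>
 proof -
  interpret B: walk T s b "ed \<gamma>" by (rule wlk[OF CG[OF gC]])
  have fr: "B.free t = A.free t" if "t < T" for t
   unfolding A.free_def B.free_def using pat(2)[OF gC, of "2 * t + 1"] that by simp
  show "B.Phi = A.Phi" unfolding A.Phi_def B.Phi_def using fr by auto
  have a: "(\<forall>k<2*T. B.nd k = 2 * t + 1 \<longrightarrow> B.lid k = 2 * t + 1 \<or> B.lid k = 2 * t + 2) \<longleftrightarrow>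
   (\<forall>k<2*T. A.nd k = 2 * t + 1 \<longrightarrow> A.lid k = 2 * t + 1 \<or> A.lid k = 2 * t + 2)" for t
   using pat[OF gC] by simp
  have c: "(\<forall>u<T. \<not> B.inter u \<longrightarrow> B.nd (2 * u + 1) \<noteq> 2 * t + 1) \<longleftrightarrow> (\<forall>u<T. \<not> B.inter u \<longrightarrow> A.nd (2 * u + 1) \<noteq> 2 * t + 1)" for t
   using pat[OF gC] by simp
  have d: "(\<forall>u<T. B.inter u \<longrightarrow> B.nd (2 * u + 1) = 2 * t + 1 \<longrightarrow> u = t) \<longleftrightarrow> (\<forall>u<T. B.inter u \<longrightarrow> A.nd (2 * u + 1) = 2 * t + 1 \<longrightarrow> u = t)" for t
   using pat[OF gC] by simp
  show G: "B.Gen = A.Gen" unfolding B.Gen_def A.Gen_def a c using fr by blast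
  show "B.Gen1 = A.Gen1" unfolding B.Gen1_def A.Gen1_def d G by blast
 qed
 have labrep: "LB \<gamma> k = LB \<gamma> (A.lid k)" if "\<gamma> \<in> \<C>" "k < 2 * T" for \<gamma> k
  using walk.lab_lid[OF wlk[OF CG[OF that(1)]] that(2)] pat(1)[OF that] by simp
 have adjLR: "adj (LB \<gamma> k) (LB \<gamma> l)" if "\<gamma> \<in> \<C>" "(k, l) \<in> A.LR" for \<gamma> k l
 proof -
  from that(2) obtain t where t: "Suc t < T"
   "(k = A.lid (2 * t + 1) \<and> l = A.lid (2 * t + 2)) \<or> (k = A.lid (2 * t + 2) \<and> l = A.lid (2 * t + 1))"
   unfolding A.LR_def by auto
  have "adj (LB \<gamma> (2 * t + 1)) (LB \<gamma> (2 * t + 2))" using adj[OF CG[OF that(1)] t(1)] .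
  then have f: "adj (LB \<gamma> (A.lid (2 * t + 1))) (LB \<gamma> (A.lid (2 * t + 2)))"
   using labrep[OF that(1), of "2 * t + 1"] labrep[OF that(1), of "2 * t + 2"] t by simp
  show ?thesis using t(2) f adj_sym[OF f] by blast
 qed
 define par where "par k = (SOME l. (k, l) \<in> A.LR \<and> A.dst l < A.dst k)" for k
 have par: "(k, par k) \<in> A.LR \<and> A.dst (par k) < A.dst k" if "k \<in> A.reps" "k \<noteq> A.nd k" for k
  unfolding par_def by (rule someI_ex) (rule A.dst_parent[OF that])
 have "\<exists>f. inj_on f {v. adj u v} \<and> f ` {v. adj u v} \<subseteq> {..<D}" for u
  using card_le_inj[OF adj_fin[of u], of "{..<D}"] adj_card[of u] by auto
 then obtain idx where idx: "\<And>u. inj_on (idx u) {v. adj u v}" "\<And>u. idx u ` {v. adj u v} \<subseteq> {..<D}" by metis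
 define pr where "pr \<gamma> t = (if fst (LB \<gamma>0 (2 * t + 1)) then (snd (LB \<gamma> (2 * t + 1)), snd (LB \<gamma> (2 * t + 2)))
   else (snd (LB \<gamma> (2 * t + 2)), snd (LB \<gamma> (2 * t + 1))))" for \<gamma> t
 define H where "H \<gamma> = (restrict (pr \<gamma>) A.Gen, restrict (\<lambda>c. snd (LB \<gamma> c)) A.SR,
   restrict (\<lambda>k. idx (LB \<gamma> (par k)) (LB \<gamma> k)) A.SN)" for \<gamma>
 define HS where "HS = (PiE A.Gen (\<lambda>_. {..<n} \<times> {..<n})) \<times> (PiE A.SR (\<lambda>_. {..<n})) \<times> (PiE A.SN (\<lambda>_. {..<D}))"
 \<comment> \<open>On \<open>Gen1\<close> the sum of \<open>w\<close> is bounded by the total mass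
   of \<open>Q\<close>, elsewhere by its sum of squares divided by
   \<open>\<rho>\<^sup>2\<close>.\<close>
 define w where "w t p = (if t \<in> A.Gen1 then Q (fst p) (snd p) else (Q (fst p) (snd p) / \<rho>)\<^sup>2)" for t p
 have type_eq: "fst (LB \<gamma> k) = fst (LB \<gamma>0 k)" if "\<gamma> \<in> \<C>" for \<gamma> k
  using lab_type[OF CG[OF that], of k] lab_type[OF C0, of k] by blast
 have lw: "lnkw \<gamma> t = Q (fst (pr \<gamma> t)) (snd (pr \<gamma> t))" if "\<gamma> \<in> \<C>" for \<gamma> t
  unfolding lnkw_def qlab_def pr_def using type_eq[OF that, of "2 * t + 1"] by auto
 have GenT: "Suc t < T" if "t \<in> A.Gen" for t using that unfolding A.Gen_def A.inter_def by auto
 have Hin: "H \<gamma> \<in> HS" if gC: "\<gamma> \<in> \<C>" for \<gamma>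
 proof -
  have "pr \<gamma> t \<in> {..<n} \<times> {..<n}" if "t \<in> A.Gen" for t
   unfolding pr_def using LB_less[of \<gamma>] GenT[OF that] C gC by auto
  moreover have "snd (LB \<gamma> c) < n" if "c \<in> A.SR" for c
   using LB_less[of \<gamma> c] that C gC unfolding A.SR_def A.comps_def by auto
  moreover have "idx (LB \<gamma> (par k)) (LB \<gamma> k) < D" if "k \<in> A.SN" for k
  proof -
   have "(k, par k) \<in> A.LR" using par that unfolding A.SN_def by auto
   then have "LB \<gamma> k \<in> {v. adj (LB \<gamma> (par k)) v}" using adjLR[OF gC] adj_sym by blast
   then show ?thesis using idx(2) by blast
  qed
  ultimately show ?thesis unfolding H_def HS_def by (auto simp: PiE_def)
 qed
 have Hinj: "inj_on H \<C>"
 proof (rule inj_onI)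
  fix \<gamma> \<gamma>' assume h: "\<gamma> \<in> \<C>" "\<gamma>' \<in> \<C>" "H \<gamma> = H \<gamma>'"
  have rG: "restrict (pr \<gamma>) A.Gen = restrict (pr \<gamma>') A.Gen"
   and rS: "restrict (\<lambda>c. snd (LB \<gamma> c)) A.SR = restrict (\<lambda>c. snd (LB \<gamma>' c)) A.SR"
   and rN: "restrict (\<lambda>k. idx (LB \<gamma> (par k)) (LB \<gamma> k)) A.SN = restrict (\<lambda>k. idx (LB \<gamma>' (par k)) (LB \<gamma>' k)) A.SN"
   using h(3) unfolding H_def by auto
  have pG: "pr \<gamma> t = pr \<gamma>' t" if "t \<in> A.Gen" for t using fun_cong[OF rG, of t] that by simp
  have pS: "snd (LB \<gamma> c) = snd (LB \<gamma>' c)" if "c \<in> A.SR" for c using fun_cong[OF rS, of c] that by simp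
  have pN: "idx (LB \<gamma> (par k)) (LB \<gamma> k) = idx (LB \<gamma>' (par k)) (LB \<gamma>' k)" if "k \<in> A.SN" for k
   using fun_cong[OF rN, of k] that by simp
  \<comment> \<open>Labels are recovered outwards from the root label of each class, by induction on
    the distance.\<close>
  have rep: "k \<in> A.reps \<Longrightarrow> LB \<gamma> k = LB \<gamma>' k" for k
  proof (induction "A.dst k" arbitrary: k rule: less_induct)
   case less
   have ty: "fst (LB \<gamma> k) = fst (LB \<gamma>' k)" using type_eq h by simp
   have k2: "k < 2 * T" "A.lid k = k" using less.prems unfolding A.reps_def by auto
   have ndc: "A.nd k \<in> A.comps" using k2 by (intro A.nd_comps)
   show ?case
   proof (cases "A.nd k \<in> (\<lambda>t. 2 * t + 1) ` A.Gen")
    case True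
    then obtain t where t: "t \<in> A.Gen" "A.nd k = 2 * t + 1" by auto
    then have "k = 2 * t + 1 \<or> k = 2 * t + 2" using k2 unfolding A.Gen_def by auto
    then have "snd (LB \<gamma> k) = snd (LB \<gamma>' k)" using pG[OF t(1)] unfolding pr_def by (auto split: if_splits)
    then show ?thesis using ty by (simp add: prod_eq_iff)
   next
    case False
    then have SR: "A.nd k \<in> A.SR" using ndc unfolding A.SR_def by auto
    show ?thesis
    proof (cases "k = A.nd k")
     case True
     then have "snd (LB \<gamma> k) = snd (LB \<gamma>' k)" using pS SR by metis
     then show ?thesis using ty by (simp add: prod_eq_iff)
    next
     case False
     then have kN: "k \<in> A.SN" using less.prems SR unfolding A.SN_def by auto
     have p: "(k, par k) \<in> A.LR" "A.dst (par k) < A.dst k" using par[OF less.prems False] by auto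
     have IH: "LB \<gamma> (par k) = LB \<gamma>' (par k)" using less.hyps[OF p(2)] A.LR_reps[OF p(1)] by blast
     have "LB \<gamma> k \<in> {v. adj (LB \<gamma> (par k)) v}" "LB \<gamma>' k \<in> {v. adj (LB \<gamma> (par k)) v}"
      using adjLR[OF h(1) p(1)] adjLR[OF h(2) p(1)] adj_sym IH by auto
     then show ?thesis using pN[OF kN] idx(1) IH by (metis inj_onD)
    qed
   qed
  qed
  have all: "LB \<gamma> k = LB \<gamma>' k" if "k < 2 * T" for k
  proof -
   have "A.lid k \<in> A.reps" using that A.lid_le[of k] unfolding A.reps_def by auto
   then show ?thesis using rep labrep[OF h(1) that] labrep[OF h(2) that] by simp
  qed
  have ww: "walk T s b (ed \<gamma>)" "walk T s b (ed \<gamma>')" using wlk CG h by blast+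
  show "\<gamma> = \<gamma>'"
  proof (rule ed_inj)
   fix t assume t: "t < T"
   show "ed \<gamma> t = ed \<gamma>' t"
    using all[of "2 * t"] all[of "2 * t + 1"] t
    unfolding walk.lab_even[OF ww(1)] walk.lab_even[OF ww(2)] walk.lab_odd[OF ww(1)] walk.lab_odd[OF ww(2)]
    by (auto simp: prod_eq_iff split: if_splits)
  qed (use h CG in blast)+
 qed
 have wnn: "0 \<le> w t p" for t p unfolding w_def using Q_nonneg by auto
 let ?W = "\<lambda>h. \<Prod>t\<in>A.Gen. w t (fst h t)"
 have wsum: "(\<Sum>p\<in>{..<n} \<times> {..<n}. w t p) \<le> real n" for t
 proof (cases "t \<in> A.Gen1")
  case True
  then show ?thesis using Q_sum unfolding w_def by (simp add: sum.cartesian_product split_beta)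
 next
  case False
  then have "(\<Sum>p\<in>{..<n} \<times> {..<n}. w t p) = (\<Sum>y<n. \<Sum>x<n. (Q y x)\<^sup>2) / \<rho>\<^sup>2"
   unfolding w_def by (simp add: sum.cartesian_product split_beta power_divide sum_divide_distrib)
  also have "\<dots> \<le> real n" using Q_sum2 rho by (simp add: pos_divide_le_eq)
  finally show ?thesis .
 qed
 have finHS: "finite HS" unfolding HS_def by (intro finite_cartesian_product finite_PiE) auto
 have "(\<Sum>\<gamma>\<in>\<C>. ?W (H \<gamma>)) = (\<Sum>h\<in>H ` \<C>. ?W h)" by (simp add: sum.reindex[OF Hinj] o_def)
 also have "\<dots> \<le> (\<Sum>h\<in>HS. ?W h)"
  using Hin finHS wnn by (intro sum_mono2 prod_nonneg) auto
 also have "\<dots> = (\<Sum>h1\<in>PiE A.Gen (\<lambda>_. {..<n} \<times> {..<n}). \<Prod>t\<in>A.Gen. w t (h1 t)) *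
   (card (PiE A.SR (\<lambda>_. {..<n})) * card (PiE A.SN (\<lambda>_. {..<D})))"
  unfolding HS_def sum_prod_fst[where f = "\<lambda>h. \<Prod>t\<in>A.Gen. w t (h t)"] card_cartesian_product of_nat_mult by (rule refl)
 also have "(\<Sum>h1\<in>PiE A.Gen (\<lambda>_. {..<n} \<times> {..<n}). \<Prod>t\<in>A.Gen. w t (h1 t)) = (\<Prod>t\<in>A.Gen. \<Sum>p\<in>{..<n} \<times> {..<n}. w t p)"
  by (rule prod_sum_PiE[symmetric]) auto
 also have "\<dots> \<le> (\<Prod>t\<in>A.Gen. real n)" using wsum wnn by (intro prod_mono conjI sum_nonneg) auto
 also have "(\<Prod>t\<in>A.Gen. real n) * (card (PiE A.SR (\<lambda>_. {..<n})) * card (PiE A.SN (\<lambda>_. {..<D})))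
  = real n ^ (card A.Gen + card A.SR) * real D ^ card A.SN"
  by (simp add: card_PiE power_add)
 also have "\<dots> \<le> real n ^ Suc (card A.Phi) * real D ^ (4 * g + 2 * b)"
  using A.gen_bounds[OF pos(2)] g[OF C(2)] pos by (intro mult_mono power_increasing) auto
 finally have S: "(\<Sum>\<gamma>\<in>\<C>. ?W (H \<gamma>)) \<le> real n ^ Suc (card A.Phi) * real D ^ (4 * g + 2 * b)"
  by (simp add: mult_right_mono)
 let ?c = "\<rho> ^ links * (1 / n) ^ (card A.Phi + g) * (2 / \<rho>) ^ (4 * g + 2 * b)"
 have wt: "weight \<gamma> \<le> ?c * ?W (H \<gamma>)" if gC: "\<gamma> \<in> \<C>" for \<gamma>
 proof -
  interpret B: walk T s b "ed \<gamma>" by (rule wlk[OF CG[OF gC]])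
  have "weight \<gamma> \<le> \<rho> ^ links * (1 / n) ^ (card B.Phi + card B.xedges) * (2 / \<rho>) ^ (4 * card B.xedges + 2 * b)
   * ((\<Prod>t\<in>B.Gen1. lnkw \<gamma> t) * (\<Prod>t\<in>B.Gen - B.Gen1. (lnkw \<gamma> t / \<rho>)\<^sup>2))"
   unfolding weight_def links_def lnkw_def
  proof (rule B.weight_le)
   fix t assume "t < T" "B.inter t"
   then show "0 \<le> B.ql Q t \<and> B.ql Q t \<le> \<rho>"
    using qlink[of \<gamma> t] lnkw_nonneg[of \<gamma> t] gC C unfolding lnkw_def by auto
  qed (use rho theta pos in auto)
  also have "(\<Prod>t\<in>B.Gen1. lnkw \<gamma> t) * (\<Prod>t\<in>B.Gen - B.Gen1. (lnkw \<gamma> t / \<rho>)\<^sup>2) = ?W (H \<gamma>)"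
  proof -
   have sub: "A.Gen1 \<subseteq> A.Gen" unfolding A.Gen1_def by auto
   have "?W (H \<gamma>) = (\<Prod>t\<in>A.Gen. w t (pr \<gamma> t))" unfolding H_def by (intro prod.cong) auto
   also have "\<dots> = (\<Prod>t\<in>A.Gen - A.Gen1. w t (pr \<gamma> t)) * (\<Prod>t\<in>A.Gen1. w t (pr \<gamma> t))"
    using sub by (intro prod.subset_diff) auto
   finally show ?thesis unfolding Gen[OF gC] Gen1[OF gC] w_def using lw[OF gC] by (simp add: mult.commute)
  qed
  finally show ?thesis unfolding Phi[OF gC] g[OF gC] .
 qed
 have "(\<Sum>\<gamma>\<in>\<C>. weight \<gamma>) \<le> (\<Sum>\<gamma>\<in>\<C>. ?c * ?W (H \<gamma>))" using wt by (rule sum_mono)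
 also have "\<dots> = ?c * (\<Sum>\<gamma>\<in>\<C>. ?W (H \<gamma>))" by (simp add: sum_distrib_left)
 also have "\<dots> \<le> ?c * (real n ^ Suc (card A.Phi) * real D ^ (4 * g + 2 * b))"
  using S rho by (intro mult_left_mono) auto
 also have "\<dots> = n * (1 / n) ^ g * \<rho> ^ links * (2 * D / \<rho>) ^ (4 * g + 2 * b)"
  using pos by (simp add: power_add power_divide power_mult_distrib field_simps)
 finally show ?thesis .
qed

lemma xedges_le: "\<gamma> \<in> \<Gamma> \<Longrightarrow> card (walk.xedges T s (ed \<gamma>)) \<le> T"
proof -
 assume "\<gamma> \<in> \<Gamma>"
 then interpret B: walk T s b "ed \<gamma>" by (rule wlk)
 have "card B.xedges \<le> card {t. t < T \<and> B.exc t}" unfolding B.xedges_def by (rule card_image_le) auto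
 also have "\<dots> \<le> card {..<T}" by (rule card_mono) auto
 finally show ?thesis by simp
qed

text \<open>Walks are grouped by the excess \<open>g\<close> and by their code, a set of at most
  \<open>b * (5 * g + 4)\<close> letters from an alphabet with fewer than
  \<open>(2 * T + 3) ^ 5\<close> elements.\<close>

theorem weight_sum:
 "(\<Sum>\<gamma>\<in>\<Gamma>. weight \<gamma>) \<le>
  (\<Sum>g\<le>T. real ((2 * T + 3) ^ (5 * (b * (5 * g + 4)))) * (n * (1 / n) ^ g * \<rho> ^ links * (2 * D / \<rho>) ^ (4 * g + 2 * b)))"
proof -
 let ?U = "{..<T} \<times> ({..3::nat} \<times> {..2 * T} \<times> {..2 * T} \<times> {..2 * T})"
 let ?K = "\<lambda>g. {S. S \<subseteq> ?U \<and> card S \<le> b * (5 * g + 4)}"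
 let ?f = "\<lambda>\<gamma>. (card (walk.xedges T s (ed \<gamma>)), walk.codes T s (ed \<gamma>))"
 let ?B = "\<lambda>g. n * (1 / n) ^ g * \<rho> ^ links * (2 * D / \<rho>) ^ (4 * g + 2 * b)"
 have finK: "finite (?K g)" for g by auto
 have img: "?f ` \<Gamma> \<subseteq> Sigma {..T} ?K"
 proof
  fix p assume "p \<in> ?f ` \<Gamma>"
  then obtain \<gamma> where g: "\<gamma> \<in> \<Gamma>" "p = ?f \<gamma>" by auto
  interpret B: walk T s b "ed \<gamma>" using wlk g by auto
  show "p \<in> Sigma {..T} ?K" using B.codes_subset B.card_codes_le xedges_le[OF g(1)] g(2) by auto
 qed
 have p5: "x * x * (x * (x * x)) = x ^ 5" for x :: nat by (simp add: eval_nat_numeral)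
 have cU: "card ?U + 1 \<le> (2 * T + 3) ^ 5"
 proof -
  have "card ?U = T * 4 * ((2 * T + 1) * ((2 * T + 1) * (2 * T + 1)))"
  proof -
   have "Suc 3 = (4::nat)" by simp
   then show ?thesis
    by (simp only: card_cartesian_product card_lessThan card_atMost mult.assoc Suc_eq_plus1)
  qed
  also have "\<dots> + 1 \<le> (2 * T + 3) * (2 * T + 3) * ((2 * T + 3) * ((2 * T + 3) * (2 * T + 3)))"
  proof -
   have a: "T * 4 + 1 \<le> (2 * T + 3) * (2 * T + 3)" by (simp add: algebra_simps)
   have c: "(2 * T + 1) * ((2 * T + 1) * (2 * T + 1)) \<le> (2 * T + 3) * ((2 * T + 3) * (2 * T + 3))"
    by (intro mult_le_mono) auto
   have "T * 4 * ((2 * T + 1) * ((2 * T + 1) * (2 * T + 1))) + 1 \<le> (T * 4 + 1) * ((2 * T + 1) * ((2 * T + 1) * (2 * T + 1)))"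
    by (simp add: algebra_simps)
   also have "\<dots> \<le> (2 * T + 3) * (2 * T + 3) * ((2 * T + 3) * ((2 * T + 3) * (2 * T + 3)))"
    using a c by (rule mult_le_mono)
   finally show ?thesis .
  qed
  also have "\<dots> = (2 * T + 3) ^ 5" by (rule p5)
  finally show ?thesis .
 qed
 have cK: "card (?K g) \<le> (2 * T + 3) ^ (5 * (b * (5 * g + 4)))" for g
 proof -
  have "card (?K g) \<le> (card ?U + 1) ^ (b * (5 * g + 4))" by (rule card_small_subsets_le) auto
  also have "\<dots> \<le> ((2 * T + 3) ^ 5) ^ (b * (5 * g + 4))" using cU by (rule power_mono) simp
  finally show ?thesis by (simp add: power_mult)
 qed
 have cls: "(\<Sum>\<gamma>\<in>{\<gamma>\<in>\<Gamma>. ?f \<gamma> = (g, S)}. weight \<gamma>) \<le> ?B g" for g S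
 proof (cases "{\<gamma>\<in>\<Gamma>. ?f \<gamma> = (g, S)} = {}")
  case True
  have "0 \<le> ?B g" using rho by simp
  then show ?thesis unfolding True by simp
 next
  case False
  then obtain \<gamma>0 where "\<gamma>0 \<in> {\<gamma>\<in>\<Gamma>. ?f \<gamma> = (g, S)}" by blast
  then show ?thesis by (intro class_sum[of _ \<gamma>0]) auto
 qed
 have "(\<Sum>\<gamma>\<in>\<Gamma>. weight \<gamma>) = (\<Sum>p\<in>Sigma {..T} ?K. \<Sum>\<gamma>\<in>{\<gamma>\<in>\<Gamma>. ?f \<gamma> = p}. weight \<gamma>)"
  by (rule sum.group[OF finG _ img, symmetric]) (use finK in auto)
 also have "\<dots> \<le> (\<Sum>p\<in>Sigma {..T} ?K. ?B (fst p))" 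
 proof (rule sum_mono)
  fix p show "(\<Sum>\<gamma>\<in>{\<gamma>\<in>\<Gamma>. ?f \<gamma> = p}. weight \<gamma>) \<le> ?B (fst p)" using cls[of "fst p" "snd p"] by simp
 qed
 also have "\<dots> = (\<Sum>g\<le>T. \<Sum>S\<in>?K g. ?B g)" by (subst sum.Sigma) (use finK in \<open>auto intro!: sum.cong\<close>)
 also have "\<dots> = (\<Sum>g\<le>T. real (card (?K g)) * ?B g)" by simp
 also have "\<dots> \<le> (\<Sum>g\<le>T. real ((2 * T + 3) ^ (5 * (b * (5 * g + 4)))) * ?B g)"
  using cK rho by (intro sum_mono mult_right_mono of_nat_mono) auto
 finally show ?thesis .
qed

end

section \<open>Averages over random permutations\<close>

definition perms :: "nat \<Rightarrow> (nat \<Rightarrow> nat) set" where "perms n = {\<sigma>. \<sigma> permutes {..<n}}"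

definition pavg :: "nat \<Rightarrow> ((nat \<Rightarrow> nat) \<Rightarrow> real) \<Rightarrow> real" where
 "pavg n f = (\<Sum>\<sigma>\<in>perms n. f \<sigma>) / fact n"

lemma finite_perms [simp]: "finite (perms n)"
 unfolding perms_def by (simp add: finite_permutations)

lemma card_perms: "card (perms n) = fact n"
 unfolding perms_def by (rule card_permutations) auto

definition matching :: "(nat \<times> nat) set \<Rightarrow> bool" where
 "matching A \<longleftrightarrow> inj_on fst A \<and> inj_on snd A"

definition contains :: "nat \<Rightarrow> (nat \<times> nat) set \<Rightarrow> (nat \<Rightarrow> nat) set" where
 "contains n A = {\<sigma>\<in>perms n. \<forall>p\<in>A. \<sigma> (fst p) = snd p}"

lemma finite_contains [simp]: "finite (contains n A)" unfolding contains_def by auto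

lemma contains_not_matching: "\<not> matching A \<Longrightarrow> contains n A = {}"
proof (rule ccontr)
 assume m: "\<not> matching A" and "contains n A \<noteq> {}"
 then obtain \<sigma> where s: "\<sigma> permutes {..<n}" "\<And>p. p \<in> A \<Longrightarrow> \<sigma> (fst p) = snd p"
  unfolding contains_def perms_def by auto
 have "inj \<sigma>" using s(1) by (rule permutes_inj)
 have "inj_on fst A"
 proof (rule inj_onI)
  fix p q assume "p \<in> A" "q \<in> A" "fst p = fst q"
  then show "p = q" using s(2)[of p] s(2)[of q] by (simp add: prod_eq_iff)
 qed
 moreover have "inj_on snd A"
 proof (rule inj_onI)
  fix p q assume h: "p \<in> A" "q \<in> A" "snd p = snd q"
  then have "\<sigma> (fst p) = \<sigma> (fst q)" using s(2)[of p] s(2)[of q] by simp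
  then have "fst p = fst q" using \<open>inj \<sigma>\<close> by (auto dest: injD)
  then show "p = q" using h(3) by (simp add: prod_eq_iff)
 qed
 ultimately have "inj_on fst A" "inj_on snd A" by auto
 then show False using m unfolding matching_def by simp
qed

text \<open>Composition with a transposition of two free values shows that all
  \<open>n - card A\<close> possible images of a new argument are equally frequent.\<close>

lemma card_contains:
 assumes "finite A" "A \<subseteq> {..<n} \<times> {..<n}" "matching A"
 shows "card (contains n A) = fact (n - card A)"
 using assms
proof (induction A)
 case empty
 then show ?case using card_perms unfolding contains_def by simp
next
 case (insert p A)
 obtain x y where p: "p = (x, y)" by (cases p)
 have m: "matching A" using insert.prems unfolding matching_def by (auto simp: inj_on_def)
 have IH: "card (contains n A) = fact (n - card A)" using insert m by auto
 have inj: "inj_on fst (insert p A)" "inj_on snd (insert p A)" using insert.prems unfolding matching_def by auto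
 have x: "x < n" and y: "y < n" using insert.prems(1) p by auto
 have x2: "x \<notin> fst ` A"
  using inj(1) insert.hyps(2) unfolding inj_on_insert p by auto
 have y2: "y \<notin> snd ` A"
  using inj(2) insert.hyps(2) unfolding inj_on_insert p by auto
 let ?Y = "{..<n} - snd ` A"
 have cY: "card ?Y = n - card A"
 proof -
  have "snd ` A \<subseteq> {..<n}" using insert.prems by auto
  moreover have "card (snd ` A) = card A" using m card_image unfolding matching_def by blast
  ultimately show ?thesis using insert.hyps(1) by (simp add: card_Diff_subset)
 qed
 have val: "\<sigma> x \<in> ?Y" if s: "\<sigma> \<in> contains n A" for \<sigma>
 proof -
  have perm: "\<sigma> permutes {..<n}" and fx: "\<And>p. p \<in> A \<Longrightarrow> \<sigma> (fst p) = snd p"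
   using s unfolding contains_def perms_def by auto
  have "\<sigma> x \<notin> snd ` A"
  proof
   assume "\<sigma> x \<in> snd ` A"
   then obtain q where q: "q \<in> A" "\<sigma> x = \<sigma> (fst q)" using fx by force
   then have "x = fst q" using permutes_inj[OF perm] by (auto dest: injD)
   then show False using x2 q by auto
  qed
  moreover have "\<sigma> x < n" using permutes_in_image[OF perm, of x] x by auto
  ultimately show ?thesis by auto
 qed
 have sw: "card (contains n (insert (x, y') A)) \<le> card (contains n (insert (x, z) A))"
  if "y' \<in> ?Y" "z \<in> ?Y" for y' z
 proof (rule card_inj_on_le)
  show "inj_on (\<lambda>\<sigma>. Transposition.transpose y' z \<circ> \<sigma>) (contains n (insert (x, y') A))"
   by (rule inj_onI) (metis comp_assoc id_comp transpose_comp_involutory)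
  show "(\<lambda>\<sigma>. Transposition.transpose y' z \<circ> \<sigma>) ` contains n (insert (x, y') A) \<subseteq> contains n (insert (x, z) A)"
  proof
   fix \<tau> assume "\<tau> \<in> (\<lambda>\<sigma>. Transposition.transpose y' z \<circ> \<sigma>) ` contains n (insert (x, y') A)"
   then obtain \<sigma> where s: "\<tau> = Transposition.transpose y' z \<circ> \<sigma>" "\<sigma> permutes {..<n}" "\<sigma> x = y'" "\<And>p. p \<in> A \<Longrightarrow> \<sigma> (fst p) = snd p"
    unfolding contains_def perms_def by auto
   have "\<tau> permutes {..<n}" unfolding s(1)
    using that by (intro permutes_compose s(2) permutes_swap_id) auto
   moreover have "\<tau> (fst p) = snd p" if "p \<in> A" for p
   proof -
    have "snd p \<noteq> y'" "snd p \<noteq> z" using that \<open>y' \<in> ?Y\<close> \<open>z \<in> ?Y\<close> by auto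
    then show ?thesis using s(4)[OF that] s(1) by simp
   qed
   ultimately show "\<tau> \<in> contains n (insert (x, z) A)" using s unfolding contains_def perms_def by auto
  qed
 qed auto
 then have sweq: "card (contains n (insert (x, z) A)) = card (contains n (insert (x, y) A))" if "z \<in> ?Y" for z
  using that y y2 by (metis DiffI antisym lessThan_iff)
 have "card (contains n A) = (\<Sum>z\<in>?Y. card {\<sigma>\<in>contains n A. \<sigma> x = z})"
  using val by (intro card_fibre_sum) auto
 also have "\<dots> = (\<Sum>z\<in>?Y. card (contains n (insert (x, z) A)))"
  unfolding contains_def by (intro sum.cong refl arg_cong[of _ _ card]) auto
 also have "\<dots> = (n - card A) * card (contains n (insert (x, y) A))" using sweq cY by simp
 finally have eq: "fact (n - card A) = (n - card A) * card (contains n (insert p A))" using IH p by simp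
 have "card ?Y > 0" using y y2 by (simp add: card_gt_0_iff) blast
 then have lt: "card A < n" using cY by simp
 then have "(fact (n - card A) :: nat) = (n - card A) * fact (n - card (insert p A))"
  using insert.hyps fact_reduce[where ?'a = nat, of "n - card A"] by simp
 then show ?case using eq lt by simp
qed

text \<open>The probability that a random permutation contains a given matching of size
  \<open>s\<close>, divided by its value \<open>n ^ (- s)\<close> for independent entries.\<close>

definition qf :: "nat \<Rightarrow> nat \<Rightarrow> real" where "qf n s = real n ^ s * fact (n - s) / fact n"

lemma qf_Suc: "s < n \<Longrightarrow> real (n - s) * qf n (Suc s) = real n * qf n s"
proof -
 assume s: "s < n"
 then have "(fact (n - s) :: real) = real (n - s) * fact (n - Suc s)" by (simp add: fact_reduce)
 then show ?thesis unfolding qf_def by simp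
qed

lemma qf_pos: "0 < n \<Longrightarrow> 0 < qf n s" unfolding qf_def by simp

lemma one_minus_mult_ge: "0 \<le> a \<Longrightarrow> 0 \<le> b \<Longrightarrow> b \<le> c \<Longrightarrow> 1 - (a + c) \<le> (1 - a) * (1 - b)" for a b c :: real
proof -
 assume h: "0 \<le> a" "0 \<le> b" "b \<le> c"
 have "(1 - a) * (1 - b) = 1 - a - b + a * b" by (simp add: algebra_simps)
 then show ?thesis using mult_nonneg_nonneg[OF h(1,2)] h(3) by (smt (verit))
qed

text \<open>The reciprocal is the product of the factors \<open>1 - j / n\<close> with
  \<open>j < s\<close>, which is at least \<open>1 - s * k / n \<ge> 1 / 2\<close>.\<close>

lemma qf_le_2:
 assumes "0 < n" "s \<le> k" "2 * k\<^sup>2 \<le> n"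
 shows "qf n s \<le> 2"
proof -
 have "j \<le> s \<Longrightarrow> qf n j * (1 - real j * real k / real n) \<le> 1" for j
 proof (induction j)
  case 0
  then show ?case unfolding qf_def by simp
 next
  case (Suc j)
  have kk: "real k * real k * 2 \<le> real n" using assms(3) by (simp add: power2_eq_square flip: of_nat_mult) 
  have jk: "j < k" using Suc assms by simp
  have "k \<le> n" using assms by (metis le_square le_trans power2_eq_square mult_2 trans_le_add1)
  then have jn: "j < n" using jk by simp
  have q: "qf n (Suc j) = real n / real (n - j) * qf n j" using qf_Suc[OF jn] jn by (simp add: field_simps)
  have nj: "real (n - j) = real n - real j" using jn by simp
  have "(1 - real (Suc j) * real k / real n) \<le> (1 - real j * real k / real n) * (1 - real j / real n)"
  proof -
   have "real j / real n \<le> real k / real n" using jk by (simp add: divide_right_mono)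
   then have "1 - (real j * real k / real n + real k / real n) \<le> (1 - real j * real k / real n) * (1 - real j / real n)"
    by (intro one_minus_mult_ge) auto
   then show ?thesis by (simp add: distrib_right add_divide_distrib add.commute)
  qed
  then have "qf n (Suc j) * (1 - real (Suc j) * real k / real n) \<le> qf n (Suc j) * ((1 - real j * real k / real n) * (1 - real j / real n))"
   using qf_pos[OF assms(1), of "Suc j"] by (intro mult_left_mono) auto
  also have "\<dots> = qf n j * (1 - real j * real k / real n)"
   unfolding q nj using jn assms(1) by (simp add: field_simps)
  also have "\<dots> \<le> 1" using Suc by simp
  finally show ?case .
 qed
 then have a: "qf n s * (1 - real s * real k / real n) \<le> 1" by simp
 have "real s * real k \<le> real k * real k" using assms by (simp add: mult_right_mono)
 also have "\<dots> \<le> real n / 2" using assms(3) by (simp add: power2_eq_square flip: of_nat_mult)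
 finally have "1/2 \<le> 1 - real s * real k / real n" using assms(1) by (simp add: field_simps)
 then have "qf n s * (1/2) \<le> qf n s * (1 - real s * real k / real n)"
  using qf_pos[OF assms(1), of s] by (intro mult_left_mono) auto
 then have "qf n s * (1/2) \<le> 1" using a by (rule order_trans)
 then show ?thesis by simp
qed

text \<open>The iterated forward differences of \<open>qf n\<close> gain a factor of order \<open>n powr (-1/2)\<close> each; this is
 how centring makes matrix entries that are used only once contribute little.\<close>

fun hd_diff :: "nat \<Rightarrow> nat \<Rightarrow> nat \<Rightarrow> real" where
 "hd_diff n 0 s = qf n s" |
 "hd_diff n (Suc r) s = hd_diff n r (Suc s) - hd_diff n r s"

text \<open>The relation \<open>qf_Suc\<close> says that \<open>n - s\<close> times the first
  difference is \<open>s * qf n s\<close>. Differencing it \<open>r\<close> times with the Leibniz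
  rule for linear factors gives three terms.\<close>

lemma hd_diff_rec:
 "s + r < n \<Longrightarrow> real (n - s - r) * hd_diff n (Suc r) s
  = real (s + 2 * r) * hd_diff n r s + real r * hd_diff n (r - 1) s"
proof (induction r arbitrary: s)
 case 0
 then have "real (n - s) * qf n (Suc s) = real n * qf n s" by (intro qf_Suc) simp
 then show ?case using 0 by (simp add: algebra_simps)
next
 case (Suc r)
 have 1: "real (n - Suc s - r) * hd_diff n (Suc r) (Suc s) = real (Suc s + 2 * r) * hd_diff n r (Suc s) + real r * hd_diff n (r - 1) (Suc s)"
  using Suc.prems by (intro Suc.IH) simp
 have 2: "real (n - s - r) * hd_diff n (Suc r) s = real (s + 2 * r) * hd_diff n r s + real r * hd_diff n (r - 1) s"
  using Suc.prems by (intro Suc.IH) simp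
 have 3: "real r * hd_diff n (r - 1) (Suc s) - real r * hd_diff n (r - 1) s = real r * hd_diff n r s"
  by (cases r) (simp_all add: algebra_simps)
 have n1: "real (n - s - r) = real (n - Suc s - r) + 1" using Suc.prems by simp
 have n2: "n - s - Suc r = n - Suc s - r" by simp
 have d: "hd_diff n (Suc (Suc r)) s = hd_diff n (Suc r) (Suc s) - hd_diff n (Suc r) s" by simp
 have e: "hd_diff n r (Suc s) = hd_diff n (Suc r) s + hd_diff n r s" by simp
 have "real (n - Suc s - r) * hd_diff n (Suc (Suc r)) s
  = (real (n - Suc s - r) * hd_diff n (Suc r) (Suc s)) - (real (n - s - r) * hd_diff n (Suc r) s) + hd_diff n (Suc r) s"
  unfolding d n1 by (simp add: algebra_simps)
 also have "\<dots> = real (Suc s + 2 * r) * hd_diff n r (Suc s) - real (s + 2 * r) * hd_diff n r s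
   + (real r * hd_diff n (r - 1) (Suc s) - real r * hd_diff n (r - 1) s) + hd_diff n (Suc r) s"
  unfolding 1 2 by simp
 also have "\<dots> = real (s + 2 * Suc r) * hd_diff n (Suc r) s + real (Suc r) * hd_diff n r s"
  unfolding 3 e by (simp only: of_nat_add of_nat_mult of_nat_Suc of_nat_numeral) (simp add: algebra_simps del: hd_diff.simps)
 finally show ?case unfolding n2 by simp
qed

text \<open>In the recurrence the term two orders down has a coefficient of order
  \<open>k / n\<close>, so two orders gain \<open>\<theta>\<^sup>2\<close>. All terms are positive,
  hence there is no cancellation to follow.\<close>

lemma hd_diff_bound:
 assumes k: "0 < k" "4 * k\<^sup>2 \<le> n" and th: "\<theta> = 2 * real k / sqrt (real n)" and s: "s + 2 * r \<le> k"
 shows "0 \<le> hd_diff n r s \<and> hd_diff n r s \<le> qf n s * \<theta> ^ r"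
 using s
proof (induction r rule: less_induct)
 case (less r)
 have kk: "k \<le> k\<^sup>2" using k(1) by (simp add: power2_eq_square)
 then have kn: "k < n" using k by linarith
 then have n0: "0 < n" by simp
 have "real (4 * k\<^sup>2) \<le> real n" using k(2) by (simp only: of_nat_le_iff)
 then have rn: "4 * (real k)\<^sup>2 \<le> real n" by simp
 have th2: "\<theta>\<^sup>2 * real n = 4 * (real k)\<^sup>2" unfolding th using n0 by (simp add: power_divide power_mult_distrib)
 have th0: "0 \<le> \<theta>" unfolding th by simp
 have th1: "\<theta> \<le> 1"
 proof -
  have "\<theta>\<^sup>2 * real n \<le> 1\<^sup>2 * real n" using th2 rn by simp
  then have "\<theta>\<^sup>2 \<le> 1\<^sup>2" using n0 by (simp add: mult_le_cancel_right)
  then show ?thesis by (rule power2_le_imp_le) simp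
 qed
 \<comment> \<open>This inequality makes \<open>\<theta> ^ r\<close> a supersolution of the
   recurrence and dictates the size of \<open>\<theta>\<close>.\<close>
 have key: "real k * \<theta> + real k \<le> \<theta>\<^sup>2 * (real n - real k)"
 proof -
  have "real k * \<theta> \<le> real k" using th1 by (simp add: mult_left_le)
  moreover have "\<theta>\<^sup>2 * real k \<le> real k" using th0 th1 by (simp add: mult_left_le_one_le power_le_one)
  moreover have "1 * real k \<le> real k * real k" using k(1) by (intro mult_right_mono) auto
  moreover have "\<theta>\<^sup>2 * (real n - real k) = 4 * (real k * real k) - \<theta>\<^sup>2 * real k"
   using th2 by (simp add: right_diff_distrib power2_eq_square)
  ultimately show ?thesis by linarith
 qed
 have q0: "0 \<le> qf n s" using qf_pos[OF n0] less_imp_le by blast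
 show ?case
 proof (cases r)
  case 0
  then show ?thesis using q0 by simp
 next
  case (Suc j)
  have IH: "0 \<le> hd_diff n j s" "hd_diff n j s \<le> qf n s * \<theta> ^ j" using less.IH[of j] less.prems Suc by auto
  have IH2: "0 \<le> hd_diff n (j - 1) s" "hd_diff n (j - 1) s \<le> qf n s * \<theta> ^ (j - 1)"
   using less.IH[of "j - 1"] less.prems Suc by auto
  have sj: "s + j < n" using less.prems Suc kn by simp
  have rec: "real (n - s - j) * hd_diff n r s = real (s + 2 * j) * hd_diff n j s + real j * hd_diff n (j - 1) s"
   unfolding Suc by (rule hd_diff_rec[OF sj])
  have pos: "0 < real (n - s - j)" using sj by simp
  have nk: "real n - real k \<le> real (n - s - j)" using less.prems Suc by simp
  have "0 \<le> real (n - s - j) * hd_diff n r s" unfolding rec using IH IH2 by simp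
  then have nn: "0 \<le> hd_diff n r s" using pos by (simp add: zero_le_mult_iff)
  have "(real n - real k) * hd_diff n r s \<le> real (n - s - j) * hd_diff n r s"
   using nk nn by (rule mult_right_mono)
  also have "\<dots> \<le> real k * (qf n s * \<theta> ^ j) + real j * (qf n s * \<theta> ^ (j - 1))"
   unfolding rec using IH IH2 less.prems Suc by (intro add_mono mult_mono) auto
  also have "\<dots> \<le> (real n - real k) * (qf n s * \<theta> ^ r)"
  proof (cases j)
   case 0
   have "\<theta>\<^sup>2 * (real n - real k) \<le> \<theta> * (real n - real k)"
    using th0 th1 kn by (intro mult_right_mono) (auto simp: power2_eq_square mult_left_le)
   then have "real k \<le> \<theta> * (real n - real k)" using key th0 k by (smt (verit) mult_nonneg_nonneg of_nat_0_le_iff)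
   then have "qf n s * real k \<le> qf n s * (\<theta> * (real n - real k))" using q0 by (rule mult_left_mono)
   then show ?thesis using 0 Suc by (simp add: algebra_simps)
  next
   case (Suc i)
   have "real k * (qf n s * \<theta> ^ j) + real j * (qf n s * \<theta> ^ (j - 1)) \<le> (qf n s * \<theta> ^ i) * (real k * \<theta> + real k)"
   proof -
    have "real j \<le> real k" using less.prems \<open>r = Suc j\<close> by simp
    then have "real j * (qf n s * \<theta> ^ i) \<le> real k * (qf n s * \<theta> ^ i)" using q0 th0 by (intro mult_right_mono) auto
    then show ?thesis using Suc by (simp add: algebra_simps)
   qed
   also have "\<dots> \<le> (qf n s * \<theta> ^ i) * (\<theta>\<^sup>2 * (real n - real k))"
    using key q0 th0 by (intro mult_left_mono) auto
   also have "\<dots> = (real n - real k) * (qf n s * \<theta> ^ r)"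
    using Suc \<open>r = Suc j\<close> by (simp add: power2_eq_square algebra_simps)
   finally show ?thesis .
  qed
  finally have "hd_diff n r s \<le> qf n s * \<theta> ^ r" using kn by simp
  then show ?thesis using nn by simp
 qed
qed

lemma alternating_qf:
 assumes "finite S"
 shows "(\<Sum>A\<in>Pow S. (- 1) ^ card (S - A) * qf n (s + card A)) = hd_diff n (card S) s"
 using assms
proof (induction S arbitrary: s)
 case (insert x S)
 have inj: "inj_on (insert x) (Pow S)" using insert.hyps by (auto simp: inj_on_def)
 have a: "(\<Sum>A\<in>Pow S. (- 1) ^ card (insert x S - A) * qf n (s + card A)) = - hd_diff n (card S) s"
 proof -
  have "(- 1) ^ card (insert x S - A) * qf n (s + card A) = - ((- 1) ^ card (S - A) * qf n (s + card A))" if "A \<in> Pow S" for A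
  proof -
   have "insert x S - A = insert x (S - A)" using that insert.hyps by auto
   then show ?thesis using insert.hyps by simp
  qed
  then show ?thesis using insert.IH[of s] by (simp add: sum_negf)
 qed
 have b: "(\<Sum>A\<in>insert x ` Pow S. (- 1) ^ card (insert x S - A) * qf n (s + card A)) = hd_diff n (card S) (Suc s)"
 proof -
  have "(- 1) ^ card (insert x S - insert x A) * qf n (s + card (insert x A)) = (- 1) ^ card (S - A) * qf n (Suc s + card A)" if "A \<in> Pow S" for A
  proof -
   have "insert x S - insert x A = S - A" using insert.hyps by auto
   moreover have "card (insert x A) = Suc (card A)" using that insert.hyps finite_subset by (intro card_insert_disjoint) auto
   ultimately show ?thesis by simp
  qed
  then show ?thesis using insert.IH[of "Suc s"] by (simp add: sum.reindex[OF inj] o_def)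
 qed
 have "Pow S \<inter> insert x ` Pow S = {}" using insert.hyps by auto
 then have "(\<Sum>A\<in>Pow (insert x S). (- 1) ^ card (insert x S - A) * qf n (s + card A))
  = hd_diff n (card S) (Suc s) - hd_diff n (card S) s"
  unfolding Pow_insert using a b insert.hyps by (subst sum.union_disjoint) auto
 then show ?case using insert.hyps by simp
qed simp

lemma sum_Pow_union:
 assumes "finite A" "finite B" "A \<inter> B = {}"
 shows "(\<Sum>X\<in>Pow (A \<union> B). f X) = (\<Sum>X\<in>Pow A. \<Sum>Y\<in>Pow B. f (X \<union> Y))"
proof -
 have "(\<Sum>X\<in>Pow (A \<union> B). f X) = (\<Sum>p\<in>Pow A \<times> Pow B. f (fst p \<union> snd p))"
  by (rule sum.reindex_bij_witness[of _ "\<lambda>p. fst p \<union> snd p" "\<lambda>X. (X \<inter> A, X \<inter> B)"]) (use assms in \<open>auto simp: Int_Un_distrib[symmetric] Int_absorb2\<close>)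
 then show ?thesis by (simp add: sum.cartesian_product')
qed

section \<open>Expected products of centred permutation entries\<close>

definition ind :: "(nat \<Rightarrow> nat) \<Rightarrow> nat \<times> nat \<Rightarrow> real" where
 "ind \<sigma> p = (if \<sigma> (fst p) = snd p then 1 else 0)"

lemma pavg_sum: "pavg n (\<lambda>\<sigma>. \<Sum>i\<in>I. f i \<sigma>) = (\<Sum>i\<in>I. pavg n (f i))"
proof -
 have "(\<Sum>\<sigma>\<in>perms n. \<Sum>i\<in>I. f i \<sigma>) = (\<Sum>i\<in>I. \<Sum>\<sigma>\<in>perms n. f i \<sigma>)" by (rule sum.swap)
 then show ?thesis unfolding pavg_def by (simp add: sum_divide_distrib)
qed

lemma pavg_cmult: "pavg n (\<lambda>\<sigma>. c * f \<sigma>) = c * pavg n f"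
 unfolding pavg_def by (simp add: sum_distrib_left)

lemma pavg_const [simp]: "pavg n (\<lambda>\<sigma>. c) = c"
 unfolding pavg_def by (simp add: card_perms)

lemma pavg_mono: "(\<And>\<sigma>. \<sigma> \<in> perms n \<Longrightarrow> f \<sigma> \<le> g \<sigma>) \<Longrightarrow> pavg n f \<le> pavg n g"
 unfolding pavg_def by (intro divide_right_mono sum_mono) auto

lemma pavg_ind:
 assumes "finite A" "A \<subseteq> {..<n} \<times> {..<n}"
 shows "pavg n (\<lambda>\<sigma>. \<Prod>p\<in>A. ind \<sigma> p) = (if matching A then (1 / n) ^ card A * qf n (card A) else 0)"
proof -
 have pr: "(\<Prod>p\<in>A. ind \<sigma> p) = (if \<forall>p\<in>A. \<sigma> (fst p) = snd p then 1 else 0)" for \<sigma>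
  using assms(1) unfolding ind_def by (auto simp: prod_zero_iff)
 have "(\<Sum>\<sigma>\<in>perms n. \<Prod>p\<in>A. ind \<sigma> p) = real (card (contains n A))"
  unfolding pr contains_def by (simp add: sum.If_cases Int_def)
 moreover have "real (fact (n - card A)) / fact n = (1 / n) ^ card A * qf n (card A)" if "matching A"
 proof (cases "n = 0")
  case True
  then have "A = {}" using assms by auto
  then show ?thesis using True by (simp add: qf_def)
 next
  case False
  then show ?thesis unfolding qf_def by (simp add: power_divide)
 qed
 ultimately show ?thesis
  using card_contains[OF assms] contains_not_matching[of A n] unfolding pavg_def by (cases "matching A") simp_all
qed

text \<open>A factor \<open>ind - 1/n\<close> of multiplicity \<open>p\<close> is affine in \<open>ind\<close> because \<open>ind\<close> is \<open>0\<close> or \<open>1\<close>.\<close>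

definition cf1 :: "nat \<Rightarrow> nat \<Rightarrow> real" where "cf1 n p = (1 - 1 / n) ^ p - (- 1 / n) ^ p"
definition cf0 :: "nat \<Rightarrow> nat \<Rightarrow> real" where "cf0 n p = (- 1 / n) ^ p"

lemma centred_power: "(ind \<sigma> f - 1 / n) ^ p = cf1 n p * ind \<sigma> f + cf0 n p"
 unfolding ind_def cf1_def cf0_def by auto

lemma coeff_bounds:
 assumes "0 < n" "0 < p"
 shows "\<bar>cf1 n p\<bar> \<le> 1" "\<bar>cf0 n p\<bar> \<le> 1 / n" "p \<noteq> 1 \<Longrightarrow> \<bar>cf0 n p\<bar> \<le> (1 / n) * (1 / n)"
proof -
 have n: "1 / real n \<le> 1" "0 \<le> 1 / real n" using assms by auto
 have cf0: "\<bar>cf0 n p\<bar> = (1 / n) ^ p" unfolding cf0_def by (simp add: power_abs)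
 have "(1 / real n) ^ p \<le> (1 / n) ^ 1" using n assms by (intro power_decreasing) auto
 then show "\<bar>cf0 n p\<bar> \<le> 1 / n" unfolding cf0 by simp
 have "(1 / real n) ^ p \<le> (1 / n) ^ 2" if "p \<noteq> 1" using n assms that by (intro power_decreasing) auto
 then show "p \<noteq> 1 \<Longrightarrow> \<bar>cf0 n p\<bar> \<le> (1 / n) * (1 / n)" unfolding cf0 by (simp add: power2_eq_square)
 have "(1 - 1 / real n) ^ p \<le> (1 - 1 / n) ^ 1" using n assms by (intro power_decreasing) auto
 then have u: "(1 - 1 / real n) ^ p \<le> 1 - 1 / n" by simp
 have l: "0 \<le> (1 - 1 / real n) ^ p" using n by simp
 have z: "\<bar>(- 1 / real n) ^ p\<bar> \<le> 1 / n" using \<open>\<bar>cf0 n p\<bar> \<le> 1 / n\<close> unfolding cf0_def .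
 have "cf1 n p \<le> (1 - 1 / real n) + 1 / n"
  unfolding cf1_def using add_mono[OF u abs_le_D2[OF z]] by simp
 moreover have "- cf1 n p \<le> 0 + 1 / real n"
  unfolding cf1_def using add_mono[of "- ((1 - 1 / real n) ^ p)" 0, OF _ abs_le_D1[OF z]] l by simp
 ultimately show "\<bar>cf1 n p\<bar> \<le> 1" unfolding abs_le_iff using n by simp
qed

text \<open>Positions used once that share no coordinate with another (\<open>S1\<close>) do not
  affect whether a subset is a matching. Summing over subsets of \<open>S1\<close> therefore
  produces an iterated difference, small by \<open>hd_diff_bound\<close>. All other positions are
  estimated in absolute value. The constant 6 is the bound 2 for \<open>qf\<close> times 3 for
  \<open>(1 + 1 / n) ^ n\<close>.\<close>

theorem centred_product_bound:
 fixes e :: "nat \<Rightarrow> nat \<times> nat"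
 assumes rng: "\<And>t. t < T \<Longrightarrow> fst (e t) < n \<and> snd (e t) < n"
  and T: "0 < T" "36 * T\<^sup>2 \<le> n" and th: "\<theta> = 6 * real T / sqrt (real n)"
 shows "\<bar>pavg n (\<lambda>\<sigma>. \<Prod>t<T. (ind \<sigma> (e t) - 1 / n))\<bar> \<le>
  6 * ((1 / n) ^ card (e ` {..<T}) * \<theta> ^ card (multi1 T e - shared T e) * 2 ^ card (multi1 T e \<inter> shared T e))"
proof -
 let ?F = "e ` {..<T}"
 define S1 where "S1 = multi1 T e - shared T e"
 define S2 where "S2 = ?F - S1"
 define p where "p f = card {t\<in>{..<T}. e t = f}" for f
 have n0: "0 < n" using rng[OF T(1)] by auto
 have F: "finite ?F" by simp
 have F2: "?F \<subseteq> {..<n} \<times> {..<n}"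
 proof
  fix f assume "f \<in> ?F"
  then obtain t where "t < T" "f = e t" by auto
  then show "f \<in> {..<n} \<times> {..<n}" using rng[of t] by (simp add: mem_Times_iff)
 qed
 have S: "finite S1" "finite S2" "S1 \<inter> S2 = {}" "?F = S2 \<union> S1" "S1 \<subseteq> ?F" "S2 \<subseteq> ?F"
  unfolding S1_def S2_def multi1_def by auto
 have cF: "card ?F \<le> T" using card_image_le[of "{..<T}" e] by simp
 \<comment> \<open>Below, \<open>hd_diff_bound\<close> is applied to sets \<open>X\<close> with
   \<open>card X + 2 * card S1 \<le> 3 * T\<close>; this explains 36 and 6.\<close>
 have k: "0 < 3 * T" "4 * (3 * T)\<^sup>2 \<le> n" "\<theta> = 2 * real (3 * T) / sqrt (real n)"
  using T th by (auto simp: power_mult_distrib)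
 have th0: "0 \<le> \<theta>" unfolding th by simp
 have p0: "0 < p f" if "f \<in> ?F" for f
  unfolding p_def using that by (subst card_gt_0_iff) auto
 have p1: "p f = 1 \<longleftrightarrow> f \<in> multi1 T e" if fF: "f \<in> ?F" for f
 proof
  assume "p f = 1"
  then obtain t where t: "{t\<in>{..<T}. e t = f} = {t}" unfolding p_def by (rule card_1_singletonE)
  have "u = t" if "u < T" "e u = f" for u using t that by blast
  then show "f \<in> multi1 T e" unfolding multi1_def using fF by blast
 next
  assume m: "f \<in> multi1 T e"
  obtain t where t: "t < T" "e t = f" using fF by auto
  then have "{t\<in>{..<T}. e t = f} = {t}" using m unfolding multi1_def by blast
  then show "p f = 1" unfolding p_def by simp
 qed
 \<comment> \<open>Isolated positions can be added to a matching without creating a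
   conflict.\<close>
 have m12: "matching (X \<union> Y) \<longleftrightarrow> matching X" if "X \<subseteq> S2" "Y \<subseteq> S1" for X Y
 proof
  assume "matching (X \<union> Y)"
  then show "matching X" unfolding matching_def by (meson inj_on_subset sup_ge1)
 next
  assume mX: "matching X"
  have iso: "f' = f" if "f \<in> S1" "f' \<in> ?F" "fst f' = fst f \<or> snd f' = snd f" for f f'
   using that S(5) unfolding S1_def shared_def by blast
  show "matching (X \<union> Y)" unfolding matching_def
  proof (intro conjI inj_onI)
   fix f f' assume h: "f \<in> X \<union> Y" "f' \<in> X \<union> Y" "fst f = fst f'"
   show "f = f'"
   proof (cases "f \<in> X \<and> f' \<in> X")
    case True then show ?thesis using mX h(3) unfolding matching_def inj_on_def by blast
   next
    case False
    then have "f \<in> ?F" "f' \<in> ?F" "f \<in> S1 \<or> f' \<in> S1" using h(1,2) that S(5,6) by blast+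
    then show ?thesis using h(3) iso[of f f'] iso[of f' f] by metis
   qed
  next
   fix f f' assume h: "f \<in> X \<union> Y" "f' \<in> X \<union> Y" "snd f = snd f'"
   show "f = f'"
   proof (cases "f \<in> X \<and> f' \<in> X")
    case True then show ?thesis using mX h(3) unfolding matching_def inj_on_def by blast
   next
    case False
    then have "f \<in> ?F" "f' \<in> ?F" "f \<in> S1 \<or> f' \<in> S1" using h(1,2) that S(5,6) by blast+
    then show ?thesis using h(3) iso[of f f'] iso[of f' f] by metis
   qed
  qed
 qed
 let ?c1 = "\<lambda>f. cf1 n (p f)" and ?c0 = "\<lambda>f. cf0 n (p f)"
 have "(\<Prod>t<T. (ind \<sigma> (e t) - 1 / n)) = (\<Prod>f\<in>?F. ?c1 f * ind \<sigma> f + ?c0 f)" for \<sigma>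
 proof -
  have "(\<Prod>t<T. (ind \<sigma> (e t) - 1 / n)) = (\<Prod>f\<in>?F. \<Prod>t\<in>{t\<in>{..<T}. e t = f}. (ind \<sigma> (e t) - 1 / n))"
   by (rule prod.group[symmetric]) auto
  also have "\<dots> = (\<Prod>f\<in>?F. (ind \<sigma> f - 1 / n) ^ p f)" unfolding p_def by (intro prod.cong) auto
  finally show ?thesis unfolding centred_power .
 qed
 then have "pavg n (\<lambda>\<sigma>. \<Prod>t<T. (ind \<sigma> (e t) - 1 / n))
  = pavg n (\<lambda>\<sigma>. \<Sum>A\<in>Pow ?F. ((\<Prod>f\<in>A. ?c1 f) * (\<Prod>f\<in>?F - A. ?c0 f)) * (\<Prod>f\<in>A. ind \<sigma> f))"
  by (simp add: prod_add prod.distrib mult_ac)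
 also have "\<dots> = (\<Sum>A\<in>Pow ?F. ((\<Prod>f\<in>A. ?c1 f) * (\<Prod>f\<in>?F - A. ?c0 f)) * (if matching A then (1 / n) ^ card A * qf n (card A) else 0))"
  unfolding pavg_sum pavg_cmult
 proof (intro sum.cong refl arg_cong2[where f = times])
  fix A assume "A \<in> Pow ?F"
  then have "finite A" "A \<subseteq> {..<n} \<times> {..<n}" using F F2 finite_subset by blast+
  then show "pavg n (\<lambda>\<sigma>. \<Prod>f\<in>A. ind \<sigma> f) = (if matching A then (1 / n) ^ card A * qf n (card A) else 0)"
   by (rule pavg_ind)
 qed
 also have "\<dots> = (\<Sum>X\<in>Pow S2. \<Sum>Y\<in>Pow S1. ((\<Prod>f\<in>X \<union> Y. ?c1 f) * (\<Prod>f\<in>?F - (X \<union> Y). ?c0 f)) * (if matching (X \<union> Y) then (1 / n) ^ card (X \<union> Y) * qf n (card (X \<union> Y)) else 0))"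
  unfolding S(4) using S by (intro sum_Pow_union) auto
 also have "\<dots> = (\<Sum>X\<in>Pow S2. if matching X then ((\<Prod>f\<in>X. ?c1 f) * (\<Prod>f\<in>S2 - X. ?c0 f)) * (1 / n) ^ card X * ((1 / n) ^ card S1 * hd_diff n (card S1) (card X)) else 0)"
 proof (rule sum.cong[OF refl])
  fix X assume X: "X \<in> Pow S2"
  then have fX: "finite X" using S finite_subset by auto
  have trm: "((\<Prod>f\<in>X \<union> Y. ?c1 f) * (\<Prod>f\<in>?F - (X \<union> Y). ?c0 f)) * (if matching (X \<union> Y) then (1 / n) ^ card (X \<union> Y) * qf n (card (X \<union> Y)) else 0)
   = (if matching X then ((\<Prod>f\<in>X. ?c1 f) * (\<Prod>f\<in>S2 - X. ?c0 f)) * (1 / n) ^ card X * ((1 / n) ^ card S1 * ((- 1) ^ card (S1 - Y) * qf n (card X + card Y))) else 0)"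
   if Y: "Y \<in> Pow S1" for Y
  proof -
   have fY: "finite Y" using Y S finite_subset by auto
   have dj: "X \<inter> Y = {}" using X Y S(3) by auto
   have pS1: "p f = 1" if "f \<in> S1" for f using p1[of f] that S(5) unfolding S1_def by auto
   have "?F - (X \<union> Y) = (S2 - X) \<union> (S1 - Y)" using S(3,4) X Y by auto
   then have a: "(\<Prod>f\<in>?F - (X \<union> Y). ?c0 f) = (\<Prod>f\<in>S2 - X. ?c0 f) * (\<Prod>f\<in>S1 - Y. ?c0 f)"
    using S by (simp only:) (intro prod.union_disjoint; auto)
   have b: "(\<Prod>f\<in>S1 - Y. ?c0 f) = (- 1) ^ card (S1 - Y) * (1 / n) ^ card (S1 - Y)"
   proof -
    have "(\<Prod>f\<in>S1 - Y. ?c0 f) = (\<Prod>f\<in>S1 - Y. - 1 / n)" using pS1 by (intro prod.cong) (auto simp: cf0_def)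
    then show ?thesis by (simp add: power_mult_distrib[symmetric])
   qed
   have c: "(\<Prod>f\<in>X \<union> Y. ?c1 f) = (\<Prod>f\<in>X. ?c1 f)"
   proof -
    have "(\<Prod>f\<in>Y. ?c1 f) = 1" using pS1 Y by (intro prod.neutral) (auto simp: cf1_def)
    then show ?thesis using prod.union_disjoint[OF fX fY dj, of ?c1] by simp
   qed
   have d: "card (X \<union> Y) = card X + card Y" using card_Un_disjoint[OF fX fY dj] .
   have e: "card S1 = card (S1 - Y) + card Y" using Y S(1) fY card_mono[of S1 Y] by (simp add: card_Diff_subset)
   show ?thesis using m12[of X Y] X Y unfolding a b c d by (simp add: e power_add mult_ac)
  qed
  show "(\<Sum>Y\<in>Pow S1. ((\<Prod>f\<in>X \<union> Y. ?c1 f) * (\<Prod>f\<in>?F - (X \<union> Y). ?c0 f)) * (if matching (X \<union> Y) then (1 / n) ^ card (X \<union> Y) * qf n (card (X \<union> Y)) else 0))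
   = (if matching X then ((\<Prod>f\<in>X. ?c1 f) * (\<Prod>f\<in>S2 - X. ?c0 f)) * (1 / n) ^ card X * ((1 / n) ^ card S1 * hd_diff n (card S1) (card X)) else 0)"
  proof -
   have "(\<Sum>Y\<in>Pow S1. ((\<Prod>f\<in>X \<union> Y. ?c1 f) * (\<Prod>f\<in>?F - (X \<union> Y). ?c0 f)) * (if matching (X \<union> Y) then (1 / n) ^ card (X \<union> Y) * qf n (card (X \<union> Y)) else 0))
    = (\<Sum>Y\<in>Pow S1. (if matching X then ((\<Prod>f\<in>X. ?c1 f) * (\<Prod>f\<in>S2 - X. ?c0 f)) * (1 / n) ^ card X * ((1 / n) ^ card S1 * ((- 1) ^ card (S1 - Y) * qf n (card X + card Y))) else 0))"
    using trm by (rule sum.cong[OF refl])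
   then show ?thesis unfolding alternating_qf[OF S(1), of n "card X", symmetric]
    by (cases "matching X") (simp_all only: if_True if_False sum_distrib_left sum.neutral_const)
  qed
 qed
 finally have eq: "pavg n (\<lambda>\<sigma>. \<Prod>t<T. (ind \<sigma> (e t) - 1 / n)) = \<dots>" .
 let ?B = "\<lambda>X. (\<Prod>f\<in>X. \<bar>?c1 f\<bar> / n) * (\<Prod>f\<in>S2 - X. \<bar>?c0 f\<bar>)"
 have "\<bar>pavg n (\<lambda>\<sigma>. \<Prod>t<T. (ind \<sigma> (e t) - 1 / n))\<bar> \<le> (\<Sum>X\<in>Pow S2. ?B X * ((1 / n) ^ card S1 * (2 * \<theta> ^ card S1)))"
  unfolding eq
 proof (rule order_trans[OF sum_abs sum_mono])
  fix X assume X: "X \<in> Pow S2"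
  then have fX: "finite X" using S finite_subset by auto
  have cX: "card X \<le> T" "card S1 \<le> T"
   using cF card_mono[OF F, of X] card_mono[OF F, of S1] X S(5,6) by (meson PowD order_trans)+
  have hb: "0 \<le> hd_diff n (card S1) (card X)" "hd_diff n (card S1) (card X) \<le> qf n (card X) * \<theta> ^ card S1"
   using hd_diff_bound[OF k, of "card X" "card S1"] cX by auto
  have "qf n (card X) \<le> 2" using k cX by (intro qf_le_2[OF n0, of _ "3 * T"]) (auto simp: power_mult_distrib)
  then have "qf n (card X) * \<theta> ^ card S1 \<le> 2 * \<theta> ^ card S1" using th0 by (intro mult_right_mono) auto
  then have h2: "\<bar>hd_diff n (card S1) (card X)\<bar> \<le> 2 * \<theta> ^ card S1" using hb by simp
  have B: "?B X = \<bar>\<Prod>f\<in>X. ?c1 f\<bar> * \<bar>\<Prod>f\<in>S2 - X. ?c0 f\<bar> * (1 / n) ^ card X"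
   by (simp add: prod_dividef abs_prod power_divide)
  show "\<bar>if matching X then ((\<Prod>f\<in>X. ?c1 f) * (\<Prod>f\<in>S2 - X. ?c0 f)) * (1 / n) ^ card X * ((1 / n) ^ card S1 * hd_diff n (card S1) (card X)) else 0\<bar>
   \<le> ?B X * ((1 / n) ^ card S1 * (2 * \<theta> ^ card S1))"
  proof (cases "matching X")
   case True
   have "\<bar>((\<Prod>f\<in>X. ?c1 f) * (\<Prod>f\<in>S2 - X. ?c0 f)) * (1 / n) ^ card X * ((1 / n) ^ card S1 * hd_diff n (card S1) (card X))\<bar>
    = ?B X * ((1 / n) ^ card S1 * \<bar>hd_diff n (card S1) (card X)\<bar>)"
    unfolding B by (simp add: abs_mult)
   also have "\<dots> \<le> ?B X * ((1 / n) ^ card S1 * (2 * \<theta> ^ card S1))"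
    using h2 by (intro mult_left_mono mult_nonneg_nonneg prod_nonneg) auto
   finally show ?thesis using True by simp
  next
   case False
   then show ?thesis using th0 by (auto intro!: mult_nonneg_nonneg prod_nonneg)
  qed
 qed
 also have "\<dots> = (\<Prod>f\<in>S2. \<bar>?c1 f\<bar> / n + \<bar>?c0 f\<bar>) * ((1 / n) ^ card S1 * (2 * \<theta> ^ card S1))"
  using S(2) by (simp add: prod_add sum_distrib_right)
 \<comment> \<open>A position used once may cost \<open>2 / n\<close>. One used at least twice costs
   only \<open>1 / n + 1 / n\<^sup>2\<close>, because its constant term is a square or a higher
   power of \<open>1 / n\<close>.\<close>
 also have "(\<Prod>f\<in>S2. \<bar>?c1 f\<bar> / n + \<bar>?c0 f\<bar>) \<le> (\<Prod>f\<in>S2. (1 / n) * ((if f \<in> multi1 T e then 2 else 1) * (1 + 1 / n)))"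
 proof (intro prod_mono conjI)
  fix f assume f: "f \<in> S2"
  then have fF: "f \<in> ?F" using S by auto
  have a: "\<bar>?c1 f\<bar> / n \<le> 1 / n" using coeff_bounds(1)[OF n0 p0[OF fF]] by (simp add: divide_right_mono)
  show "\<bar>?c1 f\<bar> / n + \<bar>?c0 f\<bar> \<le> (1 / n) * ((if f \<in> multi1 T e then 2 else 1) * (1 + 1 / n))"
  proof (cases "f \<in> multi1 T e")
   case True
   have "\<bar>?c1 f\<bar> / n + \<bar>?c0 f\<bar> \<le> 1 / n + 1 / n" using a coeff_bounds(2)[OF n0 p0[OF fF]] by (rule add_mono)
   also have "\<dots> \<le> (1 / n) * (2 * (1 + 1 / n))" by (simp add: algebra_simps)
   finally show ?thesis using True by simp
  next
   case False
   then have "\<bar>?c1 f\<bar> / n + \<bar>?c0 f\<bar> \<le> 1 / n + (1 / n) * (1 / n)"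
    using a coeff_bounds(3)[OF n0 p0[OF fF]] p1[OF fF] by (intro add_mono) auto
   then show ?thesis using False by (simp add: algebra_simps)
  qed
 qed auto
 also have "(\<Prod>f\<in>S2. (1 / n) * ((if f \<in> multi1 T e then 2 else 1) * (1 + 1 / n)))
  = (1 / n) ^ card S2 * (2 ^ card (multi1 T e \<inter> shared T e) * (1 + 1 / n) ^ card S2)"
 proof -
  have "S2 \<inter> multi1 T e = multi1 T e \<inter> shared T e" unfolding S2_def S1_def multi1_def by auto
  then have "(\<Prod>f\<in>S2. if f \<in> multi1 T e then 2 else (1::real)) = 2 ^ card (multi1 T e \<inter> shared T e)"
   using S(2) by (simp add: prod.If_cases Int_def conj_commute)
  then show ?thesis by (simp only: prod.distrib prod_constant)
 qed
 also have "(1 + 1 / real n) ^ card S2 \<le> 3"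
 proof -
  have "card S2 \<le> n" using card_mono[OF F S(6)] cF T by (metis (no_types, lifting) le_square le_trans power2_eq_square mult.commute mult_le_mono2 nat_mult_1_right one_le_numeral)
  then have "(1 + 1 / real n) ^ card S2 \<le> (1 + 1 / n) ^ n" by (intro power_increasing) auto
  also have "\<dots> \<le> exp (1 / n) ^ n" by (intro power_mono) (use exp_ge_add_one_self[of "1 / real n"] in auto)
  also have "\<dots> = exp 1" using n0 by (simp add: exp_of_nat_mult[symmetric])
  also have "\<dots> \<le> 3" by (rule exp_le)
  finally show ?thesis .
 qed
 finally have fin: "\<bar>pavg n (\<lambda>\<sigma>. \<Prod>t<T. (ind \<sigma> (e t) - 1 / n))\<bar>
   \<le> (1 / n) ^ card S2 * (2 ^ card (multi1 T e \<inter> shared T e) * 3) * ((1 / n) ^ card S1 * (2 * \<theta> ^ card S1))"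
  using th0 by (simp add: mult_right_mono mult_left_mono)
 have "card ?F = card S2 + card S1" unfolding S(4) using S by (intro card_Un_disjoint) auto
 then show ?thesis using fin unfolding S1_def[symmetric] by (simp add: power_add mult_ac)
qed

section \<open>Operator norms and trace moments\<close>

type_synonym fmat = "nat \<Rightarrow> nat \<Rightarrow> real"

definition mm :: "nat \<Rightarrow> fmat \<Rightarrow> fmat \<Rightarrow> fmat" where
 "mm n A B = (\<lambda>i j. \<Sum>k<n. A i k * B k j)"
definition mv :: "nat \<Rightarrow> fmat \<Rightarrow> (nat \<Rightarrow> real) \<Rightarrow> nat \<Rightarrow> real" where
 "mv n A v = (\<lambda>i. \<Sum>j<n. A i j * v j)"
definition nrm :: "nat \<Rightarrow> (nat \<Rightarrow> real) \<Rightarrow> real" where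
 "nrm n v = L2_set v {..<n}"
definition opb :: "nat \<Rightarrow> fmat \<Rightarrow> real \<Rightarrow> bool" where
 "opb n A K \<longleftrightarrow> 0 \<le> K \<and> (\<forall>v. nrm n (mv n A v) \<le> K * nrm n v)"

lemma nrm_nonneg [simp]: "0 \<le> nrm n v" unfolding nrm_def by (rule L2_set_nonneg)

lemma nrm_sq: "(nrm n v)\<^sup>2 = (\<Sum>i<n. (v i)\<^sup>2)"
 unfolding nrm_def L2_set_def by (simp add: sum_nonneg)

lemma nrm_cong: "(\<And>i. i < n \<Longrightarrow> v i = w i) \<Longrightarrow> nrm n v = nrm n w"
 unfolding nrm_def by (intro L2_set_cong) auto

lemma opbI:
 assumes "0 \<le> K" "\<And>v. (\<Sum>i<n. (mv n A v i)\<^sup>2) \<le> K\<^sup>2 * (\<Sum>i<n. (v i)\<^sup>2)"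
 shows "opb n A K"
 unfolding opb_def
proof (intro conjI allI assms(1))
 fix v
 have "(nrm n (mv n A v))\<^sup>2 \<le> (K * nrm n v)\<^sup>2" using assms(2)[of v] by (simp add: nrm_sq power_mult_distrib)
 then show "nrm n (mv n A v) \<le> K * nrm n v" by (rule power2_le_imp_le) (simp add: assms(1))
qed

lemma opb_nonneg: "opb n A K \<Longrightarrow> 0 \<le> K" unfolding opb_def by simp
lemma opbD: "opb n A K \<Longrightarrow> nrm n (mv n A v) \<le> K * nrm n v" unfolding opb_def by simp

lemma opb_le: "opb n A K \<Longrightarrow> K \<le> L \<Longrightarrow> opb n A L"
 unfolding opb_def by (meson mult_right_mono nrm_nonneg order_trans)

lemma opb_cong: "(\<And>i j. i < n \<Longrightarrow> j < n \<Longrightarrow> A i j = B i j) \<Longrightarrow> opb n A K \<Longrightarrow> opb n B K"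
proof -
 assume eq: "\<And>i j. i < n \<Longrightarrow> j < n \<Longrightarrow> A i j = B i j" and A: "opb n A K"
 have "nrm n (mv n B v) = nrm n (mv n A v)" for v
  by (rule nrm_cong) (simp add: mv_def eq)
 then show "opb n B K" using A unfolding opb_def by simp
qed

lemma mv_mm: "mv n (mm n A B) v = mv n A (mv n B v)"
proof
 fix i
 have "mv n (mm n A B) v i = (\<Sum>j<n. \<Sum>k<n. A i k * (B k j * v j))"
  unfolding mv_def mm_def by (simp add: sum_distrib_right mult.assoc)
 also have "\<dots> = (\<Sum>k<n. \<Sum>j<n. A i k * (B k j * v j))" by (rule sum.swap)
 finally show "mv n (mm n A B) v i = mv n A (mv n B v) i" unfolding mv_def by (simp add: sum_distrib_left)
qed

lemma mm_assoc: "mm n (mm n A B) C = mm n A (mm n B C)"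
proof (intro ext)
 fix i j
 have "mm n (mm n A B) C i j = (\<Sum>k<n. \<Sum>l<n. A i l * (B l k * C k j))"
  unfolding mm_def by (simp add: sum_distrib_right mult.assoc)
 also have "\<dots> = (\<Sum>l<n. \<Sum>k<n. A i l * (B l k * C k j))" by (rule sum.swap)
 finally show "mm n (mm n A B) C i j = mm n A (mm n B C) i j" unfolding mm_def by (simp add: sum_distrib_left)
qed

lemma opb_mm: "opb n A K \<Longrightarrow> opb n B L \<Longrightarrow> opb n (mm n A B) (K * L)"
proof -
 assume A: "opb n A K" and B: "opb n B L"
 have "nrm n (mv n (mm n A B) v) \<le> K * L * nrm n v" for v
 proof -
  have "nrm n (mv n (mm n A B) v) \<le> K * nrm n (mv n B v)" unfolding mv_mm by (rule opbD[OF A])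
  also have "\<dots> \<le> K * (L * nrm n v)" using opbD[OF B] opb_nonneg[OF A] by (rule mult_left_mono)
  finally show ?thesis by (simp add: mult.assoc)
 qed
 then show ?thesis unfolding opb_def using opb_nonneg[OF A] opb_nonneg[OF B] by simp
qed

lemma opb_add: "opb n A K \<Longrightarrow> opb n B L \<Longrightarrow> opb n (\<lambda>i j. A i j + B i j) (K + L)"
proof -
 assume A: "opb n A K" and B: "opb n B L"
 have "nrm n (mv n (\<lambda>i j. A i j + B i j) v) \<le> (K + L) * nrm n v" for v
 proof -
  have "mv n (\<lambda>i j. A i j + B i j) v = (\<lambda>i. mv n A v i + mv n B v i)"
   unfolding mv_def by (simp add: distrib_right sum.distrib)
  then have "nrm n (mv n (\<lambda>i j. A i j + B i j) v) \<le> nrm n (mv n A v) + nrm n (mv n B v)"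
   unfolding nrm_def by (simp add: L2_set_triangle_ineq)
  also have "\<dots> \<le> K * nrm n v + L * nrm n v" by (intro add_mono opbD A B)
  finally show ?thesis by (simp add: distrib_right)
 qed
 then show ?thesis unfolding opb_def using opb_nonneg[OF A] opb_nonneg[OF B] by simp
qed

lemma opb_zero: "opb n (\<lambda>i j. 0) 0"
 by (rule opbI) (simp_all add: mv_def)

lemma opb_sum: "finite X \<Longrightarrow> (\<And>x. x \<in> X \<Longrightarrow> opb n (A x) (K x)) \<Longrightarrow> opb n (\<lambda>i j. \<Sum>x\<in>X. A x i j) (\<Sum>x\<in>X. K x)"
proof (induction X rule: finite_induct)
 case empty
 then show ?case using opb_zero by simp
next
 case (insert x X)
 then have "opb n (\<lambda>i j. A x i j + (\<Sum>x\<in>X. A x i j)) (K x + (\<Sum>x\<in>X. K x))" by (intro opb_add) auto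
 then show ?case using insert.hyps by simp
qed

lemma opb_mono:
 assumes "\<And>i j. i < n \<Longrightarrow> j < n \<Longrightarrow> \<bar>A i j\<bar> \<le> B i j" "opb n B K"
 shows "opb n A K"
proof -
 have "nrm n (mv n A v) \<le> K * nrm n v" for v
 proof -
  have "nrm n (mv n A v) = nrm n (\<lambda>i. \<bar>mv n A v i\<bar>)" unfolding nrm_def L2_set_def by simp
  also have "\<dots> \<le> nrm n (mv n B (\<lambda>j. \<bar>v j\<bar>))"
   unfolding nrm_def
  proof (rule L2_set_mono)
   fix i assume i: "i \<in> {..<n}"
   have "\<bar>mv n A v i\<bar> \<le> (\<Sum>j<n. \<bar>A i j * v j\<bar>)" unfolding mv_def by (rule sum_abs)
   also have "\<dots> \<le> (\<Sum>j<n. B i j * \<bar>v j\<bar>)"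
    using assms(1) i by (intro sum_mono) (auto simp: abs_mult intro: mult_right_mono)
   finally show "\<bar>mv n A v i\<bar> \<le> mv n B (\<lambda>j. \<bar>v j\<bar>) i" unfolding mv_def .
  qed auto
  also have "\<dots> \<le> K * nrm n (\<lambda>j. \<bar>v j\<bar>)" by (rule opbD[OF assms(2)])
  also have "nrm n (\<lambda>j. \<bar>v j\<bar>) = nrm n v" unfolding nrm_def L2_set_def by simp
  finally show ?thesis .
 qed
 then show ?thesis unfolding opb_def using opb_nonneg[OF assms(2)] by simp
qed

lemma opb_frob: "opb n A (sqrt (\<Sum>i<n. \<Sum>j<n. (A i j)\<^sup>2))"
proof (rule opbI)
 fix v :: "nat \<Rightarrow> real"
 have "(mv n A v i)\<^sup>2 \<le> (\<Sum>j<n. (A i j)\<^sup>2) * (\<Sum>j<n. (v j)\<^sup>2)" for i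
  unfolding mv_def by (rule Cauchy_Schwarz_ineq_sum)
 then have "(\<Sum>i<n. (mv n A v i)\<^sup>2) \<le> (\<Sum>i<n. (\<Sum>j<n. (A i j)\<^sup>2) * (\<Sum>j<n. (v j)\<^sup>2))" by (rule sum_mono)
 also have "\<dots> = (sqrt (\<Sum>i<n. \<Sum>j<n. (A i j)\<^sup>2))\<^sup>2 * (\<Sum>i<n. (v i)\<^sup>2)"
  by (simp add: sum_nonneg sum_distrib_right)
 finally show "(\<Sum>i<n. (mv n A v i)\<^sup>2) \<le> (sqrt (\<Sum>i<n. \<Sum>j<n. (A i j)\<^sup>2))\<^sup>2 * (\<Sum>i<n. (v i)\<^sup>2)" .
qed (simp add: sum_nonneg)

lemma opb_schur:
 assumes nn: "\<And>i j. i < n \<Longrightarrow> j < n \<Longrightarrow> 0 \<le> A i j"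
  and row: "\<And>i. i < n \<Longrightarrow> (\<Sum>j<n. A i j) \<le> 1" and col: "\<And>j. j < n \<Longrightarrow> (\<Sum>i<n. A i j) \<le> 1"
 shows "opb n A 1"
proof (rule opbI)
 fix v :: "nat \<Rightarrow> real"
 have "(mv n A v i)\<^sup>2 \<le> (\<Sum>j<n. A i j * (v j)\<^sup>2)" if i: "i < n" for i
 proof -
  have "mv n A v i = (\<Sum>j<n. sqrt (A i j) * (sqrt (A i j) * v j))"
   unfolding mv_def using nn[OF i] by (intro sum.cong) (auto simp: mult.assoc[symmetric])
  then have "(mv n A v i)\<^sup>2 \<le> (\<Sum>j<n. (sqrt (A i j))\<^sup>2) * (\<Sum>j<n. (sqrt (A i j) * v j)\<^sup>2)"
   using Cauchy_Schwarz_ineq_sum by metis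
  also have "\<dots> = (\<Sum>j<n. A i j) * (\<Sum>j<n. A i j * (v j)\<^sup>2)"
   using nn[OF i] by (simp add: power_mult_distrib)
  also have "\<dots> \<le> 1 * (\<Sum>j<n. A i j * (v j)\<^sup>2)"
   using row[OF i] nn[OF i] by (intro mult_right_mono sum_nonneg) auto
  finally show ?thesis by simp
 qed
 then have "(\<Sum>i<n. (mv n A v i)\<^sup>2) \<le> (\<Sum>i<n. \<Sum>j<n. A i j * (v j)\<^sup>2)" by (intro sum_mono) auto
 also have "\<dots> = (\<Sum>j<n. (\<Sum>i<n. A i j) * (v j)\<^sup>2)" by (subst sum.swap) (simp add: sum_distrib_right)
 also have "\<dots> \<le> (\<Sum>j<n. 1 * (v j)\<^sup>2)" using col by (intro sum_mono mult_right_mono) auto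
 finally show "(\<Sum>i<n. (mv n A v i)\<^sup>2) \<le> 1\<^sup>2 * (\<Sum>i<n. (v i)\<^sup>2)" by simp
qed simp

lemma opb_diag: "0 \<le> K \<Longrightarrow> (\<And>i. i < n \<Longrightarrow> \<bar>d i\<bar> \<le> K) \<Longrightarrow> opb n (\<lambda>i j. if i = j then d i else 0) K"
proof (rule opbI)
 fix v :: "nat \<Rightarrow> real"
 assume K: "0 \<le> K" "\<And>i. i < n \<Longrightarrow> \<bar>d i\<bar> \<le> K"
 have "(mv n (\<lambda>i j. if i = j then d i else 0) v i)\<^sup>2 \<le> K\<^sup>2 * (v i)\<^sup>2" if "i < n" for i
 proof -
  have "mv n (\<lambda>i j. if i = j then d i else 0) v i = d i * v i"
   unfolding mv_def using that by (simp add: if_distrib[of "\<lambda>x. x * _"] cong: if_cong)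
  moreover have "(d i)\<^sup>2 \<le> K\<^sup>2" using K(2)[OF that] by (simp add: abs_le_square_iff[symmetric] K(1))
  ultimately show ?thesis by (simp add: power_mult_distrib mult_right_mono)
 qed
 then show "(\<Sum>i<n. (mv n (\<lambda>i j. if i = j then d i else 0) v i)\<^sup>2) \<le> K\<^sup>2 * (\<Sum>i<n. (v i)\<^sup>2)"
  unfolding sum_distrib_left by (intro sum_mono) auto
qed auto

definition idm :: fmat where "idm = (\<lambda>i j. if i = j then 1 else 0)"

lemma mm_idm_right: "j < n \<Longrightarrow> mm n A idm i j = A i j"
 unfolding mm_def idm_def by (simp add: if_distrib[of "\<lambda>x. _ * x"] cong: if_cong)

lemma mm_idm_left: "i < n \<Longrightarrow> mm n idm A i j = A i j"
 unfolding mm_def idm_def by (simp add: if_distrib[of "\<lambda>x. x * _"] cong: if_cong)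

definition tm :: "fmat \<Rightarrow> fmat" where "tm A = (\<lambda>i j. A j i)"

definition gram :: "nat \<Rightarrow> fmat \<Rightarrow> fmat" where "gram n A = mm n (tm A) A"

fun mpw :: "nat \<Rightarrow> fmat \<Rightarrow> nat \<Rightarrow> fmat" where
 "mpw n A 0 = idm" |
 "mpw n A (Suc k) = mm n A (mpw n A k)"

lemma mm_cong: "(\<And>k. k < n \<Longrightarrow> A i k = A' i k) \<Longrightarrow> (\<And>k. k < n \<Longrightarrow> B k j = B' k j) \<Longrightarrow> mm n A B i j = mm n A' B' i j"
 unfolding mm_def by (intro sum.cong) auto

lemma mpw_add: "i < n \<Longrightarrow> mm n (mpw n A a) (mpw n A b) i j = mpw n A (a + b) i j"
proof (induction a arbitrary: i)
 case 0
 then show ?case by (simp add: mm_idm_left)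
next
 case (Suc a)
 have "mm n (mpw n A (Suc a)) (mpw n A b) i j = mm n A (mm n (mpw n A a) (mpw n A b)) i j"
  by (simp add: mm_assoc)
 also have "\<dots> = mm n A (mpw n A (a + b)) i j" by (rule mm_cong) (use Suc.IH in auto)
 finally show ?case by simp
qed

lemma mpw_Suc_right: "i < n \<Longrightarrow> j < n \<Longrightarrow> mpw n A (Suc k) i j = mm n (mpw n A k) A i j"
proof -
 assume ij: "i < n" "j < n"
 have "mm n (mpw n A k) (mpw n A 1) i j = mpw n A (k + 1) i j" by (rule mpw_add[OF ij(1)])
 moreover have "mm n (mpw n A k) (mpw n A 1) i j = mm n (mpw n A k) A i j"
  by (rule mm_cong) (use ij mm_idm_right in auto)
 ultimately show ?thesis by simp
qed

lemma mpw_sym: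
 assumes "\<And>i j. A i j = A j i" "i < n" "j < n"
 shows "mpw n A k i j = mpw n A k j i"
 using assms(2,3)
proof (induction k arbitrary: i j)
 case 0
 then show ?case by (simp add: idm_def)
next
 case (Suc k)
 have "mpw n A (Suc k) i j = (\<Sum>l<n. A i l * mpw n A k l j)" by (simp add: mm_def)
 also have "\<dots> = (\<Sum>l<n. mpw n A k j l * A l i)"
  using Suc assms(1) by (intro sum.cong) (auto simp: mult.commute)
 also have "\<dots> = mpw n A (Suc k) j i" using mpw_Suc_right[OF Suc.prems(2,1)] by (simp add: mm_def)
 finally show ?case .
qed

lemma gram_sym: "gram n A i j = gram n A j i"
 unfolding gram_def mm_def tm_def by (simp add: mult.commute)

lemma mv_adjoint: "(\<Sum>i<n. mv n A v i * w i) = (\<Sum>j<n. v j * mv n (tm A) w j)"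
proof -
 have "(\<Sum>i<n. mv n A v i * w i) = (\<Sum>i<n. \<Sum>j<n. v j * (A i j * w i))"
  unfolding mv_def sum_distrib_right by (intro sum.cong refl) (simp add: mult_ac)
 also have "\<dots> = (\<Sum>j<n. \<Sum>i<n. v j * (A i j * w i))" by (rule sum.swap)
 finally show ?thesis unfolding mv_def tm_def by (simp add: sum_distrib_left)
qed

text \<open>Moments of the Gram matrix: the numbers \<open>a k = |u k|^2\<close> for \<open>u = v, A v, A^T A v, \<dots>\<close> form a
 log-convex sequence.\<close>

theorem opb_trace:
 assumes m: "0 < m" and K: "0 \<le> K" "(\<Sum>i<n. mpw n (gram n A) (2 * m) i i) \<le> K ^ (4 * m)"
 shows "opb n A K"
proof (rule opbI[OF K(1)])
 fix v :: "nat \<Rightarrow> real"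
 define u where "u = rec_nat v (\<lambda>k x. if even k then mv n A x else mv n (tm A) x)"
 define a where "a k = (\<Sum>i<n. (u k i)\<^sup>2)" for k
 have u: "u 0 = v" "u (Suc k) = (if even k then mv n A (u k) else mv n (tm A) (u k))" for k
  unfolding u_def by auto
 have a0: "0 \<le> a k" for k unfolding a_def by (simp add: sum_nonneg)
 have lc: "(a (Suc k))\<^sup>2 \<le> a k * a (Suc (Suc k))" for k
 proof -
  have "a (Suc k) = (\<Sum>i<n. u k i * u (Suc (Suc k)) i)"
  proof (cases "even k")
   case True
   then show ?thesis unfolding a_def using mv_adjoint[of n A "u k" "u (Suc k)"] by (simp add: u power2_eq_square)
  next
   case False
   then show ?thesis unfolding a_def using mv_adjoint[of n "tm A" "u k" "u (Suc k)"] by (simp add: u power2_eq_square tm_def)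
  qed
  then show ?thesis unfolding a_def using Cauchy_Schwarz_ineq_sum by metis
 qed
 \<comment> \<open>By log-convexity the ratios \<open>a (Suc k) / a k\<close> increase; the
   inequality compares the ratio at \<open>k\<close> with the first one without dividing.\<close>
 have step: "a 1 * a k \<le> a (Suc k) * a 0" for k
 proof (induction k)
  case (Suc k)
  show ?case
  proof (cases "a (Suc k) = 0")
   case True
   then show ?thesis using a0 by simp
  next
   case False
   then have pos: "0 < a (Suc k)" using a0[of "Suc k"] by simp
   have "a (Suc k) * (a 1 * a (Suc k)) = a 1 * (a (Suc k))\<^sup>2" by (simp add: power2_eq_square)
   also have "\<dots> \<le> a 1 * (a k * a (Suc (Suc k)))" using lc a0 by (rule mult_left_mono)
   also have "\<dots> = (a 1 * a k) * a (Suc (Suc k))" by simp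
   also have "\<dots> \<le> (a (Suc k) * a 0) * a (Suc (Suc k))" using Suc a0 by (rule mult_right_mono)
   finally have "a (Suc k) * (a 1 * a (Suc k)) \<le> a (Suc k) * (a (Suc (Suc k)) * a 0)" by (simp add: mult_ac)
   then show ?thesis using pos by simp
  qed
 qed (simp add: mult.commute)
 have pw: "a 1 ^ Suc k \<le> a (Suc k) * a 0 ^ k" for k
 proof (induction k)
  case (Suc k)
  have "a 1 ^ Suc (Suc k) = a 1 * a 1 ^ Suc k" by simp
  also have "\<dots> \<le> a 1 * (a (Suc k) * a 0 ^ k)" using Suc a0 by (rule mult_left_mono)
  also have "\<dots> = (a 1 * a (Suc k)) * a 0 ^ k" by simp
  also have "\<dots> \<le> (a (Suc (Suc k)) * a 0) * a 0 ^ k" using step a0 by (intro mult_right_mono) auto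
  finally show ?case by (simp add: mult_ac)
 qed simp
 let ?S = "gram n A"
 have u2: "nrm n (u (2 * k)) = nrm n (mv n (mpw n ?S k) v) \<and> (\<forall>i<n. u (2 * k) i = mv n (mpw n ?S k) v i)" for k
 proof (induction k)
  case 0
  have "mv n idm v i = v i" if "i < n" for i
   unfolding mv_def idm_def using that by (simp add: if_distrib[of "\<lambda>x. x * _"] cong: if_cong)
  then show ?case using nrm_cong[of n v "mv n idm v"] by (simp add: u)
 next
  case (Suc k)
  have "u (2 * Suc k) = mv n ?S (u (2 * k))" by (simp add: u gram_def mv_mm)
  moreover have "mv n ?S (u (2 * k)) = mv n ?S (mv n (mpw n ?S k) v)"
   using Suc unfolding mv_def[of n ?S] by (intro ext sum.cong) auto
  ultimately show ?case by (simp add: mv_mm)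
 qed
 \<comment> \<open>\<open>u (2 * m)\<close> is the \<open>m\<close>-th power of the Gram matrix
   applied to \<open>v\<close>, and the squared Frobenius norm of this power is the trace of the
   power \<open>2 * m\<close>.\<close>
 have "a (2 * m) \<le> (\<Sum>i<n. \<Sum>j<n. (mpw n ?S m i j)\<^sup>2) * a 0"
 proof -
  have "nrm n (u (2 * m)) \<le> sqrt (\<Sum>i<n. \<Sum>j<n. (mpw n ?S m i j)\<^sup>2) * nrm n v"
   using u2[of m] opbD[OF opb_frob] by simp
  then have "(nrm n (u (2 * m)))\<^sup>2 \<le> (sqrt (\<Sum>i<n. \<Sum>j<n. (mpw n ?S m i j)\<^sup>2) * nrm n v)\<^sup>2" by (intro power_mono) auto
  then show ?thesis unfolding a_def by (simp add: power_mult_distrib sum_nonneg nrm_sq u)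
 qed
 also have "(\<Sum>i<n. \<Sum>j<n. (mpw n ?S m i j)\<^sup>2) = (\<Sum>i<n. mpw n ?S (2 * m) i i)"
 proof (rule sum.cong[OF refl])
  fix i assume i: "i \<in> {..<n}"
  have "(\<Sum>j<n. (mpw n ?S m i j)\<^sup>2) = mm n (mpw n ?S m) (mpw n ?S m) i i"
   unfolding mm_def power2_eq_square using mpw_sym[where A = ?S and k = m, OF gram_sym] i by (intro sum.cong) auto
  then show "(\<Sum>j<n. (mpw n ?S m i j)\<^sup>2) = mpw n ?S (2 * m) i i" using mpw_add[of i n ?S m m i] i by (simp add: mult_2)
 qed
 also have "\<dots> * a 0 \<le> K ^ (4 * m) * a 0" using K a0 by (intro mult_right_mono)
 finally have am: "a (2 * m) \<le> K ^ (4 * m) * a 0" .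
 obtain k where k: "2 * m = Suc k" using m by (metis Suc_pred nat_0_less_mult_iff pos2)
 have "a 1 ^ (2 * m) \<le> a (2 * m) * a 0 ^ k" using pw[of k] k by simp
 also have "\<dots> \<le> (K ^ (4 * m) * a 0) * a 0 ^ k" using am a0 by (intro mult_right_mono) auto
 also have "\<dots> = K ^ (4 * m) * a 0 ^ (2 * m)" unfolding k by simp
 also have "\<dots> = (K\<^sup>2 * a 0) ^ (2 * m)" by (simp add: power_mult_distrib power_mult[symmetric])
 finally have "a 1 \<le> K\<^sup>2 * a 0" using power_mono_iff[of "a 1" "K\<^sup>2 * a 0" "2 * m"] a0 m by simp
 then show "(\<Sum>i<n. (mv n A v i)\<^sup>2) \<le> K\<^sup>2 * (\<Sum>i<n. (v i)\<^sup>2)" unfolding a_def by (simp add: u)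
qed

section \<open>Lists of fixed length and products over blocks\<close>

definition llists :: "'a set \<Rightarrow> nat \<Rightarrow> 'a list set" where
 "llists A m = {xs. set xs \<subseteq> A \<and> length xs = m}"

lemma finite_llists [simp]: "finite A \<Longrightarrow> finite (llists A m)"
 unfolding llists_def by (rule finite_lists_length_eq)

lemma llists_0 [simp]: "llists A 0 = {[]}" unfolding llists_def by auto

lemma sum_llists_Suc: "(\<Sum>xs\<in>llists A (Suc m). f xs) = (\<Sum>x\<in>A. \<Sum>xs\<in>llists A m. f (x # xs))"
proof -
 have "(\<Sum>xs\<in>llists A (Suc m). f xs) = (\<Sum>q\<in>A \<times> llists A m. f (fst q # snd q))"
  by (rule sum.reindex_bij_witness[of _ "\<lambda>q. fst q # snd q" "\<lambda>xs. (hd xs, tl xs)"])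
   (auto simp: llists_def length_Suc_conv)
 then show ?thesis by (simp add: sum.cartesian_product')
qed

lemma nth_concat_uniform:
 "(\<And>x. x \<in> set xs \<Longrightarrow> length x = s) \<Longrightarrow> j < length xs \<Longrightarrow> i < s \<Longrightarrow> concat xs ! (j * s + i) = xs ! j ! i"
proof (induction xs arbitrary: j)
 case (Cons x xs)
 show ?case
 proof (cases j)
  case 0
  then show ?thesis using Cons by (simp add: nth_append)
 next
  case (Suc k)
  have "length x = s" using Cons.prems(1) by simp
  then have "concat (x # xs) ! (j * s + i) = concat xs ! (k * s + i)"
   using Suc by (simp add: nth_append add.assoc)
  then show ?thesis using Cons Suc by simp
 qed
qed simp

lemma length_concat_uniform: "(\<And>x. x \<in> set xs \<Longrightarrow> length x = s) \<Longrightarrow> length (concat xs) = length xs * s"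
 by (induction xs) auto

lemma prod_blocks:
 fixes f :: "nat \<Rightarrow> real"
 assumes s: "0 < s"
 shows "(\<Prod>t\<in>{t. t < b * s \<and> Suc t < b * s \<and> Suc t div s = t div s}. f t) = (\<Prod>j<b. \<Prod>i<s - 1. f (j * s + i))"
proof -
 have "(\<Prod>t\<in>{t. t < b * s \<and> Suc t < b * s \<and> Suc t div s = t div s}. f t) = (\<Prod>q\<in>{..<b} \<times> {..<s - 1}. f (fst q * s + snd q))"
 proof (rule prod.reindex_bij_witness[of _ "\<lambda>q. fst q * s + snd q" "\<lambda>t. (t div s, t mod s)"])
  fix t assume t: "t \<in> {t. t < b * s \<and> Suc t < b * s \<and> Suc t div s = t div s}"
  have "t mod s < s - 1"
  proof (rule ccontr)
   assume "\<not> t mod s < s - 1"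
   then have "Suc (t mod s) = s" using s mod_less_divisor[OF s, of t] by linarith
   then have "Suc t div s = Suc (t div s)" using div_Suc[of t s] mod_Suc[of t s] by simp
   then show False using t by simp
  qed
  then show "(t div s, t mod s) \<in> {..<b} \<times> {..<s - 1}" using t by (auto simp: less_mult_imp_div_less)
 next
  fix q assume q: "q \<in> {..<b} \<times> {..<s - 1}"
  obtain j i where ji: "q = (j, i)" by (cases q)
  have i: "j < b" "i < s" "Suc i < s" using q ji by auto
  have "Suc j * s \<le> b * s" using i by (intro mult_le_mono1) simp
  then have lt: "Suc (j * s + i) < b * s" using i by simp
  have "(j * s + i) div s = j" "Suc (j * s + i) div s = j"
   using i by (auto intro!: div_nat_eqI simp: algebra_simps)
  then show "fst q * s + snd q \<in> {t. t < b * s \<and> Suc t < b * s \<and> Suc t div s = t div s}" using lt ji by simp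
  show "((fst q * s + snd q) div s, (fst q * s + snd q) mod s) = q" using ji i by simp
 qed auto
 then show ?thesis by (simp add: prod.cartesian_product split_beta)
qed

text \<open>The properties of \<open>Q\<close> on which everything up to the final section rests.
  Outside the index range \<open>Q\<close> is 0, which frees most facts from range conditions. The
  condition \<open>d_rho\<close> is the lower bound \<open>d powr (-1/2)\<close> for
  \<open>\<rho>\<close>.\<close>

locale sparse =
 fixes n d :: nat and Q :: fmat and E :: "nat set" and \<rho> :: real
 assumes n_pos: "0 < n" and Q_nonneg: "\<And>y x. 0 \<le> Q y x"
  and Q_out: "\<And>y x. Q y x \<noteq> 0 \<Longrightarrow> y < n \<and> x < n"
  and row: "\<And>y. y < n \<Longrightarrow> (\<Sum>x<n. Q y x) = 1"
  and col: "\<And>x. x < n \<Longrightarrow> (\<Sum>y<n. Q y x) = 1"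
  and srow: "\<And>y. card {x. Q y x \<noteq> 0} \<le> d" and scol: "\<And>x. card {y. Q y x \<noteq> 0} \<le> d"
  and hs: "(\<Sum>y<n. \<Sum>x<n. (Q y x)\<^sup>2) \<le> real n * \<rho>\<^sup>2"
  and Q_le: "\<And>y x. x \<notin> E \<Longrightarrow> Q y x \<le> \<rho>"
  and E_sub: "E \<subseteq> {..<n}"
  and rho: "0 < \<rho>" "\<rho> \<le> 1" and d_rho: "1 \<le> real d * \<rho>\<^sup>2" and d2: "2 \<le> d"
begin

lemma fin_row: "finite {x. Q y x \<noteq> 0}" by (rule finite_subset[of _ "{..<n}"]) (use Q_out in auto)
lemma fin_col: "finite {y. Q y x \<noteq> 0}" by (rule finite_subset[of _ "{..<n}"]) (use Q_out in auto)

lemma row_le: "(\<Sum>x<n. Q y x) \<le> 1"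
proof (cases "y < n")
 case False
 then have "Q y x = 0" for x using Q_out[of y x] by blast
 then show ?thesis by simp
qed (use row in simp)

lemma Q_le1: "Q y x \<le> 1"
proof (cases "Q y x = 0")
 case False
 then have "x < n" using Q_out by blast
 then have "Q y x \<le> (\<Sum>x<n. Q y x)" using Q_nonneg by (intro member_le_sum) auto
 then show ?thesis using row_le[of y] by simp
qed simp

subsection \<open>Paths\<close>

text \<open>A path \<open>x0, y1, x1, \<dots>, ys, xs\<close> is stored backwards, as the list of its matrix positions
 \<open>(x(s-1), ys), \<dots>, (x0, y1)\<close> together with its end point \<open>xs\<close>.\<close>

fun wt :: "(nat \<times> nat \<Rightarrow> real) \<Rightarrow> (nat \<times> nat) list \<Rightarrow> nat \<Rightarrow> real" where
 "wt f [] z = 1" |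
 "wt f (p # es) z = wt f es (fst p) * f p * Q (snd p) z"

fun st :: "(nat \<times> nat) list \<Rightarrow> nat \<Rightarrow> nat" where
 "st [] z = z" |
 "st (p # es) z = st es (fst p)"

definition good :: "(nat \<times> nat) list \<Rightarrow> nat \<Rightarrow> bool" where
 "good es z \<longleftrightarrow> distinct (z # map fst es) \<and> distinct (map snd es) \<and> set (z # map fst es) \<inter> E = {}"

definition Lst :: "nat \<Rightarrow> (nat \<times> nat) list set" where "Lst s = llists ({..<n} \<times> {..<n}) s"

text \<open>With \<open>ind \<sigma>\<close> this is the part of \<open>P^s\<close> carried by
  simple paths that avoid \<open>E\<close>; with \<open>cen \<sigma>\<close> it is the centred
  version whose norm is estimated by moments.\<close>

definition Simp :: "(nat \<times> nat \<Rightarrow> real) \<Rightarrow> nat \<Rightarrow> fmat" where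
 "Simp f s x z = (\<Sum>es\<in>{es\<in>Lst s. st es z = x \<and> good es z}. wt f es z)"

abbreviation cen :: "(nat \<Rightarrow> nat) \<Rightarrow> nat \<times> nat \<Rightarrow> real" where "cen \<sigma> \<equiv> (\<lambda>p. ind \<sigma> p - 1 / n)"

text \<open>Only the entries of \<open>Q\<close> between consecutive positions. The last entry,
  which leads to \<open>z\<close>, is kept apart because in the trace the point \<open>z\<close> is
  common to two paths and is summed out.\<close>

fun lw :: "(nat \<times> nat) list \<Rightarrow> real" where
 "lw [] = 1" |
 "lw [p] = 1" |
 "lw (p # q # es) = Q (snd q) (fst p) * lw (q # es)"

lemma finite_Lst [simp]: "finite (Lst s)" unfolding Lst_def by simp

lemma wt_split: "es \<noteq> [] \<Longrightarrow> wt f es z = lw es * Q (snd (hd es)) z * prod_list (map f es)"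
proof (induction es arbitrary: z rule: lw.induct)
 case (3 p q es)
 have IH: "wt f (q # es) (fst p) = lw (q # es) * Q (snd (hd (q # es))) (fst p) * prod_list (map f (q # es))"
  by (rule 3) simp
 show ?case unfolding wt.simps(2)[of f p] IH by (simp add: mult_ac)
qed simp_all

lemma st_eq: "es \<noteq> [] \<Longrightarrow> st es z = fst (last es)"
 by (induction es arbitrary: z) auto

lemma lw_nonneg: "0 \<le> lw es"
 by (induction es rule: lw.induct) (auto simp: Q_nonneg)

lemma lw_prod: "lw es = (\<Prod>i<length es - 1. Q (snd (es ! Suc i)) (fst (es ! i)))"
proof (induction es rule: lw.induct)
 case (3 p q es)
 have "(\<Prod>i<Suc (length es). Q (snd ((p # q # es) ! Suc i)) (fst ((p # q # es) ! i)))
  = Q (snd q) (fst p) * (\<Prod>i<length es. Q (snd ((p # q # es) ! Suc (Suc i))) (fst ((p # q # es) ! Suc i)))"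
  by (subst prod.lessThan_Suc_shift) simp
 then show ?case using 3 by simp
qed simp_all

section \<open>Expansion of the trace\<close>

definition av :: "(nat \<times> nat) list \<Rightarrow> nat \<Rightarrow> real" where
 "av es z = (if good es z then lw es * Q (snd (hd es)) z else 0)"

text \<open>The coefficient of a list of pairs in a power of the Gram matrix. The two paths of a
  pair have a common start, and neighbouring pairs meet in a common end \<open>w\<close>. Summing
  over \<open>w\<close> here leaves the matrix positions as the only summation variables.\<close>

fun cf :: "nat \<Rightarrow> ((nat \<times> nat) list \<times> (nat \<times> nat) list) list \<Rightarrow> nat \<Rightarrow> real" where
 "cf z [] z' = (if z = z' then 1 else 0)" |
 "cf z (p # pp) z' = (if fst (last (fst p)) = fst (last (snd p)) then
   av (fst p) z * (\<Sum>w<n. av (snd p) w * cf w pp z') else 0)"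

definition pl2 :: "(nat \<times> nat \<Rightarrow> real) \<Rightarrow> ((nat \<times> nat) list \<times> (nat \<times> nat) list) list \<Rightarrow> real" where
 "pl2 f pp = prod_list (map (\<lambda>p. prod_list (map f (fst p)) * prod_list (map f (snd p))) pp)"

lemma Lst_last:
 assumes "es \<in> Lst s" "0 < s"
 shows "fst (last es) < n \<and> es \<noteq> []"
proof -
 have ne: "es \<noteq> []" and sub: "set es \<subseteq> {..<n} \<times> {..<n}" using assms unfolding Lst_def llists_def by auto
 have "last es \<in> {..<n} \<times> {..<n}" using last_in_set[OF ne] sub by blast
 then show ?thesis using ne by (simp add: mem_Times_iff)
qed

lemma Simp_av:
 assumes "0 < s"
 shows "Simp f s x z = (\<Sum>es\<in>Lst s. if fst (last es) = x then av es z * prod_list (map f es) else 0)"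
proof -
 have "Simp f s x z = (\<Sum>es\<in>Lst s. if st es z = x \<and> good es z then wt f es z else 0)"
  unfolding Simp_def by (rule sum.inter_filter) simp
 also have "\<dots> = (\<Sum>es\<in>Lst s. if fst (last es) = x then av es z * prod_list (map f es) else 0)"
 proof (rule sum.cong[OF refl])
  fix es assume "es \<in> Lst s"
  then have "es \<noteq> []" using Lst_last assms by blast
  then show "(if st es z = x \<and> good es z then wt f es z else 0) = (if fst (last es) = x then av es z * prod_list (map f es) else 0)"
   using wt_split[of es f z] st_eq[of es z] unfolding av_def by auto
 qed
 finally show ?thesis .
qed

lemma gram_Simp:
 assumes s: "0 < s"
 shows "gram n (Simp f s) z w = (\<Sum>p\<in>Lst s \<times> Lst s.
  (if fst (last (fst p)) = fst (last (snd p)) then av (fst p) z * av (snd p) w else 0) * (prod_list (map f (fst p)) * prod_list (map f (snd p))))"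
proof -
 let ?m = "\<lambda>es. prod_list (map f es)"
 have "gram n (Simp f s) z w = (\<Sum>x<n. \<Sum>p\<in>Lst s \<times> Lst s. (if fst (last (fst p)) = x then av (fst p) z * ?m (fst p) else 0) * (if fst (last (snd p)) = x then av (snd p) w * ?m (snd p) else 0))"
  unfolding gram_def mm_def tm_def Simp_av[OF s] sum_product sum.cartesian_product by (simp add: split_beta)
 also have "\<dots> = (\<Sum>p\<in>Lst s \<times> Lst s. \<Sum>x<n. (if fst (last (fst p)) = x then av (fst p) z * ?m (fst p) else 0) * (if fst (last (snd p)) = x then av (snd p) w * ?m (snd p) else 0))"
  by (rule sum.swap)
 also have "\<dots> = (\<Sum>p\<in>Lst s \<times> Lst s. (if fst (last (fst p)) = fst (last (snd p)) then av (fst p) z * av (snd p) w else 0) * (?m (fst p) * ?m (snd p)))"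
 proof (rule sum.cong[OF refl])
  fix p assume p: "p \<in> Lst s \<times> Lst s"
  let ?x = "fst (last (fst p))"
  have x: "?x < n" using p Lst_last s by auto
  have "(\<Sum>x<n. (if ?x = x then av (fst p) z * ?m (fst p) else 0) * (if fst (last (snd p)) = x then av (snd p) w * ?m (snd p) else 0))
   = (\<Sum>x<n. if ?x = x then av (fst p) z * ?m (fst p) * (if fst (last (snd p)) = x then av (snd p) w * ?m (snd p) else 0) else 0)"
   by (intro sum.cong) auto
  also have "\<dots> = av (fst p) z * ?m (fst p) * (if fst (last (snd p)) = ?x then av (snd p) w * ?m (snd p) else 0)"
   using x by (simp add: sum.delta)
  finally show "(\<Sum>x<n. (if ?x = x then av (fst p) z * ?m (fst p) else 0) * (if fst (last (snd p)) = x then av (snd p) w * ?m (snd p) else 0))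
   = (if ?x = fst (last (snd p)) then av (fst p) z * av (snd p) w else 0) * (?m (fst p) * ?m (snd p))" by auto
 qed
 finally show ?thesis .
qed

lemma mpw_expand:
 assumes s: "0 < s"
 shows "z < n \<Longrightarrow> z' < n \<Longrightarrow> mpw n (gram n (Simp f s)) m z z' = (\<Sum>pp\<in>llists (Lst s \<times> Lst s) m. cf z pp z' * pl2 f pp)"
proof (induction m arbitrary: z)
 case 0
 then show ?case by (simp add: idm_def pl2_def)
next
 case (Suc m)
 let ?A = "Lst s \<times> Lst s"
 let ?m = "\<lambda>p. prod_list (map f (fst p)) * prod_list (map f (snd p))"
 let ?g = "\<lambda>p w. if fst (last (fst p)) = fst (last (snd p)) then av (fst p) z * av (snd p) w else 0"
 have "mpw n (gram n (Simp f s)) (Suc m) z z' = (\<Sum>w<n. gram n (Simp f s) z w * mpw n (gram n (Simp f s)) m w z')"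
  by (simp add: mm_def)
 also have "\<dots> = (\<Sum>w<n. (\<Sum>p\<in>?A. ?g p w * ?m p) * (\<Sum>pp\<in>llists ?A m. cf w pp z' * pl2 f pp))"
 proof (rule sum.cong[OF refl])
  fix w assume "w \<in> {..<n}"
  then have "mpw n (gram n (Simp f s)) m w z' = (\<Sum>pp\<in>llists ?A m. cf w pp z' * pl2 f pp)" using Suc by simp
  then show "gram n (Simp f s) z w * mpw n (gram n (Simp f s)) m w z'
   = (\<Sum>p\<in>?A. ?g p w * ?m p) * (\<Sum>pp\<in>llists ?A m. cf w pp z' * pl2 f pp)"
   by (simp only: gram_Simp[OF s, of f z w])
 qed
 also have "\<dots> = (\<Sum>w<n. \<Sum>p\<in>?A. \<Sum>pp\<in>llists ?A m. (?g p w * ?m p) * (cf w pp z' * pl2 f pp))"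
  by (simp only: sum_product)
 also have "\<dots> = (\<Sum>p\<in>?A. \<Sum>w<n. \<Sum>pp\<in>llists ?A m. (?g p w * ?m p) * (cf w pp z' * pl2 f pp))"
  by (rule sum.swap)
 also have "\<dots> = (\<Sum>p\<in>?A. \<Sum>pp\<in>llists ?A m. \<Sum>w<n. (?g p w * ?m p) * (cf w pp z' * pl2 f pp))"
  by (intro sum.cong refl sum.swap)
 also have "\<dots> = (\<Sum>p\<in>?A. \<Sum>pp\<in>llists ?A m. cf z (p # pp) z' * pl2 f (p # pp))"
 proof (intro sum.cong refl)
  fix p pp
  have "(\<Sum>w<n. (?g p w * ?m p) * (cf w pp z' * pl2 f pp)) = (\<Sum>w<n. ?g p w * cf w pp z') * (?m p * pl2 f pp)"
   unfolding sum_distrib_right by (intro sum.cong refl) (simp only: mult_ac)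
  also have "(\<Sum>w<n. ?g p w * cf w pp z') = cf z (p # pp) z'"
   by (simp add: sum_distrib_left mult_ac)
  finally show "(\<Sum>w<n. (?g p w * ?m p) * (cf w pp z' * pl2 f pp)) = cf z (p # pp) z' * pl2 f (p # pp)"
   by (simp add: pl2_def)
 qed
 finally show ?case by (simp add: sum_llists_Suc)
qed

definition padm :: "(nat \<times> nat) list \<Rightarrow> bool" where
 "padm es \<longleftrightarrow> distinct (map fst es) \<and> distinct (map snd es) \<and> fst ` set es \<inter> E = {} \<and> lw es \<noteq> 0"

definition near :: "(nat \<times> nat) list \<Rightarrow> (nat \<times> nat) list \<Rightarrow> bool" where
 "near p q \<longleftrightarrow> (\<exists>w. Q (snd (hd p)) w \<noteq> 0 \<and> Q (snd (hd q)) w \<noteq> 0)"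

fun adm :: "((nat \<times> nat) list \<times> (nat \<times> nat) list) list \<Rightarrow> bool" where
 "adm [] \<longleftrightarrow> True" |
 "adm [p] \<longleftrightarrow> padm (fst p) \<and> padm (snd p) \<and> fst (last (fst p)) = fst (last (snd p))" |
 "adm (p # q # pp) \<longleftrightarrow> padm (fst p) \<and> padm (snd p) \<and> fst (last (fst p)) = fst (last (snd p)) \<and>
   near (snd p) (fst q) \<and> adm (q # pp)"

definition lws :: "((nat \<times> nat) list \<times> (nat \<times> nat) list) list \<Rightarrow> real" where
 "lws pp = prod_list (map (\<lambda>p. lw (fst p) * lw (snd p)) pp)"

lemma lws_nonneg: "0 \<le> lws pp" unfolding lws_def by (intro prod_list_nonneg) (auto simp: lw_nonneg)

lemma av_bounds: "0 \<le> av es z" "av es z \<le> lw es * Q (snd (hd es)) z" "av es z \<noteq> 0 \<Longrightarrow> padm es \<and> Q (snd (hd es)) z \<noteq> 0"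
proof -
 show "0 \<le> av es z" "av es z \<le> lw es * Q (snd (hd es)) z"
  unfolding av_def using lw_nonneg Q_nonneg by simp_all
 assume "av es z \<noteq> 0"
 then have "good es z" "lw es \<noteq> 0" "Q (snd (hd es)) z \<noteq> 0" unfolding av_def by (auto split: if_splits)
 then show "padm es \<and> Q (snd (hd es)) z \<noteq> 0" unfolding padm_def good_def by auto
qed

lemma cf_nonneg: "0 \<le> cf z pp z'"
 by (induction pp arbitrary: z) (auto intro!: mult_nonneg_nonneg sum_nonneg av_bounds)

text \<open>Of the two entries of \<open>Q\<close> at a common end \<open>w\<close>, one is bounded
  by 1 and the other is summed over its row. A nonzero coefficient still remembers, through
  \<open>near\<close>, that a common end exists.\<close>

lemma cf_bounds: "pp \<noteq> [] \<Longrightarrow> z' < n \<Longrightarrow> cf z pp z' \<le> Q (snd (hd (fst (hd pp)))) z * lws pp \<and>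
  (cf z pp z' \<noteq> 0 \<longrightarrow> adm pp \<and> Q (snd (hd (fst (hd pp)))) z \<noteq> 0)"
proof (induction pp arbitrary: z rule: adm.induct)
 case (2 p)
 have "cf z [p] z' = (if fst (last (fst p)) = fst (last (snd p)) then av (fst p) z * av (snd p) z' else 0)"
  using 2 by (simp add: if_distrib[of "\<lambda>x. _ * x"] cong: if_cong)
 moreover have "av (fst p) z * av (snd p) z' \<le> (lw (fst p) * Q (snd (hd (fst p))) z) * (lw (snd p) * 1)"
 proof (intro mult_mono av_bounds)
  show "av (snd p) z' \<le> lw (snd p) * 1"
   using av_bounds(2)[of "snd p" z'] mult_left_mono[OF Q_le1[of "snd (hd (snd p))" z'] lw_nonneg[of "snd p"]] by simp
 qed (use lw_nonneg Q_nonneg in auto)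
 ultimately show ?case using av_bounds(3)[of "fst p" z] av_bounds(3)[of "snd p" z'] lw_nonneg Q_nonneg
  by (auto simp: lws_def mult_ac)
next
 case (3 p q pp)
 let ?S = "\<Sum>w<n. av (snd p) w * cf w (q # pp) z'"
 have IH: "cf w (q # pp) z' \<le> Q (snd (hd (fst q))) w * lws (q # pp)"
  "cf w (q # pp) z' \<noteq> 0 \<Longrightarrow> adm (q # pp) \<and> Q (snd (hd (fst q))) w \<noteq> 0" for w
  using 3 by auto
 have S: "?S \<le> lw (snd p) * lws (q # pp)"
 proof -
  have "?S \<le> (\<Sum>w<n. (lw (snd p) * Q (snd (hd (snd p))) w) * (1 * lws (q # pp)))"
  proof (intro sum_mono mult_mono av_bounds)
   fix w
   have "Q (snd (hd (fst q))) w * lws (q # pp) \<le> 1 * lws (q # pp)"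
    using Q_le1 lws_nonneg by (rule mult_right_mono)
   then show "cf w (q # pp) z' \<le> 1 * lws (q # pp)" using IH(1)[of w] by simp
  qed (use lw_nonneg Q_nonneg cf_nonneg[of _ "q # pp" z'] in \<open>simp_all del: cf.simps\<close>)
  also have "\<dots> = lw (snd p) * lws (q # pp) * (\<Sum>w<n. Q (snd (hd (snd p))) w)"
   by (simp add: sum_distrib_left sum_distrib_right mult_ac)
  also have "\<dots> \<le> lw (snd p) * lws (q # pp) * 1"
   using row_le lw_nonneg lws_nonneg by (intro mult_left_mono) auto
  finally show ?thesis by simp
 qed
 have S0: "0 \<le> ?S" by (intro sum_nonneg mult_nonneg_nonneg av_bounds cf_nonneg)
 have "av (fst p) z * ?S \<le> (lw (fst p) * Q (snd (hd (fst p))) z) * (lw (snd p) * lws (q # pp))"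
  by (intro mult_mono av_bounds S S0) (use lw_nonneg Q_nonneg in auto)
 then have a: "cf z (p # q # pp) z' \<le> Q (snd (hd (fst p))) z * lws (p # q # pp)"
  using lw_nonneg Q_nonneg lws_nonneg by (auto simp: lws_def mult_ac)
 have b: "adm (p # q # pp) \<and> Q (snd (hd (fst p))) z \<noteq> 0" if nz: "cf z (p # q # pp) z' \<noteq> 0"
 proof -
  have h: "fst (last (fst p)) = fst (last (snd p))" "av (fst p) z \<noteq> 0" "?S \<noteq> 0"
   using nz by (auto split: if_splits)
  then obtain w where w: "av (snd p) w \<noteq> 0" "cf w (q # pp) z' \<noteq> 0"
   by (metis (no_types, lifting) mult_eq_0_iff sum.neutral)
  have nr: "near (snd p) (fst q)" using av_bounds(3)[OF w(1)] IH(2)[OF w(2)] unfolding near_def by blast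
  show ?thesis using h(1) av_bounds(3)[OF h(2)] av_bounds(3)[OF w(1)] IH(2)[OF w(2)] nr
   unfolding adm.simps by blast
 qed
 show ?case using a b by (simp only: list.sel) blast
qed simp

lemma cf_trace:
 assumes "pp \<noteq> []"
 shows "(\<Sum>z<n. cf z pp z) \<le> lws pp" "(\<Sum>z<n. cf z pp z) \<noteq> 0 \<Longrightarrow> adm pp"
proof -
 have "(\<Sum>z<n. cf z pp z) \<le> (\<Sum>z<n. Q (snd (hd (fst (hd pp)))) z * lws pp)"
  using cf_bounds[OF assms] by (intro sum_mono) auto
 also have "\<dots> = (\<Sum>z<n. Q (snd (hd (fst (hd pp)))) z) * lws pp" by (simp add: sum_distrib_right)
 also have "\<dots> \<le> 1 * lws pp" using row_le lws_nonneg by (rule mult_right_mono)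
 finally show "(\<Sum>z<n. cf z pp z) \<le> lws pp" by simp
 assume "(\<Sum>z<n. cf z pp z) \<noteq> 0"
 then obtain z where "z < n" "cf z pp z \<noteq> 0" by (metis (no_types, lifting) lessThan_iff sum.neutral)
 then show "adm pp" using cf_bounds[OF assms, of z z] by simp
qed

lemma adm_nth:
 "adm pp \<Longrightarrow> k < length pp \<Longrightarrow> padm (fst (pp ! k)) \<and> padm (snd (pp ! k)) \<and>
  fst (last (fst (pp ! k))) = fst (last (snd (pp ! k))) \<and>
  (Suc k < length pp \<longrightarrow> near (snd (pp ! k)) (fst (pp ! Suc k)))"
proof (induction pp arbitrary: k rule: adm.induct)
 case (3 p q pp)
 then show ?case by (cases k) auto
qed auto

text \<open>The possible relations of labels across a link: inside a piece an entry of
  \<open>Q\<close> joins them; at the common start of a pair they are equal first coordinates; at a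
  summed-out end they are two rows of \<open>Q\<close> with a common column in their
  supports.\<close>

definition adjl :: "bool \<times> nat \<Rightarrow> bool \<times> nat \<Rightarrow> bool" where
 "adjl u v \<longleftrightarrow> (if fst u then (if fst v then \<exists>w. Q (snd u) w \<noteq> 0 \<and> Q (snd v) w \<noteq> 0 else Q (snd u) (snd v) \<noteq> 0)
  else (if fst v then Q (snd v) (snd u) \<noteq> 0 else snd u = snd v))"

lemma adjl_sym: "adjl u v \<Longrightarrow> adjl v u" unfolding adjl_def by (auto split: if_splits)

lemma adjl_card: "finite {v. adjl u v}" "card {v. adjl u v} \<le> d + d * d"
proof -
 define N where "N = (if fst u then Pair False ` {x. Q (snd u) x \<noteq> 0} \<union> Pair True ` (\<Union>w\<in>{x. Q (snd u) x \<noteq> 0}. {y. Q y w \<noteq> 0})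
  else Pair True ` {y. Q y (snd u) \<noteq> 0} \<union> {(False, snd u)})"
 have sub: "{v. adjl u v} \<subseteq> N"
 proof
  fix v assume "v \<in> {v. adjl u v}"
  then show "v \<in> N" unfolding N_def adjl_def by (cases v) (auto split: if_splits)
 qed
 have fin: "finite N" unfolding N_def using fin_row fin_col by auto
 show "finite {v. adjl u v}" by (rule finite_subset[OF sub fin])
 have "card N \<le> d + d * d"
 proof (cases "fst u")
  case True
  let ?R = "{x. Q (snd u) x \<noteq> 0}"
  have "card (\<Union>w\<in>?R. {y. Q y w \<noteq> 0}) \<le> (\<Sum>w\<in>?R. card {y. Q y w \<noteq> 0})" by (rule card_UN_le[OF fin_row])
  also have "\<dots> \<le> (\<Sum>w\<in>?R. d)" using scol by (intro sum_mono) auto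
  also have "\<dots> \<le> d * d" using srow by simp
  finally have a: "card (Pair True ` (\<Union>w\<in>?R. {y. Q y w \<noteq> 0})) \<le> d * d"
   by (subst card_image) (auto simp: inj_on_def)
  have b: "card (Pair False ` ?R) \<le> d" using srow by (subst card_image) (auto simp: inj_on_def)
  have "N = Pair False ` ?R \<union> Pair True ` (\<Union>w\<in>?R. {y. Q y w \<noteq> 0})" using True unfolding N_def by simp
  then have "card N \<le> card (Pair False ` ?R) + card (Pair True ` (\<Union>w\<in>?R. {y. Q y w \<noteq> 0}))" using card_Un_le by metis
  then show ?thesis using a b by simp
 next
  case False
  have b: "card (Pair True ` {y. Q y (snd u) \<noteq> 0}) \<le> d" using scol by (subst card_image) (auto simp: inj_on_def)
  have "N = Pair True ` {y. Q y (snd u) \<noteq> 0} \<union> {(False, snd u)}" using False unfolding N_def by simp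
  then have "card N \<le> card (Pair True ` {y. Q y (snd u) \<noteq> 0}) + card {(False, snd u)}" using card_Un_le by metis
  then have "card N \<le> d + 1" using b by simp
  moreover have "1 \<le> d * d" using d2 by simp
  ultimately show ?thesis by (meson add_le_mono le_refl order_trans)
 qed
 then show "card {v. adjl u v} \<le> d + d * d" using card_mono[OF fin sub] by simp
qed

text \<open>Paths are stored from their end to their start. Reversing the second path of every pair
  therefore turns the list of pairs into one closed walk whose pieces alternate in direction, as
  \<open>walk.lab\<close> expects.\<close>

definition pcs :: "((nat \<times> nat) list \<times> (nat \<times> nat) list) list \<Rightarrow> (nat \<times> nat) list list" where
 "pcs pp = concat (map (\<lambda>p. [fst p, rev (snd p)]) pp)"

definition flat :: "((nat \<times> nat) list \<times> (nat \<times> nat) list) list \<Rightarrow> (nat \<times> nat) list" where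
 "flat pp = concat (pcs pp)"

lemma pcs_nth: "k < length pp \<Longrightarrow> pcs pp ! (2 * k) = fst (pp ! k)" "k < length pp \<Longrightarrow> pcs pp ! (2 * k + 1) = rev (snd (pp ! k))"
proof -
 assume k: "k < length pp"
 have "pcs pp ! (k * 2 + i) = map (\<lambda>p. [fst p, rev (snd p)]) pp ! k ! i" if "i < 2" for i
  unfolding pcs_def by (rule nth_concat_uniform) (use k that in auto)
 from this[of 0] this[of 1] k show "pcs pp ! (2 * k) = fst (pp ! k)" "pcs pp ! (2 * k + 1) = rev (snd (pp ! k))"
  by (auto simp: mult.commute)
qed

lemma pcs_length: "length (pcs pp) = 2 * length pp"
 unfolding pcs_def by (subst length_concat_uniform[of _ 2]) auto

lemma pcs_elem: "pp \<in> llists (Lst s \<times> Lst s) m \<Longrightarrow> x \<in> set (pcs pp) \<Longrightarrow> length x = s \<and> set x \<subseteq> {..<n} \<times> {..<n}"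
 unfolding pcs_def Lst_def llists_def by fastforce

lemma flat_nth: "pp \<in> llists (Lst s \<times> Lst s) m \<Longrightarrow> j < 2 * m \<Longrightarrow> i < s \<Longrightarrow> flat pp ! (j * s + i) = pcs pp ! j ! i"
 unfolding flat_def
 by (rule nth_concat_uniform) (use pcs_elem pcs_length in \<open>auto simp: llists_def\<close>)

lemma flat_length: "pp \<in> llists (Lst s \<times> Lst s) m \<Longrightarrow> length (flat pp) = 2 * m * s"
 unfolding flat_def
 by (subst length_concat_uniform[of _ s]) (use pcs_elem pcs_length in \<open>auto simp: llists_def\<close>)

lemma pl2_flat: "pl2 f pp = prod_list (map f (flat pp))"
 unfolding pl2_def flat_def pcs_def
 by (induction pp) (auto simp: prod_list.rev rev_map[symmetric] mult.assoc)

end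

section \<open>Moments of the centred simple paths\<close>

context sparse
begin

definition Gam :: "nat \<Rightarrow> nat \<Rightarrow> ((nat \<times> nat) list \<times> (nat \<times> nat) list) list set" where
 "Gam s m = {pp\<in>llists (Lst s \<times> Lst s) m. adm pp}"

lemma block_index:
 fixes t b s :: nat
 assumes "t < b * s" "0 < s"
 obtains j i where "t = j * s + i" "j < b" "i < s" "t div s = j" "t mod s = i"
proof -
 have 1: "t = t div s * s + t mod s" by (simp only: div_mult_mod_eq)
 have 2: "t div s < b" using assms(1) by (rule less_mult_imp_div_less)
 have 3: "t mod s < s" using assms(2) by (rule mod_less_divisor)
 show thesis by (rule that[OF 1 2 3 refl refl])
qed

lemma pcs_padm:
 assumes "pp \<in> Gam s m" "j < 2 * m"
 shows "length (pcs pp ! j) = s" "distinct (map fst (pcs pp ! j))" "distinct (map snd (pcs pp ! j))"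
  "fst ` set (pcs pp ! j) \<inter> E = {}" "even j \<Longrightarrow> pcs pp ! j = fst (pp ! (j div 2))" "odd j \<Longrightarrow> pcs pp ! j = rev (snd (pp ! (j div 2)))"
proof -
 have pp: "pp \<in> llists (Lst s \<times> Lst s) m" "adm pp" "length pp = m" using assms unfolding Gam_def llists_def by auto
 have k: "j div 2 < length pp" using assms(2) pp(3) by auto
 show ev: "even j \<Longrightarrow> pcs pp ! j = fst (pp ! (j div 2))" using pcs_nth(1)[OF k] by simp
 show od: "odd j \<Longrightarrow> pcs pp ! j = rev (snd (pp ! (j div 2)))" using pcs_nth(2)[OF k] by simp
 have "pcs pp ! j \<in> set (pcs pp)" using pcs_length[of pp] pp assms(2) by (intro nth_mem) auto
 then show "length (pcs pp ! j) = s" using pcs_elem[OF pp(1)] by blast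
 have ad: "padm (fst (pp ! (j div 2)))" "padm (snd (pp ! (j div 2)))" using adm_nth[OF pp(2) k] by auto
 show "distinct (map fst (pcs pp ! j))" "distinct (map snd (pcs pp ! j))" "fst ` set (pcs pp ! j) \<inter> E = {}"
  using ev od ad unfolding padm_def by (cases "even j"; auto simp: rev_map[symmetric])+
qed

lemma prod_list_nth: "prod_list (map f xs) = (\<Prod>i<length xs. f (xs ! i))" for f :: "'b \<Rightarrow> real"
 by (induction xs) (simp_all add: prod.lessThan_Suc_shift del: prod.lessThan_Suc)

context
 fixes s m :: nat
 assumes s: "0 < s" and m: "0 < m"
begin

lemma Gam_walk: "pp \<in> Gam s m \<Longrightarrow> walk (2 * m * s) s (2 * m) (\<lambda>t. flat pp ! t)"
proof (unfold_locales)
 assume pp: "pp \<in> Gam s m"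
 then have pl: "pp \<in> llists (Lst s \<times> Lst s) m" unfolding Gam_def by auto
 fix t u assume h: "t < 2 * m * s" "u < 2 * m * s" "t div s = u div s" "t \<noteq> u"
 obtain j i where t: "t = j * s + i" "j < 2 * m" "i < s" "t div s = j" using block_index[OF h(1) s] by metis
 obtain j' i' where u: "u = j' * s + i'" "j' < 2 * m" "i' < s" "u div s = j'" using block_index[OF h(2) s] by metis
 have j: "j' = j" "i \<noteq> i'" using t u h by auto
 have "flat pp ! t = pcs pp ! j ! i" "flat pp ! u = pcs pp ! j ! i'"
  using flat_nth[OF pl] t u j by auto
 moreover have "map fst (pcs pp ! j) ! i \<noteq> map fst (pcs pp ! j) ! i'" "map snd (pcs pp ! j) ! i \<noteq> map snd (pcs pp ! j) ! i'"
  using pcs_padm(1-3)[OF pp t(2)] t(3) u(3) j(2) by (simp_all only: nth_eq_iff_index_eq length_map) simp_all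
 ultimately show "fst (flat pp ! t) \<noteq> fst (flat pp ! u) \<and> snd (flat pp ! t) \<noteq> snd (flat pp ! u)"
  using pcs_padm(1)[OF pp t(2)] t(3) u(3) by simp
qed (use s in auto)

lemma Gam_rng:
 assumes "pp \<in> Gam s m" "t < 2 * m * s"
 shows "fst (flat pp ! t) < n \<and> snd (flat pp ! t) < n"
proof -
 have pl: "pp \<in> llists (Lst s \<times> Lst s) m" using assms unfolding Gam_def by auto
 have "flat pp ! t \<in> set (flat pp)" using assms flat_length[OF pl] by (intro nth_mem) simp
 moreover have "set (flat pp) \<subseteq> {..<n} \<times> {..<n}" using pcs_elem[OF pl] unfolding flat_def by auto
 ultimately have "flat pp ! t \<in> {..<n} \<times> {..<n}" by blast
 then show ?thesis by (simp add: mem_Times_iff)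
qed

lemma Gam_inner:
 assumes pp: "pp \<in> Gam s m" and j: "j < 2 * m" and i: "Suc i < s"
 defines "t \<equiv> j * s + i"
 shows "qlab Q (walk.lab s (\<lambda>t. flat pp ! t) (2 * t + 1)) (walk.lab s (\<lambda>t. flat pp ! t) (2 * t + 2))
  = (if even j then Q (snd (pcs pp ! j ! Suc i)) (fst (pcs pp ! j ! i)) else Q (snd (pcs pp ! j ! i)) (fst (pcs pp ! j ! Suc i)))"
  "fst (walk.lab s (\<lambda>t. flat pp ! t) (2 * t + 1)) \<noteq> fst (walk.lab s (\<lambda>t. flat pp ! t) (2 * t + 2))"
proof -
 interpret W: walk "2 * m * s" s "2 * m" "\<lambda>t. flat pp ! t" by (rule Gam_walk[OF pp])
 have pl: "pp \<in> llists (Lst s \<times> Lst s) m" using pp unfolding Gam_def by auto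
 have f: "flat pp ! t = pcs pp ! j ! i" "flat pp ! Suc t = pcs pp ! j ! Suc i"
  using flat_nth[OF pl j, of i] flat_nth[OF pl j, of "Suc i"] i unfolding t_def by auto
 have dv: "t div s = j" "Suc t div s = j" unfolding t_def using i by (auto intro!: div_nat_eqI simp: algebra_simps)
 have l1: "W.lab (2 * t + 1) = (if even j then (False, fst (pcs pp ! j ! i)) else (True, snd (pcs pp ! j ! i)))"
  unfolding W.lab_odd dv f by simp
 have l2: "W.lab (2 * t + 2) = (if even j then (True, snd (pcs pp ! j ! Suc i)) else (False, fst (pcs pp ! j ! Suc i)))"
  using W.lab_even[of "Suc t"] unfolding dv f by simp
 show "qlab Q (W.lab (2 * t + 1)) (W.lab (2 * t + 2))
  = (if even j then Q (snd (pcs pp ! j ! Suc i)) (fst (pcs pp ! j ! i)) else Q (snd (pcs pp ! j ! i)) (fst (pcs pp ! j ! Suc i)))"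
  "fst (W.lab (2 * t + 1)) \<noteq> fst (W.lab (2 * t + 2))"
  unfolding l1 l2 qlab_def by auto
qed

lemma lw_piece:
 assumes pp: "pp \<in> Gam s m" and j: "j < 2 * m"
 shows "(\<Prod>i<s - 1. (if even j then Q (snd (pcs pp ! j ! Suc i)) (fst (pcs pp ! j ! i)) else Q (snd (pcs pp ! j ! i)) (fst (pcs pp ! j ! Suc i))))
  = (if even j then lw (fst (pp ! (j div 2))) else lw (snd (pp ! (j div 2))))"
proof (cases "even j")
 case True
 then show ?thesis using pcs_padm(1,5)[OF pp j] by (simp add: lw_prod)
next
 case False
 let ?p = "snd (pp ! (j div 2))"
 have l: "length ?p = s" "pcs pp ! j = rev ?p" using pcs_padm(1,6)[OF pp j] False by auto
 have "(\<Prod>i<s - 1. Q (snd (rev ?p ! i)) (fst (rev ?p ! Suc i))) = (\<Prod>i<s - 1. Q (snd (?p ! Suc i)) (fst (?p ! i)))"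
 proof (rule prod.reindex_bij_witness[of _ "\<lambda>i. s - 2 - i" "\<lambda>i. s - 2 - i"])
  fix i assume i: "i \<in> {..<s - 1}"
  then show "s - 2 - (s - 2 - i) = i" "s - 2 - i \<in> {..<s - 1}" by auto
  have "rev ?p ! i = ?p ! Suc (s - 2 - i)" "rev ?p ! Suc i = ?p ! (s - 2 - i)"
   using i l by (auto simp: rev_nth Suc_diff_Suc numeral_2_eq_2)
  then show "Q (snd (?p ! Suc (s - 2 - i))) (fst (?p ! (s - 2 - i))) = Q (snd (rev ?p ! i)) (fst (rev ?p ! Suc i))" by simp
 qed auto
 then show ?thesis using False l by (simp add: lw_prod)
qed

lemma lw_factors:
 assumes "lw es \<noteq> 0" "Suc i < length es"
 shows "Q (snd (es ! Suc i)) (fst (es ! i)) \<noteq> 0"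
proof -
 have "(\<Prod>i<length es - 1. Q (snd (es ! Suc i)) (fst (es ! i))) \<noteq> 0" using assms(1) by (simp add: lw_prod)
 moreover have "i < length es - 1" using assms(2) by simp
 ultimately show ?thesis by (metis (no_types, lifting) finite_lessThan lessThan_iff prod_zero)
qed

lemma Gam_family:
 assumes th: "0 \<le> \<theta>" "\<theta> \<le> \<rho>"
 shows "walk_family n (d + d * d) (2 * m * s) s (2 * m) Q \<rho> \<theta> (Gam s m) (\<lambda>pp t. flat pp ! t) adjl"
proof (rule walk_family.intro)
 show "finite (Gam s m)" unfolding Gam_def by auto
 show "walk (2 * m * s) s (2 * m) (\<lambda>t. flat pp ! t)" if "pp \<in> Gam s m" for pp by (rule Gam_walk[OF that])
 show "pp = pp'" if h: "pp \<in> Gam s m" "pp' \<in> Gam s m" "\<And>t. t < 2 * m * s \<Longrightarrow> flat pp ! t = flat pp' ! t" for pp pp'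
 proof (rule nth_equalityI)
  have pl: "pp \<in> llists (Lst s \<times> Lst s) m" "pp' \<in> llists (Lst s \<times> Lst s) m" using h unfolding Gam_def by auto
  then have len: "length pp = m" "length pp' = m" unfolding llists_def by auto
  then show "length pp = length pp'" by simp
  have pe: "pcs pp ! j = pcs pp' ! j" if j: "j < 2 * m" for j
  proof (rule nth_equalityI)
   have L: "length (pcs pp ! j) = s" "length (pcs pp' ! j) = s" using pcs_padm(1)[OF h(1) j] pcs_padm(1)[OF h(2) j] by auto
   then show "length (pcs pp ! j) = length (pcs pp' ! j)" by simp
   fix i assume "i < length (pcs pp ! j)"
   then have i: "i < s" using L by simp
   have "Suc j * s \<le> 2 * m * s" using j by (intro mult_le_mono1) simp
   then have "j * s + i < 2 * m * s" using i by simp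
   then show "pcs pp ! j ! i = pcs pp' ! j ! i" using h(3) flat_nth[OF pl(1) j i] flat_nth[OF pl(2) j i] by simp
  qed
  fix k assume "k < length pp"
  then have k: "k < m" using len by simp
  have "fst (pp ! k) = fst (pp' ! k)" using pe[of "2 * k"] pcs_nth(1)[of k pp] pcs_nth(1)[of k pp'] k len by simp
  moreover have "rev (snd (pp ! k)) = rev (snd (pp' ! k))" using pe[of "2 * k + 1"] pcs_nth(2)[of k pp] pcs_nth(2)[of k pp'] k len by simp
  ultimately show "pp ! k = pp' ! k" by (simp add: prod_eq_iff)
 qed
 show "fst (flat pp ! t) < n \<and> snd (flat pp ! t) < n" if "pp \<in> Gam s m" "t < 2 * m * s" for pp t
  by (rule Gam_rng[OF that])
 show "adjl u v \<Longrightarrow> adjl v u" for u v by (rule adjl_sym)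
 show "finite {v. adjl u v}" "card {v. adjl u v} \<le> d + d * d" for u by (rule adjl_card)+
 have inn: "Q (snd (pcs pp ! j ! Suc i)) (fst (pcs pp ! j ! i)) \<noteq> 0 \<and> fst (pcs pp ! j ! i) \<notin> E" if h: "pp \<in> Gam s m" "j < 2 * m" "Suc i < s" "even j" for pp j i
 proof -
  have "pp \<in> llists (Lst s \<times> Lst s) m" "adm pp" using h unfolding Gam_def by auto
  then have "padm (fst (pp ! (j div 2)))" using adm_nth[of pp "j div 2"] h unfolding llists_def by auto
  then have "lw (pcs pp ! j) \<noteq> 0" using pcs_padm(5)[OF h(1,2,4)] unfolding padm_def by simp
  then have "Q (snd (pcs pp ! j ! Suc i)) (fst (pcs pp ! j ! i)) \<noteq> 0"
   using pcs_padm(1)[OF h(1,2)] h(3) by (intro lw_factors) auto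
  moreover have "fst (pcs pp ! j ! i) \<in> fst ` set (pcs pp ! j)" using pcs_padm(1)[OF h(1,2)] h(3) by auto
  ultimately show ?thesis using pcs_padm(4)[OF h(1,2)] by blast
 qed
 have ino: "Q (snd (pcs pp ! j ! i)) (fst (pcs pp ! j ! Suc i)) \<noteq> 0 \<and> fst (pcs pp ! j ! Suc i) \<notin> E" if h: "pp \<in> Gam s m" "j < 2 * m" "Suc i < s" "odd j" for pp j i
 proof -
  let ?p = "snd (pp ! (j div 2))"
  have "pp \<in> llists (Lst s \<times> Lst s) m" "adm pp" using h unfolding Gam_def by auto
  then have pa: "padm ?p" using adm_nth[of pp "j div 2"] h unfolding llists_def by auto
  have l: "pcs pp ! j = rev ?p" "length ?p = s" using pcs_padm(6)[OF h(1,2,4)] pcs_padm(1)[OF h(1,2)] by auto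
  have r: "rev ?p ! i = ?p ! Suc (s - 2 - i)" "rev ?p ! Suc i = ?p ! (s - 2 - i)"
   using h(3) l by (auto simp: rev_nth Suc_diff_Suc numeral_2_eq_2)
  have "Q (snd (?p ! Suc (s - 2 - i))) (fst (?p ! (s - 2 - i))) \<noteq> 0"
   using pa h(3) l unfolding padm_def by (intro lw_factors) auto
  moreover have "fst (pcs pp ! j ! Suc i) \<in> fst ` set (pcs pp ! j)" using pcs_padm(1)[OF h(1,2)] h(3) by auto
  ultimately show ?thesis using r l pcs_padm(4)[OF h(1,2)] by auto
 qed
 show "qlab Q (walk.lab s (\<lambda>t. flat pp ! t) (2 * t + 1)) (walk.lab s (\<lambda>t. flat pp ! t) (2 * t + 2)) \<le> \<rho>"
  if h: "pp \<in> Gam s m" "t < 2 * m * s" "walk.inter (2 * m * s) s t" for pp t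
 proof -
  interpret W: walk "2 * m * s" s "2 * m" "\<lambda>t. flat pp ! t" by (rule Gam_walk[OF h(1)])
  obtain j i where t: "t = j * s + i" "j < 2 * m" "i < s" "t div s = j" using block_index[OF h(2) s] by metis
  have "Suc t div s = j" using h(3) t unfolding W.inter_def by simp
  have "Suc i < s"
  proof (rule ccontr)
   assume "\<not> Suc i < s"
   then have "Suc t = Suc j * s" using t by simp
   then have "Suc t div s = Suc j" using s by simp
   then show False using \<open>Suc t div s = j\<close> by simp
  qed
  then show ?thesis using Gam_inner(1)[OF h(1) t(2)] inn[OF h(1) t(2)] ino[OF h(1) t(2)] Q_le unfolding t(1) by auto
 qed
 show "adjl (walk.lab s (\<lambda>t. flat pp ! t) (2 * t + 1)) (walk.lab s (\<lambda>t. flat pp ! t) (2 * t + 2))"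
  if h: "pp \<in> Gam s m" "Suc t < 2 * m * s" for pp t
 proof -
  interpret W: walk "2 * m * s" s "2 * m" "\<lambda>t. flat pp ! t" by (rule Gam_walk[OF h(1)])
  have pl: "pp \<in> llists (Lst s \<times> Lst s) m" "adm pp" "length pp = m" using h unfolding Gam_def llists_def by auto
  have "t < 2 * m * s" using h by simp
  from block_index[OF this s] obtain j i where t: "t = j * s + i" "j < 2 * m" "i < s" "t div s = j" by metis
  show ?thesis
  proof (cases "Suc i < s")
   case True
   have "qlab Q (W.lab (2 * t + 1)) (W.lab (2 * t + 2)) \<noteq> 0"
    using Gam_inner(1)[OF h(1) t(2) True] inn[OF h(1) t(2) True] ino[OF h(1) t(2) True] unfolding t(1) by auto
   then show ?thesis using Gam_inner(2)[OF h(1) t(2) True] unfolding t(1) adjl_def qlab_def by auto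
  next
   case False
   then have i: "i = s - 1" "Suc t = Suc j * s + 0" using t by auto
   have j: "Suc j < 2 * m"
   proof (rule ccontr)
    assume "\<not> Suc j < 2 * m"
    then have "2 * m * s \<le> Suc j * s" by (intro mult_le_mono1) simp
    then show False using h(2) i by simp
   qed
   have f: "flat pp ! t = pcs pp ! j ! (s - 1)" "flat pp ! Suc t = pcs pp ! Suc j ! 0"
    using flat_nth[OF pl(1) t(2,3)] t(1) i(1) flat_nth[OF pl(1) j s] unfolding i(2) by simp_all
   have dv: "Suc t div s = Suc j" using i s by simp
   have l1: "W.lab (2 * t + 1) = (if even j then (False, fst (flat pp ! t)) else (True, snd (flat pp ! t)))"
    unfolding W.lab_odd t(4) by simp
   have l2: "W.lab (2 * t + 2) = (if even j then (False, fst (flat pp ! Suc t)) else (True, snd (flat pp ! Suc t)))"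
    using W.lab_even[of "Suc t"] unfolding dv by simp
   have len: "length (pcs pp ! j) = s" "length (pcs pp ! Suc j) = s" using pcs_padm(1)[OF h(1)] t(2) j by auto
   show ?thesis
   \<comment> \<open>A piece with even index ends at the start common to its pair; one with odd
     index ends next to the summed-out point recorded by \<open>near\<close>.\<close>
   proof (cases "even j")
    case True
    then have k: "Suc j div 2 = j div 2" "odd (Suc j)" by auto
    have p: "pcs pp ! j = fst (pp ! (j div 2))" "pcs pp ! Suc j = rev (snd (pp ! (j div 2)))"
     using pcs_padm(5)[OF h(1) t(2) True] pcs_padm(6)[OF h(1) j k(2)] k by auto
    have eq: "fst (last (fst (pp ! (j div 2)))) = fst (last (snd (pp ! (j div 2))))"
     using adm_nth[OF pl(2), of "j div 2"] t(2) pl(3) by auto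
    have "flat pp ! t = last (fst (pp ! (j div 2)))" using f p len s by (metis last_conv_nth length_0_conv not_less_zero)
    moreover have "flat pp ! Suc t = last (snd (pp ! (j div 2)))" using f p len s
     by (metis hd_conv_nth hd_rev length_0_conv not_less_zero)
    ultimately show ?thesis using True eq unfolding l1 l2 adjl_def by simp
   next
    case False
    then have k: "Suc j div 2 = Suc (j div 2)" "even (Suc j)" by (auto elim!: oddE)
    have p: "pcs pp ! j = rev (snd (pp ! (j div 2)))" "pcs pp ! Suc j = fst (pp ! Suc (j div 2))"
     using pcs_padm(6)[OF h(1) t(2) False] pcs_padm(5)[OF h(1) j k(2)] k by auto
    have "Suc j div 2 < m" using j by (intro less_mult_imp_div_less) (simp add: mult.commute)
    then have "Suc (j div 2) < length pp" unfolding k(1) pl(3) .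
    then have nr: "near (snd (pp ! (j div 2))) (fst (pp ! Suc (j div 2)))"
     using adm_nth[OF pl(2), of "j div 2"] by auto
    have "flat pp ! t = hd (snd (pp ! (j div 2)))" using f p len s
     by (metis last_conv_nth last_rev length_0_conv not_less_zero)
    moreover have "flat pp ! Suc t = hd (fst (pp ! Suc (j div 2)))" using f p len s
     by (metis hd_conv_nth length_0_conv not_less_zero)
    ultimately show ?thesis using False nr unfolding l1 l2 adjl_def near_def by auto
   qed
  qed
 qed
 show "(\<Sum>y<n. \<Sum>x<n. Q y x) \<le> real n" using row by simp
 show "0 < 2 * m * s" using s m by simp
 show "0 < d + d * d" using d2 by simp
qed (use Q_nonneg hs rho th n_pos in auto)

text \<open>The closed walks consist of \<open>2 * m\<close> pieces with \<open>s - 1\<close> inner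
  links each. Lists that are not admissible have coefficient 0; for the others the coefficient is at
  most the product of the inner entries, and the centred product is averaged with
  \<open>centred_product_bound\<close>.\<close>

theorem moment_bound:
 assumes T: "T = 2 * m * s" "36 * T\<^sup>2 \<le> n" and th: "6 * real T / sqrt (real n) \<le> \<rho>"
 shows "pavg n (\<lambda>\<sigma>. \<Sum>i<n. mpw n (gram n (Simp (cen \<sigma>) s)) m i i) \<le>
  6 * (\<Sum>g\<le>T. real ((2 * T + 3) ^ (5 * (2 * m * (5 * g + 4)))) *
   (n * (1 / n) ^ g * \<rho> ^ (2 * m * (s - 1)) * (2 * real (d + d * d) / \<rho>) ^ (4 * g + 2 * (2 * m))))"
proof -
 let ?th = "6 * real T / sqrt (real n)"
 interpret F: walk_family n "d + d * d" "2 * m * s" s "2 * m" Q \<rho> ?th "Gam s m" "\<lambda>pp t. flat pp ! t" adjl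
  by (rule Gam_family) (use th in auto)
 let ?L = "llists (Lst s \<times> Lst s) m"
 let ?C = "\<lambda>pp. \<Sum>z<n. cf z pp z"
 have T0: "0 < T" using T s m by simp
 have ne: "pp \<noteq> []" if "pp \<in> ?L" for pp using that m unfolding llists_def by auto
 have tr: "(\<Sum>i<n. mpw n (gram n (Simp (cen \<sigma>) s)) m i i) = (\<Sum>pp\<in>?L. ?C pp * pl2 (cen \<sigma>) pp)" for \<sigma>
 proof -
  have "(\<Sum>i<n. mpw n (gram n (Simp (cen \<sigma>) s)) m i i) = (\<Sum>i<n. \<Sum>pp\<in>?L. cf i pp i * pl2 (cen \<sigma>) pp)"
   using mpw_expand[OF s, of _ _ "cen \<sigma>" m] by (intro sum.cong) auto
  also have "\<dots> = (\<Sum>pp\<in>?L. \<Sum>i<n. cf i pp i * pl2 (cen \<sigma>) pp)" by (rule sum.swap)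
  finally show ?thesis by (simp add: sum_distrib_right)
 qed
 have lk: "F.links = 2 * m * (s - 1)"
 proof -
  have "(\<Prod>t\<in>{t. t < 2 * m * s \<and> walk.inter (2 * m * s) s t}. (2::real)) = (\<Prod>j<2 * m. \<Prod>i<s - 1. 2)"
  proof -
   have "(\<Prod>t\<in>{t. t < 2 * m * s \<and> Suc t < 2 * m * s \<and> Suc t div s = t div s}. (2::real)) = (\<Prod>j<2 * m. \<Prod>i<s - 1. 2)"
    using prod_blocks[OF s, where b = "2 * m" and f = "\<lambda>_. 2"] .
   moreover have "{t. t < 2 * m * s \<and> walk.inter (2 * m * s) s t} = {t. t < 2 * m * s \<and> Suc t < 2 * m * s \<and> Suc t div s = t div s}"
   proof (cases "Gam s m = {}")
    case False
    then obtain pp where "pp \<in> Gam s m" by auto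
    then interpret W: walk "2 * m * s" s "2 * m" "\<lambda>t. flat pp ! t" by (rule Gam_walk)
    show ?thesis unfolding W.inter_def by auto
   next
    case True
    \<comment> \<open>The predicate \<open>inter\<close> depends on \<open>T\<close> and
      \<open>s\<close> alone, so any walk serves when \<open>Gam s m\<close> is empty.\<close>
    interpret W: walk "2 * m * s" s "2 * m" "\<lambda>t. (t, t)" by unfold_locales (use s in auto)
    show ?thesis unfolding W.inter_def by auto
   qed
   ultimately show ?thesis by simp
  qed
  then have "(2::real) ^ F.links = 2 ^ (2 * m * (s - 1))" unfolding F.links_def by (simp add: power_mult[symmetric] mult.commute)
  then show ?thesis by (simp add: power_inject_exp)
 qed
 have lws_eq: "lws pp = (\<Prod>t\<in>{t. t < 2 * m * s \<and> walk.inter (2 * m * s) s t}. F.lnkw pp t)" if pp: "pp \<in> Gam s m" for pp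
 proof -
  interpret W: walk "2 * m * s" s "2 * m" "\<lambda>t. flat pp ! t" by (rule Gam_walk[OF pp])
  have len: "length pp = m" using pp unfolding Gam_def llists_def by auto
  have "{t. t < 2 * m * s \<and> W.inter t} = {t. t < 2 * m * s \<and> Suc t < 2 * m * s \<and> Suc t div s = t div s}"
   unfolding W.inter_def by auto
  then have "(\<Prod>t\<in>{t. t < 2 * m * s \<and> W.inter t}. F.lnkw pp t) = (\<Prod>j<2 * m. \<Prod>i<s - 1. F.lnkw pp (j * s + i))"
   using prod_blocks[OF s, where b = "2 * m"] by simp
  also have "\<dots> = (\<Prod>j<2 * m. if even j then lw (fst (pp ! (j div 2))) else lw (snd (pp ! (j div 2))))"
  proof (rule prod.cong[OF refl])
   fix j assume j: "j \<in> {..<2 * m}"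
   have "(\<Prod>i<s - 1. F.lnkw pp (j * s + i)) = (\<Prod>i<s - 1. (if even j then Q (snd (pcs pp ! j ! Suc i)) (fst (pcs pp ! j ! i)) else Q (snd (pcs pp ! j ! i)) (fst (pcs pp ! j ! Suc i))))"
    unfolding F.lnkw_def using j by (intro prod.cong refl Gam_inner(1)[OF pp]) auto
   then show "(\<Prod>i<s - 1. F.lnkw pp (j * s + i)) = (if even j then lw (fst (pp ! (j div 2))) else lw (snd (pp ! (j div 2))))"
    using lw_piece[OF pp] j by simp
  qed
  also have "\<dots> = (\<Prod>k<m. lw (fst (pp ! k)) * lw (snd (pp ! k)))"
  proof -
   have "(\<Prod>j<2 * k. if even j then lw (fst (pp ! (j div 2))) else lw (snd (pp ! (j div 2)))) = (\<Prod>k<k. lw (fst (pp ! k)) * lw (snd (pp ! k)))" for k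
    by (induction k) (simp_all add: mult.assoc)
   then show ?thesis .
  qed
  also have "\<dots> = lws pp" unfolding lws_def prod_list_nth len ..
  finally show ?thesis by simp
 qed
 have pb: "\<bar>pavg n (\<lambda>\<sigma>. pl2 (cen \<sigma>) pp)\<bar> \<le> 6 * ((1 / n) ^ card ((\<lambda>t. flat pp ! t) ` {..<T}) *
   ?th ^ card (multi1 T (\<lambda>t. flat pp ! t) - shared T (\<lambda>t. flat pp ! t)) * 2 ^ card (multi1 T (\<lambda>t. flat pp ! t) \<inter> shared T (\<lambda>t. flat pp ! t)))"
  if pp: "pp \<in> Gam s m" for pp
 proof -
  have "length (flat pp) = T" using flat_length[of pp s m] pp T unfolding Gam_def by simp
  then have "pl2 (cen \<sigma>) pp = (\<Prod>t<T. (ind \<sigma> (flat pp ! t) - 1 / n))" for \<sigma>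
   unfolding pl2_flat prod_list_nth by simp
  then show ?thesis
   using centred_product_bound[OF _ T0 T(2) refl, of "\<lambda>t. flat pp ! t"] Gam_rng[OF pp] T by simp
 qed
 have "pavg n (\<lambda>\<sigma>. \<Sum>i<n. mpw n (gram n (Simp (cen \<sigma>) s)) m i i) = (\<Sum>pp\<in>?L. ?C pp * pavg n (\<lambda>\<sigma>. pl2 (cen \<sigma>) pp))"
  unfolding tr pavg_sum pavg_cmult ..
 also have "\<dots> = (\<Sum>pp\<in>Gam s m. ?C pp * pavg n (\<lambda>\<sigma>. pl2 (cen \<sigma>) pp))"
 proof (rule sum.mono_neutral_right)
  show "\<forall>pp\<in>?L - Gam s m. ?C pp * pavg n (\<lambda>\<sigma>. pl2 (cen \<sigma>) pp) = 0"
   using cf_trace(2) ne unfolding Gam_def by fastforce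
 qed (auto simp: Gam_def)
 also have "\<dots> \<le> (\<Sum>pp\<in>Gam s m. 6 * F.weight pp)"
 proof (rule sum_mono)
  fix pp assume pp: "pp \<in> Gam s m"
  have "?C pp * pavg n (\<lambda>\<sigma>. pl2 (cen \<sigma>) pp) \<le> ?C pp * \<bar>pavg n (\<lambda>\<sigma>. pl2 (cen \<sigma>) pp)\<bar>"
   by (intro mult_left_mono sum_nonneg cf_nonneg) auto
  also have "\<dots> \<le> lws pp * (6 * ((1 / n) ^ card ((\<lambda>t. flat pp ! t) ` {..<T}) *
   ?th ^ card (multi1 T (\<lambda>t. flat pp ! t) - shared T (\<lambda>t. flat pp ! t)) * 2 ^ card (multi1 T (\<lambda>t. flat pp ! t) \<inter> shared T (\<lambda>t. flat pp ! t))))"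
   using cf_trace(1) ne pp pb[OF pp] lws_nonneg unfolding Gam_def by (intro mult_mono) auto
  also have "\<dots> = 6 * F.weight pp" unfolding F.weight_def lws_eq[OF pp] unfolding T(1) by (simp add: mult_ac)
  finally show "?C pp * pavg n (\<lambda>\<sigma>. pl2 (cen \<sigma>) pp) \<le> 6 * F.weight pp" .
 qed
 also have "\<dots> = 6 * (\<Sum>pp\<in>Gam s m. F.weight pp)" by (simp add: sum_distrib_left)
 also have "\<dots> \<le> 6 * (\<Sum>g\<le>T. real ((2 * T + 3) ^ (5 * (2 * m * (5 * g + 4)))) *
   (n * (1 / n) ^ g * \<rho> ^ (2 * m * (s - 1)) * (2 * real (d + d * d) / \<rho>) ^ (4 * g + 2 * (2 * m))))"
  using F.weight_sum[unfolded lk] unfolding T(1)[symmetric] by (intro mult_left_mono) auto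
 finally show ?thesis .
qed

end

end

section \<open>Cycles and tangles\<close>

locale arcs =
 fixes arc :: "nat \<Rightarrow> nat \<Rightarrow> bool" and L :: nat
begin

definition cycle :: "nat list \<Rightarrow> bool" where
 "cycle cs \<longleftrightarrow> cs \<noteq> [] \<and> length cs \<le> L \<and> distinct cs \<and> successively arc cs \<and> arc (last cs) (hd cs)"

text \<open>A cycle with a second route that leaves it at its first vertex and ends on the cycle or
  on itself. It has one arc more than vertices, which makes it improbable.\<close>

definition tangle :: "nat list \<Rightarrow> nat list \<Rightarrow> nat \<Rightarrow> bool" where
 "tangle cs us z \<longleftrightarrow> cycle cs \<and> us \<noteq> [] \<and> length us \<le> L \<and> distinct (cs @ us) \<and> arc (hd cs) (hd us) \<and>
  successively arc us \<and> arc (last us) z \<and> z \<in> set (cs @ us)"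

lemma successively_map_upt:
 assumes "\<And>k. a \<le> k \<Longrightarrow> Suc k < b \<Longrightarrow> arc (w k) (w (Suc k))"
 shows "successively arc (map w [a..<b])"
 using assms by (auto simp: successively_conv_nth)

lemma cycle_rotate1: "cycle cs \<Longrightarrow> cycle (rotate1 cs)"
proof (cases cs)
 case (Cons x xs)
 assume c: "cycle cs"
 show ?thesis
 proof (cases "xs = []")
  case True then show ?thesis using c Cons by simp
 next
  case False
  have h: "distinct (x # xs)" "successively arc (x # xs)" "arc (last xs) x" "length (x # xs) \<le> L"
   using c False unfolding cycle_def Cons by auto
  have "successively arc xs" "arc x (hd xs)" using h(2) False unfolding successively_Cons by auto
  then have "successively arc (xs @ [x])" using h(3) unfolding successively_append_iff by simp
  then show ?thesis unfolding cycle_def Cons using h False \<open>arc x (hd xs)\<close> by simp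
 qed
qed (simp add: cycle_def)

lemma cycle_rotate: "cycle cs \<Longrightarrow> cycle (rotate k cs)"
 by (induction k) (auto intro: cycle_rotate1)

lemma hd_rotate_nth: "cs \<noteq> [] \<Longrightarrow> hd (rotate k cs) = cs ! (k mod length cs)"
 by (simp add: hd_rotate_conv_nth)

text \<open>A chord yields a shorter cycle through its two ends, and the part of the old cycle that
  is bypassed is the second route. If the chord is a loop at \<open>v\<close>, the cycle is
  \<open>[v]\<close> and the rest of the old cycle leads back to it.\<close>

lemma chord_tangle:
 assumes c: "cycle cs" and z: "z \<in> set cs" "arc (hd cs) z" "z \<noteq> cs ! (1 mod length cs)"
 shows "\<exists>cs us z. tangle cs us z"
proof -
 obtain v rest where cs: "cs = v # rest" using c unfolding cycle_def by (cases cs) auto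
 show ?thesis
 proof (cases "z = v")
  case True
  have ne: "rest \<noteq> []" using z(3) True cs by (cases rest) auto
  have "tangle [v] rest v"
   using c ne True z(2) unfolding tangle_def cycle_def cs by (cases rest) auto
  then show ?thesis by blast
 next
  case False
  then obtain mid tl where r: "rest = mid @ z # tl" using z(1) cs by (auto dest: split_list)
  have ne: "mid \<noteq> []"
  proof
   assume "mid = []"
   then show False using z(3) r cs by simp
  qed
  obtain m mid' where m: "mid = m # mid'" using ne by (cases mid) auto
  have s: "successively arc (v # mid @ z # tl)" "arc (last (z # tl)) v" "distinct (v # mid @ z # tl)" "length (v # mid @ z # tl) \<le> L"
   using c unfolding cycle_def cs r by auto
  have s2: "successively arc mid" "successively arc (z # tl)" "arc (last mid) z" "arc v m"
  proof -
   have "successively arc ((v # mid) @ (z # tl))" using s(1) by simp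
   then have a: "successively arc (v # mid)" "successively arc (z # tl)" "arc (last (v # mid)) z"
    unfolding successively_append_iff by auto
   then show "successively arc mid" "successively arc (z # tl)" "arc (last mid) z" "arc v m"
    using ne m unfolding successively_Cons by auto
  qed
  have "cycle (v # z # tl)" unfolding cycle_def using s s2 z(2) cs by auto
  then have "tangle (v # z # tl) mid z" unfolding tangle_def using s s2 m by auto
  then show ?thesis by blast
 qed
qed

text \<open>At the first deviation the walk must leave the vertex set of the cycle, otherwise there
  is a chord. If it later returned to the cycle or met its own track, the first such time would
  complete a tangle.\<close>

lemma follow:
 assumes nt: "\<nexists>cs us z. tangle cs us z" and c: "cycle cs" and w: "w 0 = hd cs"
  and a: "\<And>k. k < r \<Longrightarrow> arc (w k) (w (Suc k))" and r: "r \<le> L"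
 shows "(\<forall>k\<le>r. w k = cs ! (k mod length cs)) \<or>
  (\<exists>t. 0 < t \<and> t \<le> r \<and> (\<forall>k<t. w k = cs ! (k mod length cs)) \<and> inj_on w {t..r} \<and> w ` {t..r} \<inter> set cs = {})"
proof (cases "\<forall>k\<le>r. w k = cs ! (k mod length cs)")
 case False
 let ?cyc = "\<lambda>k. cs ! (k mod length cs)"
 have ne: "cs \<noteq> []" using c unfolding cycle_def by simp
 define t where "t = (LEAST k. k \<le> r \<and> w k \<noteq> ?cyc k)"
 have t: "t \<le> r" "w t \<noteq> ?cyc t" using LeastI_ex[of "\<lambda>k. k \<le> r \<and> w k \<noteq> ?cyc k"] False unfolding t_def by auto
 have before: "w k = ?cyc k" if "k < t" for k
  using not_less_Least[of k "\<lambda>k. k \<le> r \<and> w k \<noteq> ?cyc k"] that t unfolding t_def[symmetric] by auto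
 have t0: "0 < t" using t w ne by (metis hd_conv_nth mod_0 neq0_conv)
 let ?cs = "rotate (t - 1) cs"
 have c': "cycle ?cs" by (rule cycle_rotate[OF c])
 have hd': "hd ?cs = w (t - 1)" using hd_rotate_nth[OF ne] before[of "t - 1"] t0 by simp
 have set': "set ?cs = set cs" by simp
 have wt: "w t \<notin> set cs"
 proof
  assume "w t \<in> set cs"
  moreover have "arc (hd ?cs) (w t)" using a[of "t - 1"] t t0 hd' by simp
  moreover have "?cs ! (1 mod length ?cs) = ?cyc t"
  proof -
   have "1 mod length cs < length cs" using ne by (intro mod_less_divisor) simp
   then have "?cs ! (1 mod length cs) = cs ! ((t - 1 + 1 mod length cs) mod length cs)" by (rule nth_rotate)
   also have "(t - 1 + 1 mod length cs) mod length cs = t mod length cs" unfolding mod_add_right_eq using t0 by simp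
   finally show ?thesis by (simp only: length_rotate)
  qed
  ultimately show False using chord_tangle[OF c'] t(2) nt set' by metis
 qed
 let ?bad = "\<lambda>u. t \<le> u \<and> u \<le> r \<and> (w u \<in> set cs \<or> w u \<in> w ` {t..<u})"
 have nobad: "\<not> ?bad u" for u
 proof
  assume "?bad u"
  then have b: "?bad (LEAST u. ?bad u)" by (rule LeastI)
  define u' where "u' = (LEAST u. ?bad u)"
  have u': "t \<le> u'" "u' \<le> r" "w u' \<in> set cs \<or> w u' \<in> w ` {t..<u'}" using b unfolding u'_def by auto
  have nb: "\<not> ?bad k" if "k < u'" for k using not_less_Least that unfolding u'_def by blast
  have tu: "t < u'" using u' wt by (metis atLeastLessThan_empty image_empty empty_iff le_neq_implies_less order_refl)
  let ?us = "map w [t..<u']"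
  have dis: "distinct ?us"
  proof -
   have "inj_on w {t..<u'}"
   proof (rule linorder_inj_onI)
    fix x y assume xy: "x < y" "x \<in> {t..<u'}" "y \<in> {t..<u'}"
    show "w x \<noteq> w y"
    proof
     assume "w x = w y"
     then have "w y \<in> w ` {t..<y}" using xy by (intro image_eqI[of _ _ x]) auto
     moreover have "t \<le> y" "y \<le> r" "y < u'" using xy u' by auto
     ultimately show False using nb by blast
    qed
   qed auto
   then show ?thesis by (simp add: distinct_map)
  qed
  have "w k \<notin> set cs" if "t \<le> k" "k < u'" for k
   using nb[OF that(2)] that u'(2) by (meson less_imp_le order_trans)
  then have disj: "set ?us \<inter> set cs = {}" by auto
  have "tangle ?cs ?us (w u')"
   unfolding tangle_def
  proof (intro conjI c')
   show "?us \<noteq> []" "length ?us \<le> L" using tu u' r by auto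
   show "distinct (?cs @ ?us)" using dis disj c unfolding cycle_def by auto
   show "arc (hd ?cs) (hd ?us)" using a[of "t - 1"] hd' tu t0 u' by (simp add: upt_conv_Cons)
   show "successively arc ?us" by (rule successively_map_upt) (use a u' in auto)
   show "arc (last ?us) (w u')" using a[of "u' - 1"] tu u' by (simp add: last_map)
   show "w u' \<in> set (?cs @ ?us)" using u' by auto
  qed
  then show False using nt by blast
 qed
 have "inj_on w {t..r}"
 proof (rule linorder_inj_onI)
  fix x y assume xy: "x < y" "x \<in> {t..r}" "y \<in> {t..r}"
  show "w x \<noteq> w y"
  proof
   assume "w x = w y"
   then have "w y \<in> w ` {t..<y}" using xy by (intro image_eqI[of _ _ x]) auto
   moreover have "t \<le> y" "y \<le> r" using xy by auto
   ultimately show False using nobad by blast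
  qed
 qed auto
 moreover have "w ` {t..r} \<inter> set cs = {}"
 proof -
  have "w k \<notin> set cs" if "t \<le> k" "k \<le> r" for k using nobad[of k] that by blast
  then show ?thesis by auto
 qed
 ultimately show ?thesis using t t0 before by blast
qed simp

text \<open>A shortest closed walk through \<open>w 0\<close> repeats no vertex, since the part
  between two equal vertices could be cut out.\<close>

lemma closed_walk_cycle:
 assumes r: "0 < r" "r \<le> L" and a: "\<And>k. k < r \<Longrightarrow> arc (w k) (w (Suc k))" and cl: "w r = w 0"
 shows "\<exists>cs. cycle cs \<and> hd cs = w 0"
proof -
 let ?P = "\<lambda>r. 0 < r \<and> r \<le> L \<and> (\<exists>v. (\<forall>k<r. arc (v k) (v (Suc k))) \<and> v r = v 0 \<and> v 0 = w 0)"
 have "?P r" using assms by auto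
 then have P: "?P (LEAST r. ?P r)" by (rule LeastI)
 define q where "q = (LEAST r. ?P r)"
 obtain v where q: "0 < q" "q \<le> L" "\<And>k. k < q \<Longrightarrow> arc (v k) (v (Suc k))" "v q = v 0" "v 0 = w 0"
  using P unfolding q_def by blast
 have mn: "\<not> ?P k" if "k < q" for k using not_less_Least that unfolding q_def by blast
 have "inj_on v {0..<q}"
 proof (rule linorder_inj_onI)
  fix x y assume xy: "x < y" "x \<in> {0..<q}" "y \<in> {0..<q}"
  show "v x \<noteq> v y"
  proof
   assume eq: "v x = v y"
   define v' where "v' k = (if k \<le> x then v k else v (k + (y - x)))" for k
   have P': "?P (q - (y - x))"
   proof (intro conjI exI[of _ v'] allI impI)
    fix k assume k: "k < q - (y - x)"
    show "arc (v' k) (v' (Suc k))"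
    proof (cases "k < x")
     case True then show ?thesis using q(3)[of k] xy unfolding v'_def by auto
    next
     case False
     show ?thesis
     proof (cases "k = x")
      case True then show ?thesis using q(3)[of y] xy eq unfolding v'_def by auto
     next
      case False
      then have "k > x" using \<open>\<not> k < x\<close> by simp
      then show ?thesis using q(3)[of "k + (y - x)"] k xy unfolding v'_def by auto
     qed
    qed
   next
    show "v' (q - (y - x)) = v' 0" using xy q(4) unfolding v'_def by (cases "q - (y - x) \<le> x") auto
   qed (use xy q in \<open>auto simp: v'_def\<close>)
   have "q - (y - x) < q" using xy by auto
   then show False using mn P' by blast
  qed
 qed auto
 then have "cycle (map v [0..<q])"
  unfolding cycle_def using q by (auto simp: distinct_map last_map hd_map intro!: successively_map_upt) (metis Suc_pred lessI q(3) q(4) diff_less zero_less_one)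
 moreover have "hd (map v [0..<q]) = w 0" using q by (simp add: hd_map)
 ultimately show ?thesis by blast
qed

text \<open>Both walks start on the same cycle. By \<open>follow\<close> a walk that leaves it never
  returns, so both run around it all the time.\<close>

lemma closed_walk_unique:
 assumes nt: "\<nexists>cs us z. tangle cs us z" and r: "0 < r" "r \<le> L"
  and w: "\<And>k. k < r \<Longrightarrow> arc (w k) (w (Suc k))" "w r = w 0"
  and v: "\<And>k. k < r \<Longrightarrow> arc (v k) (v (Suc k))" "v r = v 0" and eq: "v 0 = w 0"
 shows "k \<le> r \<Longrightarrow> v k = w k"
proof -
 obtain cs where cs: "cycle cs" "hd cs = w 0" using closed_walk_cycle[OF r w] by blast
 have ne: "cs \<noteq> []" using cs unfolding cycle_def by simp
 have "\<forall>k\<le>r. u k = cs ! (k mod length cs)" if u: "u 0 = hd cs" "\<And>k. k < r \<Longrightarrow> arc (u k) (u (Suc k))" "u r = u 0" for u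
 proof (rule ccontr)
  assume "\<not> ?thesis"
  then obtain t where t: "t \<le> r" "u ` {t..r} \<inter> set cs = {}" using follow[OF nt cs(1) u(1,2) r(2)] by blast
  have "u r \<in> set cs" using u ne by simp
  moreover have "u r \<in> u ` {t..r}" using t(1) by simp
  ultimately show False using t(2) by blast
 qed
 from this[of w] this[of v] show "k \<le> r \<Longrightarrow> v k = w k" using w v eq cs(2) by simp
qed

text \<open>The loop begins at the vertex of the first repetition and ends at the last visit to that
  vertex, so it may run around the cycle several times. What follows runs along the cycle for less
  than a full turn and then never meets it again.\<close>

lemma loop_split:
 assumes nt: "\<nexists>cs us z. tangle cs us z" and s: "s \<le> L"
  and a: "\<And>k. k < s \<Longrightarrow> arc (w k) (w (Suc k))" and ni: "\<not> inj_on w {..s}"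
 shows "\<exists>i j cs. i < j \<and> j \<le> s \<and> w i = w j \<and> inj_on w {..i} \<and> inj_on w {j..s} \<and> cycle cs \<and> hd cs = w i"
proof -
 let ?P = "\<lambda>j. j \<le> s \<and> (\<exists>i<j. w i = w j)"
 have "\<exists>j. ?P j"
 proof (rule ccontr)
  assume n: "\<nexists>j. ?P j"
  have "inj_on w {..s}"
  proof (rule linorder_inj_onI)
   fix x y assume "x < y" "x \<in> {..s}" "y \<in> {..s}"
   then show "w x \<noteq> w y" using n by auto
  qed auto
  then show False using ni by simp
 qed
 then have P: "?P (LEAST j. ?P j)" by (rule LeastI_ex)
 define j where "j = (LEAST j. ?P j)"
 obtain i where i: "i < j" "w i = w j" "j \<le> s" using P unfolding j_def by blast
 have mn: "\<not> ?P k" if "k < j" for k using not_less_Least that unfolding j_def by blast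
 have inj: "inj_on w {..<j}"
 proof (rule linorder_inj_onI)
  fix x y assume "x < y" "x \<in> {..<j}" "y \<in> {..<j}"
  then show "w x \<noteq> w y" using mn[of y] i by auto
 qed auto
 let ?cs = "map w [i..<j]"
 have cyc: "cycle ?cs"
  unfolding cycle_def
 proof (intro conjI)
  show "?cs \<noteq> []" "length ?cs \<le> L" using i s by auto
  show "distinct ?cs" using inj by (auto simp: distinct_map intro: inj_on_subset)
  show "successively arc ?cs" by (rule successively_map_upt) (use a i in auto)
  show "arc (last ?cs) (hd ?cs)" using a[of "j - 1"] i by (simp add: last_map hd_map)
 qed
 have hdc: "hd ?cs = w i" using i by (simp add: hd_map)
 define J where "J = {k. k \<le> s \<and> w k = w i}"
 have J: "finite J" "j \<in> J" using i unfolding J_def by auto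
 \<comment> \<open>Taking the last visit to the base guarantees that the final part never comes back
   to it.\<close>
 define j' where "j' = Max J"
 have j': "j' \<in> J" "j \<le> j'" "\<And>k. k \<in> J \<Longrightarrow> k \<le> j'" unfolding j'_def using J Max_in by auto
 have j2: "j' \<le> s" "w j' = w i" using j'(1) unfolding J_def by auto
 have nr: "w (j' + k) \<noteq> w i" if "0 < k" "j' + k \<le> s" for k
  using j'(3)[of "j' + k"] that unfolding J_def by auto
 have F: "(\<forall>k\<le>s - j'. w (j' + k) = ?cs ! (k mod length ?cs)) \<or>
  (\<exists>t. 0 < t \<and> t \<le> s - j' \<and> (\<forall>k<t. w (j' + k) = ?cs ! (k mod length ?cs)) \<and> inj_on (\<lambda>k. w (j' + k)) {t..s - j'} \<and> (\<lambda>k. w (j' + k)) ` {t..s - j'} \<inter> set ?cs = {})"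
  by (rule follow[OF nt cyc]) (use hdc j2 a s in auto)
 have len: "length ?cs = j - i" "0 < j - i" using i by auto
 have cyc0: "?cs ! ((j - i) mod length ?cs) = w i" using i by simp
 have "inj_on (\<lambda>k. w (j' + k)) {0..s - j'}"
 proof -
  from F show ?thesis
  proof
   assume f: "\<forall>k\<le>s - j'. w (j' + k) = ?cs ! (k mod length ?cs)"
   \<comment> \<open>A full turn after \<open>j'\<close> would be a further visit to the
     base.\<close>
   have lt: "s - j' < j - i"
   proof (rule ccontr)
    assume "\<not> s - j' < j - i"
    then have "j - i \<le> s - j'" by simp
    then have "w (j' + (j - i)) = w i" using f cyc0 by metis
    moreover have "j' + (j - i) \<le> s" using \<open>j - i \<le> s - j'\<close> j2(1) by arith
    ultimately show False using nr len(2) by blast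
   qed
   show ?thesis
   proof (rule linorder_inj_onI)
    fix x y assume xy: "x < y" "x \<in> {0..s - j'}" "y \<in> {0..s - j'}"
    then have "w (j' + x) = w (i + x)" "w (j' + y) = w (i + y)" using f lt len by (auto simp: nth_map)
    moreover have "y < j - i" using xy(3) lt by simp
    then have "i + y < j" by (simp add: less_diff_conv add.commute)
    then have "w (i + x) \<noteq> w (i + y)" using inj_onD[OF inj, of "i + x" "i + y"] xy(1) by auto
    ultimately show "w (j' + x) \<noteq> w (j' + y)" by simp
   qed auto
  next
   assume "\<exists>t. 0 < t \<and> t \<le> s - j' \<and> (\<forall>k<t. w (j' + k) = ?cs ! (k mod length ?cs)) \<and> inj_on (\<lambda>k. w (j' + k)) {t..s - j'} \<and> (\<lambda>k. w (j' + k)) ` {t..s - j'} \<inter> set ?cs = {}"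
   then obtain t where t: "0 < t" "t \<le> s - j'" "\<And>k. k < t \<Longrightarrow> w (j' + k) = ?cs ! (k mod length ?cs)"
    "inj_on (\<lambda>k. w (j' + k)) {t..s - j'}" "(\<lambda>k. w (j' + k)) ` {t..s - j'} \<inter> set ?cs = {}" by blast
   have lt: "t \<le> j - i"
   proof (rule ccontr)
    assume n: "\<not> t \<le> j - i"
    then have "j - i < t" by simp
    then have "w (j' + (j - i)) = w i" using t(3)[of "j - i"] cyc0 by metis
    moreover have "j' + (j - i) \<le> s" using \<open>j - i < t\<close> t(2) j2(1) by arith
    ultimately show False using nr len(2) by blast
   qed
   have e: "w (j' + k) = w (i + k)" "w (j' + k) \<in> set ?cs" if "k < t" for k
    using t(3)[OF that] lt that len by auto
   show ?thesis
   proof (rule linorder_inj_onI)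
    fix x y assume xy: "x < y" "x \<in> {0..s - j'}" "y \<in> {0..s - j'}"
    show "w (j' + x) \<noteq> w (j' + y)"
    proof (cases "y < t")
     case True
     then have "y < j - i" using lt by simp
     then have "i + y < j" by (simp add: less_diff_conv add.commute)
     then have "w (i + x) \<noteq> w (i + y)" using inj_onD[OF inj, of "i + x" "i + y"] xy(1) by auto
     then show ?thesis using e(1)[of x] e(1)[of y] xy(1) True by simp
    next
     case False
     show ?thesis
     proof (cases "x < t")
      case True
      have "w (j' + y) \<in> (\<lambda>k. w (j' + k)) ` {t..s - j'}" using False xy by auto
      then have "w (j' + y) \<notin> set ?cs" using t(5) by blast
      then show ?thesis using e(2)[OF True] by metis
     next
      case False2: False
      then show ?thesis using inj_onD[OF t(4), of x y] False xy by auto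
     qed
    qed
   qed auto
  qed
 qed
 then have "inj_on w {j'..s}"
 proof -
  assume h: "inj_on (\<lambda>k. w (j' + k)) {0..s - j'}"
  show ?thesis
  proof (rule inj_onI)
   fix x y assume "x \<in> {j'..s}" "y \<in> {j'..s}" "w x = w y"
   then have "x - j' = y - j'" "j' \<le> x" "j' \<le> y" using inj_onD[OF h, of "x - j'" "y - j'"] by auto
   then show "x = y" by (metis le_add_diff_inverse)
  qed
 qed
 moreover have "inj_on w {..i}" using inj i by (auto intro: inj_on_subset)
 ultimately show ?thesis using i j2 j'(2) cyc hdc by (intro exI[of _ i] exI[of _ j'] exI[of _ ?cs]) auto
qed

text \<open>Every vertex of a closed walk of length at most \<open>L\<close> is the head of a cycle,
  hence outside \<open>E\<close>. Erasing such walks does not change the visits to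
  \<open>E\<close>.\<close>

lemma loop_erase:
 assumes nc: "\<And>cs. cycle cs \<Longrightarrow> hd cs \<notin> E"
 shows "successively arc xs \<Longrightarrow> length xs \<le> Suc L \<Longrightarrow>
  \<exists>ys. distinct ys \<and> successively arc ys \<and> length ys \<le> Suc L \<and> set ys \<subseteq> set xs \<and> filter (\<lambda>x. x \<in> E) ys = filter (\<lambda>x. x \<in> E) xs"
proof (induction xs rule: length_induct)
 case (1 xs)
 show ?case
 proof (cases "distinct xs")
  case False
  then obtain A v B C where xs: "xs = A @ [v] @ B @ [v] @ C" using not_distinct_decomp by blast
  have suc: "successively arc (v # B @ [v])"
  proof -
   have "successively arc (A @ ((v # B @ [v]) @ C))" using 1(2) unfolding xs by simp
   then show ?thesis unfolding successively_append_iff by blast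
  qed
  let ?w = "\<lambda>k. (v # B @ [v]) ! k" and ?r = "Suc (length B)"
  have ar: "arc (?w k) (?w (Suc k))" if "k < ?r" for k
   using suc that unfolding successively_conv_nth by (metis length_Cons length_append_singleton Suc_less_eq)
  have clr: "?w ?r = v" by (simp add: nth_append)
  have rL: "?r \<le> L" using 1(3) unfolding xs by simp
  have noE: "x \<notin> E" if "x \<in> set (v # B)" for x :: nat
  proof -
   obtain p where p0: "p < length (v # B)" "(v # B) ! p = x" using \<open>x \<in> set (v # B)\<close> unfolding in_set_conv_nth by blast
   have "((v # B) @ [v]) ! p = x" using p0 by (simp only: nth_append if_True)
   then have p: "p < ?r" "x = ?w p" using p0 by simp_all
   \<comment> \<open>The closed walk, rotated so that it starts at \<open>x\<close>.\<close>
   define w' where "w' k = (if p + k < ?r then ?w (p + k) else ?w (p + k - ?r))" for k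
   have "\<exists>cs. cycle cs \<and> hd cs = w' 0"
   proof (rule closed_walk_cycle[of ?r])
    fix k assume k: "k < ?r"
    show "arc (w' k) (w' (Suc k))"
    proof (cases "p + Suc k < ?r")
     case True then show ?thesis using ar[of "p + k"] unfolding w'_def by auto
    next
     case False
     show ?thesis
     proof (cases "p + k < ?r")
      case True
      then have e: "p + k = ?r - 1" "p + Suc k - ?r = 0" using False by auto
      have "w' (Suc k) = ?w 0" using False e unfolding w'_def by simp
      then have "w' (Suc k) = ?w ?r" using clr by simp
      moreover have "w' k = ?w (?r - 1)" using True e unfolding w'_def by simp
      ultimately show ?thesis using ar[of "?r - 1"] by simp
     next
      case F2: False
      then have "p + Suc k - ?r = Suc (p + k - ?r)" by simp
      then show ?thesis using ar[of "p + k - ?r"] F2 False k p unfolding w'_def by auto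
     qed
    qed
   next
    show "w' ?r = w' 0" using p unfolding w'_def by simp
   qed (use rL in auto)
   moreover have "w' 0 = x" using p unfolding w'_def by simp
   ultimately show ?thesis using nc by metis
  qed
  let ?xs = "A @ [v] @ C"
  have "successively arc ((A @ [v] @ B) @ (v # C))" "successively arc (A @ (v # B @ [v] @ C))" using 1(2) unfolding xs by simp_all
  then have "successively arc (v # C)" "successively arc A" "A \<noteq> [] \<Longrightarrow> arc (last A) v"
   unfolding successively_append_iff by (metis, metis, metis list.distinct(1) list.sel(1))
  then have "successively arc (A @ (v # C))" unfolding successively_append_iff by auto
  then have "successively arc ?xs" by simp
  moreover have "length ?xs < length xs" "length ?xs \<le> Suc L" using 1(3) unfolding xs by auto
  ultimately obtain ys where "distinct ys" "successively arc ys" "length ys \<le> Suc L" "set ys \<subseteq> set ?xs" "filter (\<lambda>x. x \<in> E) ys = filter (\<lambda>x. x \<in> E) ?xs"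
   using 1(1) by blast
  moreover have "filter (\<lambda>x. x \<in> E) B = []" using noE by (auto simp: filter_empty_conv)
  ultimately show ?thesis using noE[of v] unfolding xs by (intro exI[of _ ys]) auto
 qed (use 1 in auto)
qed

end

definition dg :: "nat set \<Rightarrow> fmat" where "dg Z = (\<lambda>i j. if i = j \<and> i \<in> Z then 1 else 0)"

text \<open>Inductive step for comparing three products with factors \<open>f - e\<close>,
  \<open>f\<close> and \<open>f + e\<close>: the deviation of the first from the second is dominated
  by that of the third.\<close>

lemma abs_diff_prod_step:
 fixes a c p f e :: real
 assumes "\<bar>c - a\<bar> \<le> p - a" "0 \<le> f" "0 \<le> e" "0 \<le> a"
 shows "\<bar>c * (f - e) - a * f\<bar> \<le> p * (f + e) - a * f"
proof -
 have "\<bar>c * (f - e) - a * f\<bar> = \<bar>(c - a) * (f - e) - a * e\<bar>" by (simp add: algebra_simps)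
 also have "\<dots> \<le> \<bar>(c - a) * (f - e)\<bar> + \<bar>a * e\<bar>" by (rule abs_triangle_ineq4)
 also have "\<dots> = \<bar>c - a\<bar> * \<bar>f - e\<bar> + a * e" using assms by (simp add: abs_mult)
 also have "\<dots> \<le> (p - a) * (f + e) + a * e"
  using assms by (intro add_mono mult_mono) auto
 finally show ?thesis by (simp add: algebra_simps)
qed

section \<open>The error of the centring\<close>

locale walks = sparse +
 fixes \<sigma> :: "nat \<Rightarrow> nat" and L :: nat
 assumes perm: "\<sigma> permutes {..<n}"
begin

definition P :: fmat where "P x z = Q (\<sigma> x) z"

sublocale arcs "\<lambda>x z. P x z \<noteq> 0" L .

lemma P_nonneg: "0 \<le> P x z" unfolding P_def by (rule Q_nonneg)

lemma sig_less: "\<sigma> x < n \<longleftrightarrow> x < n"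
 using permutes_in_image[OF perm, of x] by simp

lemma P_row: "x < n \<Longrightarrow> (\<Sum>z<n. P x z) = 1"
 unfolding P_def using row[of "\<sigma> x"] sig_less by blast

lemma P_col: "z < n \<Longrightarrow> (\<Sum>x<n. P x z) = 1"
 unfolding P_def using sum.permute[OF perm, of "\<lambda>y. Q y z"] col[of z] by (simp add: o_def)

lemma opb_P: "opb n P 1"
 by (rule opb_schur) (use P_nonneg P_row P_col in auto)

lemma mpw_P: "z < n \<Longrightarrow> (\<Sum>x<n. mpw n P s x z) = 1" "x < n \<Longrightarrow> (\<Sum>z<n. mpw n P s x z) = 1" "0 \<le> mpw n P s x z"
proof -
 show n: "0 \<le> mpw n P s x z" for x z
  by (induction s arbitrary: x) (auto simp: idm_def mm_def intro!: sum_nonneg mult_nonneg_nonneg P_nonneg)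
 show "z < n \<Longrightarrow> (\<Sum>x<n. mpw n P s x z) = 1"
 proof (induction s)
  case (Suc s)
  have "(\<Sum>x<n. mpw n P (Suc s) x z) = (\<Sum>k<n. \<Sum>x<n. P x k * mpw n P s k z)"
   unfolding mpw.simps mm_def by (rule sum.swap)
  also have "\<dots> = (\<Sum>k<n. mpw n P s k z)"
   by (intro sum.cong refl) (simp add: sum_distrib_right[symmetric] P_col)
  finally show ?case using Suc by simp
 qed (simp add: idm_def)
 show "x < n \<Longrightarrow> (\<Sum>z<n. mpw n P s x z) = 1"
 proof (induction s arbitrary: x)
  case (Suc s)
  have "(\<Sum>z<n. mpw n P (Suc s) x z) = (\<Sum>k<n. \<Sum>z<n. P x k * mpw n P s k z)"
   unfolding mpw.simps mm_def by (rule sum.swap)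
  also have "\<dots> = (\<Sum>k<n. P x k)"
   by (intro sum.cong refl) (simp add: sum_distrib_left[symmetric] Suc)
  finally show ?case using Suc P_row by simp
 qed (simp add: idm_def)
qed

definition All :: "(nat \<times> nat \<Rightarrow> real) \<Rightarrow> nat \<Rightarrow> fmat" where
 "All f s x z = (\<Sum>es\<in>{es\<in>Lst s. st es z = x}. wt f es z)"

definition Bad :: "(nat \<times> nat \<Rightarrow> real) \<Rightarrow> nat \<Rightarrow> fmat" where
 "Bad f s x z = (\<Sum>es\<in>{es\<in>Lst s. st es z = x \<and> \<not> good es z}. wt f es z)"

abbreviation plus :: "nat \<times> nat \<Rightarrow> real" where "plus \<equiv> (\<lambda>p. ind \<sigma> p + 1 / n)"

lemma All_split: "All f s x z = Simp f s x z + Bad f s x z"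
proof -
 have "{es\<in>Lst s. st es z = x} = {es\<in>Lst s. st es z = x \<and> good es z} \<union> {es\<in>Lst s. st es z = x \<and> \<not> good es z}" by blast
 then show ?thesis unfolding All_def Simp_def Bad_def by (simp only:) (rule sum.union_disjoint; auto)
qed

lemma All_Suc: "All f (Suc s) x z = (\<Sum>x'<n. All f s x x' * (\<Sum>y<n. f (x', y) * Q y z))"
proof -
 have "All f (Suc s) x z = (\<Sum>es\<in>Lst (Suc s). if st es z = x then wt f es z else 0)"
  unfolding All_def by (rule sum.inter_filter) simp
 also have "\<dots> = (\<Sum>p\<in>{..<n} \<times> {..<n}. \<Sum>es\<in>Lst s. (if st es (fst p) = x then wt f es (fst p) else 0) * (f p * Q (snd p) z))"
  unfolding Lst_def sum_llists_Suc by (intro sum.cong refl) (simp add: mult.assoc)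
 also have "\<dots> = (\<Sum>p\<in>{..<n} \<times> {..<n}. All f s x (fst p) * (f p * Q (snd p) z))"
  unfolding All_def sum_distrib_right[symmetric] by (intro sum.cong refl arg_cong2[where f = times] sum.inter_filter[symmetric]) simp
 also have "\<dots> = (\<Sum>x'<n. \<Sum>y<n. All f s x x' * (f (x', y) * Q y z))"
  by (simp add: sum.cartesian_product split_beta)
 finally show ?thesis by (simp add: sum_distrib_left)
qed

lemma ind_row:
 assumes "x < n" "z < n"
 shows "(\<Sum>y<n. (ind \<sigma> (x, y) + c / n) * Q y z) = P x z + c / n"
proof -
 have "(\<Sum>y<n. (ind \<sigma> (x, y) + c / n) * Q y z) = (\<Sum>y<n. if y = \<sigma> x then Q y z else 0) + (\<Sum>y<n. c / n * Q y z)"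
  unfolding sum.distrib[symmetric] by (intro sum.cong) (auto simp: ind_def distrib_right)
 also have "\<dots> = P x z + c / n"
  unfolding sum_distrib_left[symmetric] col[OF assms(2)] using assms sig_less by (simp add: P_def)
 finally show ?thesis .
qed

lemma All_shift:
 "x < n \<Longrightarrow> z < n \<Longrightarrow> All (\<lambda>p. ind \<sigma> p + c / n) s x z = mpw n P s x z + ((1 + c) ^ s - 1) / n"
proof (induction s arbitrary: z)
 case 0
 have "{es \<in> {[]}. st es z = x} = (if x = z then {[]} else {})" by auto
 then show ?case by (simp add: All_def Lst_def idm_def)
next
 case (Suc s)
 let ?g = "(1 + c) ^ s - 1"
 have "All (\<lambda>p. ind \<sigma> p + c / n) (Suc s) x z = (\<Sum>x'<n. (mpw n P s x x' + ?g / n) * (P x' z + c / n))"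
  unfolding All_Suc using Suc ind_row by (intro sum.cong) auto
 also have "\<dots> = (\<Sum>x'<n. mpw n P s x x' * P x' z) + (\<Sum>x'<n. mpw n P s x x') * (c / n) + ?g / n * (\<Sum>x'<n. P x' z) + (\<Sum>x'<n. ?g / n * (c / n))"
  by (simp only: distrib_left distrib_right sum.distrib sum_distrib_left sum_distrib_right add_ac)
 also have "(\<Sum>x'<n. mpw n P s x x' * P x' z) = mpw n P (Suc s) x z"
  unfolding mpw_Suc_right[OF Suc(2,3)] mm_def ..
 also have "(\<Sum>x'<n. ?g / n * (c / n)) = ?g * c / n" using n_pos by simp
 finally have e: "All (\<lambda>p. ind \<sigma> p + c / n) (Suc s) x z = mpw n P (Suc s) x z + 1 * (c / n) + ?g / n * 1 + ?g * c / n"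
  by (simp only: mpw_P(2)[OF Suc(2)] P_col[OF Suc(3)])
 have "1 * (c / n) + ?g / n * 1 + ?g * c / n = (c + ?g + ?g * c) / n" by (simp add: add_divide_distrib)
 also have "c + ?g + ?g * c = (1 + c) ^ Suc s - 1" by (simp add: algebra_simps)
 finally show ?case unfolding e by (simp only: add.assoc)
qed

lemma wt_bounds:
 "0 \<le> wt (ind \<sigma>) es z" "wt (ind \<sigma>) es z \<le> wt plus es z" "\<bar>wt (cen \<sigma>) es z - wt (ind \<sigma>) es z\<bar> \<le> wt plus es z - wt (ind \<sigma>) es z"
proof -
 have i0: "0 \<le> ind \<sigma> p" for p unfolding ind_def by simp
 show a: "0 \<le> wt (ind \<sigma>) es z" for es z
  by (induction es arbitrary: z) (auto intro!: mult_nonneg_nonneg Q_nonneg i0)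
 show c: "\<bar>wt (cen \<sigma>) es z - wt (ind \<sigma>) es z\<bar> \<le> wt plus es z - wt (ind \<sigma>) es z" for es z
 proof (induction es arbitrary: z)
  case (Cons p es)
  have "\<bar>wt (cen \<sigma>) es (fst p) * (ind \<sigma> p - 1 / n) - wt (ind \<sigma>) es (fst p) * ind \<sigma> p\<bar> * Q (snd p) z
   \<le> (wt plus es (fst p) * (ind \<sigma> p + 1 / n) - wt (ind \<sigma>) es (fst p) * ind \<sigma> p) * Q (snd p) z"
   by (intro mult_right_mono abs_diff_prod_step Cons Q_nonneg i0 a) simp
  then show ?case using Q_nonneg[of "snd p" z] by (simp add: left_diff_distrib[symmetric] abs_mult)
 qed simp
 show "wt (ind \<sigma>) es z \<le> wt plus es z" using c[of es z] by linarith
qed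

text \<open>Over all paths the sums with shifts 0 and -1 differ by exactly \<open>1 / n\<close>, so
  the error sits on the paths that are not good. There it is dominated termwise by
  \<open>plus\<close> minus \<open>ind\<close>, and the shift 1 bounds the total of this by
  \<open>2 ^ s / n\<close>.\<close>

lemma remainder_bound:
 assumes s: "0 < s" and xz: "x < n" "z < n"
 defines "Y \<equiv> Simp (ind \<sigma>) s x z - 1 / n - Simp (cen \<sigma>) s x z"
 shows "\<bar>Y\<bar> \<le> Bad plus s x z" "\<bar>Y\<bar> \<le> 2 ^ s / n" "0 \<le> Bad plus s x z"
proof -
 let ?A = "{es\<in>Lst s. st es z = x \<and> \<not> good es z}" and ?G = "{es\<in>Lst s. st es z = x \<and> good es z}"
 have A: "All (ind \<sigma>) s x z = mpw n P s x z" "All (cen \<sigma>) s x z = mpw n P s x z - 1 / n"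
  "All plus s x z = mpw n P s x z + (2 ^ s - 1) / n"
  using All_shift[OF xz, of 0 s] All_shift[OF xz, of "-1" s] All_shift[OF xz, of 1 s] s by (simp_all add: zero_power)
 have "\<bar>Y\<bar> = \<bar>Bad (cen \<sigma>) s x z - Bad (ind \<sigma>) s x z\<bar>"
  using A(1,2) unfolding All_split Y_def by simp
 also have "\<dots> \<le> (\<Sum>es\<in>?A. \<bar>wt (cen \<sigma>) es z - wt (ind \<sigma>) es z\<bar>)"
  unfolding Bad_def sum_subtractf[symmetric] by (rule sum_abs)
 also have "\<dots> \<le> (\<Sum>es\<in>?A. wt plus es z - wt (ind \<sigma>) es z)" by (rule sum_mono) (rule wt_bounds(3))
 also have "\<dots> = Bad plus s x z - Bad (ind \<sigma>) s x z" unfolding Bad_def by (rule sum_subtractf)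
 finally have Y: "\<bar>Y\<bar> \<le> Bad plus s x z - Bad (ind \<sigma>) s x z" .
 have b0: "0 \<le> Bad (ind \<sigma>) s x z" unfolding Bad_def by (rule sum_nonneg) (rule wt_bounds(1))
 show "\<bar>Y\<bar> \<le> Bad plus s x z" using Y b0 by linarith
 then show "0 \<le> Bad plus s x z" by (smt (verit))
 have "Simp (ind \<sigma>) s x z \<le> Simp plus s x z" unfolding Simp_def by (rule sum_mono) (rule wt_bounds(2))
 then have "\<bar>Y\<bar> \<le> All plus s x z - All (ind \<sigma>) s x z" using Y unfolding All_split by (smt (verit))
 also have "\<dots> \<le> 2 ^ s / n" unfolding A by (simp add: divide_right_mono)
 finally show "\<bar>Y\<bar> \<le> 2 ^ s / n" .
qed

definition bad_mass :: "nat \<Rightarrow> real" where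
 "bad_mass s = (\<Sum>z<n. \<Sum>es\<in>{es\<in>Lst s. \<not> good es z}. wt plus es z)"

text \<open>The squared Frobenius norm is at most the largest entry times the sum of the entries; no
  spectral information about the error is needed.\<close>

lemma remainder_opb:
 assumes s: "0 < s" and h: "2 ^ s / n * bad_mass s \<le> \<eta>\<^sup>2" "0 \<le> \<eta>"
 shows "opb n (\<lambda>x z. Simp (ind \<sigma>) s x z - 1 / n - Simp (cen \<sigma>) s x z) \<eta>"
proof -
 let ?Y = "\<lambda>x z. Simp (ind \<sigma>) s x z - 1 / n - Simp (cen \<sigma>) s x z"
 have "(\<Sum>x<n. \<Sum>z<n. (?Y x z)\<^sup>2) \<le> (\<Sum>x<n. \<Sum>z<n. 2 ^ s / n * Bad plus s x z)"
 proof (intro sum_mono)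
  fix x z assume "x \<in> {..<n}" "z \<in> {..<n}"
  then have "\<bar>?Y x z\<bar> * \<bar>?Y x z\<bar> \<le> 2 ^ s / n * Bad plus s x z"
   using remainder_bound[OF s, of x z] by (intro mult_mono) auto
  then show "(?Y x z)\<^sup>2 \<le> 2 ^ s / n * Bad plus s x z" by (simp add: power2_eq_square abs_mult_self_eq)
 qed
 also have "\<dots> = 2 ^ s / n * (\<Sum>x<n. \<Sum>z<n. Bad plus s x z)" by (simp add: sum_distrib_left)
 also have "(\<Sum>x<n. \<Sum>z<n. Bad plus s x z) = (\<Sum>z<n. \<Sum>x<n. Bad plus s x z)" by (rule sum.swap)
 also have "\<dots> = bad_mass s"
  unfolding bad_mass_def
 proof (intro sum.cong refl)
  fix z assume "z \<in> {..<n}"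
  let ?B = "{es\<in>Lst s. \<not> good es z}"
  have im: "(\<lambda>es. st es z) ` ?B \<subseteq> {..<n}" using Lst_last[OF _ s] st_eq[of _ z] by fastforce
  have "(\<Sum>x<n. Bad plus s x z) = (\<Sum>x<n. \<Sum>es\<in>{es\<in>?B. st es z = x}. wt plus es z)"
   unfolding Bad_def by (intro sum.cong refl) auto
  also have "\<dots> = (\<Sum>es\<in>?B. wt plus es z)"
   by (rule sum.group) (use im in auto)
  finally show "(\<Sum>x<n. Bad plus s x z) = (\<Sum>es\<in>?B. wt plus es z)" .
 qed
 also have "2 ^ s / n * bad_mass s \<le> \<eta>\<^sup>2" by (rule h)
 finally have "sqrt (\<Sum>x<n. \<Sum>z<n. (?Y x z)\<^sup>2) \<le> \<eta>" using h(2) real_le_lsqrt by blast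
 then show ?thesis by (rule opb_le[OF opb_frob])
qed

subsection \<open>Walks as vertex lists\<close>

definition V :: "nat \<Rightarrow> nat list set" where "V s = llists {..<n} (Suc s)"

definition W :: "nat list \<Rightarrow> real" where "W xs = (\<Prod>k<length xs - 1. P (xs ! k) (xs ! Suc k))"

lemma finite_V [simp]: "finite (V s)" unfolding V_def by simp

lemma W_nonneg: "0 \<le> W xs" unfolding W_def by (intro prod_nonneg) (simp add: P_nonneg)

lemma W_Cons: "ys \<noteq> [] \<Longrightarrow> W (x # ys) = P x (hd ys) * W ys"
proof -
 assume "ys \<noteq> []"
 then obtain y zs where ys: "ys = y # zs" by (cases ys) auto
 show ?thesis unfolding W_def ys by (simp del: prod.lessThan_Suc add: prod.lessThan_Suc_shift)
qed

lemma W_snoc: "xs \<noteq> [] \<Longrightarrow> W (xs @ [z]) = W xs * P (last xs) z"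
proof (induction xs)
 case (Cons x xs)
 show ?case
 proof (cases "xs = []")
  case True then show ?thesis by (simp add: W_def)
 next
  case False
  have "W ((x # xs) @ [z]) = P x (hd xs) * W (xs @ [z])" using W_Cons[of "xs @ [z]" x] False by simp
  then show ?thesis using Cons.IH[OF False] W_Cons[OF False, of x] False by simp
 qed
qed simp

lemma W_split: "i \<le> s \<Longrightarrow> length xs = Suc s \<Longrightarrow> W xs = W (take (Suc i) xs) * W (drop i xs)"
proof (induction i arbitrary: s xs)
 case 0
 then show ?case by (simp add: W_def)
next
 case (Suc i)
 obtain x ys where xs: "xs = x # ys" using Suc(3) by (cases xs) auto
 obtain s' where s': "s = Suc s'" using Suc(2) by (cases s) auto
 have l: "length ys = Suc s'" "ys \<noteq> []" using Suc(3) xs s' by auto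
 have "W ys = W (take (Suc i) ys) * W (drop i ys)" using Suc l s' by simp
 moreover have "W (x # take (Suc i) ys) = P x (hd ys) * W (take (Suc i) ys)" using l W_Cons[of "take (Suc i) ys" x] by auto
 ultimately show ?case using W_Cons[OF l(2), of x] xs by simp
qed

lemma W_arc: "W xs \<noteq> 0 \<Longrightarrow> k < length xs - 1 \<Longrightarrow> P (xs ! k) (xs ! Suc k) \<noteq> 0"
 unfolding W_def by (auto simp: prod_zero_iff)

lemma W_successively: "W xs \<noteq> 0 \<Longrightarrow> successively (\<lambda>x z. P x z \<noteq> 0) xs"
 unfolding successively_conv_nth using W_arc[of xs] by auto

lemma wt_ind_list: "wt (ind \<sigma>) (map (\<lambda>v. (v, \<sigma> v)) vs) z = W (rev (z # vs))"
proof (induction vs arbitrary: z)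
 case Nil
 then show ?case by (simp add: W_def)
next
 case (Cons v vs)
 have "W (rev (z # v # vs)) = W (rev (v # vs)) * P v z" using W_snoc[of "rev (v # vs)" z] by simp
 then show ?case using Cons by (simp add: ind_def P_def)
qed

lemma Simp_ind:
 assumes xz: "x < n" "z < n"
 shows "Simp (ind \<sigma>) s x z = (\<Sum>xs\<in>{xs\<in>V s. hd xs = x \<and> last xs = z \<and> distinct xs \<and> set xs \<inter> E = {}}. W xs)"
proof -
 let ?A = "{es\<in>Lst s. st es z = x \<and> good es z}" and ?r = "\<lambda>v. (v, \<sigma> v)"
 let ?B = "{xs\<in>V s. hd xs = x \<and> last xs = z \<and> distinct xs \<and> set xs \<inter> E = {}}"
 have sti: "st (map ?r vs) z = last (z # vs)" for vs
  by (induction vs arbitrary: z) auto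
 have "(\<Sum>es\<in>{es\<in>?A. map ?r (map fst es) = es}. wt (ind \<sigma>) es z) = Simp (ind \<sigma>) s x z"
  unfolding Simp_def
 proof (rule sum.mono_neutral_left)
  have "wt (ind \<sigma>) es w \<noteq> 0 \<Longrightarrow> map ?r (map fst es) = es" for es w
   by (induction es arbitrary: w) (auto simp: ind_def split: if_splits)
  then show "\<forall>es\<in>?A - {es\<in>?A. map ?r (map fst es) = es}. wt (ind \<sigma>) es z = 0" by blast
 qed auto
 also have "(\<Sum>es\<in>{es\<in>?A. map ?r (map fst es) = es}. wt (ind \<sigma>) es z) = (\<Sum>xs\<in>?B. W xs)"
 proof (rule sum.reindex_bij_witness[of _ "\<lambda>xs. map ?r (tl (rev xs))" "\<lambda>es. rev (z # map fst es)"])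
  fix es assume es: "es \<in> {es\<in>?A. map ?r (map fst es) = es}"
  then have m: "map ?r (map fst es) = es" by blast
  then show "map ?r (tl (rev (rev (z # map fst es)))) = es" by simp
  have "st es z = last (z # map fst es)" using sti[of "map fst es"] m by simp
  then have "hd (rev (z # map fst es)) = x" using es unfolding hd_rev by simp
  moreover have "last (rev (z # map fst es)) = z" by simp
  moreover have "rev (z # map fst es) \<in> V s"
   using es xz unfolding V_def Lst_def llists_def by auto
  moreover have "distinct (rev (z # map fst es))" "set (rev (z # map fst es)) \<inter> E = {}"
   using es unfolding good_def by auto
  ultimately show "rev (z # map fst es) \<in> ?B" by blast
  show "W (rev (z # map fst es)) = wt (ind \<sigma>) es z" using wt_ind_list[of "map fst es" z] m by simp
 next
  fix xs assume xs: "xs \<in> ?B"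
  then have l: "length xs = Suc s" "set xs \<subseteq> {..<n}" unfolding V_def llists_def by auto
  obtain ys where ys: "xs = ys @ [z]" using xs l by (metis (mono_tags, lifting) append_butlast_last_id length_0_conv mem_Collect_eq nat.simps(3))
  have f: "map fst (map ?r (rev ys)) = rev ys" by (simp add: o_def)
  show "rev (z # map fst (map ?r (tl (rev xs)))) = xs" unfolding ys by (simp add: o_def)
  have "st (map ?r (rev ys)) z = last (z # rev ys)" by (rule sti)
  also have "\<dots> = hd xs" unfolding ys by (cases ys) auto
  finally have "st (map ?r (rev ys)) z = x" using xs by simp
  moreover have "distinct (map snd (map ?r (rev ys)))"
   using xs unfolding ys by (auto simp: distinct_map o_def intro!: inj_on_subset[OF permutes_inj[OF perm]])
  moreover have "map ?r (rev ys) \<in> Lst s" using l sig_less unfolding ys Lst_def llists_def by auto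
  ultimately show "map ?r (tl (rev xs)) \<in> {es\<in>?A. map ?r (map fst es) = es}"
   using xs unfolding ys good_def by (auto simp: o_def)
 qed
 finally show ?thesis by simp
qed

primrec G :: "nat \<Rightarrow> nat \<Rightarrow> fmat" where
 "G 0 = (\<lambda>r x z. if x = z \<and> (if x \<in> E then 1 else 0) = r then 1 else 0)" |
 "G (Suc s) = (\<lambda>r x z. if x \<in> E then (if r = 0 then 0 else mm n P (G s (r - 1)) x z) else mm n P (G s r) x z)"

lemma walks_Suc:
 assumes "x < n"
 shows "(\<Sum>y<n. P x y * (\<Sum>ys\<in>V s. if hd ys = y \<and> D ys then W ys else 0)) = (\<Sum>xs\<in>V (Suc s). if hd xs = x \<and> D (tl xs) then W xs else 0)"
proof -
 have "(\<Sum>y<n. P x y * (\<Sum>ys\<in>V s. if hd ys = y \<and> D ys then W ys else 0))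
  = (\<Sum>y<n. \<Sum>ys\<in>V s. if hd ys = y then (if D ys then P x y * W ys else 0) else 0)"
  unfolding sum_distrib_left by (intro sum.cong) auto
 also have "\<dots> = (\<Sum>ys\<in>V s. \<Sum>y<n. if hd ys = y then (if D ys then P x y * W ys else 0) else 0)" by (rule sum.swap)
 also have "\<dots> = (\<Sum>ys\<in>V s. if D ys then W (x # ys) else 0)"
 proof (rule sum.cong[OF refl])
  fix ys assume "ys \<in> V s"
  then have "ys \<noteq> []" "hd ys < n" unfolding V_def llists_def by (auto simp: length_Suc_conv)
  then show "(\<Sum>y<n. if hd ys = y then (if D ys then P x y * W ys else 0) else 0) = (if D ys then W (x # ys) else 0)"
   by (simp add: W_Cons)
 qed
 also have "\<dots> = (\<Sum>x'<n. if x' = x then (\<Sum>ys\<in>V s. if D ys then W (x' # ys) else 0) else 0)" using assms by simp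
 also have "\<dots> = (\<Sum>x'<n. \<Sum>ys\<in>V s. if x' = x \<and> D ys then W (x' # ys) else 0)"
  by (intro sum.cong) auto
 also have "\<dots> = (\<Sum>xs\<in>V (Suc s). if hd xs = x \<and> D (tl xs) then W xs else 0)"
  unfolding V_def sum_llists_Suc[of _ _ "Suc s"] by simp
 finally show ?thesis .
qed

abbreviation visits :: "nat list \<Rightarrow> nat" where "visits xs \<equiv> length (filter (\<lambda>x. x \<in> E) xs)"

lemma G_walks_if:
 "x < n \<Longrightarrow> z < n \<Longrightarrow> G s r x z = (\<Sum>xs\<in>V s. if hd xs = x \<and> last xs = z \<and> visits xs = r then W xs else 0)"
proof (induction s arbitrary: r x)
 case 0
 have "G 0 r x z = (\<Sum>y<n. if y = x then (if y = z \<and> visits [y] = r then 1 else 0) else 0)" using 0 by (cases "x = z") auto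
 also have "\<dots> = (\<Sum>y<n. if hd [y] = x \<and> last [y] = z \<and> visits [y] = r then W [y] else 0)"
  by (intro sum.cong) (auto simp: W_def)
 finally show ?case
  unfolding V_def sum_llists_Suc llists_0
  by (simp only: sum.insert finite.emptyI empty_iff not_False_eq_True sum.empty add_0_right)
next
 case (Suc s)
 let ?c = "if x \<in> E then 1 else 0 :: nat"
 have st: "mm n P (G s r') x z = (\<Sum>xs\<in>V (Suc s). if hd xs = x \<and> last xs = z \<and> visits xs = r' + ?c then W xs else 0)" for r'
 proof -
  have "mm n P (G s r') x z = (\<Sum>y<n. P x y * (\<Sum>ys\<in>V s. if hd ys = y \<and> (last ys = z \<and> visits ys = r') then W ys else 0))"
   unfolding mm_def using Suc by (intro sum.cong) auto
  also have "\<dots> = (\<Sum>xs\<in>V (Suc s). if hd xs = x \<and> (last (tl xs) = z \<and> visits (tl xs) = r') then W xs else 0)"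
   by (rule walks_Suc[OF Suc(2)])
  also have "\<dots> = (\<Sum>xs\<in>V (Suc s). if hd xs = x \<and> last xs = z \<and> visits xs = r' + ?c then W xs else 0)"
  proof (rule sum.cong[OF refl])
   fix xs assume "xs \<in> V (Suc s)"
   then obtain a b zs where "xs = a # b # zs" unfolding V_def llists_def by (auto simp: length_Suc_conv)
   then show "(if hd xs = x \<and> (last (tl xs) = z \<and> visits (tl xs) = r') then W xs else 0) = (if hd xs = x \<and> last xs = z \<and> visits xs = r' + ?c then W xs else 0)"
    by auto
  qed
  finally show ?thesis .
 qed
 show ?case
 proof (cases "x \<in> E \<and> r = 0")
  case True
  have "(\<Sum>xs\<in>V (Suc s). if hd xs = x \<and> last xs = z \<and> visits xs = r then W xs else 0) = 0"
  proof (rule sum.neutral, rule ballI)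
   fix xs assume "xs \<in> V (Suc s)"
   then obtain b zs where "xs = b # zs" unfolding V_def llists_def by (auto simp: length_Suc_conv)
   then show "(if hd xs = x \<and> last xs = z \<and> visits xs = r then W xs else 0) = 0" using True by auto
  qed
  then show ?thesis using True by simp
 next
  case False
  then have "G (Suc s) r x z = mm n P (G s (r - ?c)) x z" "r - ?c + ?c = r" by auto
  then show ?thesis using st by simp
 qed
qed

lemma G_walks:
 "x < n \<Longrightarrow> z < n \<Longrightarrow> G s r x z = (\<Sum>xs\<in>{xs\<in>V s. hd xs = x \<and> last xs = z \<and> visits xs = r}. W xs)"
 unfolding G_walks_if by (rule sum.inter_filter[symmetric]) simp

lemma G_sum: "x < n \<Longrightarrow> s + 2 \<le> R \<Longrightarrow> (\<Sum>r<R. G s r x z) = mpw n P s x z"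
proof (induction s arbitrary: R x)
 case 0
 have "(\<Sum>r<R. G 0 r x z) = (\<Sum>r<R. if (if x \<in> E then 1 else 0) = r then idm x z else 0)"
  by (intro sum.cong) (auto simp: idm_def)
 also have "\<dots> = idm x z" using 0 by (simp add: sum.delta)
 finally show ?case by simp
next
 case (Suc s)
 have st: "(\<Sum>r<R'. mm n P (G s r) x z) = mpw n P (Suc s) x z" if R': "s + 2 \<le> R'" for R'
 proof -
  have "(\<Sum>r<R'. mm n P (G s r) x z) = (\<Sum>y<n. P x y * (\<Sum>r<R'. G s r y z))"
   unfolding mm_def sum_distrib_left by (rule sum.swap)
  also have "\<dots> = (\<Sum>y<n. P x y * mpw n P s y z)" using Suc.IH R' by (intro sum.cong) auto
  finally show ?thesis by (simp add: mm_def)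
 qed
 obtain R' where R': "R = Suc R'" "s + 2 \<le> R'" using Suc(3) by (cases R) auto
 show ?case
 proof (cases "x \<in> E")
  case True
  have "(\<Sum>r<R. G (Suc s) r x z) = (\<Sum>r<R'. mm n P (G s r) x z)"
   unfolding R'(1) by (subst sum.lessThan_Suc_shift) (use True in simp)
  then show ?thesis using st R' by simp
 next
  case False
  then show ?thesis using st[of R] R' by simp
 qed
qed

lemma mm_dg_left: "x < n \<Longrightarrow> mm n (dg Z) A x z = (if x \<in> Z then A x z else 0)"
proof -
 assume "x < n"
 have "mm n (dg Z) A x z = (\<Sum>k<n. if x = k then (if x \<in> Z then A x z else 0) else 0)"
  unfolding mm_def dg_def by (intro sum.cong) auto
 then show ?thesis using \<open>x < n\<close> by simp
qed

lemma mm_dg_right: "z < n \<Longrightarrow> mm n A (dg Z) x z = (if z \<in> Z then A x z else 0)"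
proof -
 assume "z < n"
 have "mm n A (dg Z) x z = (\<Sum>k<n. if k = z then (if z \<in> Z then A x z else 0) else 0)"
  unfolding mm_def dg_def by (intro sum.cong) auto
 then show ?thesis using \<open>z < n\<close> by simp
qed

text \<open>Walks of length \<open>t\<close> whose first visit to \<open>E\<close> is at their end.
  The matrix \<open>X r k\<close> defined next is the rest of the walk: \<open>k\<close> further
  steps with \<open>r\<close> further visits after leaving the current point.\<close>

primrec Dm :: "nat \<Rightarrow> fmat" where
 "Dm 0 = dg E" |
 "Dm (Suc t) = (\<lambda>x z. if x \<in> E then 0 else mm n P (Dm t) x z)"

primrec X :: "nat \<Rightarrow> nat \<Rightarrow> fmat" where
 "X r 0 = (\<lambda>x z. if r = 0 \<and> x = z then 1 else 0)" |
 "X r (Suc k) = mm n P (G k r)"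

lemma mm_Dm_Suc: "mm n (Dm (Suc t)) A x z = (if x \<in> E then 0 else mm n P (mm n (Dm t) A) x z)"
proof (cases "x \<in> E")
 case True then show ?thesis by (simp add: mm_def)
next
 case False
 have "mm n (Dm (Suc t)) A x z = mm n (mm n P (Dm t)) A x z" using False by (intro mm_cong) auto
 then show ?thesis using False by (simp add: mm_assoc)
qed

lemma first_visit: "x < n \<Longrightarrow> G s (Suc r) x z = (\<Sum>t\<le>s. mm n (Dm t) (X r (s - t)) x z)"
proof (induction s arbitrary: x)
 case 0
 then show ?case by (auto simp: mm_dg_left)
next
 case (Suc s)
 have "(\<Sum>t\<le>Suc s. mm n (Dm t) (X r (Suc s - t)) x z) = mm n (dg E) (X r (Suc s)) x z + (\<Sum>t\<le>s. mm n (Dm (Suc t)) (X r (s - t)) x z)"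
  by (subst sum.atMost_Suc_shift) simp
 also have "\<dots> = G (Suc s) (Suc r) x z"
 proof (cases "x \<in> E")
  case True
  then show ?thesis unfolding mm_Dm_Suc using Suc(2) by (simp add: mm_dg_left)
 next
  case False
  have "(\<Sum>t\<le>s. mm n P (mm n (Dm t) (X r (s - t))) x z) = (\<Sum>y<n. P x y * (\<Sum>t\<le>s. mm n (Dm t) (X r (s - t)) y z))"
   unfolding mm_def[of n P] sum_distrib_left by (rule sum.swap)
  also have "\<dots> = (\<Sum>y<n. P x y * G s (Suc r) y z)" using Suc.IH by (intro sum.cong) auto
  also have "\<dots> = mm n P (G s (Suc r)) x z" by (simp add: mm_def)
  finally show ?thesis unfolding mm_Dm_Suc using Suc(2) False by (simp add: mm_dg_left)
 qed
 finally show ?case by simp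
qed

text \<open>Splitting off the step into \<open>E\<close> leaves a walk that avoids \<open>E\<close>,
  and puts \<open>P\<close> restricted to the columns in \<open>E\<close> at its right, where the
  constant part is small.\<close>

lemma Dm_G: "x < n \<Longrightarrow> Dm (Suc t) x z = mm n (G t 0) (mm n P (dg E)) x z"
proof (induction t arbitrary: x)
 case 0
 have "mm n (G 0 0) (mm n P (dg E)) x z = mm n (dg (- E)) (mm n P (dg E)) x z"
  by (intro mm_cong) (auto simp: dg_def)
 then show ?case using 0 by (simp add: mm_dg_left)
next
 case (Suc t)
 show ?case
 proof (cases "x \<in> E")
  case True
  then show ?thesis by (simp add: mm_def)
 next
  case False
  have "Dm (Suc (Suc t)) x z = mm n P (Dm (Suc t)) x z" using False by simp
  also have "\<dots> = mm n P (mm n (G t 0) (mm n P (dg E))) x z" using Suc.IH by (intro mm_cong) auto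
  also have "\<dots> = mm n (mm n P (G t 0)) (mm n P (dg E)) x z" by (simp add: mm_assoc)
  also have "\<dots> = mm n (G (Suc t) 0) (mm n P (dg E)) x z" using False by (intro mm_cong) auto
  finally show ?thesis .
 qed
qed

lemma W_le_power:
 assumes "set xs \<inter> E = {}"
 shows "W xs \<le> \<rho> ^ (length xs - 1)"
proof -
 have "W xs \<le> (\<Prod>k<length xs - 1. \<rho>)"
  unfolding W_def
 proof (intro prod_mono conjI P_nonneg)
  fix k assume "k \<in> {..<length xs - 1}"
  then have "xs ! Suc k \<in> set xs" by (intro nth_mem) auto
  then have "xs ! Suc k \<notin> E" using assms by blast
  then show "P (xs ! k) (xs ! Suc k) \<le> \<rho>" unfolding P_def by (rule Q_le)
 qed
 then show ?thesis by simp
qed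

definition Oc :: "nat set" where "Oc = {v. v < n \<and> (\<exists>cs. cycle cs \<and> hd cs = v)}"

end

section \<open>Paths with a loop\<close>

context walks
begin

abbreviation B :: "nat \<Rightarrow> fmat" where "B s \<equiv> Simp (ind \<sigma>) s"

lemma finite_pairs: "finite {p :: nat \<times> nat. fst p < snd p \<and> snd p \<le> s}"
 by (rule finite_subset[of _ "{..s} \<times> {..s}"]) auto

lemma loop_excess:
 assumes nt: "\<nexists>cs us z. tangle cs us z" and s: "s \<le> L" and xz: "x < n" "z < n"
 shows "B s x z \<le> G s 0 x z"
  "G s 0 x z - B s x z \<le> (\<Sum>p\<in>{p. fst p < snd p \<and> snd p \<le> s}. \<rho> ^ (snd p - fst p) * mm n (B (fst p)) (mm n (dg Oc) (B (s - snd p))) x z)"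
proof -
 let ?S = "{xs\<in>V s. hd xs = x \<and> last xs = z \<and> set xs \<inter> E = {}}"
 let ?N = "{xs\<in>?S. \<not> distinct xs}" and ?I = "{p :: nat \<times> nat. fst p < snd p \<and> snd p \<le> s}"
 have v0: "visits xs = 0 \<longleftrightarrow> set xs \<inter> E = {}" for xs by (auto simp: filter_empty_conv)
 have "G s 0 x z = (\<Sum>xs\<in>?S. W xs)" unfolding G_walks[OF xz] v0 by (rule sum.cong) auto
 also have "?S = {xs\<in>V s. hd xs = x \<and> last xs = z \<and> distinct xs \<and> set xs \<inter> E = {}} \<union> ?N" by blast
 also have "(\<Sum>xs\<in>\<dots>. W xs) = B s x z + (\<Sum>xs\<in>?N. W xs)"
  unfolding Simp_ind[OF xz] by (rule sum.union_disjoint) auto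
 finally have eq: "G s 0 x z = B s x z + (\<Sum>xs\<in>?N. W xs)" .
 then show "B s x z \<le> G s 0 x z" using sum_nonneg[of ?N W, OF W_nonneg] by simp
 define C where "C p = {xs\<in>?S. W xs \<noteq> 0 \<and> xs ! fst p = xs ! snd p \<and> distinct (take (Suc (fst p)) xs) \<and> distinct (drop (snd p) xs) \<and> xs ! fst p \<in> Oc}" for p :: "nat \<times> nat"
 have fC: "finite (C p)" for p unfolding C_def by simp
 have "(\<Sum>xs\<in>?N. W xs) \<le> (\<Sum>xs\<in>?N. \<Sum>p\<in>?I. if xs \<in> C p then W xs else 0)"
 proof (rule sum_mono)
  fix xs assume xs: "xs \<in> ?N"
  show "W xs \<le> (\<Sum>p\<in>?I. if xs \<in> C p then W xs else 0)"
  proof (cases "W xs = 0")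
   case False
   have l: "length xs = Suc s" "set xs \<subseteq> {..<n}" using xs unfolding V_def llists_def by auto
   have ar: "P (xs ! k) (xs ! Suc k) \<noteq> 0" if "k < s" for k using W_arc[OF False, of k] l that by simp
   have ninj: "\<not> inj_on (\<lambda>k. xs ! k) {..s}"
   proof
    assume "inj_on (\<lambda>k. xs ! k) {..s}"
    then have "distinct xs" unfolding distinct_conv_nth using l by (auto simp: inj_on_def less_Suc_eq_le)
    then show False using xs by blast
   qed
   obtain i j cs where ij: "i < j" "j \<le> s" "xs ! i = xs ! j" "inj_on (\<lambda>k. xs ! k) {..i}" "inj_on (\<lambda>k. xs ! k) {j..s}" "cycle cs" "hd cs = xs ! i"
    using loop_split[OF nt s, of "\<lambda>k. xs ! k", OF ar ninj] by blast
   have "distinct (take (Suc i) xs)"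
    unfolding distinct_conv_nth using ij(4) l ij(1,2) by (auto simp: inj_on_def less_Suc_eq_le)
   moreover have "distinct (drop j xs)"
    unfolding distinct_conv_nth
   proof (intro allI impI)
    fix a b assume ab: "a < length (drop j xs)" "b < length (drop j xs)" "a \<noteq> b"
    then have "j + a \<le> s" "j + b \<le> s" using l(1) ij(2) by simp_all
    then show "drop j xs ! a \<noteq> drop j xs ! b" using inj_onD[OF ij(5), of "j + a" "j + b"] ab l by auto
   qed
   moreover have "xs ! i \<in> set xs" using l ij(1,2) by (intro nth_mem) simp
   then have "xs ! i < n" using l(2) by blast
   then have "xs ! i \<in> Oc" using ij(6,7) unfolding Oc_def by blast
   ultimately have "xs \<in> C (i, j)" using xs False ij(3) unfolding C_def by auto
   moreover have "(i, j) \<in> ?I" using ij by simp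
   ultimately have "W xs = (\<Sum>p\<in>{(i, j)}. if xs \<in> C p then W xs else 0)" by simp
   also have "\<dots> \<le> (\<Sum>p\<in>?I. if xs \<in> C p then W xs else 0)"
    using \<open>(i, j) \<in> ?I\<close> by (intro sum_mono2 finite_pairs) (auto simp: W_nonneg)
   finally show ?thesis .
  qed (simp add: W_nonneg sum_nonneg)
 qed
 also have "\<dots> = (\<Sum>p\<in>?I. \<Sum>xs\<in>?N. if xs \<in> C p then W xs else 0)" by (rule sum.swap)
 also have "\<dots> \<le> (\<Sum>p\<in>?I. \<rho> ^ (snd p - fst p) * mm n (B (fst p)) (mm n (dg Oc) (B (s - snd p))) x z)"
 proof (rule sum_mono)
  fix p assume "p \<in> ?I"
  then obtain i j where p: "p = (i, j)" "i < j" "j \<le> s" by (cases p) auto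
  have len: "length xs = Suc s" "set xs \<subseteq> {..<n}" "xs \<in> ?S" "W xs \<noteq> 0" "xs ! i = xs ! j" if "xs \<in> C p" for xs
   using that unfolding C_def V_def llists_def p by auto
  let ?h = "\<lambda>xs. (take (Suc i) xs, drop j xs)" and ?g = "\<lambda>q. W (fst q) * W (snd q)"
  let ?A = "\<lambda>v. {xs\<in>V i. hd xs = x \<and> last xs = v \<and> distinct xs \<and> set xs \<inter> E = {}}"
  let ?A' = "\<lambda>v. {xs\<in>V (s - j). hd xs = v \<and> last xs = z \<and> distinct xs \<and> set xs \<inter> E = {}}"
  have w: "W xs \<le> \<rho> ^ (j - i) * ?g (?h xs)" if xs: "xs \<in> C p" for xs
  proof -
   have "W xs = W (take (Suc i) xs) * W (drop i xs)" by (rule W_split[of _ s]) (use p len[OF xs] in auto)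
   moreover have "W (drop i xs) = W (take (Suc (j - i)) (drop i xs)) * W (drop (j - i) (drop i xs))"
    by (rule W_split[of _ "s - i"]) (use p len[OF xs] in auto)
   moreover have "drop (j - i) (drop i xs) = drop j xs" using p by simp
   moreover have "W (take (Suc (j - i)) (drop i xs)) \<le> \<rho> ^ (j - i)"
   proof -
    have "set (take (Suc (j - i)) (drop i xs)) \<subseteq> set xs" by (meson order_trans set_drop_subset set_take_subset)
    then have "set (take (Suc (j - i)) (drop i xs)) \<inter> E = {}" using len(3)[OF xs] by blast
    then have "W (take (Suc (j - i)) (drop i xs)) \<le> \<rho> ^ (length (take (Suc (j - i)) (drop i xs)) - 1)" by (rule W_le_power)
    also have "length (take (Suc (j - i)) (drop i xs)) - 1 = j - i" using p len(1)[OF xs] by simp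
    finally show ?thesis .
   qed
   then have "W (take (Suc i) xs) * W (drop j xs) * W (take (Suc (j - i)) (drop i xs)) \<le> W (take (Suc i) xs) * W (drop j xs) * \<rho> ^ (j - i)"
    by (intro mult_left_mono mult_nonneg_nonneg W_nonneg)
   ultimately show ?thesis by (simp add: mult_ac)
  qed
  have inj: "inj_on ?h (C p)"
  proof (rule inj_onI)
   fix xs ys assume xs: "xs \<in> C p" and ys: "ys \<in> C p" and e: "?h xs = ?h ys"
   have t: "xs ! k = ys ! k" if "k \<le> i" for k
    using e that nth_take[of k "Suc i" xs] nth_take[of k "Suc i" ys] by auto
   have d: "xs ! k = ys ! k" if "j \<le> k" "k \<le> s" for k
    using e that nth_drop[of j xs "k - j"] nth_drop[of j ys "k - j"] len(1)[OF xs] len(1)[OF ys] p by auto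
   \<comment> \<open>Two loops of equal length at the same base coincide because there is no
     tangle.\<close>
   have m: "xs ! (i + k) = ys ! (i + k)" if k: "k \<le> j - i" for k
   proof (rule closed_walk_unique[OF nt, of "j - i" "\<lambda>k. ys ! (i + k)" "\<lambda>k. xs ! (i + k)"])
    show "0 < j - i" "j - i \<le> L" "k \<le> j - i" using p s k by auto
    show "P (ys ! (i + k)) (ys ! (i + Suc k)) \<noteq> 0" if "k < j - i" for k
     using W_arc[OF len(4)[OF ys], of "i + k"] len(1)[OF ys] that p by simp
    show "P (xs ! (i + k)) (xs ! (i + Suc k)) \<noteq> 0" if "k < j - i" for k
     using W_arc[OF len(4)[OF xs], of "i + k"] len(1)[OF xs] that p by simp
    show "ys ! (i + (j - i)) = ys ! (i + 0)" "xs ! (i + (j - i)) = xs ! (i + 0)" using len(5)[OF xs] len(5)[OF ys] p by auto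
    show "xs ! (i + 0) = ys ! (i + 0)" using t[of i] by simp
   qed
   show "xs = ys"
   proof (rule nth_equalityI)
    fix k assume "k < length xs"
    then have "k \<le> s" using len(1)[OF xs] by simp
    then show "xs ! k = ys ! k" using t[of k] d[of k] m[of "k - i"] by (cases "k \<le> i"; cases "j \<le> k") auto
   qed (simp add: len(1)[OF xs] len(1)[OF ys])
  qed
  have img: "?h ` C p \<subseteq> (\<Union>v\<in>Oc. ?A v \<times> ?A' v)"
  proof
   fix q assume "q \<in> ?h ` C p"
   then obtain xs where xs: "xs \<in> C p" "q = ?h xs" by blast
   have l: "length xs = Suc s" "hd xs = x" "last xs = z" "set xs \<subseteq> {..<n}" "set xs \<inter> E = {}"
    using len[OF xs(1)] by auto
   have a: "take (Suc i) xs \<in> ?A (xs ! i)"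
   proof -
    have "set (take (Suc i) xs) \<subseteq> set xs" by (rule set_take_subset)
    moreover have "last (take (Suc i) xs) = xs ! i" using l p by (simp add: take_Suc_conv_app_nth)
    moreover have "hd (take (Suc i) xs) = x" using l by (cases xs) auto
    ultimately show ?thesis using xs(1) l p unfolding C_def V_def llists_def by auto
   qed
   have b: "drop j xs \<in> ?A' (xs ! i)"
   proof -
    have "set (drop j xs) \<subseteq> set xs" by (rule set_drop_subset)
    moreover have "hd (drop j xs) = xs ! i" using l p len(5)[OF xs(1)] by (simp add: hd_drop_conv_nth)
    moreover have "last (drop j xs) = z" using l p by simp
    moreover have "length (drop j xs) = Suc (s - j)" using l p by simp
    ultimately show ?thesis using xs(1) l p unfolding C_def V_def llists_def by auto
   qed
   have "xs ! i \<in> Oc" using xs(1) unfolding C_def p fst_conv by blast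
   then show "q \<in> (\<Union>v\<in>Oc. ?A v \<times> ?A' v)" unfolding xs(2) using a b by blast
  qed
  have fO: "finite Oc" unfolding Oc_def by simp
  have "(\<Sum>xs\<in>?N. if xs \<in> C p then W xs else 0) = (\<Sum>xs\<in>{xs\<in>?N. xs \<in> C p}. W xs)"
   by (rule sum.inter_filter[symmetric]) simp
  also have "\<dots> \<le> (\<Sum>xs\<in>C p. W xs)" by (rule sum_mono2) (auto simp: fC W_nonneg)
  also have "\<dots> \<le> (\<Sum>xs\<in>C p. \<rho> ^ (j - i) * ?g (?h xs))" by (rule sum_mono) (rule w)
  also have "\<dots> = \<rho> ^ (j - i) * (\<Sum>xs\<in>C p. ?g (?h xs))" by (rule sum_distrib_left[symmetric])
  also have "(\<Sum>xs\<in>C p. ?g (?h xs)) = (\<Sum>q\<in>?h ` C p. ?g q)" by (simp only: sum.reindex[OF inj] o_def)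
  also have "\<dots> \<le> (\<Sum>q\<in>(\<Union>v\<in>Oc. ?A v \<times> ?A' v). ?g q)"
  proof (rule sum_mono2)
   show "finite (\<Union>v\<in>Oc. ?A v \<times> ?A' v)" using fO by simp
   show "?h ` C p \<subseteq> (\<Union>v\<in>Oc. ?A v \<times> ?A' v)" using img by blast
  qed (simp add: W_nonneg)
  also have "\<dots> \<le> (\<Sum>v\<in>Oc. \<Sum>q\<in>?A v \<times> ?A' v. ?g q)"
  proof -
   have "(\<Sum>q\<in>(\<Union>v\<in>Oc. ?A v \<times> ?A' v). ?g q) = (\<Sum>v\<in>Oc. \<Sum>q\<in>?A v \<times> ?A' v. ?g q)"
    by (rule sum.UNION_disjoint) (use fO in auto)
   then show ?thesis by simp
  qed
  also have "\<dots> = (\<Sum>v\<in>Oc. B i x v * B (s - j) v z)"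
  proof (rule sum.cong[OF refl])
   fix v assume "v \<in> Oc"
   then have v: "v < n" unfolding Oc_def by simp
   show "(\<Sum>q\<in>?A v \<times> ?A' v. ?g q) = B i x v * B (s - j) v z"
    unfolding Simp_ind[OF xz(1) v] Simp_ind[OF v xz(2)] sum_product by (simp add: sum.cartesian_product split_beta)
  qed
  also have "\<dots> = (\<Sum>v<n. B i x v * mm n (dg Oc) (B (s - j)) v z)"
   by (rule sum.mono_neutral_cong_left) (auto simp: mm_dg_left Oc_def)
  finally show "(\<Sum>xs\<in>?N. if xs \<in> C p then W xs else 0) \<le> \<rho> ^ (snd p - fst p) * mm n (B (fst p)) (mm n (dg Oc) (B (s - snd p))) x z"
   unfolding p using rho by (simp add: mm_def)
 qed
 finally show "G s 0 x z - B s x z \<le> (\<Sum>p\<in>?I. \<rho> ^ (snd p - fst p) * mm n (B (fst p)) (mm n (dg Oc) (B (s - snd p))) x z)"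
  using eq by simp
qed

end

lemma opb_cmult: "0 \<le> c \<Longrightarrow> opb n A K \<Longrightarrow> opb n (\<lambda>i j. c * A i j) (c * K)"
proof -
 assume c: "0 \<le> c" and A: "opb n A K"
 have "opb n (mm n (\<lambda>i j. if i = j then c else 0) A) (c * K)"
  using opb_mm[OF opb_diag[of c n "\<lambda>_. c"] A] c by simp
 then show ?thesis
 proof (rule opb_cong[rotated])
  fix i j assume "i < n" "j < n"
  have "mm n (\<lambda>i j. if i = j then c else 0) A i j = (\<Sum>k<n. if i = k then c * A i j else 0)"
   unfolding mm_def by (rule sum.cong) auto
  then show "mm n (\<lambda>i j. if i = j then c else 0) A i j = c * A i j" using \<open>i < n\<close> by simp
 qed
qed

lemma opb_dg: "opb n (dg Z) 1"
 unfolding dg_def by (rule opb_cong[OF _ opb_diag[of 1 n "\<lambda>i. if i \<in> Z then 1 else 0"]]) auto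

text \<open>A matrix with \<open>card Z\<close> constant columns or rows has Frobenius norm
  \<open>sqrt (card Z / n)\<close>. This makes \<open>J / n\<close> harmless next to a small
  set.\<close>

lemma opb_cols:
 assumes n: "0 < n" and Z: "Z \<subseteq> {..<n}" "real (card Z) \<le> \<eta>\<^sup>2 * real n" "0 \<le> \<eta>"
 shows "opb n (\<lambda>x z. if z \<in> Z then 1 / real n else 0) \<eta>" "opb n (\<lambda>x z. if x \<in> Z then 1 / real n else 0) \<eta>"
proof -
 have s: "(\<Sum>z<n. (if z \<in> Z then 1 / real n else 0)\<^sup>2) = card Z * (1 / real n)\<^sup>2"
 proof -
  have "(\<Sum>z<n. (if z \<in> Z then 1 / real n else 0)\<^sup>2) = (\<Sum>z\<in>Z. (1 / real n)\<^sup>2)"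
   by (rule sum.mono_neutral_cong_right) (use Z in auto)
  then show ?thesis by simp
 qed
 have le: "sqrt (real n * (real (card Z) * (1 / real n)\<^sup>2)) \<le> \<eta>"
 proof (rule real_le_lsqrt)
  show "real n * (real (card Z) * (1 / real n)\<^sup>2) \<le> \<eta>\<^sup>2" using Z n by (simp add: power2_eq_square field_simps)
 qed (use Z in auto)
 have "(\<Sum>x<n. \<Sum>z<n. (if z \<in> Z then 1 / real n else 0)\<^sup>2) = real n * (real (card Z) * (1 / real n)\<^sup>2)" unfolding s by simp
 then show "opb n (\<lambda>x z. if z \<in> Z then 1 / real n else 0) \<eta>"
  using le by (intro opb_le[OF opb_frob]) (simp only:)
 have "(\<Sum>x<n. \<Sum>z<n. (if x \<in> Z then 1 / real n else 0)\<^sup>2) = (\<Sum>x<n. real n * (if x \<in> Z then 1 / real n else 0)\<^sup>2)" by simp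
 also have "\<dots> = real n * (real (card Z) * (1 / real n)\<^sup>2)" unfolding sum_distrib_left[symmetric] s ..
 finally show "opb n (\<lambda>x z. if x \<in> Z then 1 / real n else 0) \<eta>"
  using le by (intro opb_le[OF opb_frob]) (simp only:)
qed

context walks
begin

lemma dg_idem: "x < n \<Longrightarrow> mm n (dg Z) (mm n (dg Z) A) x z = mm n (dg Z) A x z"
 by (simp add: mm_dg_left)

lemma mm_dg_insert: "mm n (mm n A (dg Z)) (mm n (dg Z) C) x z = mm n A (mm n (dg Z) C) x z"
proof -
 have "mm n (mm n A (dg Z)) (mm n (dg Z) C) x z = mm n A (mm n (dg Z) (mm n (dg Z) C)) x z" by (simp add: mm_assoc)
 also have "\<dots> = mm n A (mm n (dg Z) C) x z" by (intro mm_cong refl dg_idem)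
 finally show ?thesis .
qed

text \<open>The deterministic part works on the event described by these assumptions. As
  \<open>\<eta> \<le> \<rho> ^ L\<close>, every error of size \<open>\<eta>\<close> is absorbed by
  \<open>K * \<rho> ^ s\<close> for all \<open>s \<le> L\<close>.\<close>

context
 fixes K \<eta> :: real and r0 :: nat
 assumes K1: "1 \<le> K"
  and H1: "\<And>s. 0 < s \<Longrightarrow> s \<le> L \<Longrightarrow> opb n (Simp (cen \<sigma>) s) (K * \<rho> ^ s)"
  and H2: "\<And>s. 0 < s \<Longrightarrow> s \<le> L \<Longrightarrow> 2 ^ s / n * bad_mass s \<le> \<eta>\<^sup>2"
  and eta: "0 \<le> \<eta>" "\<eta> \<le> \<rho> ^ L"
  and H3: "real (card E) \<le> \<eta>\<^sup>2 * n" "real (card Oc) \<le> \<eta>\<^sup>2 * n"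
  and H4: "\<nexists>cs us z. tangle cs us z"
  and H5: "\<And>cs. cycle cs \<Longrightarrow> hd cs \<notin> E"
  and H6: "\<And>xs. distinct xs \<Longrightarrow> successively (\<lambda>x z. P x z \<noteq> 0) xs \<Longrightarrow> length xs \<le> Suc L \<Longrightarrow> visits xs < r0"
begin

lemma rho_pow: "s \<le> L \<Longrightarrow> \<eta> \<le> K * \<rho> ^ s" "0 < \<rho> ^ s"
proof -
 assume "s \<le> L"
 then have "\<rho> ^ L \<le> \<rho> ^ s" using rho by (intro power_decreasing) auto
 also have "\<dots> \<le> K * \<rho> ^ s" using K1 rho by simp
 finally show "\<eta> \<le> K * \<rho> ^ s" using eta by simp
qed (use rho in simp)

abbreviation Y :: "nat \<Rightarrow> fmat" where "Y s \<equiv> (\<lambda>x z. B s x z - 1 / n - Simp (cen \<sigma>) s x z)"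

lemma opb_Y: "0 < s \<Longrightarrow> s \<le> L \<Longrightarrow> opb n (Y s) \<eta>"
 by (rule remainder_opb[OF _ H2 eta(1)])

lemma B_0: "B 0 x z = dg (- E) x z"
proof -
 have "{es \<in> Lst 0. st es z = x \<and> good es z} = (if z = x \<and> z \<notin> E then {[]} else {})"
  unfolding Lst_def good_def by auto
 then show ?thesis unfolding Simp_def dg_def by auto
qed

text \<open>\<open>B s\<close> is the centred matrix plus \<open>J / n\<close> plus a small error.
  The norm of \<open>J / n\<close> is not small, so \<open>B s\<close> is estimated only next to a
  factor \<open>R\<close> for which \<open>J R / n\<close> is; the second assumption states
  this.\<close>

lemma opb_B_right:
 assumes R: "opb n R 1" "opb n (\<lambda>x z. (\<Sum>k<n. R k z) / n) \<eta>" and s: "s \<le> L"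
 shows "opb n (mm n (B s) R) (3 * K * \<rho> ^ s)"
proof (cases "s = 0")
 case True
 have "opb n (mm n (B 0) R) (1 * 1)"
  unfolding B_0 by (rule opb_mm[OF opb_dg R(1)])
 then show ?thesis using True K1 by (auto intro: opb_le)
next
 case False
 have "opb n (\<lambda>x z. mm n (Simp (cen \<sigma>) s) R x z + (\<Sum>k<n. R k z) / n + mm n (Y s) R x z) (K * \<rho> ^ s * 1 + \<eta> + \<eta> * 1)"
  by (intro opb_add opb_mm R opb_Y H1) (use False s in auto)
 then have "opb n (mm n (B s) R) (K * \<rho> ^ s * 1 + \<eta> + \<eta> * 1)"
  by (rule opb_cong[rotated]) (simp add: mm_def algebra_simps sum.distrib sum_subtractf sum_divide_distrib)
 then show ?thesis by (rule opb_le) (use rho_pow(1)[OF s] in simp)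
qed

lemma opb_B_left:
 assumes R: "opb n R 1" "opb n (\<lambda>x z. (\<Sum>k<n. R x k) / n) \<eta>" and s: "s \<le> L"
 shows "opb n (mm n R (B s)) (3 * K * \<rho> ^ s)"
proof (cases "s = 0")
 case True
 have "opb n (mm n R (B 0)) (1 * 1)"
  unfolding B_0 by (rule opb_mm[OF R(1) opb_dg])
 then show ?thesis using True K1 by (auto intro: opb_le)
next
 case False
 have "opb n (\<lambda>x z. mm n R (Simp (cen \<sigma>) s) x z + (\<Sum>k<n. R x k) / n + mm n R (Y s) x z) (1 * (K * \<rho> ^ s) + \<eta> + 1 * \<eta>)"
  by (intro opb_add opb_mm R opb_Y H1) (use False s in auto)
 then have "opb n (mm n R (B s)) (1 * (K * \<rho> ^ s) + \<eta> + 1 * \<eta>)"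
  by (rule opb_cong[rotated]) (simp add: mm_def algebra_simps sum.distrib sum_subtractf sum_divide_distrib)
 then show ?thesis by (rule opb_le) (use rho_pow(1)[OF s] in simp)
qed

lemma sum_dg: "z < n \<Longrightarrow> (\<Sum>k<n. dg Z k z) = (if z \<in> Z then 1 else 0)" "x < n \<Longrightarrow> (\<Sum>k<n. dg Z x k) = (if x \<in> Z then 1 else 0)"
proof -
 assume "z < n"
 have "(\<Sum>k<n. dg Z k z) = (\<Sum>k<n. if k = z then (if z \<in> Z then 1 else 0) else 0)" unfolding dg_def by (rule sum.cong) auto
 then show "(\<Sum>k<n. dg Z k z) = (if z \<in> Z then 1 else 0)" using \<open>z < n\<close> by simp
next
 assume "x < n"
 have "(\<Sum>k<n. dg Z x k) = (\<Sum>k<n. if x = k then (if x \<in> Z then 1 else 0) else 0)" unfolding dg_def by (rule sum.cong) auto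
 then show "(\<Sum>k<n. dg Z x k) = (if x \<in> Z then 1 else 0)" using \<open>x < n\<close> by simp
qed

lemma Oc_sub: "Oc \<subseteq> {..<n}" unfolding Oc_def by auto

lemma opb_ends:
 assumes s: "s \<le> L"
 shows "opb n (mm n (B s) (dg Oc)) (3 * K * \<rho> ^ s)" "opb n (mm n (dg Oc) (B s)) (3 * K * \<rho> ^ s)"
  "opb n (mm n (B s) (mm n P (dg E))) (3 * K * \<rho> ^ s)" "opb n (mm n (mm n (dg E) P) (B s)) (3 * K * \<rho> ^ s)"
proof -
 note cO = opb_cols[OF n_pos Oc_sub H3(2) eta(1)] and cE = opb_cols[OF n_pos E_sub H3(1) eta(1)]
 show "opb n (mm n (B s) (dg Oc)) (3 * K * \<rho> ^ s)"
  by (rule opb_B_right[OF opb_dg opb_cong[OF _ cO(1)] s]) (simp add: sum_dg)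
 show "opb n (mm n (dg Oc) (B s)) (3 * K * \<rho> ^ s)"
  by (rule opb_B_left[OF opb_dg opb_cong[OF _ cO(2)] s]) (simp add: sum_dg)
 have PE: "opb n (mm n P (dg E)) 1" using opb_mm[OF opb_P opb_dg] by simp
 have EP: "opb n (mm n (dg E) P) 1" using opb_mm[OF opb_dg opb_P] by simp
 have "(\<Sum>k<n. mm n P (dg E) k z) = (if z \<in> E then 1 else 0)" if "z < n" for z
  using that P_col[of z] by (cases "z \<in> E") (simp_all add: mm_dg_right)
 then show "opb n (mm n (B s) (mm n P (dg E))) (3 * K * \<rho> ^ s)"
  by (intro opb_B_right[OF PE opb_cong[OF _ cE(1)] s]) simp
 have "(\<Sum>k<n. mm n (dg E) P x k) = (if x \<in> E then 1 else 0)" if "x < n" for x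
  using that P_row[of x] by (cases "x \<in> E") (simp_all add: mm_dg_left)
 then show "opb n (mm n (mm n (dg E) P) (B s)) (3 * K * \<rho> ^ s)"
  by (intro opb_B_left[OF EP opb_cong[OF _ cE(2)] s]) simp
qed

text \<open>\<open>\<gamma>\<close> covers one stretch between visits to \<open>E\<close>, with at
  most one loop: twice the constant of \<open>opb_excess\<close>, which leaves room for the term
  \<open>3 * K\<close>. \<open>q\<close> is the price of a visit: the choice of its time, one more
  stretch, and the steps into and out of \<open>E\<close>, which are bounded by 1 instead of
  \<open>\<rho>\<close>.\<close>

definition \<gamma> :: real where "\<gamma> = 18 * (real L + 1)\<^sup>2 * K\<^sup>2"
definition q :: real where "q = (real L + 1) * \<gamma> / \<rho>\<^sup>2"

lemma gamma_ge: "9 * (real L + 1)\<^sup>2 * K\<^sup>2 + 3 * K \<le> \<gamma>" "1 \<le> \<gamma>" "1 \<le> q"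
proof -
 have a: "K \<le> K\<^sup>2" "1 \<le> (real L + 1)\<^sup>2" using K1 by (simp add: power2_eq_square mult_le_cancel_left1) (rule one_le_power, simp)
 have "3 * K \<le> 9 * ((real L + 1)\<^sup>2 * K\<^sup>2)"
 proof -
  have "1 * K\<^sup>2 \<le> (real L + 1)\<^sup>2 * K\<^sup>2" using a by (intro mult_right_mono) auto
  then show ?thesis using a K1 by linarith
 qed
 then show g: "9 * (real L + 1)\<^sup>2 * K\<^sup>2 + 3 * K \<le> \<gamma>" unfolding \<gamma>_def by (simp add: mult.assoc)
 have "0 \<le> 9 * (real L + 1)\<^sup>2 * K\<^sup>2" by simp
 then show g1: "1 \<le> \<gamma>" using g K1 by linarith
 have "\<rho>\<^sup>2 \<le> 1" using rho by (simp add: power_le_one)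
 moreover have "1 \<le> (real L + 1) * \<gamma>" using g1 mult_mono[of 1 "real L + 1" 1 \<gamma>] by simp
 ultimately show "1 \<le> q" unfolding q_def using rho by (simp add: le_divide_eq)
qed

lemma opb_excess:
 assumes s: "s \<le> L"
 shows "opb n (\<lambda>x z. G s 0 x z - B s x z) (9 * (real L + 1)\<^sup>2 * K\<^sup>2 * \<rho> ^ s)"
proof -
 let ?I = "{p :: nat \<times> nat. fst p < snd p \<and> snd p \<le> s}"
 let ?A = "\<lambda>p. mm n (B (fst p)) (mm n (dg Oc) (B (s - snd p)))"
 have "opb n (\<lambda>x z. \<Sum>p\<in>?I. \<rho> ^ (snd p - fst p) * ?A p x z) (\<Sum>p\<in>?I. 9 * K\<^sup>2 * \<rho> ^ s)"
 proof (rule opb_sum[OF finite_pairs])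
  fix p assume p: "p \<in> ?I"
  then have pL: "fst p \<le> L" "s - snd p \<le> L" using s by auto
  have "opb n (mm n (mm n (B (fst p)) (dg Oc)) (mm n (dg Oc) (B (s - snd p)))) (3 * K * \<rho> ^ fst p * (3 * K * \<rho> ^ (s - snd p)))"
   by (rule opb_mm[OF opb_ends(1)[OF pL(1)] opb_ends(2)[OF pL(2)]])
  then have "opb n (?A p) (3 * K * \<rho> ^ fst p * (3 * K * \<rho> ^ (s - snd p)))"
   by (rule opb_cong[rotated]) (rule mm_dg_insert)
  then have h: "opb n (\<lambda>x z. \<rho> ^ (snd p - fst p) * ?A p x z) (\<rho> ^ (snd p - fst p) * (3 * K * \<rho> ^ fst p * (3 * K * \<rho> ^ (s - snd p))))"
   by (rule opb_cmult[rotated]) (use rho in simp)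
  have e1: "\<rho> ^ (snd p - fst p) * (3 * K * \<rho> ^ fst p * (3 * K * \<rho> ^ (s - snd p))) = 9 * K\<^sup>2 * (\<rho> ^ (snd p - fst p) * \<rho> ^ fst p * \<rho> ^ (s - snd p))"
   by (simp add: power2_eq_square)
  have e2: "\<rho> ^ (snd p - fst p) * \<rho> ^ fst p * \<rho> ^ (s - snd p) = \<rho> ^ s"
   using p by (simp add: power_add[symmetric])
  show "opb n (\<lambda>x z. \<rho> ^ (snd p - fst p) * ?A p x z) (9 * K\<^sup>2 * \<rho> ^ s)" using h unfolding e1 e2 .
 qed
 then have "opb n (\<lambda>x z. G s 0 x z - B s x z) (\<Sum>p\<in>?I. 9 * K\<^sup>2 * \<rho> ^ s)"
  by (rule opb_mono[rotated]) (use loop_excess[OF H4 s] in auto)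
 moreover have "(\<Sum>p\<in>?I. 9 * K\<^sup>2 * \<rho> ^ s) \<le> 9 * (real L + 1)\<^sup>2 * K\<^sup>2 * \<rho> ^ s"
 proof -
  have "card ?I \<le> card ({..s} \<times> {..s})" by (rule card_mono) auto
  then have "card ?I \<le> (s + 1) * (s + 1)" by simp
  also have "\<dots> \<le> (L + 1) * (L + 1)" using s by (intro mult_le_mono) auto
  finally have "real (card ?I) \<le> real ((L + 1) * (L + 1))" by (rule of_nat_mono)
  then have "real (card ?I) \<le> (real L + 1)\<^sup>2" by (simp add: power2_eq_square algebra_simps)
  then have "real (card ?I) * (9 * K\<^sup>2 * \<rho> ^ s) \<le> (real L + 1)\<^sup>2 * (9 * K\<^sup>2 * \<rho> ^ s)"
   by (rule mult_right_mono) (use rho in simp)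
  then show ?thesis by (simp add: mult_ac)
 qed
 ultimately show ?thesis by (rule opb_le)
qed

lemma opb_G0_ends:
 assumes s: "s \<le> L"
 shows "opb n (mm n (G s 0) (mm n P (dg E))) (\<gamma> * \<rho> ^ s)" "opb n (mm n (mm n (dg E) P) (G s 0)) (\<gamma> * \<rho> ^ s)"
proof -
 let ?F = "\<lambda>x z. G s 0 x z - B s x z" and ?c = "9 * (real L + 1)\<^sup>2 * K\<^sup>2 * \<rho> ^ s"
 have PE: "opb n (mm n P (dg E)) 1" using opb_mm[OF opb_P opb_dg] by simp
 have EP: "opb n (mm n (dg E) P) 1" using opb_mm[OF opb_dg opb_P] by simp
 have le: "?c + 3 * K * \<rho> ^ s \<le> \<gamma> * \<rho> ^ s"
  using mult_right_mono[OF gamma_ge(1), of "\<rho> ^ s"] rho by (simp add: distrib_right)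
 have "opb n (\<lambda>x z. mm n ?F (mm n P (dg E)) x z + mm n (B s) (mm n P (dg E)) x z) (?c * 1 + 3 * K * \<rho> ^ s)"
  by (rule opb_add[OF opb_mm[OF opb_excess[OF s] PE] opb_ends(3)[OF s]])
 then have "opb n (mm n (G s 0) (mm n P (dg E))) (?c * 1 + 3 * K * \<rho> ^ s)"
  by (rule opb_cong[rotated]) (simp add: mm_def[of n ?F] mm_def[of n "B s"] mm_def[of n "G s 0"] sum.distrib[symmetric] algebra_simps)
 then show "opb n (mm n (G s 0) (mm n P (dg E))) (\<gamma> * \<rho> ^ s)" by (rule opb_le) (use le in simp)
 have "opb n (\<lambda>x z. mm n (mm n (dg E) P) ?F x z + mm n (mm n (dg E) P) (B s) x z) (1 * ?c + 3 * K * \<rho> ^ s)"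
  by (rule opb_add[OF opb_mm[OF EP opb_excess[OF s]] opb_ends(4)[OF s]])
 then have "opb n (mm n (mm n (dg E) P) (G s 0)) (1 * ?c + 3 * K * \<rho> ^ s)"
  by (rule opb_cong[rotated]) (simp add: mm_def[of n "mm n (dg E) P"] sum.distrib[symmetric] algebra_simps)
 then show "opb n (mm n (mm n (dg E) P) (G s 0)) (\<gamma> * \<rho> ^ s)" by (rule opb_le) (use le in simp)
qed

text \<open>The walk is cut at its first visit to \<open>E\<close>. The projection
  \<open>dg E\<close> at the cut is idempotent, so it can serve both factors. The assumption has
  \<open>dg E\<close> in front because for \<open>r = 0\<close> the matrix \<open>G k 0\<close>
  still contains the constant part, which only this projection makes small.\<close>

lemma opb_G_step:
 assumes A: "\<And>k. k \<le> L \<Longrightarrow> opb n (mm n (dg E) (mm n P (G k r))) (\<gamma> * q ^ r * \<rho> ^ k)" and s: "s \<le> L"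
 shows "opb n (G s (Suc r)) (\<gamma> * q ^ Suc r * \<rho> ^ s)"
proof -
 let ?xe = "\<lambda>k. \<gamma> * q ^ r * \<rho> ^ k / \<rho>"
 have g1: "1 \<le> \<gamma> * q ^ r" using gamma_ge mult_mono[of 1 \<gamma> 1 "q ^ r"] one_le_power[of q r] by simp
 have X: "opb n (mm n (dg E) (X r k)) (?xe k)" if k: "k \<le> L" for k
 proof (cases k)
  case 0
  have "opb n (X r 0) 1"
   by (rule opb_cong[OF _ opb_diag[of 1 n "\<lambda>i. if r = 0 then 1 else 0"]]) auto
  then have "opb n (mm n (dg E) (X r 0)) (1 * 1)" by (rule opb_mm[OF opb_dg])
  moreover have "1 * 1 \<le> ?xe 0" using g1 rho by (simp add: le_divide_eq)
  ultimately show ?thesis unfolding 0 by (rule opb_le)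
 next
  case (Suc j)
  have "\<gamma> * q ^ r * \<rho> ^ j = ?xe (Suc j)" using rho by simp
  then show ?thesis using A[of j] k unfolding Suc X.simps by simp
 qed
 have T: "opb n (mm n (Dm t) (X r (s - t))) (\<gamma> * q ^ r * (\<gamma> / \<rho>\<^sup>2) * \<rho> ^ s)" if t: "t \<le> s" for t
 proof (cases t)
  case 0
  have "?xe s * 1 \<le> ?xe s * (\<gamma> / \<rho>)" using g1 rho gamma_ge(2) by (intro mult_left_mono) (auto simp: le_divide_eq)
  then have "?xe s \<le> \<gamma> * q ^ r * (\<gamma> / \<rho>\<^sup>2) * \<rho> ^ s" by (simp add: power2_eq_square mult_ac)
  then show ?thesis unfolding 0 using X[OF s] by (auto intro: opb_le)
 next
  case (Suc t')
  have "opb n (mm n (mm n (G t' 0) (mm n P (dg E))) (mm n (dg E) (X r (s - t)))) (\<gamma> * \<rho> ^ t' * ?xe (s - t))"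
   by (rule opb_mm[OF opb_G0_ends(1) X]) (use t s Suc in auto)
  then have "opb n (mm n (Dm t) (X r (s - t))) (\<gamma> * \<rho> ^ t' * ?xe (s - t))"
  proof (rule opb_cong[rotated])
   fix x z assume x: "x < n" "z < n"
   have "mm n (mm n (G t' 0) (mm n P (dg E))) (mm n (dg E) (X r (s - t))) x z = mm n (mm n (G t' 0) P) (mm n (dg E) (X r (s - t))) x z"
    unfolding mm_assoc[symmetric, of n "G t' 0" P "dg E"] by (rule mm_dg_insert)
   also have "\<dots> = mm n (mm n (G t' 0) (mm n P (dg E))) (X r (s - t)) x z" by (simp add: mm_assoc)
   also have "\<dots> = mm n (Dm t) (X r (s - t)) x z"
    unfolding Suc using x by (intro mm_cong Dm_G[symmetric] refl)
   finally show "mm n (mm n (G t' 0) (mm n P (dg E))) (mm n (dg E) (X r (s - t))) x z = mm n (Dm t) (X r (s - t)) x z" .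
  qed
  moreover have "\<gamma> * \<rho> ^ t' * ?xe (s - t) = \<gamma> * q ^ r * (\<gamma> / \<rho>\<^sup>2) * \<rho> ^ s"
  proof -
   have "\<rho> ^ s = \<rho> * \<rho> ^ t' * \<rho> ^ (s - t)" using t Suc by (simp add: power_add[symmetric] power_Suc[symmetric] del: power_Suc)
   then show ?thesis using rho by (simp add: power2_eq_square)
  qed
  ultimately show ?thesis by simp
 qed
 have "opb n (\<lambda>x z. \<Sum>t\<le>s. mm n (Dm t) (X r (s - t)) x z) (\<Sum>t\<le>s. \<gamma> * q ^ r * (\<gamma> / \<rho>\<^sup>2) * \<rho> ^ s)"
  by (rule opb_sum) (use T in auto)
 then have "opb n (G s (Suc r)) (\<Sum>t\<le>s. \<gamma> * q ^ r * (\<gamma> / \<rho>\<^sup>2) * \<rho> ^ s)"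
  by (rule opb_cong[rotated]) (simp add: first_visit)
 moreover have "(\<Sum>t\<le>s. \<gamma> * q ^ r * (\<gamma> / \<rho>\<^sup>2) * \<rho> ^ s) \<le> \<gamma> * q ^ Suc r * \<rho> ^ s"
 proof -
  have "(\<Sum>t\<le>s. \<gamma> * q ^ r * (\<gamma> / \<rho>\<^sup>2) * \<rho> ^ s) = (real s + 1) * (\<gamma> * q ^ r * (\<gamma> / \<rho>\<^sup>2) * \<rho> ^ s)" by simp
  also have "\<dots> \<le> (real L + 1) * (\<gamma> * q ^ r * (\<gamma> / \<rho>\<^sup>2) * \<rho> ^ s)"
   using s g1 gamma_ge rho by (intro mult_right_mono mult_nonneg_nonneg) auto
  also have "\<dots> = \<gamma> * q ^ Suc r * \<rho> ^ s" unfolding power_Suc q_def[symmetric] by (simp add: q_def)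
  finally show ?thesis .
 qed
 ultimately show ?thesis by (rule opb_le)
qed

lemma opb_G: "s \<le> L \<Longrightarrow> opb n (G s (Suc r)) (\<gamma> * q ^ Suc r * \<rho> ^ s)"
proof (induction r arbitrary: s)
 case 0
 show ?case
 proof (rule opb_G_step)
  fix k assume "k \<le> L"
  then show "opb n (mm n (dg E) (mm n P (G k 0))) (\<gamma> * q ^ 0 * \<rho> ^ k)" using opb_G0_ends(2)[of k] by (simp add: mm_assoc)
 qed (rule 0)
next
 case (Suc r)
 show ?case
 proof (rule opb_G_step)
  fix k assume "k \<le> L"
  then have "opb n (mm n (dg E) (mm n P (G k (Suc r)))) (1 * (1 * (\<gamma> * q ^ Suc r * \<rho> ^ k)))"
   by (intro opb_mm opb_dg opb_P Suc.IH)
  then show "opb n (mm n (dg E) (mm n P (G k (Suc r)))) (\<gamma> * q ^ Suc r * \<rho> ^ k)" by simp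
 qed (rule Suc.prems)
qed

text \<open>Loop erasure turns a walk with many visits to \<open>E\<close> into a simple one with
  the same visits, which \<open>H6\<close> excludes.\<close>

lemma G_zero: "s \<le> L \<Longrightarrow> r0 \<le> r \<Longrightarrow> x < n \<Longrightarrow> z < n \<Longrightarrow> G s r x z = 0"
proof -
 assume s: "s \<le> L" "r0 \<le> r" and xz: "x < n" "z < n"
 show ?thesis
  unfolding G_walks[OF xz]
 proof (rule sum.neutral, rule ballI, rule ccontr)
  fix xs assume xs: "xs \<in> {xs \<in> V s. hd xs = x \<and> last xs = z \<and> visits xs = r}" and nz: "W xs \<noteq> 0"
  have "length xs \<le> Suc L" using xs s unfolding V_def llists_def by auto
  then obtain ys where ys: "distinct ys" "successively (\<lambda>x z. P x z \<noteq> 0) ys" "length ys \<le> Suc L"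
   "filter (\<lambda>x. x \<in> E) ys = filter (\<lambda>x. x \<in> E) xs"
   using loop_erase[where E = E, OF H5 W_successively[OF nz]] by blast
  then have "visits xs < r0" using H6[of ys] by simp
  then show False using xs s by simp
 qed
qed

text \<open>\<open>P^s - J / n\<close> is the sum of the centred simple paths, the centring error,
  the paths avoiding \<open>E\<close> that have a loop, and the paths with 1 to \<open>r0\<close>
  visits to \<open>E\<close>; each summand has been estimated.\<close>

theorem power_bound:
 assumes s: "0 < s" "s \<le> L"
 shows "opb n (\<lambda>x z. mpw n P s x z - 1 / n) ((real r0 + 2) * \<gamma> * q ^ r0 * \<rho> ^ s)"
proof -
 let ?F = "\<lambda>x z. G s 0 x z - B s x z" and ?c = "9 * (real L + 1)\<^sup>2 * K\<^sup>2 * \<rho> ^ s"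
 have "opb n (\<lambda>x z. \<Sum>r<r0. G s (Suc r) x z) (\<Sum>r<r0. \<gamma> * q ^ r0 * \<rho> ^ s)"
 proof (rule opb_sum)
  fix r assume "r \<in> {..<r0}"
  then have "q ^ Suc r \<le> q ^ r0" using gamma_ge(3) by (intro power_increasing) auto
  then have "\<gamma> * q ^ Suc r * \<rho> ^ s \<le> \<gamma> * q ^ r0 * \<rho> ^ s"
   using gamma_ge(2) rho by (intro mult_right_mono mult_left_mono) auto
  then show "opb n (G s (Suc r)) (\<gamma> * q ^ r0 * \<rho> ^ s)" by (rule opb_le[OF opb_G[OF s(2)]])
 qed simp
 then have "opb n (\<lambda>x z. Simp (cen \<sigma>) s x z + Y s x z + ?F x z + (\<Sum>r<r0. G s (Suc r) x z))
  (K * \<rho> ^ s + \<eta> + ?c + (\<Sum>r<r0. \<gamma> * q ^ r0 * \<rho> ^ s))"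
  by (intro opb_add H1 opb_Y opb_excess s)
 then have "opb n (\<lambda>x z. mpw n P s x z - 1 / n) (K * \<rho> ^ s + \<eta> + ?c + (\<Sum>r<r0. \<gamma> * q ^ r0 * \<rho> ^ s))"
 proof (rule opb_cong[rotated])
  fix x z assume xz: "x < n" "z < n"
  \<comment> \<open>A walk of length \<open>s\<close> has at most \<open>s + 1\<close> visits; the
    extra \<open>r0\<close> makes the range contain the \<open>r0\<close> terms kept below.\<close>
  have "mpw n P s x z = (\<Sum>r<Suc (r0 + s + 1). G s r x z)" by (rule G_sum[symmetric]) (use xz in auto)
  also have "\<dots> = G s 0 x z + (\<Sum>r<r0 + s + 1. G s (Suc r) x z)" by (rule sum.lessThan_Suc_shift)
  also have "(\<Sum>r<r0 + s + 1. G s (Suc r) x z) = (\<Sum>r<r0. G s (Suc r) x z)"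
   by (rule sum.mono_neutral_right) (use G_zero[OF s(2) _ xz] in auto)
  finally show "Simp (cen \<sigma>) s x z + Y s x z + ?F x z + (\<Sum>r<r0. G s (Suc r) x z) = mpw n P s x z - 1 / n" by simp
 qed
 moreover have "K * \<rho> ^ s + \<eta> + ?c + (\<Sum>r<r0. \<gamma> * q ^ r0 * \<rho> ^ s) \<le> (real r0 + 2) * \<gamma> * q ^ r0 * \<rho> ^ s"
 proof -
  have "K * \<rho> ^ s + \<eta> + ?c \<le> (9 * (real L + 1)\<^sup>2 * K\<^sup>2 + 3 * K) * \<rho> ^ s"
  proof -
   have "0 \<le> K * \<rho> ^ s" using K1 rho by simp
   then show ?thesis using rho_pow(1)[OF s(2)] by (simp add: distrib_right)
  qed
  also have "\<dots> \<le> \<gamma> * \<rho> ^ s" using gamma_ge(1) rho by (intro mult_right_mono) auto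
  also have "\<dots> \<le> \<gamma> * q ^ r0 * \<rho> ^ s"
   using gamma_ge rho one_le_power[OF gamma_ge(3), of r0] by (intro mult_right_mono) (auto simp: mult_le_cancel_left1)
  finally have "K * \<rho> ^ s + \<eta> + ?c + (\<Sum>r<r0. \<gamma> * q ^ r0 * \<rho> ^ s) \<le> (real r0 + 1) * (\<gamma> * q ^ r0 * \<rho> ^ s)" by (simp add: distrib_right)
  also have "\<dots> \<le> (real r0 + 2) * (\<gamma> * q ^ r0 * \<rho> ^ s)"
   using gamma_ge rho by (intro mult_right_mono mult_nonneg_nonneg) auto
  finally show ?thesis by (simp add: mult_ac)
 qed
 ultimately show ?thesis by (rule opb_le)
qed

lemmas power_bound_explicit = power_bound[unfolded q_def \<gamma>_def]

end

end

section \<open>Probabilities of exceptional configurations\<close>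

definition pr :: "nat \<Rightarrow> ((nat \<Rightarrow> nat) \<Rightarrow> bool) \<Rightarrow> real" where
 "pr n A = pavg n (\<lambda>\<sigma>. if A \<sigma> then 1 else 0)"

lemma pr_mono: "(\<And>\<sigma>. \<sigma> \<in> perms n \<Longrightarrow> A \<sigma> \<Longrightarrow> B \<sigma>) \<Longrightarrow> pr n A \<le> pr n B"
 unfolding pr_def by (rule pavg_mono) auto

lemma pr_disj: "pr n (\<lambda>\<sigma>. A \<sigma> \<or> B \<sigma>) \<le> pr n A + pr n B"
proof -
 have "pr n (\<lambda>\<sigma>. A \<sigma> \<or> B \<sigma>) \<le> pavg n (\<lambda>\<sigma>. (if A \<sigma> then 1 else 0) + (if B \<sigma> then 1 else 0))"
  unfolding pr_def by (rule pavg_mono) auto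
 also have "\<dots> = pr n A + pr n B" unfolding pr_def pavg_def by (simp add: sum.distrib add_divide_distrib)
 finally show ?thesis .
qed

lemma pr_Bex:
 assumes "finite I"
 shows "pr n (\<lambda>\<sigma>. \<exists>i\<in>I. A i \<sigma>) \<le> (\<Sum>i\<in>I. pr n (A i))"
proof -
 have "pr n (\<lambda>\<sigma>. \<exists>i\<in>I. A i \<sigma>) \<le> pavg n (\<lambda>\<sigma>. \<Sum>i\<in>I. if A i \<sigma> then 1 else 0)"
  unfolding pr_def
 proof (rule pavg_mono)
  fix \<sigma>
  show "(if \<exists>i\<in>I. A i \<sigma> then 1 else 0) \<le> (\<Sum>i\<in>I. if A i \<sigma> then 1 else 0 :: real)"
  proof (cases "\<exists>i\<in>I. A i \<sigma>")
   case True
   then obtain i where i: "i \<in> I" "A i \<sigma>" by blast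
   have "(if A i \<sigma> then 1 else 0 :: real) \<le> (\<Sum>i\<in>I. if A i \<sigma> then 1 else 0)"
    by (rule member_le_sum) (use i assms in auto)
   then show ?thesis using i by auto
  qed (simp add: sum_nonneg)
 qed
 also have "\<dots> = (\<Sum>i\<in>I. pr n (A i))" unfolding pavg_sum pr_def ..
 finally show ?thesis .
qed

lemma pr_markov:
 assumes "\<And>\<sigma>. \<sigma> \<in> perms n \<Longrightarrow> 0 \<le> f \<sigma>" "0 < c" "pavg n f \<le> M"
 shows "pr n (\<lambda>\<sigma>. c \<le> f \<sigma>) \<le> M / c"
proof -
 have "pr n (\<lambda>\<sigma>. c \<le> f \<sigma>) \<le> pavg n (\<lambda>\<sigma>. (1 / c) * f \<sigma>)"
  unfolding pr_def by (rule pavg_mono) (use assms in auto)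
 also have "\<dots> = pavg n f / c" unfolding pavg_cmult by simp
 also have "\<dots> \<le> M / c" using assms by (simp add: divide_right_mono)
 finally show ?thesis .
qed

lemma pavg_ind_le:
 assumes "0 < n" "2 * m\<^sup>2 \<le> n" "A \<subseteq> {..<n} \<times> {..<n}" "finite A" "card A \<le> m"
 shows "pavg n (\<lambda>\<sigma>. \<Prod>p\<in>A. ind \<sigma> p) \<le> 2 * (1 / n) ^ card A"
 using pavg_ind[OF assms(4,3)] mult_left_mono[OF qf_le_2[OF assms(1,5,2)], of "(1 / real n) ^ card A"]
 by (simp add: mult.commute)

text \<open>First moment bound: \<open>w\<close> majorises the indicator of an admissible structure,
  and the \<open>m\<close> prescribed values with distinct arguments have probability at most
  \<open>2 / n ^ m\<close>. Distinct images need not be asked for, because otherwise the probability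
  is 0.\<close>

lemma pr_structures:
 assumes n: "0 < n" "2 * m\<^sup>2 \<le> n" and F: "finite F" "\<And>t. t \<in> F \<Longrightarrow> 0 \<le> w t"
  and e: "\<And>t. t \<in> F \<Longrightarrow> e t \<in> llists ({..<n} \<times> {..<n}) m"
  and A: "\<And>\<sigma>. \<sigma> \<in> perms n \<Longrightarrow> A \<sigma> \<Longrightarrow> \<exists>t\<in>F. 1 \<le> w t \<and> distinct (map fst (e t)) \<and> (\<forall>p\<in>set (e t). \<sigma> (fst p) = snd p)"
 shows "pr n A \<le> 2 * (1 / n) ^ m * (\<Sum>t\<in>F. w t)"
proof -
 let ?w = "\<lambda>t. if distinct (map fst (e t)) then w t else 0"
 have "pr n A \<le> pavg n (\<lambda>\<sigma>. \<Sum>t\<in>F. ?w t * (\<Prod>p\<in>set (e t). ind \<sigma> p))"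
  unfolding pr_def
 proof (rule pavg_mono)
  fix \<sigma> assume s: "\<sigma> \<in> perms n"
  have nn: "0 \<le> ?w t * (\<Prod>p\<in>set (e t). ind \<sigma> p)" if "t \<in> F" for t
   using F(2)[OF that] by (auto intro!: mult_nonneg_nonneg prod_nonneg simp: ind_def)
  show "(if A \<sigma> then 1 else 0) \<le> (\<Sum>t\<in>F. ?w t * (\<Prod>p\<in>set (e t). ind \<sigma> p))"
  proof (cases "A \<sigma>")
   case True
   then obtain t where t: "t \<in> F" "1 \<le> w t" "distinct (map fst (e t))" "\<forall>p\<in>set (e t). \<sigma> (fst p) = snd p" using A[OF s] by blast
   have "1 \<le> ?w t * (\<Prod>p\<in>set (e t). ind \<sigma> p)" using t by (simp add: ind_def)
   also have "\<dots> \<le> (\<Sum>t\<in>F. ?w t * (\<Prod>p\<in>set (e t). ind \<sigma> p))"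
    using nn by (intro member_le_sum[OF t(1)] F(1)) auto
   finally show ?thesis using True by simp
  qed (simp add: sum_nonneg nn)
 qed
 also have "\<dots> = (\<Sum>t\<in>F. ?w t * pavg n (\<lambda>\<sigma>. \<Prod>p\<in>set (e t). ind \<sigma> p))" unfolding pavg_sum pavg_cmult ..
 also have "\<dots> \<le> (\<Sum>t\<in>F. w t * (2 * (1 / n) ^ m))"
 proof (rule sum_mono)
  fix t assume t: "t \<in> F"
  show "?w t * pavg n (\<lambda>\<sigma>. \<Prod>p\<in>set (e t). ind \<sigma> p) \<le> w t * (2 * (1 / n) ^ m)"
  proof (cases "distinct (map fst (e t))")
   case True
   have "card (set (e t)) = m" using distinct_card[of "e t"] True e[OF t] unfolding llists_def by (simp add: distinct_map)
   then show ?thesis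
    using pavg_ind_le[OF n, of "set (e t)"] e[OF t] F(2)[OF t] True unfolding llists_def by (auto intro!: mult_left_mono)
  qed (use F(2)[OF t] in simp)
 qed
 also have "\<dots> = 2 * (1 / n) ^ m * (\<Sum>t\<in>F. w t)" by (simp add: sum_distrib_left sum_distrib_right mult_ac)
 finally show ?thesis .
qed

text \<open>Expanding the product over the \<open>2 ^ m\<close> subsets, every subset contributes at
  most \<open>2 / n ^ m\<close>: an entry has mean about \<open>1 / n\<close>, the same as the
  constant added to it.\<close>

lemma pavg_plus_le:
 assumes "0 < n" "2 * m\<^sup>2 \<le> n" "es \<in> llists ({..<n} \<times> {..<n}) m" "distinct es"
 shows "pavg n (\<lambda>\<sigma>. prod_list (map (\<lambda>p. ind \<sigma> p + 1 / n) es)) \<le> 2 * 2 ^ m * (1 / n) ^ m"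
proof -
 have c: "card (set es) = m" "set es \<subseteq> {..<n} \<times> {..<n}" using assms(3,4) distinct_card[of es] unfolding llists_def by auto
 have "prod_list (map (\<lambda>p. ind \<sigma> p + 1 / n) es) = (\<Sum>X\<in>Pow (set es). (1 / n) ^ card (set es - X) * (\<Prod>p\<in>X. ind \<sigma> p))" for \<sigma>
  using assms(4) by (simp add: prod.distinct_set_conv_list[symmetric] prod_add mult.commute)
 then have "pavg n (\<lambda>\<sigma>. prod_list (map (\<lambda>p. ind \<sigma> p + 1 / n) es))
  = (\<Sum>X\<in>Pow (set es). (1 / n) ^ card (set es - X) * pavg n (\<lambda>\<sigma>. \<Prod>p\<in>X. ind \<sigma> p))"
  by (simp only: pavg_sum pavg_cmult)
 also have "\<dots> \<le> (\<Sum>X\<in>Pow (set es). 2 * (1 / n) ^ m)"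
 proof (rule sum_mono)
  fix X assume X: "X \<in> Pow (set es)"
  then have f: "finite X" "card X \<le> m" "X \<subseteq> {..<n} \<times> {..<n}" using c card_mono[of "set es" X] by (auto intro: finite_subset)
  have cX: "card (set es - X) = m - card X" using X c f by (simp add: card_Diff_subset)
  have "(1 / n) ^ (m - card X) * pavg n (\<lambda>\<sigma>. \<Prod>p\<in>X. ind \<sigma> p) \<le> (1 / n) ^ (m - card X) * (2 * (1 / n) ^ card X)"
   by (intro mult_left_mono pavg_ind_le[OF assms(1,2) f(3,1,2)]) simp
  also have "(1 / n) ^ (m - card X) * (2 * (1 / n) ^ card X) = 2 * (1 / real n) ^ m"
   using f(2) by (simp add: power_add[symmetric] mult_ac del: power_divide power_one_over)
  finally show "(1 / n) ^ card (set es - X) * pavg n (\<lambda>\<sigma>. \<Prod>p\<in>X. ind \<sigma> p) \<le> 2 * (1 / n) ^ m" unfolding cX .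
 qed
 also have "\<dots> = 2 * 2 ^ m * (1 / n) ^ m" using c by (simp add: card_Pow mult_ac)
 finally show ?thesis .
qed

lemma successively_snoc_ex: "successively R (xs @ [z]) \<Longrightarrow> x \<in> set xs \<Longrightarrow> \<exists>y. R x y"
 by (induction xs) (auto simp: successively_Cons)

section \<open>Expected numbers of cycles, tangles and visits\<close>

context sparse
begin

abbreviation arc_of :: "(nat \<Rightarrow> nat) \<Rightarrow> nat \<Rightarrow> nat \<Rightarrow> bool" where "arc_of \<sigma> \<equiv> (\<lambda>x z. Q (\<sigma> x) z \<noteq> 0)"

abbreviation cycle_at :: "(nat \<Rightarrow> nat) \<Rightarrow> nat \<Rightarrow> nat \<Rightarrow> nat \<Rightarrow> bool" where
 "cycle_at \<sigma> L c v \<equiv> \<exists>cs. arcs.cycle (arc_of \<sigma>) L cs \<and> length cs = c \<and> hd cs = v"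

abbreviation tangle_at :: "(nat \<Rightarrow> nat) \<Rightarrow> nat \<Rightarrow> nat \<Rightarrow> nat \<Rightarrow> bool" where
 "tangle_at \<sigma> L c k \<equiv> \<exists>cs us z. arcs.tangle (arc_of \<sigma>) L cs us z \<and> length cs = c \<and> length us = k"

abbreviation visit_walk :: "(nat \<Rightarrow> nat) \<Rightarrow> nat \<Rightarrow> nat \<Rightarrow> bool" where
 "visit_walk \<sigma> s r0 \<equiv> \<exists>xs. distinct xs \<and> successively (arc_of \<sigma>) xs \<and> length xs = Suc s \<and> r0 \<le> length (filter (\<lambda>x. x \<in> E) xs)"

abbreviation on_cycle :: "(nat \<Rightarrow> nat) \<Rightarrow> nat \<Rightarrow> nat \<Rightarrow> bool" where
 "on_cycle \<sigma> L v \<equiv> \<exists>cs. arcs.cycle (arc_of \<sigma>) L cs \<and> hd cs = v"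

definition aq :: "nat \<Rightarrow> nat \<Rightarrow> real" where "aq y x = (if Q y x = 0 then 0 else 1)"

lemma aq_nonneg: "0 \<le> aq y x" unfolding aq_def by simp

lemma aq_sum: "(\<Sum>x<n. aq y x) \<le> d" "(\<Sum>y<n. aq y x) \<le> d"
proof -
 have "(\<Sum>x<n. aq y x) = real (card {x\<in>{..<n}. Q y x \<noteq> 0})" unfolding aq_def by (simp add: sum.If_cases Int_def)
 also have "card {x\<in>{..<n}. Q y x \<noteq> 0} \<le> card {x. Q y x \<noteq> 0}" by (rule card_mono[OF fin_row]) auto
 also have "\<dots> \<le> d" by (rule srow)
 finally show "(\<Sum>x<n. aq y x) \<le> d" by simp
 have "(\<Sum>y<n. aq y x) = real (card {y\<in>{..<n}. Q y x \<noteq> 0})" unfolding aq_def by (simp add: sum.If_cases Int_def)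
 also have "card {y\<in>{..<n}. Q y x \<noteq> 0} \<le> card {y. Q y x \<noteq> 0}" by (rule card_mono[OF fin_col]) auto
 also have "\<dots> \<le> d" by (rule scol)
 finally show "(\<Sum>y<n. aq y x) \<le> d" by simp
qed

fun ac :: "(nat \<times> nat) list \<Rightarrow> nat \<Rightarrow> real" where
 "ac [] z = 1" |
 "ac (p # es) z = ac es (fst p) * aq (snd p) z"

lemma ac_nonneg: "0 \<le> ac es z"
 by (induction es arbitrary: z) (auto intro!: mult_nonneg_nonneg aq_nonneg)

lemma ac_walk: "successively (arc_of \<sigma>) (rev vs @ [z]) \<Longrightarrow> ac (map (\<lambda>v. (v, \<sigma> v)) vs) z = 1"
proof (induction vs arbitrary: z)
 case (Cons v vs)
 then have "successively (arc_of \<sigma>) (rev vs @ [v])" "Q (\<sigma> v) z \<noteq> 0"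
  by (auto simp: successively_append_iff)
 then show ?case using Cons.IH by (simp add: aq_def)
qed simp

text \<open>The end point may depend on the vertices of the chain: only its last label is summed first.\<close>

lemma chain_start_sum:
 "0 < k \<Longrightarrow> (\<Sum>es\<in>Lst k. if fst (last es) = u then ac es (\<zeta> (map fst es)) else 0) \<le> d * (real n * d) ^ (k - 1)"
proof (induction k arbitrary: \<zeta>)
 case (Suc k)
 show ?case
 proof (cases "k = 0")
  case True
  have "(\<Sum>es\<in>Lst (Suc k). if fst (last es) = u then ac es (\<zeta> (map fst es)) else 0) = (\<Sum>p\<in>{..<n} \<times> {..<n}. if fst p = u then aq (snd p) (\<zeta> [fst p]) else 0)"
   unfolding Lst_def sum_llists_Suc True llists_0 by (intro sum.cong) auto
  also have "\<dots> = (\<Sum>x<n. \<Sum>y<n. if x = u then aq y (\<zeta> [u]) else 0)"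
   unfolding sum.cartesian_product by (intro sum.cong) auto
  also have "\<dots> = (\<Sum>x<n. if x = u then (\<Sum>y<n. aq y (\<zeta> [u])) else 0)" by (intro sum.cong) auto
  also have "\<dots> \<le> d" using aq_sum(2) by (simp add: sum.delta)
  finally show ?thesis using True by simp
 next
  case False
  have "(\<Sum>es\<in>Lst (Suc k). if fst (last es) = u then ac es (\<zeta> (map fst es)) else 0)
   = (\<Sum>p\<in>{..<n} \<times> {..<n}. \<Sum>es\<in>Lst k. if fst (last es) = u then ac es (fst p) * aq (snd p) (\<zeta> (fst p # map fst es)) else 0)"
   unfolding Lst_def sum_llists_Suc
  proof (intro sum.cong refl)
   fix p es assume "es \<in> llists ({..<n} \<times> {..<n}) k"
   then have "es \<noteq> []" using False unfolding llists_def by auto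
   then show "(if fst (last (p # es)) = u then ac (p # es) (\<zeta> (map fst (p # es))) else 0) = (if fst (last es) = u then ac es (fst p) * aq (snd p) (\<zeta> (fst p # map fst es)) else 0)"
    by simp
  qed
  also have "\<dots> = (\<Sum>x<n. \<Sum>y<n. \<Sum>es\<in>Lst k. if fst (last es) = u then ac es x * aq y (\<zeta> (x # map fst es)) else 0)"
   unfolding sum.cartesian_product' fst_conv snd_conv by simp
  also have "\<dots> = (\<Sum>x<n. \<Sum>es\<in>Lst k. \<Sum>y<n. if fst (last es) = u then ac es x * aq y (\<zeta> (x # map fst es)) else 0)"
   by (rule sum.cong[OF refl]) (rule sum.swap)
  also have "\<dots> \<le> (\<Sum>x<n. \<Sum>es\<in>Lst k. d * (if fst (last es) = u then ac es x else 0))"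
  proof (intro sum_mono)
   fix x es
   have "ac es x * (\<Sum>y<n. aq y (\<zeta> (x # map fst es))) \<le> ac es x * d" by (intro mult_left_mono aq_sum ac_nonneg)
   then show "(\<Sum>y<n. if fst (last es) = u then ac es x * aq y (\<zeta> (x # map fst es)) else 0) \<le> d * (if fst (last es) = u then ac es x else 0)"
    by (simp add: sum_distrib_left mult.commute)
  qed
  also have "\<dots> = (\<Sum>x<n. d * (\<Sum>es\<in>Lst k. if fst (last es) = u then ac es x else 0))" by (simp only: sum_distrib_left)
  also have "\<dots> \<le> (\<Sum>x<n. d * (d * (real n * d) ^ (k - 1)))"
   by (intro sum_mono mult_left_mono) (use Suc.IH[of "\<lambda>_. _"] False in auto)
  also have "\<dots> = d * (real n * d) ^ k" using False by (cases k) auto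
  finally show ?thesis by simp
 qed
qed simp

text \<open>With the first vertex fixed there are \<open>n ^ (c - 1)\<close> choices of vertices and
  at most \<open>d ^ c\<close> of images, against the probability of order \<open>1 / n ^ c\<close>
  that \<open>\<sigma>\<close> has the prescribed values.\<close>

lemma cycle_prob:
 assumes c: "0 < c" "2 * c\<^sup>2 \<le> n"
 shows "pr n (\<lambda>\<sigma>. cycle_at \<sigma> L c v) \<le> 2 * d ^ c / n"
proof (cases "v < n")
 case True
 have "pr n (\<lambda>\<sigma>. cycle_at \<sigma> L c v)
  \<le> 2 * (1 / n) ^ c * (\<Sum>es\<in>Lst c. if fst (last es) = v then ac es ((\<lambda>_. v) (map fst es)) else 0)"
 proof (rule pr_structures[where e = "\<lambda>es. es", OF n_pos c(2)])
  fix \<sigma> assume s: "\<sigma> \<in> perms n" and "cycle_at \<sigma> L c v"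
  then obtain cs where cs: "arcs.cycle (arc_of \<sigma>) L cs" "length cs = c" "hd cs = v" by blast
  note cy = cs(1)[unfolded arcs.cycle_def]
  have p: "\<sigma> permutes {..<n}" using s unfolding perms_def by simp
  have suc: "successively (arc_of \<sigma>) (cs @ [v])" using cy cs(3) by (simp add: successively_append_iff)
  have sn: "x < n" "\<sigma> x < n" if "x \<in> set cs" for x
  proof -
   show "\<sigma> x < n" using successively_snoc_ex[OF suc that] Q_out by blast
   then show "x < n" using permutes_in_image[OF p, of x] by simp
  qed
  let ?es = "map (\<lambda>v. (v, \<sigma> v)) (rev cs)"
  have "successively (arc_of \<sigma>) (rev (rev cs) @ [v])"
   using suc by simp
  then have "ac ?es v = 1" by (rule ac_walk)
  moreover have "fst (last ?es) = v" using cy cs(3) by (simp add: last_map last_rev)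
  moreover have "?es \<in> Lst c" using sn cs(2) unfolding Lst_def llists_def by auto
  moreover have "distinct (map fst ?es)" using cy by (simp add: o_def)
  ultimately show "\<exists>t\<in>Lst c. 1 \<le> (if fst (last t) = v then ac t ((\<lambda>_. v) (map fst t)) else 0) \<and> distinct (map fst t) \<and> (\<forall>p\<in>set t. \<sigma> (fst p) = snd p)"
   by (intro bexI[of _ ?es]) auto
 qed (auto simp: ac_nonneg Lst_def)
 also have "\<dots> \<le> 2 * (1 / n) ^ c * (d * (real n * d) ^ (c - 1))"
  by (intro mult_left_mono chain_start_sum c) simp
 also have "\<dots> = 2 * d ^ c / n"
  using c n_pos by (cases c) (simp_all add: power_mult_distrib power_divide field_simps)
 finally show ?thesis .
next
 case False
 have "pr n (\<lambda>\<sigma>. cycle_at \<sigma> L c v) \<le> pr n (\<lambda>\<sigma>. False)"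
 proof (rule pr_mono)
  fix \<sigma> assume "cycle_at \<sigma> L c v"
  then obtain cs where "Q (\<sigma> (last cs)) v \<noteq> 0" unfolding arcs.cycle_def by blast
  then show False using Q_out False by blast
 qed
 also have "\<dots> = 0" unfolding pr_def by simp
 finally show ?thesis by (rule order_trans) simp
qed

end

context sparse
begin

lemma arcs_in_range:
 assumes "\<sigma> \<in> perms n" "successively (arc_of \<sigma>) (xs @ [z])" "x \<in> set xs"
 shows "x < n" "\<sigma> x < n"
proof -
 have p: "\<sigma> permutes {..<n}" using assms(1) unfolding perms_def by simp
 show "\<sigma> x < n" using successively_snoc_ex[OF assms(2,3)] Q_out by blast
 then show "x < n" using permutes_in_image[OF p, of x] by simp
qed

text \<open>There are \<open>c + k\<close> vertices but \<open>c + k + 1\<close> arcs. The start of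
  the second route costs only \<open>d\<close> instead of \<open>n\<close> because its predecessor
  is on the cycle, and its end is one of \<open>c + k\<close> vertices already listed.\<close>

lemma tangle_prob:
 assumes c: "0 < c" "0 < k" "2 * (c + k)\<^sup>2 \<le> n"
 shows "pr n (\<lambda>\<sigma>. tangle_at \<sigma> L c k) \<le> 2 * real (c + k) * d ^ (c + k + 1) / n"
proof -
 let ?F = "{..<c + k} \<times> Lst c \<times> Lst k"
 \<comment> \<open>The closing vertex is named by its index \<open>i\<close> in the list of all
   vertices, so it depends on vertices that are summed over; \<open>chain_start_sum\<close> allows
   this.\<close>
 let ?\<zeta> = "\<lambda>i es vs. (map fst es @ vs) ! i"
 let ?w = "\<lambda>(i, es, es'). ac es (fst (last es)) * (aq (snd (last es)) (fst (last es')) * ac es' (?\<zeta> i es (map fst es')))"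
 let ?D = "real n * d"
 have "pr n (\<lambda>\<sigma>. tangle_at \<sigma> L c k) \<le> 2 * (1 / n) ^ (c + k) * (\<Sum>t\<in>?F. ?w t)"
 proof (rule pr_structures[where e = "\<lambda>(i, es, es'). es' @ es", OF n_pos c(3)])
  fix \<sigma> assume s: "\<sigma> \<in> perms n" and "tangle_at \<sigma> L c k"
  then obtain cs us z where t: "arcs.tangle (arc_of \<sigma>) L cs us z" "length cs = c" "length us = k" by blast
  note ta = t(1)[unfolded arcs.tangle_def arcs.cycle_def]
  have suc: "successively (arc_of \<sigma>) (cs @ [hd cs])" "successively (arc_of \<sigma>) (us @ [z])"
   using ta by (simp_all add: successively_append_iff)
  let ?es = "map (\<lambda>v. (v, \<sigma> v)) (rev cs)" and ?es' = "map (\<lambda>v. (v, \<sigma> v)) (rev us)"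
  have mf: "map fst ?es = rev cs" "map fst ?es' = rev us" by (simp_all add: o_def)
  have L: "?es \<in> Lst c" "?es' \<in> Lst k"
   using arcs_in_range[OF s suc(1)] arcs_in_range[OF s suc(2)] t unfolding Lst_def llists_def by auto
  have ac: "ac ?es (hd cs) = 1" "ac ?es' z = 1"
   by (rule ac_walk, use suc in simp)+
  have la: "last ?es = (hd cs, \<sigma> (hd cs))" "last ?es' = (hd us, \<sigma> (hd us))"
   using ta by (simp_all add: last_map last_rev)
  have "z \<in> set (rev cs @ rev us)" using ta by simp
  then obtain i where i: "i < length (rev cs @ rev us)" "(rev cs @ rev us) ! i = z" unfolding in_set_conv_nth by blast
  have "?w (i, ?es, ?es') = 1" unfolding prod.case mf la fst_conv snd_conv i(2) ac using ta by (simp add: aq_def)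
  moreover have "(i, ?es, ?es') \<in> ?F" using L i(1) t by simp
  moreover have "distinct (map fst (?es' @ ?es))" unfolding map_append mf using ta by auto
  moreover have "\<forall>p\<in>set (?es' @ ?es). \<sigma> (fst p) = snd p" by auto
  ultimately show "\<exists>t\<in>?F. 1 \<le> ?w t \<and> distinct (map fst ((\<lambda>(i, es, es'). es' @ es) t)) \<and> (\<forall>p\<in>set ((\<lambda>(i, es, es'). es' @ es) t). \<sigma> (fst p) = snd p)"
   by (intro bexI[of _ "(i, ?es, ?es')"]) (simp_all only: prod.case order_refl simp_thms)
 next
  fix t assume "t \<in> ?F"
  then show "(\<lambda>(i, es, es'). es' @ es) t \<in> llists ({..<n} \<times> {..<n}) (c + k)"
   unfolding Lst_def llists_def by auto
 next
  fix t show "0 \<le> ?w t" by (cases t) (auto intro!: mult_nonneg_nonneg ac_nonneg aq_nonneg)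
 qed simp
 also have "(\<Sum>t\<in>?F. ?w t) = (\<Sum>i<c + k. \<Sum>es\<in>Lst c. \<Sum>es'\<in>Lst k. ?w (i, es, es'))"
  unfolding sum.cartesian_product' fst_conv snd_conv by simp
 also have "\<dots> \<le> (\<Sum>i<c + k. real n * (d * ?D ^ (c - 1)) * (d * (d * ?D ^ (k - 1))))"
 proof (rule sum_mono)
  fix i :: nat
  have "(\<Sum>es\<in>Lst c. \<Sum>es'\<in>Lst k. ?w (i, es, es')) \<le> (\<Sum>es\<in>Lst c. ac es (fst (last es)) * (d * (d * ?D ^ (k - 1))))"
  proof (rule sum_mono)
   fix es :: "(nat \<times> nat) list"
   let ?x = "\<lambda>es'. ac es' (?\<zeta> i es (map fst es'))" and ?y = "snd (last es)"
   have "(\<Sum>es'\<in>Lst k. aq ?y (fst (last es')) * ?x es') = (\<Sum>es'\<in>Lst k. \<Sum>u<n. aq ?y u * (if fst (last es') = u then ?x es' else 0))"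
   proof (rule sum.cong[OF refl])
    fix es' assume "es' \<in> Lst k"
    then have "fst (last es') < n" using Lst_last[OF _ c(2)] by blast
    moreover have "(\<Sum>u<n. aq ?y u * (if fst (last es') = u then ?x es' else 0)) = (\<Sum>u<n. if fst (last es') = u then aq ?y u * ?x es' else 0)"
     by (rule sum.cong) auto
    ultimately show "aq ?y (fst (last es')) * ?x es' = (\<Sum>u<n. aq ?y u * (if fst (last es') = u then ?x es' else 0))" by simp
   qed
   also have "\<dots> = (\<Sum>u<n. aq ?y u * (\<Sum>es'\<in>Lst k. if fst (last es') = u then ?x es' else 0))"
    unfolding sum_distrib_left by (rule sum.swap)
   also have "\<dots> \<le> (\<Sum>u<n. aq ?y u * (d * ?D ^ (k - 1)))"
    by (intro sum_mono mult_left_mono aq_nonneg chain_start_sum[where \<zeta> = "?\<zeta> i es"] c)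
   also have "\<dots> = (\<Sum>u<n. aq ?y u) * (d * ?D ^ (k - 1))" by (rule sum_distrib_right[symmetric])
   also have "\<dots> \<le> d * (d * ?D ^ (k - 1))" by (intro mult_right_mono aq_sum) simp
   finally have "ac es (fst (last es)) * (\<Sum>es'\<in>Lst k. aq ?y (fst (last es')) * ?x es') \<le> ac es (fst (last es)) * (d * (d * ?D ^ (k - 1)))"
    by (rule mult_left_mono) (rule ac_nonneg)
   then show "(\<Sum>es'\<in>Lst k. ?w (i, es, es')) \<le> ac es (fst (last es)) * (d * (d * ?D ^ (k - 1)))"
    by (simp only: prod.case sum_distrib_left)
  qed
  also have "\<dots> = (\<Sum>es\<in>Lst c. ac es (fst (last es))) * (d * (d * ?D ^ (k - 1)))" by (rule sum_distrib_right[symmetric])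
  also have "(\<Sum>es\<in>Lst c. ac es (fst (last es))) = (\<Sum>es\<in>Lst c. \<Sum>v<n. if fst (last es) = v then ac es v else 0)"
  proof (rule sum.cong[OF refl])
   fix es assume "es \<in> Lst c"
   then have "fst (last es) < n" using Lst_last[OF _ c(1)] by blast
   then show "ac es (fst (last es)) = (\<Sum>v<n. if fst (last es) = v then ac es v else 0)" by simp
  qed
  also have "\<dots> = (\<Sum>v<n. \<Sum>es\<in>Lst c. if fst (last es) = v then ac es ((\<lambda>_. v) (map fst es)) else 0)" by (rule sum.swap)
  also have "\<dots> * (d * (d * ?D ^ (k - 1))) \<le> (\<Sum>v<n. d * ?D ^ (c - 1)) * (d * (d * ?D ^ (k - 1)))"
   by (intro mult_right_mono sum_mono chain_start_sum c) simp
  finally show "(\<Sum>es\<in>Lst c. \<Sum>es'\<in>Lst k. ?w (i, es, es')) \<le> real n * (d * ?D ^ (c - 1)) * (d * (d * ?D ^ (k - 1)))"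
   by simp
 qed
 finally have "pr n (\<lambda>\<sigma>. tangle_at \<sigma> L c k)
  \<le> 2 * (1 / n) ^ (c + k) * (\<Sum>i<c + k. real n * (d * ?D ^ (c - 1)) * (d * (d * ?D ^ (k - 1))))"
  by (simp add: mult_left_mono)
 also have "\<dots> = 2 * (1 / n) ^ (c + k) * (real (c + k) * (?D ^ c * d * ?D ^ k) / n)"
 proof -
  have "real n * (d * ?D ^ (c - 1)) * (d * (d * ?D ^ (k - 1))) = ?D ^ c * d * ?D ^ k / n"
   using c n_pos by (cases c; cases k) (simp_all add: field_simps)
  then show ?thesis by simp
 qed
 also have "\<dots> = 2 * real (c + k) * d ^ (c + k + 1) / n"
  using n_pos by (simp add: power_mult_distrib power_add power_divide field_simps)
 finally show ?thesis .
qed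

text \<open>Exponential weighting: each vertex of \<open>E\<close> gets weight
  \<open>\<kappa>\<close>. As \<open>\<kappa> * card E \<le> n\<close>, the total vertex weight
  merely doubles, whereas a path with \<open>r0\<close> visits is counted with weight
  \<open>\<kappa> ^ r0\<close>.\<close>

lemma visit_prob:
 fixes \<kappa> :: real
 assumes s: "0 < s" "2 * s\<^sup>2 \<le> n" and lam: "1 \<le> \<kappa>" "\<kappa> * card E \<le> n"
 shows "pr n (\<lambda>\<sigma>. visit_walk \<sigma> s r0)
  \<le> 4 * n * (2 * d) ^ s / \<kappa> ^ r0"
proof -
 define v where "v x = (if x \<in> E then \<kappa> else 1)" for x
 have v0: "0 \<le> v x" for x unfolding v_def using lam by auto
 have vs: "(\<Sum>x<n. v x) \<le> 2 * n"
 proof -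
  have "(\<Sum>x<n. v x) \<le> (\<Sum>x<n. 1 + (if x \<in> E then \<kappa> else 0))" unfolding v_def by (rule sum_mono) auto
  also have "\<dots> = n + (\<Sum>x\<in>E. \<kappa>)" unfolding sum.distrib using E_sub
   by (simp add: sum.If_cases Int_absorb1 inf.absorb2)
  finally show ?thesis using lam by (simp add: mult.commute)
 qed
 let ?g = "\<lambda>es. prod_list (map (\<lambda>p. v (fst p)) es)"
 have g0: "0 \<le> ?g es" for es by (intro prod_list_nonneg) (auto simp: v0)
 have sum: "(\<Sum>es\<in>Lst m. ?g es * ac es z) \<le> (2 * real n * d) ^ m" for m z
 proof (induction m arbitrary: z)
  case 0
  then show ?case by (simp add: Lst_def)
 next
  case (Suc m)
  have "(\<Sum>es\<in>Lst (Suc m). ?g es * ac es z) = (\<Sum>p\<in>{..<n} \<times> {..<n}. \<Sum>es\<in>Lst m. v (fst p) * aq (snd p) z * (?g es * ac es (fst p)))"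
   unfolding Lst_def sum_llists_Suc by (intro sum.cong refl) (simp add: mult_ac)
  also have "\<dots> = (\<Sum>p\<in>{..<n} \<times> {..<n}. v (fst p) * aq (snd p) z * (\<Sum>es\<in>Lst m. ?g es * ac es (fst p)))"
   by (simp only: sum_distrib_left)
  also have "\<dots> \<le> (\<Sum>p\<in>{..<n} \<times> {..<n}. v (fst p) * aq (snd p) z * (2 * real n * d) ^ m)"
   by (intro sum_mono mult_left_mono mult_nonneg_nonneg Suc v0 aq_nonneg)
  also have "\<dots> = (\<Sum>x<n. \<Sum>y<n. v x * aq y z * (2 * real n * d) ^ m)"
   unfolding sum.cartesian_product' by simp
  also have "\<dots> = (\<Sum>x<n. v x) * (\<Sum>y<n. aq y z) * (2 * real n * d) ^ m"
   by (simp only: sum_distrib_right[symmetric] sum_product[symmetric])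
  also have "\<dots> \<le> (2 * real n) * real d * (2 * real n * d) ^ m"
   using vs by (intro mult_right_mono mult_mono aq_sum sum_nonneg aq_nonneg) auto
  finally show ?case by simp
 qed
 let ?F = "{..<n} \<times> Lst s"
 let ?w = "\<lambda>t. v (fst t) * (?g (snd t) * ac (snd t) (fst t)) / \<kappa> ^ r0"
 have "pr n (\<lambda>\<sigma>. visit_walk \<sigma> s r0)
  \<le> 2 * (1 / n) ^ s * (\<Sum>t\<in>?F. ?w t)"
 proof (rule pr_structures[where e = snd, OF n_pos s(2)])
  fix \<sigma> assume sg: "\<sigma> \<in> perms n" and "visit_walk \<sigma> s r0"
  then obtain xs where xs: "distinct xs" "successively (arc_of \<sigma>) xs" "length xs = Suc s" "r0 \<le> length (filter (\<lambda>x. x \<in> E) xs)" by blast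
  obtain ys z where ys: "xs = ys @ [z]" using xs(3) by (cases xs rule: rev_cases) auto
  have ne: "ys \<noteq> []" "length ys = s" using xs(3) s ys by auto
  have zn: "z < n"
  proof -
   have "arc_of \<sigma> (last ys) z" using xs(2) ne unfolding ys successively_append_iff by simp
   then show ?thesis using Q_out by blast
  qed
  let ?es = "map (\<lambda>v. (v, \<sigma> v)) (rev ys)"
  have "?es \<in> Lst s" using arcs_in_range[OF sg xs(2)[unfolded ys]] ne unfolding Lst_def llists_def by auto
  moreover have ac: "ac ?es z = 1" by (rule ac_walk) (use xs ys in simp)
  moreover have "distinct (map fst ?es)" using xs(1) unfolding ys by (simp add: o_def)
  moreover have "1 \<le> ?w (z, ?es)"
  proof -
   have pw: "prod_list (map v zs) = \<kappa> ^ length (filter (\<lambda>x. x \<in> E) zs)" for zs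
    by (induction zs) (auto simp: v_def)
   have "v z * ?g ?es = prod_list (map v (z # rev ys))" by (simp add: o_def)
   also have "\<dots> = \<kappa> ^ length (filter (\<lambda>x. x \<in> E) (z # rev ys))" by (rule pw)
   also have "length (filter (\<lambda>x. x \<in> E) (z # rev ys)) = length (filter (\<lambda>x. x \<in> E) xs)" unfolding ys by (simp add: rev_filter[symmetric])
   finally have "v z * ?g ?es = \<kappa> ^ length (filter (\<lambda>x. x \<in> E) xs)" .
   moreover have "\<kappa> ^ r0 \<le> \<kappa> ^ length (filter (\<lambda>x. x \<in> E) xs)" using xs(4) lam(1) by (rule power_increasing)
   ultimately show ?thesis unfolding fst_conv snd_conv ac using lam(1) by (simp add: le_divide_eq)
  qed
  ultimately show "\<exists>t\<in>?F. 1 \<le> ?w t \<and> distinct (map fst (snd t)) \<and> (\<forall>p\<in>set (snd t). \<sigma> (fst p) = snd p)"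
   using zn by (intro bexI[of _ "(z, ?es)"]) auto
 next
  fix t show "0 \<le> ?w t" using lam(1) by (intro divide_nonneg_nonneg mult_nonneg_nonneg v0 g0 ac_nonneg zero_le_power) simp
 qed (auto simp: Lst_def)
 also have "(\<Sum>t\<in>?F. ?w t) = (\<Sum>z<n. v z * (\<Sum>es\<in>Lst s. ?g es * ac es z)) / \<kappa> ^ r0"
  by (simp add: sum.cartesian_product' sum_divide_distrib sum_distrib_left)
 also have "\<dots> \<le> (\<Sum>z<n. v z * (2 * real n * d) ^ s) / \<kappa> ^ r0"
  using lam by (intro divide_right_mono sum_mono mult_left_mono sum v0) auto
 also have "\<dots> = (\<Sum>z<n. v z) * (2 * real n * d) ^ s / \<kappa> ^ r0" by (simp only: sum_distrib_right)
 also have "\<dots> \<le> (2 * n) * (2 * real n * d) ^ s / \<kappa> ^ r0"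
  using lam vs by (intro divide_right_mono mult_right_mono) auto
 finally have "pr n (\<lambda>\<sigma>. visit_walk \<sigma> s r0)
  \<le> 2 * (1 / n) ^ s * ((2 * n) * (2 * real n * d) ^ s / \<kappa> ^ r0)" by (simp add: mult_left_mono)
 also have "\<dots> = 4 * n * (2 * d) ^ s / \<kappa> ^ r0"
  using n_pos by (simp add: power_mult_distrib power_divide field_simps)
 finally show ?thesis .
qed

lemma cycle_at_prob:
 assumes L: "2 * L\<^sup>2 \<le> n"
 shows "pr n (\<lambda>\<sigma>. on_cycle \<sigma> L v) \<le> 2 * real L * real d ^ L / n"
proof -
 have "pr n (\<lambda>\<sigma>. on_cycle \<sigma> L v)
  \<le> pr n (\<lambda>\<sigma>. \<exists>c\<in>{1..L}. cycle_at \<sigma> L c v)"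
 proof (rule pr_mono)
  fix \<sigma> assume "on_cycle \<sigma> L v"
  then obtain cs where cs: "arcs.cycle (arc_of \<sigma>) L cs" "hd cs = v" by blast
  then have "length cs \<in> {1..L}" unfolding arcs.cycle_def by (cases cs) auto
  then show "\<exists>c\<in>{1..L}. cycle_at \<sigma> L c v" using cs by blast
 qed
 also have "\<dots> \<le> (\<Sum>c\<in>{1..L}. pr n (\<lambda>\<sigma>. cycle_at \<sigma> L c v))"
  by (rule pr_Bex) simp
 also have "\<dots> \<le> (\<Sum>c\<in>{1..L}. 2 * real d ^ L / n)"
 proof (rule sum_mono)
  fix c assume c: "c \<in> {1..L}"
  have "2 * c\<^sup>2 \<le> 2 * L\<^sup>2" using c by (intro mult_left_mono power_mono) auto
  then have "2 * c\<^sup>2 \<le> n" using L by (rule order_trans)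
  then have "pr n (\<lambda>\<sigma>. cycle_at \<sigma> L c v) \<le> 2 * real d ^ c / n"
   using cycle_prob[of c L v] c by simp
  also have "\<dots> \<le> 2 * real d ^ L / n"
   using c d2 by (intro divide_right_mono mult_left_mono power_increasing) auto
  finally show "pr n (\<lambda>\<sigma>. cycle_at \<sigma> L c v) \<le> 2 * real d ^ L / n" .
 qed
 also have "\<dots> = 2 * real L * real d ^ L / n" by simp
 finally show ?thesis .
qed

lemma cycle_count:
 assumes L: "2 * L\<^sup>2 \<le> n"
 shows "pavg n (\<lambda>\<sigma>. real (card {v. v < n \<and> (on_cycle \<sigma> L v)})) \<le> 2 * real L * real d ^ L"
proof -
 have "pr n (\<lambda>\<sigma>. on_cycle \<sigma> L v) \<le> 2 * real L * real d ^ L / n" for v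
  by (rule order_trans[OF cycle_at_prob]) (use L in auto)
 then have "(\<Sum>v<n. pr n (\<lambda>\<sigma>. on_cycle \<sigma> L v)) \<le> (\<Sum>v<n. 2 * real L * real d ^ L / n)"
  by (intro sum_mono)
 also have "\<dots> = 2 * real L * real d ^ L" using n_pos by simp
 also have "(\<Sum>v<n. pr n (\<lambda>\<sigma>. on_cycle \<sigma> L v))
  = pavg n (\<lambda>\<sigma>. \<Sum>v<n. if on_cycle \<sigma> L v then 1 else 0)"
  unfolding pr_def pavg_sum ..
 also have "\<dots> = pavg n (\<lambda>\<sigma>. real (card {v. v < n \<and> (on_cycle \<sigma> L v)}))"
  by (simp add: sum.If_cases Int_def)
 finally show ?thesis .
qed

section \<open>Expected mass of the paths that are not good\<close>

definition bad_mass_of :: "(nat \<Rightarrow> nat) \<Rightarrow> nat \<Rightarrow> real" where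
 "bad_mass_of \<sigma> s = (\<Sum>z<n. \<Sum>es\<in>{es\<in>Lst s. \<not> good es z}. wt (\<lambda>p. ind \<sigma> p + 1 / n) es z)"

lemma wt_const_sum: "z < n \<Longrightarrow> (\<Sum>es\<in>Lst s. wt (\<lambda>_. 1) es z) = real n ^ s"
proof (induction s arbitrary: z)
 case 0
 then show ?case by (simp add: Lst_def)
next
 case (Suc s)
 have "(\<Sum>es\<in>Lst (Suc s). wt (\<lambda>_. 1) es z) = (\<Sum>p\<in>{..<n} \<times> {..<n}. \<Sum>es\<in>Lst s. wt (\<lambda>_. 1) es (fst p) * Q (snd p) z)"
  unfolding Lst_def sum_llists_Suc by (intro sum.cong refl) simp
 also have "\<dots> = (\<Sum>p\<in>{..<n} \<times> {..<n}. real n ^ s * Q (snd p) z)"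
  unfolding sum_distrib_right[symmetric] by (intro sum.cong refl) (use Suc.IH in auto)
 also have "\<dots> = (\<Sum>x<n. \<Sum>y<n. real n ^ s * Q y z)" unfolding sum.cartesian_product' fst_conv snd_conv by simp
 also have "\<dots> = real n ^ Suc s" using col[OF Suc.prems] by (simp add: sum_distrib_left[symmetric])
 finally show ?case .
qed

lemma wt_prod: "wt f es z = wt (\<lambda>_. 1) es z * prod_list (map f es)"
 by (induction es arbitrary: z) auto

lemma Q_mass:
 assumes "finite S"
 shows "(\<Sum>z<n. \<Sum>y<n. if z \<in> S then Q y z else 0) \<le> card S" "(\<Sum>z<n. \<Sum>y<n. if y \<in> S then Q y z else 0) \<le> card S"
proof -
 have "(\<Sum>z<n. \<Sum>y<n. if z \<in> S then Q y z else 0) = (\<Sum>z<n. if z \<in> S then 1 else 0)"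
  using col by (intro sum.cong) auto
 also have "\<dots> = card ({..<n} \<inter> S)" by (simp add: sum.If_cases Int_def)
 also have "\<dots> \<le> card S" using assms by (intro of_nat_mono card_mono) auto
 finally show "(\<Sum>z<n. \<Sum>y<n. if z \<in> S then Q y z else 0) \<le> card S" .
 have "(\<Sum>z<n. \<Sum>y<n. if y \<in> S then Q y z else 0) = (\<Sum>y<n. \<Sum>z<n. if y \<in> S then Q y z else 0)" by (rule sum.swap)
 also have "\<dots> = (\<Sum>y<n. if y \<in> S then 1 else 0)"
  using row by (intro sum.cong) auto
 also have "\<dots> = card ({..<n} \<inter> S)" by (simp add: sum.If_cases Int_def)
 also have "\<dots> \<le> card S" using assms by (intro of_nat_mono card_mono) auto
 finally show "(\<Sum>z<n. \<Sum>y<n. if y \<in> S then Q y z else 0) \<le> card S" .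
qed

definition newly_bad :: "(nat \<times> nat) \<Rightarrow> (nat \<times> nat) list \<Rightarrow> nat \<Rightarrow> real" where
 "newly_bad p es z = (if z \<in> E then 1 else 0) + (if z \<in> set (map fst (p # es)) then 1 else 0) + (if snd p \<in> set (map snd es) then 1 else 0)"

lemma newly_bad_mass:
 assumes "es \<in> Lst s"
 shows "(\<Sum>z<n. \<Sum>y<n. newly_bad (x, y) es z * Q y z) \<le> card E + 2 * s + 1"
proof -
 let ?S = "set (x # map fst es)" and ?T = "set (map snd es)"
 have fE: "finite E" using E_sub finite_subset by blast
 have "(\<Sum>z<n. \<Sum>y<n. newly_bad (x, y) es z * Q y z)
  = (\<Sum>z<n. \<Sum>y<n. (if z \<in> E then Q y z else 0) + (if z \<in> ?S then Q y z else 0) + (if y \<in> ?T then Q y z else 0))"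
  unfolding newly_bad_def by (intro sum.cong refl) (simp add: distrib_right)
 also have "\<dots> = (\<Sum>z<n. \<Sum>y<n. if z \<in> E then Q y z else 0) + (\<Sum>z<n. \<Sum>y<n. if z \<in> ?S then Q y z else 0) + (\<Sum>z<n. \<Sum>y<n. if y \<in> ?T then Q y z else 0)"
  by (simp only: sum.distrib)
 also have "\<dots> \<le> real (card E) + real (card ?S) + real (card ?T)"
  by (intro add_mono Q_mass fE) auto
 also have "\<dots> \<le> card E + real (s + 1) + real s"
  using assms card_length[of "x # map fst es"] card_length[of "map snd es"]
  unfolding Lst_def llists_def by (intro add_mono order_refl of_nat_mono) auto
 finally show ?thesis by simp
qed

text \<open>If a path is bad before its last step, summing over that step costs the row sum 2 of
  \<open>plus\<close>. Otherwise its positions are distinct, so \<open>pavg_plus_le\<close> applies,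
  and the last step must end in \<open>E\<close> or repeat a vertex or a label, which leaves a mass
  of at most \<open>card E + 2 * s + 1\<close>.\<close>

lemma bad_mass_step:
 assumes s: "2 * (Suc s)\<^sup>2 \<le> n"
 shows "pavg n (\<lambda>\<sigma>. bad_mass_of \<sigma> (Suc s)) \<le> 2 * pavg n (\<lambda>\<sigma>. bad_mass_of \<sigma> s) + 2 * 2 ^ Suc s * real (card E + 2 * s + 1)"
proof -
 let ?pl = "\<lambda>\<sigma> p. ind \<sigma> p + 1 / real n" and ?R = "{..<n} \<times> {..<n}"
 let ?A = "\<lambda>\<sigma>. \<Sum>z<n. \<Sum>p\<in>?R. \<Sum>es\<in>Lst s. (if \<not> good es (fst p) then wt (?pl \<sigma>) es (fst p) * ?pl \<sigma> p else 0) * Q (snd p) z"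
 let ?c = "\<lambda>z p es. (if good es (fst p) then newly_bad p es z * (wt (\<lambda>_. 1) es (fst p) * Q (snd p) z) else 0)"
 let ?B = "\<lambda>\<sigma>. \<Sum>z<n. \<Sum>p\<in>?R. \<Sum>es\<in>Lst s. ?c z p es * prod_list (map (?pl \<sigma>) (p # es))"
 have pl0: "0 \<le> ?pl \<sigma> p" for \<sigma> p unfolding ind_def by simp
 have wt0: "0 \<le> wt (?pl \<sigma>) es z" for \<sigma> es z by (induction es arbitrary: z) (auto intro!: mult_nonneg_nonneg pl0 Q_nonneg)
 have w1: "0 \<le> wt (\<lambda>_. 1) es z" for es z by (induction es arbitrary: z) (auto intro!: mult_nonneg_nonneg Q_nonneg)
 have nb0: "0 \<le> newly_bad p es z" for p es z unfolding newly_bad_def by simp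
 have split: "bad_mass_of \<sigma> (Suc s) \<le> ?A \<sigma> + ?B \<sigma>" for \<sigma>
 proof -
  have "bad_mass_of \<sigma> (Suc s) = (\<Sum>z<n. \<Sum>es\<in>Lst (Suc s). if \<not> good es z then wt (?pl \<sigma>) es z else 0)"
   unfolding bad_mass_of_def by (intro sum.cong refl sum.inter_filter) simp
  also have "\<dots> = (\<Sum>z<n. \<Sum>p\<in>?R. \<Sum>es\<in>Lst s. if \<not> good (p # es) z then wt (?pl \<sigma>) (p # es) z else 0)"
   unfolding Lst_def sum_llists_Suc ..
  also have "\<dots> \<le> (\<Sum>z<n. \<Sum>p\<in>?R. \<Sum>es\<in>Lst s. (if \<not> good es (fst p) then wt (?pl \<sigma>) es (fst p) * ?pl \<sigma> p else 0) * Q (snd p) z + ?c z p es * prod_list (map (?pl \<sigma>) (p # es)))"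
  proof (intro sum_mono)
   fix z :: nat and p :: "nat \<times> nat" and es :: "(nat \<times> nat) list"
   let ?x = "wt (?pl \<sigma>) es (fst p) * ?pl \<sigma> p * Q (snd p) z"
   have x0: "0 \<le> ?x" by (intro mult_nonneg_nonneg wt0 pl0 Q_nonneg)
   have e: "?c z p es * prod_list (map (?pl \<sigma>) (p # es)) = (if good es (fst p) then newly_bad p es z * ?x else 0)"
    unfolding wt_prod[of "?pl \<sigma>" es] by (simp add: mult_ac)
   have nb: "1 \<le> newly_bad p es z" if "\<not> good (p # es) z" "good es (fst p)"
    using that unfolding good_def newly_bad_def by auto
   show "(if \<not> good (p # es) z then wt (?pl \<sigma>) (p # es) z else 0) \<le> (if \<not> good es (fst p) then wt (?pl \<sigma>) es (fst p) * ?pl \<sigma> p else 0) * Q (snd p) z + ?c z p es * prod_list (map (?pl \<sigma>) (p # es))"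
    unfolding e
   proof (cases "good es (fst p)")
    case True
    show "(if \<not> good (p # es) z then wt (?pl \<sigma>) (p # es) z else 0) \<le> (if \<not> good es (fst p) then wt (?pl \<sigma>) es (fst p) * ?pl \<sigma> p else 0) * Q (snd p) z + (if good es (fst p) then newly_bad p es z * ?x else 0)"
    proof (cases "good (p # es) z")
     case True
     then show ?thesis using nb0[of p es z] x0 \<open>good es (fst p)\<close> by simp
    next
     case False
     have "1 * ?x \<le> newly_bad p es z * ?x" by (rule mult_right_mono[OF nb[OF False True] x0])
     then show ?thesis using False True by simp
    qed
   next
    case False
    then show "(if \<not> good (p # es) z then wt (?pl \<sigma>) (p # es) z else 0) \<le> (if \<not> good es (fst p) then wt (?pl \<sigma>) es (fst p) * ?pl \<sigma> p else 0) * Q (snd p) z + (if good es (fst p) then newly_bad p es z * ?x else 0)"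
     using x0 by simp
   qed
  qed
  also have "\<dots> = ?A \<sigma> + ?B \<sigma>" by (simp only: sum.distrib)
  finally show ?thesis .
 qed
 \<comment> \<open>A row of \<open>ind + 1 / n\<close> sums to at most 2, and the row sums of
   \<open>Q\<close> are at most 1.\<close>
 have A: "?A \<sigma> \<le> 2 * bad_mass_of \<sigma> s" for \<sigma>
 proof -
  let ?w = "\<lambda>es x. if \<not> good es x then wt (?pl \<sigma>) es x else 0"
  have "?A \<sigma> = (\<Sum>p\<in>?R. \<Sum>z<n. \<Sum>es\<in>Lst s. ?w es (fst p) * ?pl \<sigma> p * Q (snd p) z)"
   by (subst sum.swap) (intro sum.cong refl, simp)
  also have "\<dots> = (\<Sum>p\<in>?R. (\<Sum>es\<in>Lst s. ?w es (fst p)) * ?pl \<sigma> p * (\<Sum>z<n. Q (snd p) z))"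
   by (simp only: sum_distrib_left sum_distrib_right)
  also have "\<dots> \<le> (\<Sum>p\<in>?R. (\<Sum>es\<in>Lst s. ?w es (fst p)) * ?pl \<sigma> p * 1)"
   by (intro sum_mono mult_left_mono row_le mult_nonneg_nonneg sum_nonneg pl0) (simp add: wt0)
  also have "\<dots> = (\<Sum>x<n. \<Sum>y<n. (\<Sum>es\<in>Lst s. ?w es x) * ?pl \<sigma> (x, y))" unfolding sum.cartesian_product' fst_conv snd_conv by simp
  also have "\<dots> = (\<Sum>x<n. (\<Sum>es\<in>Lst s. ?w es x) * (\<Sum>y<n. ?pl \<sigma> (x, y)))" by (simp only: sum_distrib_left)
  also have "\<dots> \<le> (\<Sum>x<n. (\<Sum>es\<in>Lst s. ?w es x) * 2)"
  proof (intro sum_mono mult_left_mono sum_nonneg)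
   fix x
   have "(\<Sum>y<n. ?pl \<sigma> (x, y)) = (\<Sum>y<n. if \<sigma> x = y then 1 else 0) + 1" unfolding sum.distrib ind_def using n_pos by simp
   then show "(\<Sum>y<n. ?pl \<sigma> (x, y)) \<le> 2" by (simp add: sum.delta)
  qed (simp add: wt0)
  also have "\<dots> = (\<Sum>x<n. \<Sum>es\<in>Lst s. ?w es x) * 2" by (rule sum_distrib_right[symmetric])
  also have "\<dots> = 2 * (\<Sum>x<n. \<Sum>es\<in>Lst s. ?w es x)" by (rule mult.commute)
  also have "(\<Sum>x<n. \<Sum>es\<in>Lst s. ?w es x) = bad_mass_of \<sigma> s"
   unfolding bad_mass_of_def by (intro sum.cong refl sum.inter_filter[symmetric]) simp
  finally show ?thesis .
 qed
 let ?D = "2 * 2 ^ Suc s * (1 / real n) ^ Suc s"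
 have B: "pavg n ?B \<le> 2 * 2 ^ Suc s * real (card E + 2 * s + 1)"
 proof -
  have "pavg n ?B = (\<Sum>z<n. \<Sum>p\<in>?R. \<Sum>es\<in>Lst s. ?c z p es * pavg n (\<lambda>\<sigma>. prod_list (map (?pl \<sigma>) (p # es))))"
   by (simp only: pavg_sum pavg_cmult)
  also have "\<dots> \<le> (\<Sum>z<n. \<Sum>p\<in>?R. \<Sum>es\<in>Lst s. newly_bad p es z * (wt (\<lambda>_. 1) es (fst p) * Q (snd p) z) * ?D)"
  proof (intro sum_mono)
   fix z p es assume p: "p \<in> ?R" and es: "es \<in> Lst s"
   have c0: "0 \<le> newly_bad p es z * (wt (\<lambda>_. 1) es (fst p) * Q (snd p) z)" by (intro mult_nonneg_nonneg nb0 w1 Q_nonneg)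
   show "?c z p es * pavg n (\<lambda>\<sigma>. prod_list (map (?pl \<sigma>) (p # es))) \<le> newly_bad p es z * (wt (\<lambda>_. 1) es (fst p) * Q (snd p) z) * ?D"
   proof (cases "good es (fst p)")
    case True
    then have "distinct (map fst (p # es))" unfolding good_def by simp
    then have "distinct (p # es)" by (simp only: distinct_map)
    moreover have "p # es \<in> llists ?R (Suc s)" using p es unfolding Lst_def llists_def by auto
    ultimately have "pavg n (\<lambda>\<sigma>. prod_list (map (?pl \<sigma>) (p # es))) \<le> ?D" by (intro pavg_plus_le[OF n_pos s])
    then show ?thesis using True c0 by (simp only: if_True mult_left_mono)
   next
    case False
    then show ?thesis using c0 by simp
   qed
  qed
  also have "\<dots> = (\<Sum>p\<in>?R. \<Sum>es\<in>Lst s. \<Sum>z<n. newly_bad p es z * (wt (\<lambda>_. 1) es (fst p) * Q (snd p) z) * ?D)"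
   by (subst sum.swap) (intro sum.cong refl sum.swap)
  also have "\<dots> = (\<Sum>x<n. \<Sum>y<n. \<Sum>es\<in>Lst s. \<Sum>z<n. newly_bad (x, y) es z * (wt (\<lambda>_. 1) es x * Q y z) * ?D)"
   unfolding sum.cartesian_product' fst_conv snd_conv by simp
  also have "\<dots> = (\<Sum>x<n. \<Sum>es\<in>Lst s. \<Sum>y<n. \<Sum>z<n. newly_bad (x, y) es z * (wt (\<lambda>_. 1) es x * Q y z) * ?D)"
   by (intro sum.cong refl sum.swap)
  also have "\<dots> = (\<Sum>x<n. \<Sum>es\<in>Lst s. \<Sum>z<n. \<Sum>y<n. newly_bad (x, y) es z * (wt (\<lambda>_. 1) es x * Q y z) * ?D)"
   by (intro sum.cong refl sum.swap)
  also have "\<dots> = (\<Sum>x<n. \<Sum>es\<in>Lst s. wt (\<lambda>_. 1) es x * ?D * (\<Sum>z<n. \<Sum>y<n. newly_bad (x, y) es z * Q y z))"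
   unfolding sum_distrib_left by (intro sum.cong refl) (simp only: mult_ac)
  also have "\<dots> \<le> (\<Sum>x<n. \<Sum>es\<in>Lst s. wt (\<lambda>_. 1) es x * ?D * real (card E + 2 * s + 1))"
   by (intro sum_mono mult_left_mono newly_bad_mass mult_nonneg_nonneg w1) auto
  also have "\<dots> = (\<Sum>x<n. \<Sum>es\<in>Lst s. wt (\<lambda>_. 1) es x) * ?D * real (card E + 2 * s + 1)"
   by (simp only: sum_distrib_right)
  also have "(\<Sum>x<n. \<Sum>es\<in>Lst s. wt (\<lambda>_. 1) es x) = real n ^ Suc s" using wt_const_sum by simp
  also have "real n ^ Suc s * ?D * real (card E + 2 * s + 1) = 2 * 2 ^ Suc s * real (card E + 2 * s + 1)"
   using n_pos by (simp add: power_divide field_simps)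
  finally show ?thesis .
 qed
 have "pavg n (\<lambda>\<sigma>. bad_mass_of \<sigma> (Suc s)) \<le> pavg n (\<lambda>\<sigma>. 2 * bad_mass_of \<sigma> s + ?B \<sigma>)"
  by (rule pavg_mono) (rule order_trans[OF split add_right_mono[OF A]])
 also have "\<dots> = 2 * pavg n (\<lambda>\<sigma>. bad_mass_of \<sigma> s) + pavg n ?B"
  unfolding pavg_cmult[symmetric] unfolding pavg_def by (simp only: sum.distrib add_divide_distrib)
 finally show ?thesis using B by linarith
qed

lemma bad_mass_avg:
 "2 * s\<^sup>2 \<le> n \<Longrightarrow> pavg n (\<lambda>\<sigma>. bad_mass_of \<sigma> s) \<le> real (s + 1) * 2 ^ (s + 1) * real (card E + 2 * s + 1)"
proof (induction s)
 case 0
 have "bad_mass_of \<sigma> 0 = card E" for \<sigma>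
 proof -
  have "{es \<in> Lst 0. \<not> good es z} = (if z \<in> E then {[]} else {})" for z
   unfolding Lst_def good_def by auto
  then have "bad_mass_of \<sigma> 0 = (\<Sum>z<n. if z \<in> E then 1 else 0)" unfolding bad_mass_of_def by (intro sum.cong) auto
  also have "\<dots> = card ({..<n} \<inter> E)" by (simp add: sum.If_cases Int_def)
  also have "{..<n} \<inter> E = E" using E_sub by blast
  finally show ?thesis .
 qed
 then show ?case by simp
next
 case (Suc s)
 let ?e = "real (card E + 2 * s + 1)"
 have "2 * s\<^sup>2 \<le> 2 * (Suc s)\<^sup>2" by (simp add: power2_eq_square)
 then have IH: "pavg n (\<lambda>\<sigma>. bad_mass_of \<sigma> s) \<le> real (s + 1) * 2 ^ (s + 1) * ?e" using Suc by linarith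
 have "pavg n (\<lambda>\<sigma>. bad_mass_of \<sigma> (Suc s)) \<le> 2 * (real (s + 1) * 2 ^ (s + 1) * ?e) + 2 * 2 ^ Suc s * ?e"
  using bad_mass_step[OF Suc.prems] IH by linarith
 also have "\<dots> = real (Suc s + 1) * 2 ^ (Suc s + 1) * ?e" by (simp add: algebra_simps)
 also have "\<dots> \<le> real (Suc s + 1) * 2 ^ (Suc s + 1) * real (card E + 2 * Suc s + 1)" by (intro mult_left_mono) auto
 finally show ?case .
qed

end

lemma pr_add2: "pr n A \<le> a \<Longrightarrow> pr n B \<le> b \<Longrightarrow> pr n (\<lambda>\<sigma>. A \<sigma> \<or> B \<sigma>) \<le> a + b"
 using pr_disj[of n A B] by linarith

section \<open>The probability that one of the good properties fails\<close>

context sparse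
begin

abbreviation Jn :: "(nat \<Rightarrow> nat) \<Rightarrow> nat \<Rightarrow> fmat" where
 "Jn \<sigma> s \<equiv> (\<lambda>x z. mpw n (\<lambda>x z. Q (\<sigma> x) z) s x z - 1 / n)"

lemma rho_pow_d: "1 \<le> real d ^ s * (\<rho> ^ s)\<^sup>2"
proof -
 have "1 \<le> (real d * \<rho>\<^sup>2) ^ s" using d_rho by (rule one_le_power)
 then show ?thesis by (simp add: power_mult_distrib power_mult[symmetric] mult.commute)
qed

text \<open>The six summands belong, in order, to a large centred matrix, a large bad mass, many
  vertices on short cycles, a tangle, a short cycle through \<open>E\<close>, and a simple path with
  \<open>r0\<close> visits to \<open>E\<close>. Outside these events \<open>power_bound\<close>
  applies to all \<open>s \<le> L\<close> at once.\<close>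

lemma fail_prob:
 fixes K p \<kappa> :: real
 assumes L: "0 < L" "8 * L\<^sup>2 \<le> n" and K: "1 \<le> K" and r0: "2 \<le> r0"
  and lam: "1 \<le> \<kappa>" "\<kappa> * card E \<le> n" and Ed: "real (card E) * real d ^ L \<le> real n"
  and p: "\<And>s. 0 < s \<Longrightarrow> s \<le> L \<Longrightarrow> pr n (\<lambda>\<sigma>. \<not> opb n (Simp (cen \<sigma>) s) (K * \<rho> ^ s)) \<le> p"
 defines "g \<equiv> 18 * (real L + 1)\<^sup>2 * K\<^sup>2"
 shows "pr n (\<lambda>\<sigma>. \<exists>s. 0 < s \<and> s \<le> L \<and> \<not> opb n (Jn \<sigma> s) ((real r0 + 2) * g * ((real L + 1) * g / \<rho>\<^sup>2) ^ r0 * \<rho> ^ s))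
  \<le> real L * p + real L * (2 * 4 ^ L * real (L + 1) * real (card E + 2 * L + 1) * real d ^ L / n) + 2 * real L * real d ^ L * real d ^ L / n
   + real L * (real L * (4 * real L * real d ^ (2 * L + 1) / n)) + real (card E) * (2 * real L * real d ^ L / n) + real L * (4 * real n * (2 * real d) ^ L / \<kappa> ^ r0)"
proof -
 \<comment> \<open>The largest value that the deterministic part admits. Since
   \<open>1 / \<eta>\<^sup>2 \<le> d ^ L\<close>, the denominators in the Markov bounds turn into
   powers of \<open>d\<close>.\<close>
 define \<eta> where "\<eta> = \<rho> ^ L"
 have eta: "0 < \<eta>" "1 \<le> real d ^ L * \<eta>\<^sup>2" unfolding \<eta>_def using rho rho_pow_d by auto
 let ?O = "\<lambda>\<sigma>. {v. v < n \<and> (on_cycle \<sigma> L v)}"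
 let ?F1 = "\<lambda>\<sigma>. \<exists>s\<in>{1..L}. \<not> opb n (Simp (cen \<sigma>) s) (K * \<rho> ^ s)"
 let ?F2 = "\<lambda>\<sigma>. \<exists>s\<in>{1..L}. \<eta>\<^sup>2 * n / 2 ^ s \<le> bad_mass_of \<sigma> s"
 let ?F3 = "\<lambda>\<sigma>. \<eta>\<^sup>2 * n \<le> real (card (?O \<sigma>))"
 let ?F4 = "\<lambda>\<sigma>. \<exists>c\<in>{1..L}. \<exists>k\<in>{1..L}. tangle_at \<sigma> L c k"
 let ?F5 = "\<lambda>\<sigma>. \<exists>v\<in>E. on_cycle \<sigma> L v"
 let ?F6 = "\<lambda>\<sigma>. \<exists>s\<in>{1..L}. visit_walk \<sigma> s r0"
 \<comment> \<open>The range reaches \<open>2 * L\<close> because a tangle has up to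
   \<open>2 * L\<close> vertices.\<close>
 have sL: "2 * s\<^sup>2 \<le> n" if "s \<le> 2 * L" for s
 proof -
  have "2 * s\<^sup>2 \<le> 2 * (2 * L)\<^sup>2" using that by (intro mult_left_mono power_mono) auto
  then show ?thesis using L(2) by (simp add: power_mult_distrib)
 qed
 have dpos: "1 \<le> real d" using d2 by simp
 have fE: "finite E" using E_sub finite_subset by blast
 have inv: "a / (\<eta>\<^sup>2 * n) \<le> a * real d ^ L / n" if a: "0 \<le> a" for a
 proof -
  have "a * 1 \<le> a * (real d ^ L * \<eta>\<^sup>2)" using eta a by (intro mult_left_mono) auto
  then show ?thesis using eta n_pos by (simp add: field_simps)
 qed
 have F1: "pr n ?F1 \<le> real L * p"
 proof -
  have "pr n ?F1 \<le> (\<Sum>s\<in>{1..L}. pr n (\<lambda>\<sigma>. \<not> opb n (Simp (cen \<sigma>) s) (K * \<rho> ^ s)))" by (rule pr_Bex) simp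
  also have "\<dots> \<le> (\<Sum>s\<in>{1..L}. p)" by (rule sum_mono) (use p in auto)
  finally show ?thesis by simp
 qed
 have F2: "pr n ?F2 \<le> real L * (2 * 4 ^ L * real (L + 1) * real (card E + 2 * L + 1) * real d ^ L / n)"
 proof -
  have "pr n ?F2 \<le> (\<Sum>s\<in>{1..L}. pr n (\<lambda>\<sigma>. \<eta>\<^sup>2 * n / 2 ^ s \<le> bad_mass_of \<sigma> s))" by (rule pr_Bex) simp
  also have "\<dots> \<le> (\<Sum>s\<in>{1..L}. 2 * 4 ^ L * real (L + 1) * real (card E + 2 * L + 1) * real d ^ L / n)"
  proof (rule sum_mono)
   fix s assume s: "s \<in> {1..L}"
   have nn: "0 \<le> bad_mass_of \<sigma> s" for \<sigma>
   proof -
    have "0 \<le> ind \<sigma> p + 1 / n" for p by (simp add: ind_def)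
    then have "0 \<le> wt (\<lambda>p. ind \<sigma> p + 1 / n) es z" for es z
     by (induction es arbitrary: z) (auto intro!: mult_nonneg_nonneg Q_nonneg)
    then show ?thesis unfolding bad_mass_of_def by (intro sum_nonneg)
   qed
   let ?M = "real (s + 1) * 2 ^ (s + 1) * real (card E + 2 * s + 1)"
   have "pr n (\<lambda>\<sigma>. \<eta>\<^sup>2 * n / 2 ^ s \<le> bad_mass_of \<sigma> s) \<le> ?M / (\<eta>\<^sup>2 * n / 2 ^ s)"
    by (rule pr_markov[OF nn _ bad_mass_avg]) (use eta n_pos sL s in auto)
   also have "\<dots> = ?M * 2 ^ s / (\<eta>\<^sup>2 * n)" by simp
   also have "\<dots> \<le> ?M * 2 ^ s * real d ^ L / n" by (rule inv) simp
   also have "?M * 2 ^ s = 2 * 4 ^ s * real (s + 1) * real (card E + 2 * s + 1)"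
    by (simp add: power_mult_distrib[symmetric])
   also have "\<dots> * real d ^ L / n \<le> 2 * 4 ^ L * real (L + 1) * real (card E + 2 * L + 1) * real d ^ L / n"
    using s by (intro divide_right_mono mult_mono order_refl power_increasing of_nat_mono) auto
   finally show "pr n (\<lambda>\<sigma>. \<eta>\<^sup>2 * n / 2 ^ s \<le> bad_mass_of \<sigma> s) \<le> 2 * 4 ^ L * real (L + 1) * real (card E + 2 * L + 1) * real d ^ L / n" by simp
  qed
  finally show ?thesis by simp
 qed
 have F3: "pr n ?F3 \<le> 2 * real L * real d ^ L * real d ^ L / n"
 proof -
  have "pr n ?F3 \<le> (2 * real L * real d ^ L) / (\<eta>\<^sup>2 * n)"
   by (rule pr_markov[OF _ _ cycle_count]) (use eta n_pos sL in auto)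
  also have "\<dots> \<le> 2 * real L * real d ^ L * real d ^ L / n" by (rule inv) simp
  finally show ?thesis .
 qed
 have F4: "pr n ?F4 \<le> real L * (real L * (4 * real L * real d ^ (2 * L + 1) / n))"
 proof -
  have "pr n ?F4 \<le> (\<Sum>c\<in>{1..L}. pr n (\<lambda>\<sigma>. \<exists>k\<in>{1..L}. tangle_at \<sigma> L c k))"
   by (rule pr_Bex) simp
  also have "\<dots> \<le> (\<Sum>c\<in>{1..L}. \<Sum>k\<in>{1..L}. pr n (\<lambda>\<sigma>. tangle_at \<sigma> L c k))"
   by (intro sum_mono pr_Bex) simp
  also have "\<dots> \<le> (\<Sum>c\<in>{1..L}. \<Sum>k\<in>{1..L}. 4 * real L * real d ^ (2 * L + 1) / n)"
  proof (intro sum_mono)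
   fix c k assume ck: "c \<in> {1..L}" "k \<in> {1..L}"
   then have "pr n (\<lambda>\<sigma>. tangle_at \<sigma> L c k) \<le> 2 * real (c + k) * d ^ (c + k + 1) / n"
    by (intro tangle_prob sL) auto
   also have "\<dots> \<le> 2 * real (2 * L) * real d ^ (2 * L + 1) / n"
   proof -
    have "real d ^ (c + k + 1) \<le> real d ^ (2 * L + 1)" by (rule power_increasing) (use ck dpos in auto)
    then show ?thesis using ck by (intro divide_right_mono mult_mono) auto
   qed
   finally show "pr n (\<lambda>\<sigma>. tangle_at \<sigma> L c k) \<le> 4 * real L * real d ^ (2 * L + 1) / n" by simp
  qed
  finally show ?thesis by simp
 qed
 have F5: "pr n ?F5 \<le> real (card E) * (2 * real L * real d ^ L / n)"
 proof -
  have "pr n ?F5 \<le> (\<Sum>v\<in>E. pr n (\<lambda>\<sigma>. on_cycle \<sigma> L v))" by (rule pr_Bex[OF fE])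
  also have "\<dots> \<le> (\<Sum>v\<in>E. 2 * real L * real d ^ L / n)" by (rule sum_mono) (rule cycle_at_prob[OF sL], simp)
  finally show ?thesis by simp
 qed
 have F6: "pr n ?F6 \<le> real L * (4 * real n * (2 * real d) ^ L / \<kappa> ^ r0)"
 proof -
  have "pr n ?F6 \<le> (\<Sum>s\<in>{1..L}. pr n (\<lambda>\<sigma>. visit_walk \<sigma> s r0))"
   by (rule pr_Bex) simp
  also have "\<dots> \<le> (\<Sum>s\<in>{1..L}. 4 * real n * (2 * real d) ^ L / \<kappa> ^ r0)"
  proof (rule sum_mono)
   fix s assume s: "s \<in> {1..L}"
   then have "pr n (\<lambda>\<sigma>. visit_walk \<sigma> s r0) \<le> 4 * n * (2 * d) ^ s / \<kappa> ^ r0"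
    by (intro visit_prob sL lam) auto
   also have "\<dots> = 4 * real n * (2 * real d) ^ s / \<kappa> ^ r0" by simp
   also have "\<dots> \<le> 4 * real n * (2 * real d) ^ L / \<kappa> ^ r0"
   proof -
    have pw: "(2 * real d) ^ s \<le> (2 * real d) ^ L" by (rule power_increasing) (use s dpos in auto)
    show ?thesis by (rule divide_right_mono[OF mult_left_mono[OF pw]]) (use lam(1) in auto)
   qed
   finally show "pr n (\<lambda>\<sigma>. visit_walk \<sigma> s r0) \<le> 4 * real n * (2 * real d) ^ L / \<kappa> ^ r0" .
  qed
  finally show ?thesis by simp
 qed
 have "pr n (\<lambda>\<sigma>. \<exists>s. 0 < s \<and> s \<le> L \<and> \<not> opb n (Jn \<sigma> s) ((real r0 + 2) * g * ((real L + 1) * g / \<rho>\<^sup>2) ^ r0 * \<rho> ^ s))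
  \<le> pr n (\<lambda>\<sigma>. ((((?F1 \<sigma> \<or> ?F2 \<sigma>) \<or> ?F3 \<sigma>) \<or> ?F4 \<sigma>) \<or> ?F5 \<sigma>) \<or> ?F6 \<sigma>)"
 proof (rule pr_mono, rule ccontr)
  fix \<sigma> assume sg: "\<sigma> \<in> perms n"
   and ex: "\<exists>s. 0 < s \<and> s \<le> L \<and> \<not> opb n (Jn \<sigma> s) ((real r0 + 2) * g * ((real L + 1) * g / \<rho>\<^sup>2) ^ r0 * \<rho> ^ s)"
   and no: "\<not> (((((?F1 \<sigma> \<or> ?F2 \<sigma>) \<or> ?F3 \<sigma>) \<or> ?F4 \<sigma>) \<or> ?F5 \<sigma>) \<or> ?F6 \<sigma>)"
  interpret walks n d Q E \<rho> \<sigma> L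
   by (intro walks.intro walks_axioms.intro sparse_axioms) (use sg in \<open>simp add: perms_def\<close>)
  have P: "P = (\<lambda>x z. Q (\<sigma> x) z)" by (intro ext) (simp add: P_def)
  have bm: "bad_mass s = bad_mass_of \<sigma> s" for s unfolding bad_mass_def bad_mass_of_def ..
  have Oc: "Oc = ?O \<sigma>" unfolding Oc_def P ..
  have "opb n (\<lambda>x z. mpw n P s x z - 1 / n) ((real r0 + 2) * g * ((real L + 1) * g / \<rho>\<^sup>2) ^ r0 * \<rho> ^ s)" if s: "0 < s" "s \<le> L" for s
   unfolding g_def
  proof (rule power_bound_explicit[where \<eta> = \<eta>, OF K _ _ _ _ _ _ _ _ _ s])
   fix s assume s: "0 < s" "s \<le> L"
   show "opb n (Simp (cen \<sigma>) s) (K * \<rho> ^ s)" using no s by (metis atLeastAtMost_iff Suc_leI One_nat_def)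
   have "\<not> \<eta>\<^sup>2 * n / 2 ^ s \<le> bad_mass s" unfolding bm using no s by (metis atLeastAtMost_iff Suc_leI One_nat_def)
   then show "2 ^ s / n * bad_mass s \<le> \<eta>\<^sup>2" using n_pos by (simp add: field_simps)
  next
   show "0 \<le> \<eta>" "\<eta> \<le> \<rho> ^ L" using eta unfolding \<eta>_def by auto
   have "real (card E) * 1 \<le> real (card E) * (real d ^ L * \<eta>\<^sup>2)" using eta by (intro mult_left_mono) auto
   also have "\<dots> \<le> n * \<eta>\<^sup>2" using mult_right_mono[OF Ed, of "\<eta>\<^sup>2"] by (simp add: mult.assoc)
   finally show "real (card E) \<le> \<eta>\<^sup>2 * n" by (simp add: mult.commute)
   have "\<not> ?F3 \<sigma>" using no by blast
   then show "real (card Oc) \<le> \<eta>\<^sup>2 * n" unfolding Oc by simp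
  next
   show "\<nexists>cs us z. tangle cs us z"
   proof
    assume "\<exists>cs us z. tangle cs us z"
    then obtain cs us z where t: "tangle cs us z" by blast
    then have "length cs \<in> {1..L}" "length us \<in> {1..L}" unfolding tangle_def cycle_def by (cases cs; cases us; auto)+
    moreover have "arcs.tangle (arc_of \<sigma>) L cs us z" using t unfolding P .
    ultimately have "?F4 \<sigma>" by blast
    then show False using no by blast
   qed
  next
   fix cs assume "cycle cs"
   then have "arcs.cycle (arc_of \<sigma>) L cs" unfolding P .
   then show "hd cs \<notin> E" using no by blast
  next
   fix xs assume xs: "distinct xs" "successively (\<lambda>x z. P x z \<noteq> 0) xs" "length xs \<le> Suc L"
   show "visits xs < r0"
   \<comment> \<open>The sixth event concerns paths with at least one step; a shorter list has fewer
     than \<open>2 \<le> r0\<close> visits.\<close>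
   proof (cases "length xs \<le> 1")
    case True
    have "visits xs \<le> length xs" by (rule length_filter_le)
    then show ?thesis using True r0 by linarith
   next
    case False
    then obtain s where s: "length xs = Suc s" "s \<in> {1..L}" using xs(3) by (cases "length xs") auto
    show ?thesis
    proof (rule ccontr)
     assume "\<not> visits xs < r0"
     then have "distinct xs \<and> successively (arc_of \<sigma>) xs \<and> length xs = Suc s \<and> r0 \<le> visits xs" using xs s unfolding P by simp
     then have "?F6 \<sigma>" using s(2) by blast
     then show False using no by blast
    qed
   qed
  qed
  then show False using ex unfolding P by blast
 qed
 also have "\<dots> \<le> ((((real L * p + real L * (2 * 4 ^ L * real (L + 1) * real (card E + 2 * L + 1) * real d ^ L / n)) + 2 * real L * real d ^ L * real d ^ L / n)
   + real L * (real L * (4 * real L * real d ^ (2 * L + 1) / n))) + real (card E) * (2 * real L * real d ^ L / n)) + real L * (4 * real n * (2 * real d) ^ L / \<kappa> ^ r0)"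
  by (intro pr_add2 F1 F2 F3 F4 F5 F6)
 finally show ?thesis by simp
qed

text \<open>The trace is that of the power \<open>2 * m\<close> of the Gram matrix, so there are
  \<open>4 * m\<close> pieces and \<open>b = 2 * T + 3\<close> with \<open>T = 4 * m * s\<close>.
  The assumption \<open>small\<close> makes the sum over the excess \<open>g\<close> geometric with
  ratio 1/2. Of the factor \<open>n ^ 4\<close> in the choice of \<open>K\<close>, one
  \<open>n\<close> pays for the trace and three remain for the probability.\<close>

lemma moment_fail:
 fixes K :: real
 assumes s: "0 < s" and m: "0 < m" and b: "b = 8 * m * s + 3"
  and n: "36 * (4 * m * s)\<^sup>2 \<le> n" "6 * real (4 * m * s) / sqrt (real n) \<le> \<rho>"
  and small: "2 * real b ^ (100 * m) * (2 * real (d + d * d) / \<rho>) ^ 4 \<le> n"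
  and K: "0 < K" "12 * real n ^ 4 * real b ^ (80 * m) * (2 * real (d + d * d) / \<rho>) ^ (8 * m) / \<rho> ^ (4 * m) \<le> K ^ (4 * m)"
 shows "pr n (\<lambda>\<sigma>. \<not> opb n (Simp (cen \<sigma>) s) (K * \<rho> ^ s)) \<le> 1 / real n ^ 3"
proof -
 let ?R = "2 * real (d + d * d) / \<rho>" and ?T = "4 * m * s"
 let ?tr = "\<lambda>\<sigma>. \<Sum>i<n. mpw n (gram n (Simp (cen \<sigma>) s)) (2 * m) i i"
 let ?C = "real b ^ (80 * m) * ?R ^ (8 * m) * (n * \<rho> ^ (4 * m * (s - 1)))"
 have R0: "0 \<le> ?R" using rho by simp
 have nr: "0 < real n" using n_pos by simp
 have "pavg n ?tr \<le> 6 * (\<Sum>g\<le>?T. real ((2 * ?T + 3) ^ (5 * (2 * (2 * m) * (5 * g + 4)))) * (n * (1 / n) ^ g * \<rho> ^ (2 * (2 * m) * (s - 1)) * ?R ^ (4 * g + 2 * (2 * (2 * m)))))"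
  by (rule moment_bound) (use s m n in \<open>simp_all add: mult.assoc\<close>)
 also have "(\<Sum>g\<le>?T. real ((2 * ?T + 3) ^ (5 * (2 * (2 * m) * (5 * g + 4)))) * (n * (1 / n) ^ g * \<rho> ^ (2 * (2 * m) * (s - 1)) * ?R ^ (4 * g + 2 * (2 * (2 * m)))))
  = (\<Sum>g\<le>?T. ?C * (real b ^ (100 * m) * ?R ^ 4 / n) ^ g)"
 proof (rule sum.cong[OF refl])
  fix g
  have bb: "2 * ?T + 3 = b" unfolding b by simp
  have e1: "5 * (2 * (2 * m) * (5 * g + 4)) = 80 * m + 100 * m * g" by (simp add: algebra_simps)
  have e2: "4 * g + 2 * (2 * (2 * m)) = 8 * m + 4 * g" by simp
  have e3: "2 * (2 * m) * (s - 1) = 4 * m * (s - 1)" by simp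
  have alg: "B ^ (80 * m + 100 * m * g) * (N * (1 / N) ^ g * X * R ^ (8 * m + 4 * g)) = B ^ (80 * m) * R ^ (8 * m) * (N * X) * (B ^ (100 * m) * R ^ 4 / N) ^ g"
   for B N X R :: real
   by (simp add: power_add power_mult power_mult_distrib power_divide)
  show "real ((2 * ?T + 3) ^ (5 * (2 * (2 * m) * (5 * g + 4)))) * (n * (1 / n) ^ g * \<rho> ^ (2 * (2 * m) * (s - 1)) * ?R ^ (4 * g + 2 * (2 * (2 * m)))) = ?C * (real b ^ (100 * m) * ?R ^ 4 / n) ^ g"
   unfolding bb e1 e2 e3 of_nat_power by (rule alg)
 qed
 also have "\<dots> \<le> (\<Sum>g\<le>?T. ?C * (1 / 2) ^ g)"
 proof (intro sum_mono mult_left_mono power_mono)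
  show "real b ^ (100 * m) * ?R ^ 4 / n \<le> 1 / 2" using small nr by (simp add: divide_le_eq)
 qed (use R0 rho in auto)
 also have "\<dots> = ?C * (\<Sum>g\<le>?T. (1 / 2) ^ g)" by (rule sum_distrib_left[symmetric])
 also have "\<dots> \<le> ?C * 2"
 proof (rule mult_left_mono)
  have "(\<Sum>g\<le>k. (1 / 2) ^ g) \<le> (2 :: real) - (1 / 2) ^ k" for k by (induction k) auto
  then show "(\<Sum>g\<le>?T. (1 / 2) ^ g) \<le> (2 :: real)" by (rule order_trans) simp
 qed (use R0 rho in simp)
 finally have avg: "pavg n ?tr \<le> 12 * ?C" by simp
 have Kp: "0 < K * \<rho> ^ s" using K rho by simp
 have nn: "0 \<le> ?tr \<sigma>" for \<sigma>
 proof -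
  have "0 \<le> mpw n (gram n A) (2 * m) i i" if "i < n" for A i
  proof -
   have "mpw n (gram n A) (m + m) i i = mm n (mpw n (gram n A) m) (mpw n (gram n A) m) i i" using mpw_add[OF that] by simp
   also have "\<dots> = (\<Sum>k<n. (mpw n (gram n A) m i k)\<^sup>2)"
    unfolding mm_def power2_eq_square using mpw_sym[where A = "gram n A" and k = m, OF gram_sym] that by (intro sum.cong) auto
   finally show ?thesis by (simp add: mult_2 sum_nonneg)
  qed
  then show ?thesis by (intro sum_nonneg) simp
 qed
 have "pr n (\<lambda>\<sigma>. \<not> opb n (Simp (cen \<sigma>) s) (K * \<rho> ^ s)) \<le> pr n (\<lambda>\<sigma>. (K * \<rho> ^ s) ^ (4 * m) \<le> ?tr \<sigma>)"
 proof (rule pr_mono, rule ccontr)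
  fix \<sigma> assume "\<not> opb n (Simp (cen \<sigma>) s) (K * \<rho> ^ s)" "\<not> (K * \<rho> ^ s) ^ (4 * m) \<le> ?tr \<sigma>"
  then show False using opb_trace[OF m less_imp_le[OF Kp], of n "Simp (cen \<sigma>) s"] by linarith
 qed
 also have "\<dots> \<le> 12 * ?C / (K * \<rho> ^ s) ^ (4 * m)" by (rule pr_markov[OF nn _ avg]) (use Kp in simp)
 also have "\<dots> \<le> 1 / real n ^ 3"
 proof -
  let ?X = "12 * real b ^ (80 * m) * ?R ^ (8 * m)"
  have rs: "(\<rho> ^ s) ^ (4 * m) = \<rho> ^ (4 * m) * \<rho> ^ (4 * m * (s - 1))"
   using s by (cases s) (simp_all add: power_mult[symmetric] power_add[symmetric] algebra_simps)
  have "real n ^ 4 * ?X = (12 * real n ^ 4 * real b ^ (80 * m) * ?R ^ (8 * m) / \<rho> ^ (4 * m)) * \<rho> ^ (4 * m)" using rho by simp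
  also have "\<dots> \<le> K ^ (4 * m) * \<rho> ^ (4 * m)" using K(2) rho by (intro mult_right_mono) auto
  finally have "real n ^ 4 * ?X * \<rho> ^ (4 * m * (s - 1)) \<le> K ^ (4 * m) * \<rho> ^ (4 * m) * \<rho> ^ (4 * m * (s - 1))"
   using rho by (intro mult_right_mono) auto
  then have "real n ^ 3 * (12 * ?C) \<le> (K * \<rho> ^ s) ^ (4 * m)"
   unfolding power_mult_distrib rs by (simp add: mult_ac eval_nat_numeral)
  moreover have "b / c \<le> 1 / a" if "a * b \<le> c" "0 < a" "0 < c" for a b c :: real
   using that by (simp add: field_simps)
  ultimately show ?thesis using Kp nr by simp
 qed
 finally show ?thesis .
qed

end

section \<open>Choice of the parameters\<close>

text \<open>Bounds the number \<open>8 * m * s + 3\<close> of \<open>moment_fail\<close> when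
  \<open>m \<le> x + 1\<close> and \<open>s \<le> x\<^sup>2\<close>.\<close>

definition blen :: "real \<Rightarrow> real" where "blen x = 8 * (x + 1) * x\<^sup>2 + 3"

text \<open>Here \<open>x\<close> stands for \<open>sqrt (ln n)\<close>, so
  \<open>exp (x\<^sup>2)\<close> is \<open>n\<close>, while \<open>exp x\<close> bounds
  \<open>d\<close> and every loss that is allowed in the final estimate.\<close>

definition large :: "real \<Rightarrow> nat \<Rightarrow> real \<Rightarrow> bool" where
 "large \<epsilon> r0 x \<longleftrightarrow> 1 \<le> x \<and> 1 \<le> \<epsilon> * x \<and> 8 * (x\<^sup>2)\<^sup>2 \<le> exp (x\<^sup>2) \<and> 36 * (4 * (x + 1) * x\<^sup>2)\<^sup>2 \<le> exp (x\<^sup>2) \<and>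
  6 * (4 * (x + 1) * x\<^sup>2) * exp x \<le> exp (x\<^sup>2 / 2) \<and>
  2 * blen x powr (100 * (x + 1)) * (4 * exp (3 * x)) ^ 4 \<le> exp (x\<^sup>2) \<and>
  192 * blen x ^ 20 \<le> exp x \<and> 18 * (x\<^sup>2 + 1)\<^sup>2 \<le> exp x \<and> real r0 + 2 \<le> exp x \<and>
  24 * (x\<^sup>2 + 1) ^ 3 * exp x \<le> exp (5 * \<epsilon> * x\<^sup>2)"

lemma eventually_large:
 assumes "0 < \<epsilon>"
 shows "eventually (large \<epsilon> r0) at_top"
proof -
 have "eventually (\<lambda>x. 1 \<le> \<epsilon> * x) at_top" "eventually (\<lambda>x. 24 * (x\<^sup>2 + 1) ^ 3 * exp x \<le> exp (5 * \<epsilon> * x\<^sup>2)) at_top"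
  using assms by real_asymp+
 moreover have "eventually (\<lambda>x::real. 1 \<le> x) at_top" "eventually (\<lambda>x::real. 8 * (x\<^sup>2)\<^sup>2 \<le> exp (x\<^sup>2)) at_top"
  "eventually (\<lambda>x::real. 36 * (4 * (x + 1) * x\<^sup>2)\<^sup>2 \<le> exp (x\<^sup>2)) at_top"
  "eventually (\<lambda>x::real. 6 * (4 * (x + 1) * x\<^sup>2) * exp x \<le> exp (x\<^sup>2 / 2)) at_top"
  "eventually (\<lambda>x::real. 192 * blen x ^ 20 \<le> exp x) at_top" "eventually (\<lambda>x::real. 18 * (x\<^sup>2 + 1)\<^sup>2 \<le> exp x) at_top"
  "eventually (\<lambda>x::real. real r0 + 2 \<le> exp x) at_top"
  unfolding blen_def by real_asymp+
 moreover have "eventually (\<lambda>x::real. 2 * blen x powr (100 * (x + 1)) * (4 * exp (3 * x)) ^ 4 \<le> exp (x\<^sup>2)) at_top"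
  unfolding blen_def by real_asymp
 ultimately show ?thesis unfolding large_def by eventually_elim blast
qed

context sparse
begin

lemma rho_d: "1 / \<rho> \<le> d" "1 / \<rho>\<^sup>2 \<le> d" "1 / real d \<le> \<rho>"
proof -
 show "1 / \<rho>\<^sup>2 \<le> d" using d_rho rho by (simp add: divide_le_eq)
 have "real d * \<rho>\<^sup>2 \<le> real d * \<rho>" using rho by (intro mult_left_mono) (auto simp: power2_eq_square mult_le_cancel_right1)
 then have "1 \<le> real d * \<rho>" using d_rho by linarith
 then show "1 / \<rho> \<le> d" "1 / real d \<le> \<rho>" using rho d2 by (auto simp: divide_le_eq mult.commute)
qed

text \<open>\<open>L\<close> is chosen so that \<open>d ^ L \<le> N = n powr \<epsilon>\<close>.
  Each of the six terms of \<open>fail_prob\<close> is at most a polynomial in \<open>x\<close>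
  times \<open>exp x * N ^ 3 * n powr (- \<delta>)\<close>; \<open>large\<close> bounds the sum of
  the prefactors by \<open>n powr (5 * \<epsilon>)\<close>. The total exponent
  \<open>8 * \<epsilon> - \<delta>\<close> is \<open>- c0\<close>, which explains the 8 in
  \<open>\<epsilon>\<close>.\<close>

lemma good_prob:
 fixes c0 \<delta> :: real
 assumes c: "0 < c0" "c0 < \<delta>" "\<delta> \<le> 1" and E: "card E \<le> real n powr (1 - \<delta>)"
 defines "x \<equiv> sqrt (ln n)" and "\<epsilon> \<equiv> (\<delta> - c0) / 8" and "r0 \<equiv> nat \<lceil>3 / \<delta>\<rceil>"
 defines "L \<equiv> nat \<lfloor>\<epsilon> * x\<^sup>2 / ln d\<rfloor>"
 assumes dx: "ln d \<le> x" and lg: "large \<epsilon> r0 x"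
 shows "pr n (\<lambda>\<sigma>. \<exists>s. 0 < s \<and> s \<le> L \<and> \<not> opb n (Jn \<sigma> s) (exp (real (20 + 21 * r0) * x) * \<rho> ^ s)) \<le> real n powr (- c0)"
  "0 < L"
proof -
 note lg = lg[unfolded large_def]
 have x1: "1 \<le> x" using lg by blast
 have nr: "0 < real n" using n_pos by simp
 have n1: "1 \<le> real n" using n_pos by simp
 have x2: "x\<^sup>2 = ln n" unfolding x_def using n1 by simp
 have nx: "real n = exp (x\<^sup>2)" unfolding x2 using nr by simp
 have d2': "2 \<le> real d" using d2 by simp
 have lnd: "ln 2 \<le> ln (real d)" "0 < ln (real d)" using d2' by auto
 have dle: "real d \<le> exp x"
 proof -
  have "exp (ln (real d)) \<le> exp x" unfolding exp_le_cancel_iff by (rule dx)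
  then show ?thesis using d2' by simp
 qed
 have eps: "0 < \<epsilon>" "\<epsilon> \<le> 1 / 8" "\<epsilon> \<le> \<delta>" unfolding \<epsilon>_def using c by auto
 have e0: "0 \<le> \<epsilon> * x\<^sup>2 / ln d" using eps lnd by simp
 have Lle: "real L \<le> \<epsilon> * x\<^sup>2 / ln d" unfolding L_def using e0 by linarith
 have "1 \<le> \<epsilon> * x\<^sup>2 / ln d"
 proof -
  have "x * 1 \<le> x * (\<epsilon> * x)" using lg x1 by (intro mult_left_mono) auto
  then have "ln d \<le> \<epsilon> * x\<^sup>2" using dx by (simp add: power2_eq_square mult_ac)
  then show ?thesis using lnd by simp
 qed
 then show L0: "0 < L" unfolding L_def by linarith
 have Lx: "real L \<le> x\<^sup>2"
 proof -
  have "1 / 2 \<le> ln (2::real)" using ln2_ge_two_thirds by linarith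
  then have "\<epsilon> * x\<^sup>2 \<le> ln d * x\<^sup>2" using eps lnd by (intro mult_right_mono) auto
  then have "\<epsilon> * x\<^sup>2 / ln d \<le> x\<^sup>2" using lnd by (simp add: divide_le_eq mult.commute)
  then show ?thesis using Lle by linarith
 qed
 define N where "N = exp (\<epsilon> * x\<^sup>2)"
 have N1: "1 \<le> N" unfolding N_def using eps by simp
 have dL: "real d ^ L \<le> N"
 proof -
  have "real d ^ L = exp (real L * ln d)" using d2' by (simp add: exp_of_nat_mult)
  also have "\<dots> \<le> N" unfolding N_def using Lle lnd by (simp add: le_divide_eq)
  finally show ?thesis .
 qed
 have twoL: "2 ^ L \<le> N"
 proof -
  have "(2::real) ^ L \<le> real d ^ L" using d2' by (intro power_mono) auto
  then show ?thesis using dL by linarith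
 qed
 have Enn: "real (card E) \<le> n * exp (- \<delta> * x\<^sup>2)"
 proof -
  have "real n powr (1 - \<delta>) = exp ((1 - \<delta>) * x\<^sup>2)" unfolding powr_def x2 using nr by simp
  also have "\<dots> = n * exp (- \<delta> * x\<^sup>2)" unfolding nx exp_add[symmetric] by (simp add: algebra_simps)
  finally show ?thesis using E by simp
 qed
 define m where "m = nat \<lceil>x\<rceil>"
 have m: "0 < m" "x \<le> m" "real m \<le> x + 1" unfolding m_def using x1 by linarith+
 \<comment> \<open>A root of order \<open>4 * m\<close> of the requirement in
   \<open>moment_fail\<close>, factor by factor. The first \<open>exp x\<close> covers
   \<open>n ^ 4\<close>, because \<open>m \<ge> x\<close>, and the last one covers
   \<open>1 / \<rho> \<le> d\<close>.\<close>
 define K where "K = 12 * exp x * blen x ^ 20 * (4 * exp (3 * x))\<^sup>2 * exp x"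
 have bl: "1 \<le> blen x" unfolding blen_def using x1 by simp
 have K1: "1 \<le> K"
 proof -
  have "1 * 1 * 1 * 1 * 1 \<le> K" unfolding K_def
   using x1 bl by (intro mult_mono one_le_power) (auto intro: order_trans[of 1 "4 * 1"])
  then show ?thesis by simp
 qed
 let ?R = "2 * real (d + d * d) / \<rho>"
 have R: "0 \<le> ?R" "?R \<le> 4 * exp (3 * x)"
 proof -
  show "0 \<le> ?R" using rho by simp
  have "real d * 1 \<le> real d * real d" using d2' by (intro mult_left_mono) auto
  then have "?R \<le> (4 * real d ^ 2) * (1 / \<rho>)" using rho by (simp add: divide_right_mono power2_eq_square)
  also have "\<dots> \<le> (4 * real d ^ 2) * d" by (intro mult_left_mono rho_d) simp
  also have "\<dots> = 4 * real d ^ 3" by (simp add: eval_nat_numeral)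
  also have "\<dots> \<le> 4 * exp x ^ 3" using dle by (intro mult_left_mono power_mono) auto
  finally show "?R \<le> 4 * exp (3 * x)" by (simp add: exp_of_nat_mult[symmetric])
 qed
 have mom: "pr n (\<lambda>\<sigma>. \<not> opb n (Simp (cen \<sigma>) s) (K * \<rho> ^ s)) \<le> 1 / real n ^ 3" if s: "0 < s" "s \<le> L" for s
 proof (rule moment_fail[OF s(1) m(1) refl])
  have sx: "real s \<le> x\<^sup>2" using s Lx by linarith
  have T: "real (4 * m * s) \<le> 4 * (x + 1) * x\<^sup>2"
   using m sx x1 by (auto intro!: mult_mono)
  have b: "real (8 * m * s + 3) \<le> blen x"
  proof -
   have "real (8 * m * s + 3) = 2 * real (4 * m * s) + 3" by simp
   also have "\<dots> \<le> 2 * (4 * (x + 1) * x\<^sup>2) + 3" using T by linarith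
   also have "\<dots> = blen x" unfolding blen_def by (simp add: algebra_simps)
   finally show ?thesis .
  qed
  have "real (36 * (4 * m * s)\<^sup>2) \<le> 36 * (4 * (x + 1) * x\<^sup>2)\<^sup>2"
   using power_mono[OF T, of 2] by simp
  also have "\<dots> \<le> real n" unfolding nx using lg by blast
  finally show "36 * (4 * m * s)\<^sup>2 \<le> n" unfolding of_nat_le_iff .
  have sq: "sqrt (real n) = exp (x\<^sup>2 / 2)"
   unfolding nx by (rule real_sqrt_unique) (simp_all add: exp_of_nat_mult[symmetric])
  have "6 * real (4 * m * s) * d \<le> 6 * (4 * (x + 1) * x\<^sup>2) * exp x"
   using T dle x1 by (intro mult_mono) auto
  also have "\<dots> \<le> sqrt n" unfolding sq using lg by blast
  finally have "6 * real (4 * m * s) * d \<le> sqrt n" .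
  then have "6 * real (4 * m * s) / sqrt (real n) \<le> 1 / d" using nr d2' by (simp add: field_simps)
  then show "6 * real (4 * m * s) / sqrt (real n) \<le> \<rho>" using rho_d(3) by linarith
  have "real (8 * m * s + 3) ^ (100 * m) \<le> blen x ^ (100 * m)" using b by (intro power_mono) auto
  also have "\<dots> = blen x powr (real (100 * m))" using bl by (simp only: powr_realpow)
  also have "\<dots> \<le> blen x powr (100 * (x + 1))" using bl m by (intro powr_mono) auto
  finally have b100: "real (8 * m * s + 3) ^ (100 * m) \<le> blen x powr (100 * (x + 1))" .
  have "2 * real (8 * m * s + 3) ^ (100 * m) * ?R ^ 4 \<le> 2 * blen x powr (100 * (x + 1)) * (4 * exp (3 * x)) ^ 4"
   using b100 R by (intro mult_mono power_mono) auto
  also have "\<dots> \<le> n" unfolding nx using lg by blast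
  finally show "2 * real (8 * m * s + 3) ^ (100 * m) * ?R ^ 4 \<le> n" .
  show "0 < K" using K1 by simp
  have n4: "real n ^ 4 \<le> exp x ^ (4 * m)"
  proof -
   have "real n ^ 4 = exp (4 * x\<^sup>2)" unfolding nx by (simp add: exp_of_nat_mult[symmetric])
   also have "\<dots> \<le> exp (real (4 * m) * x)" using m x1 by (simp add: power2_eq_square mult_right_mono)
   also have "\<dots> = exp x ^ (4 * m)" by (rule exp_of_nat_mult)
   finally show ?thesis .
  qed
  have b80: "real (8 * m * s + 3) ^ (80 * m) \<le> (blen x ^ 20) ^ (4 * m)"
   using power_mono[OF b, of "80 * m"] by (simp add: power_mult[symmetric])
  have R8: "?R ^ (8 * m) \<le> ((4 * exp (3 * x))\<^sup>2) ^ (4 * m)"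
  proof -
   have "((4 * exp (3 * x))\<^sup>2) ^ (4 * m) = (4 * exp (3 * x)) ^ (8 * m)" unfolding power_mult[symmetric] by simp
   then show ?thesis using power_mono[OF R(2,1), of "8 * m"] by (simp only:)
  qed
  have r4: "(1 / \<rho>) ^ (4 * m) \<le> exp x ^ (4 * m)"
   using rho_d(1) dle rho by (intro power_mono) auto
  have c12: "(12::real) \<le> 12 ^ (4 * m)" using m(1) by (intro self_le_power) auto
  have "12 * real n ^ 4 * real (8 * m * s + 3) ^ (80 * m) * ?R ^ (8 * m) * (1 / \<rho>) ^ (4 * m)
   \<le> 12 ^ (4 * m) * exp x ^ (4 * m) * (blen x ^ 20) ^ (4 * m) * ((4 * exp (3 * x))\<^sup>2) ^ (4 * m) * exp x ^ (4 * m)"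
   using rho R bl by (intro mult_mono[OF mult_mono[OF mult_mono[OF mult_mono[OF c12 n4] b80] R8] r4]) auto
  also have "\<dots> = K ^ (4 * m)" unfolding K_def by (simp only: power_mult_distrib)
  finally show "12 * real n ^ 4 * real (8 * m * s + 3) ^ (80 * m) * ?R ^ (8 * m) / \<rho> ^ (4 * m) \<le> K ^ (4 * m)"
   by (simp add: power_divide)
 qed
 define \<gamma> where "\<gamma> = 18 * (real L + 1)\<^sup>2 * K\<^sup>2"
 define K2 where "K2 = (real r0 + 2) * \<gamma> * ((real L + 1) * \<gamma> / \<rho>\<^sup>2) ^ r0"
 \<comment> \<open>The exponents are 9 for \<open>K\<close>, then \<open>1 + 2 * 9 = 19\<close> for
   \<open>\<gamma>\<close>, then \<open>1 + 19 + 1 = 21\<close> for each of the \<open>r0\<close>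
   visits; the final \<open>20 + 21 * r0\<close> includes 1 for \<open>r0 + 2\<close>.\<close>
 have K2: "K2 \<le> exp (real (20 + 21 * r0) * x)"
 proof -
  have "K = 192 * blen x ^ 20 * exp (8 * x)"
   unfolding K_def power_mult_distrib by (simp add: exp_add[symmetric] exp_of_nat_mult[symmetric] power2_eq_square mult_ac)
  also have "\<dots> \<le> exp x * exp (8 * x)" using lg by (intro mult_right_mono) auto
  finally have K9: "K \<le> exp (9 * x)" by (simp add: exp_add[symmetric])
  have "18 * (real L + 1)\<^sup>2 \<le> 18 * (x\<^sup>2 + 1)\<^sup>2" using Lx by (intro mult_left_mono power_mono) auto
  also have "\<dots> \<le> exp x" using lg by blast
  finally have "\<gamma> \<le> exp x * exp (9 * x) ^ 2" unfolding \<gamma>_def using K9 K1 by (intro mult_mono power_mono) auto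
  then have g: "\<gamma> \<le> exp (19 * x)" by (simp add: exp_add[symmetric] exp_of_nat_mult[symmetric])
  have g0: "0 \<le> \<gamma>" unfolding \<gamma>_def by simp
  have "real L + 1 \<le> exp x"
  proof -
   have "real L + 1 \<le> x\<^sup>2 + 1" using Lx by simp
   also have "\<dots> \<le> (x\<^sup>2 + 1)\<^sup>2" by (rule self_le_power) auto
   also have "\<dots> = 1 * (x\<^sup>2 + 1)\<^sup>2" by simp
   also have "\<dots> \<le> 18 * (x\<^sup>2 + 1)\<^sup>2" by (rule mult_right_mono) auto
   finally have "real L + 1 \<le> 18 * (x\<^sup>2 + 1)\<^sup>2" .
   then show ?thesis using lg by linarith
  qed
  then have "((real L + 1) * \<gamma>) * (1 / \<rho>\<^sup>2) \<le> (exp x * exp (19 * x)) * exp x"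
   using g g0 rho_d(2) dle rho by (intro mult_mono) auto
  then have q: "(real L + 1) * \<gamma> / \<rho>\<^sup>2 \<le> exp (21 * x)" by (simp add: exp_add[symmetric])
  have q0: "0 \<le> (real L + 1) * \<gamma> / \<rho>\<^sup>2" using g0 by simp
  have "K2 \<le> exp x * exp (19 * x) * exp (21 * x) ^ r0"
   unfolding K2_def using lg g g0 q q0 by (intro mult_mono power_mono) auto
  also have "\<dots> = exp (real (20 + 21 * r0) * x)"
   by (simp add: exp_add[symmetric] exp_of_nat_mult[symmetric] algebra_simps)
  finally show ?thesis .
 qed
 \<comment> \<open>This is \<open>n powr \<delta>\<close>, as large as the size of \<open>E\<close>
   permits. Then \<open>r0 \<ge> 3 / \<delta>\<close> gives
   \<open>\<kappa> ^ r0 \<ge> n ^ 3\<close>.\<close>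
 define \<kappa> where "\<kappa> = exp (\<delta> * x\<^sup>2)"
 have r03: "3 \<le> \<delta> * real r0" "2 \<le> r0"
 proof -
  have "3 / \<delta> \<le> real r0" unfolding r0_def by linarith
  then show "3 \<le> \<delta> * real r0" using c by (simp add: divide_le_eq mult.commute)
  have "3 \<le> 3 / \<delta>" using c by (simp add: le_divide_eq)
  then have "3 \<le> real r0" using \<open>3 / \<delta> \<le> real r0\<close> by linarith
  then show "2 \<le> r0" by simp
 qed
 let ?Z = "4 * (x\<^sup>2 + 1) ^ 3 * exp x * N ^ 3 * exp (- \<delta> * x\<^sup>2)"
 have "pr n (\<lambda>\<sigma>. \<exists>s. 0 < s \<and> s \<le> L \<and> \<not> opb n (Jn \<sigma> s) (exp (real (20 + 21 * r0) * x) * \<rho> ^ s))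
  \<le> pr n (\<lambda>\<sigma>. \<exists>s. 0 < s \<and> s \<le> L \<and> \<not> opb n (Jn \<sigma> s) (K2 * \<rho> ^ s))"
 proof (rule pr_mono)
  fix \<sigma> assume "\<exists>s. 0 < s \<and> s \<le> L \<and> \<not> opb n (Jn \<sigma> s) (exp (real (20 + 21 * r0) * x) * \<rho> ^ s)"
  then obtain s where s: "0 < s" "s \<le> L" "\<not> opb n (Jn \<sigma> s) (exp (real (20 + 21 * r0) * x) * \<rho> ^ s)" by blast
  have "K2 * \<rho> ^ s \<le> exp (real (20 + 21 * r0) * x) * \<rho> ^ s" using K2 rho by (intro mult_right_mono) auto
  then have "\<not> opb n (Jn \<sigma> s) (K2 * \<rho> ^ s)" using s(3) opb_le by blast
  then show "\<exists>s. 0 < s \<and> s \<le> L \<and> \<not> opb n (Jn \<sigma> s) (K2 * \<rho> ^ s)" using s by blast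
 qed
 also have "\<dots> \<le> real L * (1 / real n ^ 3) + real L * (2 * 4 ^ L * real (L + 1) * real (card E + 2 * L + 1) * real d ^ L / n) + 2 * real L * real d ^ L * real d ^ L / n
   + real L * (real L * (4 * real L * real d ^ (2 * L + 1) / n)) + real (card E) * (2 * real L * real d ^ L / n) + real L * (4 * real n * (2 * real d) ^ L / \<kappa> ^ r0)"
  unfolding K2_def \<gamma>_def
 proof (rule fail_prob[OF L0 _ K1 r03(2) _ _ _ mom])
  have "(real L)\<^sup>2 \<le> (x\<^sup>2)\<^sup>2" by (rule power_mono[OF Lx]) simp
  then have "real (8 * L\<^sup>2) \<le> 8 * (x\<^sup>2)\<^sup>2" by simp
  also have "\<dots> \<le> real n" unfolding nx using lg by blast
  finally show "8 * L\<^sup>2 \<le> n" unfolding of_nat_le_iff .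
  show "1 \<le> \<kappa>" unfolding \<kappa>_def using c by simp
  have "\<kappa> * real (card E) \<le> \<kappa> * (n * exp (- \<delta> * x\<^sup>2))" unfolding \<kappa>_def using Enn by (intro mult_left_mono) auto
  also have "\<dots> = n" unfolding \<kappa>_def by (simp add: exp_minus field_simps)
  finally show "\<kappa> * real (card E) \<le> n" .
  have "real (card E) * real d ^ L \<le> (n * exp (- \<delta> * x\<^sup>2)) * N" using Enn dL by (intro mult_mono) auto
  also have "\<dots> = n * exp (\<epsilon> * x\<^sup>2 - \<delta> * x\<^sup>2)" unfolding N_def by (simp add: exp_diff exp_minus field_simps)
  also have "\<dots> \<le> real n * 1"
  proof -
   have "\<epsilon> * x\<^sup>2 \<le> \<delta> * x\<^sup>2" using eps by (intro mult_right_mono) auto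
   then show ?thesis by (intro mult_left_mono) auto
  qed
  finally show "real (card E) * real d ^ L \<le> real n" by simp
 qed
 also have "\<dots> \<le> ?Z + ?Z + ?Z + ?Z + ?Z + ?Z"
 proof (intro add_mono)
  let ?y = "x\<^sup>2 + 1" and ?e = "exp (- \<delta> * x\<^sup>2)"
  have y1: "1 \<le> ?y" by simp
  have Ly: "real L \<le> ?y" "real L + 1 \<le> ?y" using Lx by auto
  have ex: "1 \<le> exp x" using x1 by simp
  have y3: "a * ?y \<le> a * ?y ^ 3" if "0 \<le> a" for a
   using that self_le_power[OF y1, of 3] by (intro mult_left_mono) auto
  have NN: "N \<le> N ^ 3" "N * N \<le> N ^ 3" "1 \<le> N ^ 3"
   using N1 self_le_power[OF N1, of 3] power_increasing[of 2 3 N] one_le_power[OF N1, of 3] by (auto simp: power2_eq_square)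
  have "\<delta> * x\<^sup>2 \<le> 1 * x\<^sup>2" using c by (intro mult_right_mono) auto
  then have e1: "1 / real n \<le> ?e" unfolding nx exp_minus[symmetric] inverse_eq_divide[symmetric] by simp
  have base: "a * N' * ?e \<le> ?Z" if "0 \<le> a" "a \<le> 4 * ?y ^ 3 * exp x" "0 \<le> N'" "N' \<le> N ^ 3" for a N'
   using that N1 by (intro mult_mono mult_nonneg_nonneg) auto
  have y13: "?y \<le> ?y ^ 3" using y3[of 1] by simp
  have a1: "c' * ?y \<le> 4 * ?y ^ 3 * exp x" "c' * ?y ^ 3 \<le> 4 * ?y ^ 3 * exp x" if "0 \<le> c'" "c' \<le> 4" for c'
  proof -
   have "c' * ?y ^ 3 \<le> 4 * ?y ^ 3" using that by (intro mult_right_mono) auto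
   also have "\<dots> \<le> 4 * ?y ^ 3 * exp x" using ex mult_left_mono[OF ex, of "4 * ?y ^ 3"] by simp
   finally show "c' * ?y ^ 3 \<le> 4 * ?y ^ 3 * exp x" .
   then show "c' * ?y \<le> 4 * ?y ^ 3 * exp x" using y3[OF that(1)] by linarith
  qed
  have n3: "1 / real n ^ 3 \<le> 1 / real n" "1 / real n ^ 2 \<le> 1 / real n" "0 \<le> 1 / real n"
   using n1 nr by (auto intro!: divide_left_mono self_le_power)
  have "real L * (1 / real n ^ 3) \<le> ?y * 1 * ?e"
   using Ly n3 e1 by (intro mult_mono) auto
  also have "\<dots> \<le> ?Z" by (rule base) (use a1(1)[of 1] NN in auto)
  finally show "real L * (1 / real n ^ 3) \<le> ?Z" .
  have "(2::real) ^ L * 2 ^ L \<le> N * N" using twoL N1 by (intro mult_mono) auto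
  then have fl: "(4::real) ^ L \<le> N * N" by (simp add: power_mult_distrib[symmetric])
  have En: "real (card E + 2 * L + 1) / n \<le> 2 * ?y * ?e"
  proof -
   have "real (card E + 2 * L + 1) / n = real (card E) / n + (2 * real L + 1) * (1 / n)" by (simp add: add_divide_distrib)
   also have "\<dots> \<le> 1 * ?e + (2 * real L + 1) * ?e"
    using Enn nr e1 by (intro add_mono mult_left_mono) (auto simp: divide_le_eq mult_ac)
   also have "\<dots> = (2 * (real L + 1)) * ?e" by (simp add: algebra_simps)
   also have "\<dots> \<le> (2 * ?y) * ?e" using Ly by (intro mult_right_mono) auto
   finally show ?thesis .
  qed
  have "real L * (2 * 4 ^ L * real (L + 1) * real (card E + 2 * L + 1) * real d ^ L / n)
   = real L * (2 * 4 ^ L * real (L + 1) * (real (card E + 2 * L + 1) / n) * real d ^ L)" by simp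
  also have "\<dots> \<le> ?y * (2 * (N * N) * ?y * (2 * ?y * ?e) * N)"
   using Ly fl En dL N1 by (intro mult_mono) auto
  also have "\<dots> = (4 * ?y ^ 3) * N ^ 3 * ?e" by (simp add: eval_nat_numeral)
  also have "\<dots> \<le> ?Z" by (rule base) (use a1(2)[of 4] N1 in auto)
  finally show "real L * (2 * 4 ^ L * real (L + 1) * real (card E + 2 * L + 1) * real d ^ L / n) \<le> ?Z" .
  have "2 * real L * real d ^ L * real d ^ L / n = 2 * real L * (real d ^ L * real d ^ L) * (1 / n)" by simp
  also have "\<dots> \<le> (2 * ?y) * (N * N) * ?e" using Ly dL N1 e1 by (intro mult_mono) auto
  also have "\<dots> \<le> ?Z" by (rule base) (use a1(1)[of 2] NN N1 in auto)
  finally show "2 * real L * real d ^ L * real d ^ L / n \<le> ?Z" .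
  have "real L * (real L * (4 * real L * real d ^ (2 * L + 1) / n)) = (4 * (real L * (real L * real L)) * real d) * (real d ^ L * real d ^ L) * (1 / n)"
   by (simp add: power_add mult_2)
  also have "\<dots> \<le> (4 * (?y * (?y * ?y)) * exp x) * (N * N) * ?e"
   using Ly dL dle N1 e1 by (intro mult_mono) auto
  also have "\<dots> \<le> ?Z" by (rule base) (use NN N1 in \<open>auto simp: eval_nat_numeral\<close>)
  finally show "real L * (real L * (4 * real L * real d ^ (2 * L + 1) / n)) \<le> ?Z" .
  have "real (card E) * (2 * real L * real d ^ L / n) = (2 * real L) * real d ^ L * (real (card E) / n)" by simp
  also have "\<dots> \<le> (2 * ?y) * N * ?e"
   using Ly dL N1 Enn nr by (intro mult_mono) (auto simp: divide_le_eq mult_ac)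
  also have "\<dots> \<le> ?Z" by (rule base) (use a1(1)[of 2] NN N1 in auto)
  finally show "real (card E) * (2 * real L * real d ^ L / n) \<le> ?Z" .
  have k3: "real n ^ 3 \<le> \<kappa> ^ r0"
  proof -
   have "real n ^ 3 = exp (3 * x\<^sup>2)" unfolding nx by (simp add: exp_of_nat_mult[symmetric])
   also have "\<dots> \<le> exp (real r0 * (\<delta> * x\<^sup>2))" using r03(1) mult_right_mono[OF r03(1), of "x\<^sup>2"] by (simp add: mult_ac)
   also have "\<dots> = \<kappa> ^ r0" unfolding \<kappa>_def by (rule exp_of_nat_mult)
   finally show ?thesis .
  qed
  have "real L * (4 * real n * (2 * real d) ^ L / \<kappa> ^ r0) \<le> real L * (4 * real n * (2 * real d) ^ L / real n ^ 3)"
   using k3 nr by (intro mult_left_mono divide_left_mono mult_pos_pos) (auto intro: less_le_trans[OF _ k3])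
  also have "\<dots> = (4 * real L) * (2 ^ L * real d ^ L) * (1 / real n ^ 2)"
   using nr by (simp add: power_mult_distrib eval_nat_numeral)
  also have "\<dots> \<le> (4 * ?y) * (N * N) * ?e"
   using Ly dL twoL N1 order_trans[OF n3(2) e1] by (intro mult_mono) auto
  also have "\<dots> \<le> ?Z" by (rule base) (use a1(1)[of 4] NN N1 in auto)
  finally show "real L * (4 * real n * (2 * real d) ^ L / \<kappa> ^ r0) \<le> ?Z" .
 qed
 also have "\<dots> = (24 * (x\<^sup>2 + 1) ^ 3 * exp x) * (N ^ 3 * exp (- \<delta> * x\<^sup>2))" by simp
 also have "\<dots> \<le> exp (5 * \<epsilon> * x\<^sup>2) * (N ^ 3 * exp (- \<delta> * x\<^sup>2))"
  using lg N1 by (intro mult_right_mono) auto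
 also have "N ^ 3 = exp (3 * (\<epsilon> * x\<^sup>2))" unfolding N_def by (simp add: exp_of_nat_mult[symmetric])
 also have "exp (5 * \<epsilon> * x\<^sup>2) * (exp (3 * (\<epsilon> * x\<^sup>2)) * exp (- \<delta> * x\<^sup>2)) = exp (5 * \<epsilon> * x\<^sup>2 + (3 * (\<epsilon> * x\<^sup>2) + - \<delta> * x\<^sup>2))"
  by (simp only: exp_add)
 also have "5 * \<epsilon> * x\<^sup>2 + (3 * (\<epsilon> * x\<^sup>2) + - \<delta> * x\<^sup>2) = - c0 * x\<^sup>2" unfolding \<epsilon>_def by (simp add: field_simps)
 also have "exp (- c0 * x\<^sup>2) = real n powr (- c0)" unfolding powr_def x2 using nr by simp
 finally show "pr n (\<lambda>\<sigma>. \<exists>s. 0 < s \<and> s \<le> L \<and> \<not> opb n (Jn \<sigma> s) (exp (real (20 + 21 * r0) * x) * \<rho> ^ s)) \<le> real n powr (- c0)" .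
qed

end

section \<open>The norm on the complement of the constants\<close>

context sparse
begin

text \<open>\<open>J / n\<close> is a projection that absorbs powers of \<open>P\<close> on both
  sides, so the two mixed products and the square combine to a single
  \<open>- J / n\<close>.\<close>

lemma Jn_add:
 assumes sg: "\<sigma> \<in> perms n" and xz: "x < n" "z < n"
 shows "Jn \<sigma> (a + b) x z = mm n (Jn \<sigma> a) (Jn \<sigma> b) x z"
proof -
 interpret walks n d Q E \<rho> \<sigma> 0
  by (intro walks.intro walks_axioms.intro sparse_axioms) (use sg in \<open>simp add: perms_def\<close>)
 have P: "(\<lambda>x z. Q (\<sigma> x) z) = P" by (intro ext) (simp add: P_def)
 have "mm n (\<lambda>x z. mpw n P a x z - 1 / n) (\<lambda>x z. mpw n P b x z - 1 / n) x z
  = (\<Sum>k<n. mpw n P a x k * mpw n P b k z - mpw n P a x k * (1 / n) - (1 / n) * mpw n P b k z + (1 / n) * (1 / n))"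
  unfolding mm_def by (intro sum.cong refl) (simp add: algebra_simps)
 also have "\<dots> = mm n (mpw n P a) (mpw n P b) x z - (\<Sum>k<n. mpw n P a x k) * (1 / n) - (1 / n) * (\<Sum>k<n. mpw n P b k z) + (\<Sum>k<n. (1 / n) * (1 / n))"
  unfolding mm_def sum_distrib_left sum_distrib_right by (simp only: sum.distrib sum_subtractf)
 also have "\<dots> = mpw n P (a + b) x z - 1 / n"
  using mpw_P(1)[OF xz(2), of b] mpw_P(2)[OF xz(1), of a] mpw_add[OF xz(1)] n_pos by simp
 finally show ?thesis unfolding P by simp
qed

text \<open>Each block of length \<open>L\<close> contributes one factor \<open>C\<close>, and the
  rest another. The assumption \<open>2 \<le> C\<close> covers an empty rest, where
  \<open>I - J / n\<close> is estimated by 2.\<close>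

lemma block_bound:
 assumes sg: "\<sigma> \<in> perms n" and C: "2 \<le> C" and L: "0 < L"
  and b: "\<And>s. 0 < s \<Longrightarrow> s \<le> L \<Longrightarrow> opb n (Jn \<sigma> s) (C * \<rho> ^ s)" and r: "r < L"
 shows "opb n (Jn \<sigma> (q * L + r)) (C ^ Suc q * \<rho> ^ (q * L + r))"
proof (induction q)
 case 0
 show ?case
 proof (cases "r = 0")
  case True
  have "opb n (\<lambda>i j. idm i j + 1 / n) (1 + 1)"
  proof (rule opb_add)
   show "opb n idm 1" unfolding idm_def by (rule opb_diag) auto
   show "opb n (\<lambda>i j. 1 / n) 1" by (rule opb_schur) (use n_pos in auto)
  qed
  then have "opb n (Jn \<sigma> 0) (1 + 1)" by (rule opb_mono[rotated]) (simp add: idm_def)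
  then show ?thesis using True C by (auto intro: opb_le)
 next
  case False
  then show ?thesis using b[of r] r by simp
 qed
next
 case (Suc q)
 have "opb n (mm n (Jn \<sigma> L) (Jn \<sigma> (q * L + r))) ((C * \<rho> ^ L) * (C ^ Suc q * \<rho> ^ (q * L + r)))"
  by (rule opb_mm[OF b[OF L order_refl] Suc])
 then have "opb n (Jn \<sigma> (L + (q * L + r))) ((C * \<rho> ^ L) * (C ^ Suc q * \<rho> ^ (q * L + r)))"
  by (rule opb_cong[rotated]) (rule Jn_add[OF sg, symmetric])
 moreover have "L + (q * L + r) = Suc q * L + r" by simp
 moreover have "(C * \<rho> ^ L) * (C ^ Suc q * \<rho> ^ (q * L + r)) = C ^ Suc (Suc q) * \<rho> ^ (L + (q * L + r))"
  by (simp only: power_add power_Suc mult_ac)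
 ultimately show ?case by (simp only:)
qed

end

text \<open>Subtracting a constant from all entries does not change the action on vectors with
  coordinate sum 0.\<close>

lemma norm_ones_perp_le:
 assumes n: "2 \<le> n" and A: "A \<in> carrier_mat n n" and K: "opb n (\<lambda>i j. A $$ (i, j) - c) K"
 shows "norm_ones_perp A \<le> K"
 unfolding norm_ones_perp_def
proof (rule cSup_least)
 have dr: "dim_row A = n" using A by simp
 \<comment> \<open>A nonzero vector orthogonal to \<open>ones n\<close>, which shows that the
   supremum is over a nonempty set.\<close>
 let ?v = "vec n (\<lambda>i. if i = 0 then 1 else if i = 1 then - 1 else 0 :: real)"
 have "?v \<bullet> ones n = (\<Sum>i<n. if i = 0 then 1 else if i = 1 then - 1 else 0 :: real)"
  unfolding ones_def scalar_prod_def by (simp add: atLeast0LessThan)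
 also have "\<dots> = (\<Sum>i\<in>{0, 1 :: nat}. if i = 0 then 1 else if i = 1 then - 1 else 0 :: real)"
  by (rule sum.mono_neutral_right) (use n in auto)
 also have "\<dots> = 0" by (subst sum.insert) auto
 finally have "?v \<bullet> ones n = 0" .
 moreover have "?v \<noteq> 0\<^sub>v n"
 proof
  assume "?v = 0\<^sub>v n"
  then have "?v $ 0 = 0\<^sub>v n $ 0" by simp
  then show False using n by simp
 qed
 ultimately show "{norm2 (A *\<^sub>v v) / norm2 v |v. v \<in> carrier_vec (dim_row A) \<and> v \<noteq> 0\<^sub>v (dim_row A) \<and> v \<bullet> ones (dim_row A) = 0} \<noteq> {}"
  unfolding dr by (auto intro!: exI[of _ ?v])
 fix y assume "y \<in> {norm2 (A *\<^sub>v v) / norm2 v |v. v \<in> carrier_vec (dim_row A) \<and> v \<noteq> 0\<^sub>v (dim_row A) \<and> v \<bullet> ones (dim_row A) = 0}"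
 then obtain v where v: "y = norm2 (A *\<^sub>v v) / norm2 v" "v \<in> carrier_vec n" "v \<noteq> 0\<^sub>v n" "v \<bullet> ones n = 0" unfolding dr by blast
 let ?f = "\<lambda>i. v $ i"
 have s0: "(\<Sum>j<n. ?f j) = 0" using v(2,4) unfolding ones_def scalar_prod_def by (simp add: atLeast0LessThan)
 have nv: "norm2 v = nrm n ?f" using v(2) unfolding norm2_def nrm_def by simp
 have Av: "(A *\<^sub>v v) $ i = mv n (\<lambda>i j. A $$ (i, j) - c) ?f i" if "i < n" for i
 proof -
  have "(A *\<^sub>v v) $ i = (\<Sum>j<n. A $$ (i, j) * ?f j)"
   using that A v(2) by (auto simp: scalar_prod_def atLeast0LessThan intro!: sum.cong)
  also have "\<dots> = mv n (\<lambda>i j. A $$ (i, j) - c) ?f i + c * (\<Sum>j<n. ?f j)"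
   unfolding mv_def by (simp add: left_diff_distrib sum_subtractf sum_distrib_left)
  finally show ?thesis using s0 by simp
 qed
 have "norm2 (A *\<^sub>v v) = nrm n (\<lambda>i. (A *\<^sub>v v) $ i)" unfolding norm2_def nrm_def using A by simp
 also have "\<dots> = nrm n (mv n (\<lambda>i j. A $$ (i, j) - c) ?f)" by (rule nrm_cong) (rule Av)
 also have "\<dots> \<le> K * nrm n ?f" by (rule opbD[OF K])
 finally have le: "norm2 (A *\<^sub>v v) \<le> K * norm2 v" unfolding nv .
 have "0 < norm2 v"
 proof -
  obtain i where i: "i < n" "v $ i \<noteq> 0" using v(2,3) by (metis carrier_vecD eq_vecI index_zero_vec(1) index_zero_vec(2))
  have "0 < (v $ i)\<^sup>2" using i by simp
  also have "\<dots> \<le> (\<Sum>i<n. (?f i)\<^sup>2)" by (rule member_le_sum) (use i in auto)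
  finally have "0 < (nrm n ?f)\<^sup>2" unfolding nrm_sq .
  then show ?thesis unfolding nv by (simp add: zero_less_power2 less_le)
 qed
 then show "y \<le> K" using le unfolding v(1) by (simp add: divide_le_eq)
qed

definition entries :: "nat \<Rightarrow> real mat \<Rightarrow> fmat" where
 "entries n Q y x = (if y < n \<and> x < n then Q $$ (y, x) else 0)"

lemma index_mult_sum:
 "A \<in> carrier_mat n n \<Longrightarrow> B \<in> carrier_mat n n \<Longrightarrow> i < n \<Longrightarrow> j < n \<Longrightarrow> (A * B) $$ (i, j) = (\<Sum>k<n. A $$ (i, k) * B $$ (k, j) :: real)"
 by (auto simp: scalar_prod_def atLeast0LessThan intro!: sum.cong)

lemma perm_mult_power:
 assumes Q: "Q \<in> carrier_mat n n" and s: "\<sigma> permutes {..<n}" and xz: "x < n" "z < n"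
 shows "((perm_mat n \<sigma> * Q) ^\<^sub>m l) $$ (x, z) = mpw n (\<lambda>x z. entries n Q (\<sigma> x) z) l x z"
 using xz
proof (induction l arbitrary: z)
 let ?P = "perm_mat n \<sigma> * Q" and ?f = "\<lambda>x z. entries n Q (\<sigma> x) z"
 have P: "?P \<in> carrier_mat n n" by (rule mult_carrier_mat[OF _ Q]) (simp add: perm_mat_def)
 have e: "?P $$ (i, j) = ?f i j" if "i < n" "j < n" for i j
 proof -
  have sn: "\<sigma> i < n" using permutes_in_image[OF s, of i] that by simp
  have "?P $$ (i, j) = (\<Sum>k<n. (if \<sigma> i = k then 1 else 0) * Q $$ (k, j))"
   using that Q unfolding perm_mat_def by (auto simp: scalar_prod_def atLeast0LessThan intro!: sum.cong)
  also have "\<dots> = (\<Sum>k<n. if \<sigma> i = k then Q $$ (k, j) else 0)" by (rule sum.cong) auto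
  also have "\<dots> = ?f i j" using sn that by (simp add: entries_def)
  finally show ?thesis .
 qed
 {
  case 0
  have "dim_row (perm_mat n \<sigma>) = n" by (simp add: perm_mat_def)
  then show ?case using 0 by (simp add: idm_def)
 next
  case (Suc l)
  have Pl: "?P ^\<^sub>m l \<in> carrier_mat n n" using P by simp
  have "(?P ^\<^sub>m Suc l) $$ (x, z) = (\<Sum>k<n. (?P ^\<^sub>m l) $$ (x, k) * ?P $$ (k, z))"
   unfolding pow_mat.simps by (rule index_mult_sum[OF Pl P Suc.prems])
  also have "\<dots> = (\<Sum>k<n. mpw n ?f l x k * ?f k z)" using Suc e by (intro sum.cong) auto
  also have "\<dots> = mpw n ?f (Suc l) x z" unfolding mpw_Suc_right[OF Suc.prems] mm_def ..
  finally show ?case .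
 }
qed

lemma prob_perms: "measure_pmf.prob (pmf_of_set {\<sigma>. \<sigma> permutes {..<n}}) A = pr n (\<lambda>\<sigma>. \<sigma> \<in> A)"
proof -
 have ne: "perms n \<noteq> {}" unfolding perms_def using permutes_id by blast
 have "measure_pmf.prob (pmf_of_set (perms n)) A = card (perms n \<inter> A) / card (perms n)"
  by (rule measure_pmf_of_set[OF ne finite_perms])
 also have "\<dots> = pr n (\<lambda>\<sigma>. \<sigma> \<in> A)"
  unfolding pr_def pavg_def card_perms by (simp add: sum.If_cases Int_def)
 finally show ?thesis unfolding perms_def .
qed

text \<open>\<open>E\<close> is an exceptional set that attains the infimum. The supports are
  controlled by the rows of \<open>Q^T Q\<close>: as there is no cancellation, row \<open>x\<close>
  has a nonzero entry at every column that shares a row of \<open>Q\<close> with column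
  \<open>x\<close>.\<close>

lemma bistochastic_sparse:
 fixes Q :: "real mat"
 assumes n: "1 \<le> n" and Q: "Q \<in> carrier_mat n n" "bistochastic Q" and del: "\<delta> \<le> 1"
 defines "d \<equiv> norm_1_to_0 (transpose_mat Q * Q)" and "\<rho> \<equiv> max (hs_norm Q) (norm_1_to_inf \<delta> Q)"
 assumes d2: "2 \<le> d"
 shows "\<exists>E. sparse n d (entries n Q) E \<rho> \<and> card E \<le> real n powr (1 - \<delta>)"
proof -
 let ?Q = "entries n Q"
 have dr: "dim_row Q = n" "dim_col Q = n" using Q(1) by auto
 have n0: "0 < real n" using n by simp
 have nn: "0 \<le> ?Q y x" for y x using Q(2) unfolding bistochastic_def entries_def dr by simp
 have out: "?Q y x \<noteq> 0 \<Longrightarrow> y < n \<and> x < n" for y x unfolding entries_def by (auto split: if_splits)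
 have row: "(\<Sum>x<n. ?Q y x) = 1" if "y < n" for y
  using Q(2) that unfolding bistochastic_def entries_def dr by simp
 have col: "(\<Sum>y<n. ?Q y x) = 1" if "x < n" for x
  using Q(2) that unfolding bistochastic_def entries_def dr by simp
 have le1: "?Q y x \<le> 1" for y x
 proof (cases "y < n \<and> x < n")
  case True
  have "?Q y x \<le> (\<Sum>x<n. ?Q y x)" by (rule member_le_sum) (use True nn in auto)
  then show ?thesis using row True by simp
 next
  case False
  then show ?thesis unfolding entries_def by auto
 qed
 let ?S = "\<lambda>x. {y. y < n \<and> (transpose_mat Q * Q) $$ (x, y) \<noteq> 0}"
 have Sd: "card (?S x) \<le> d" if "x < n" for x
 proof -
  have "d = Max ((\<lambda>x. card (?S x)) ` {..<n})"
   unfolding d_def norm_1_to_0_def using dr by (simp add: setcompr_eq_image lessThan_def)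
  then show ?thesis using that by (simp add: Max_ge)
 qed
 have Sq: "z \<in> ?S x" if "?Q k x \<noteq> 0" "?Q k z \<noteq> 0" for k x z
 proof -
  have b: "k < n" "x < n" "z < n" using that out by blast+
  have "0 < ?Q k x * ?Q k z" using that nn[of k x] nn[of k z] by (simp add: less_le)
  also have "\<dots> \<le> (\<Sum>k<n. ?Q k x * ?Q k z)" by (rule member_le_sum) (use b nn in auto)
  also have "\<dots> = (transpose_mat Q * Q) $$ (x, z)"
   using b Q(1) by (auto simp: scalar_prod_def entries_def atLeast0LessThan intro!: sum.cong)
  finally show ?thesis using b by simp
 qed
 have srow: "card {x. ?Q y x \<noteq> 0} \<le> d" for y
 proof (cases "{x. ?Q y x \<noteq> 0} = {}")
  case False
  then obtain x0 where x0: "?Q y x0 \<noteq> 0" by blast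
  have "card {x. ?Q y x \<noteq> 0} \<le> card (?S x0)" by (rule card_mono) (use Sq[OF x0] in auto)
  then show ?thesis using Sd[of x0] out[OF x0] by simp
 qed simp
 \<comment> \<open>The rows that meet column \<open>x\<close> have total mass
   \<open>card ?Y\<close>. This mass lies in the columns of \<open>?S x\<close>, each of which has
   mass 1.\<close>
 have scol: "card {y. ?Q y x \<noteq> 0} \<le> d" for x
 proof (cases "x < n")
  case True
  let ?Y = "{y. ?Q y x \<noteq> 0}"
  have Yn: "?Y \<subseteq> {..<n}" using out by blast
  have "real (card ?Y) = (\<Sum>y\<in>?Y. \<Sum>z<n. ?Q y z)" using row Yn by (simp add: subset_iff)
  also have "\<dots> = (\<Sum>y\<in>?Y. \<Sum>z\<in>?S x. ?Q y z)"
  proof (rule sum.cong[OF refl])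
   fix y assume y: "y \<in> ?Y"
   have "?Q y z = 0" if "z \<notin> ?S x" for z using Sq[of y x z] y that by blast
   then show "(\<Sum>z<n. ?Q y z) = (\<Sum>z\<in>?S x. ?Q y z)" by (intro sum.mono_neutral_right finite_lessThan) blast+
  qed
  also have "\<dots> \<le> (\<Sum>y<n. \<Sum>z\<in>?S x. ?Q y z)"
   by (rule sum_mono2) (use Yn nn in \<open>auto intro: sum_nonneg\<close>)
  also have "\<dots> = (\<Sum>z\<in>?S x. \<Sum>y<n. ?Q y z)" by (rule sum.swap)
  also have "\<dots> = card (?S x)" using col by simp
  finally show ?thesis using Sd[OF True] by simp
 next
  case False
  then have "{y. ?Q y x \<noteq> 0} = {}" using out by blast
  then show ?thesis by simp
 qed
 have hs: "(\<Sum>y<n. \<Sum>x<n. (?Q y x)\<^sup>2) = real n * (hs_norm Q)\<^sup>2"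
 proof -
  have "(\<Sum>y<n. \<Sum>x<n. (?Q y x)\<^sup>2) = (\<Sum>y<n. \<Sum>x<n. (norm (Q $$ (y, x)))\<^sup>2)"
   unfolding entries_def by (intro sum.cong) auto
  moreover have "(hs_norm Q)\<^sup>2 = 1 / real n * (\<Sum>y<n. \<Sum>x<n. (norm (Q $$ (y, x)))\<^sup>2)"
   unfolding hs_norm_def dr by (rule real_sqrt_pow2) (simp add: sum_nonneg)
  ultimately show ?thesis using n0 by simp
 qed
 have hs0: "0 \<le> hs_norm Q" unfolding hs_norm_def by (simp add: sum_nonneg)
 have hs1: "hs_norm Q \<le> 1"
 proof -
  have "real n * (hs_norm Q)\<^sup>2 \<le> (\<Sum>y<n. \<Sum>x<n. ?Q y x)"
   unfolding hs[symmetric] by (intro sum_mono) (use nn le1 in \<open>simp add: power2_eq_square mult_left_le\<close>)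
  also have "\<dots> = real n" using row by simp
  finally have "(hs_norm Q)\<^sup>2 \<le> 1\<^sup>2" using n0 by simp
  then show ?thesis by (rule power2_le_imp_le) simp
 qed
 \<comment> \<open>Cauchy-Schwarz on a row with at most \<open>d\<close> nonzero entries and sum 1,
   then the mean over all rows.\<close>
 have drho: "1 \<le> real d * \<rho>\<^sup>2"
 proof -
  have "1 \<le> real d * (\<Sum>x<n. (?Q y x)\<^sup>2)" if y: "y < n" for y
  proof -
   let ?X = "{x. ?Q y x \<noteq> 0}"
   have Xn: "?X \<subseteq> {..<n}" using out by blast
   have "(\<Sum>x<n. ?Q y x) = (\<Sum>x\<in>?X. 1 * ?Q y x)" by (rule sum.mono_neutral_cong_right) (use Xn in auto)
   then have "1 = (\<Sum>x\<in>?X. 1 * ?Q y x)\<^sup>2" using row[OF y] by simp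
   also have "\<dots> \<le> (\<Sum>x\<in>?X. 1\<^sup>2) * (\<Sum>x\<in>?X. (?Q y x)\<^sup>2)" by (rule Cauchy_Schwarz_ineq_sum)
   also have "\<dots> = real (card ?X) * (\<Sum>x<n. (?Q y x)\<^sup>2)"
    using sum.mono_neutral_cong_right[of "{..<n}" ?X "\<lambda>x. (?Q y x)\<^sup>2" "\<lambda>x. (?Q y x)\<^sup>2"] Xn by auto
   also have "\<dots> \<le> real d * (\<Sum>x<n. (?Q y x)\<^sup>2)" using srow[of y] by (intro mult_right_mono sum_nonneg) auto
   finally show ?thesis .
  qed
  then have "(\<Sum>y<n. 1) \<le> (\<Sum>y<n. real d * (\<Sum>x<n. (?Q y x)\<^sup>2))" by (intro sum_mono) auto
  then have "real n \<le> real d * (real n * (hs_norm Q)\<^sup>2)" unfolding sum_distrib_left[symmetric] hs by simp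
  then have "real n * 1 \<le> real n * (real d * (hs_norm Q)\<^sup>2)" by (simp add: mult_ac)
  then have "1 \<le> real d * (hs_norm Q)\<^sup>2" using n0 by (simp only: mult_le_cancel_left_pos)
  also have "\<dots> \<le> real d * \<rho>\<^sup>2" unfolding \<rho>_def using hs0 by (intro mult_left_mono power_mono) auto
  finally show ?thesis .
 qed
 let ?M = "\<lambda>E. Max {norm (Q $$ (y, x)) | x y. x \<in> {..<n} - E \<and> y \<in> {..<n}}"
 let ?adm = "{E. E \<subseteq> {..<n} \<and> real (card E) < real n powr (1 - \<delta>)}"
 have inf: "norm_1_to_inf \<delta> Q = Inf (?M ` ?adm)"
  unfolding norm_1_to_inf_def dr by (simp add: setcompr_eq_image)
 have fin: "finite (?M ` ?adm)" by (rule finite_imageI, rule finite_subset[of _ "Pow {..<n}"]) auto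
 have em: "{} \<in> ?adm" using n0 by simp
 have fe: "finite {norm (Q $$ (y, x)) | x y. x \<in> {..<n} - E \<and> y \<in> {..<n}}" for E
  by (rule finite_subset[of _ "(\<lambda>(x, y). norm (Q $$ (y, x))) ` ({..<n} \<times> {..<n})"]) auto
 \<comment> \<open>An infimum over a nonempty finite set is attained.\<close>
 have "Inf (?M ` ?adm) \<in> ?M ` ?adm"
  using cInf_eq_Min[OF fin] Min_in[OF fin] em by (metis (no_types, lifting) empty_iff image_eqI)
 then obtain E where E: "E \<in> ?adm" "norm_1_to_inf \<delta> Q = ?M E" unfolding inf by blast
 have Qle: "?Q y x \<le> \<rho>" if x: "x \<notin> E" for y x
 proof (cases "y < n \<and> x < n")
  case True
  have "norm (Q $$ (y, x)) \<le> ?M E" by (rule Max_ge[OF fe]) (use True x in auto)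
  moreover have "?M E \<le> \<rho>" unfolding \<rho>_def E(2)[symmetric] by simp
  ultimately show ?thesis using True unfolding entries_def by simp
 next
  case False
  then show ?thesis using hs0 unfolding entries_def \<rho>_def by auto
 qed
 have inf1: "norm_1_to_inf \<delta> Q \<le> 1"
 proof -
  have "Inf (?M ` ?adm) \<le> ?M {}" by (rule cInf_lower[OF imageI[OF em] bdd_below_finite[OF fin]])
  also have "?M {} \<le> 1"
  proof (subst Max_le_iff[OF fe])
   have "norm (Q $$ (0, 0)) \<in> {norm (Q $$ (y, x)) | x y. x \<in> {..<n} - {} \<and> y \<in> {..<n}}"
    by (rule CollectI, rule exI[of _ 0], rule exI[of _ 0]) (use n in auto)
   then show "{norm (Q $$ (y, x)) | x y. x \<in> {..<n} - {} \<and> y \<in> {..<n}} \<noteq> {}" by blast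
   show "\<forall>a\<in>{norm (Q $$ (y, x)) | x y. x \<in> {..<n} - {} \<and> y \<in> {..<n}}. a \<le> 1"
   proof
    fix a assume "a \<in> {norm (Q $$ (y, x)) | x y. x \<in> {..<n} - {} \<and> y \<in> {..<n}}"
    then obtain x y where "a = norm (Q $$ (y, x))" "x < n" "y < n" by auto
    then show "a \<le> 1" using le1[of y x] nn[of y x] unfolding entries_def by simp
   qed
  qed
  finally show ?thesis unfolding inf .
 qed
 have rho: "0 < \<rho>" "\<rho> \<le> 1"
 proof -
  have "0 \<le> \<rho>" unfolding \<rho>_def using hs0 by simp
  moreover have "\<rho> \<noteq> 0" using drho by auto
  ultimately show "0 < \<rho>" by simp
  show "\<rho> \<le> 1" unfolding \<rho>_def using hs1 inf1 by simp
 qed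
 have hsr: "(\<Sum>y<n. \<Sum>x<n. (?Q y x)\<^sup>2) \<le> real n * \<rho>\<^sup>2"
  unfolding hs \<rho>_def using hs0 by (intro mult_left_mono power_mono) auto
 have "sparse n d ?Q E \<rho>"
  by (rule sparse.intro)
   (use n in simp, rule nn, erule out, erule row, erule col, rule srow, rule scol, rule hsr, erule Qle, use E(1) in blast, rule rho(1), rule rho(2), rule drho, rule d2)
 moreover have "real (card E) \<le> real n powr (1 - \<delta>)" using E(1) by simp
 ultimately show ?thesis by blast
qed

theorem theorem5:
 fixes c\<^sub>0 \<delta> :: real
 assumes "0 < c\<^sub>0" and "c\<^sub>0 < \<delta>" and "\<delta> \<le> 1"
 shows "\<exists>c\<^sub>1::real. c\<^sub>1 > 0 \<and>
  (\<forall>(n::nat) (Q::real mat) (l::nat).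
   let d = norm_1_to_0 (transpose_mat Q * Q);
     \<rho> = max (hs_norm Q) (norm_1_to_inf \<delta> Q)
   in n \<ge> 1 \<longrightarrow> Q \<in> carrier_mat n n \<longrightarrow> bistochastic Q \<longrightarrow> d \<ge> 2 \<longrightarrow> l \<ge> 1 \<longrightarrow>
     measure_pmf.prob (pmf_of_set {\<sigma>. \<sigma> permutes {..<n}})
      {\<sigma>. let M = perm_mat n \<sigma>; P = M * Q
        in norm_ones_perp (P ^\<^sub>m l) \<ge> exp (c\<^sub>1 * sqrt (ln (real n))) * \<rho> ^ l}
     \<le> real d powr (real l + 50 * sqrt (ln (real n))) * real n powr (- c\<^sub>0))"
proof -
 define \<epsilon> where "\<epsilon> = (\<delta> - c\<^sub>0) / 8"
 define r0 where "r0 = nat \<lceil>3 / \<delta>\<rceil>"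
 define k where "k = real (20 + 21 * r0)"
 have eps: "0 < \<epsilon>" unfolding \<epsilon>_def using assms by simp
 obtain x0 where x0: "\<And>x. x0 \<le> x \<Longrightarrow> large \<epsilon> r0 x"
  using eventually_large[OF eps, of r0] unfolding eventually_at_top_linorder by blast
 \<comment> \<open>The first summand pays for at most \<open>2 * c\<^sub>0 / \<epsilon> + 1\<close>
   blocks at \<open>exp (k * x)\<close> each, the second one for the range \<open>x < x0\<close>,
   where \<open>large\<close> may fail.\<close>
 define c1 where "c1 = k * (2 * c\<^sub>0 / \<epsilon> + 1) + c\<^sub>0 * max 0 x0 + 1"
 have k20: "20 \<le> k" unfolding k_def by simp
 have pos: "0 \<le> k * (2 * c\<^sub>0 / \<epsilon> + 1)" "0 \<le> c\<^sub>0 * max 0 x0" using k20 assms eps by auto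
 then have c1: "0 < c1" unfolding c1_def by linarith
 have main: "measure_pmf.prob (pmf_of_set {\<sigma>. \<sigma> permutes {..<n}}) {\<sigma>. exp (c1 * sqrt (ln (real n))) * \<rho> ^ l \<le> norm_ones_perp ((perm_mat n \<sigma> * Q) ^\<^sub>m l)}
   \<le> real d powr (real l + 50 * sqrt (ln (real n))) * real n powr (- c\<^sub>0)"
  if h: "1 \<le> n" "Q \<in> carrier_mat n n" "bistochastic Q" "2 \<le> d" "1 \<le> l"
   and d: "d = norm_1_to_0 (transpose_mat Q * Q)" and \<rho>: "\<rho> = max (hs_norm Q) (norm_1_to_inf \<delta> Q)"
  for n :: nat and Q :: "real mat" and l d :: nat and \<rho> :: real
 proof -
  define x where "x = sqrt (ln (real n))"
  let ?rhs = "real d powr (real l + 50 * x) * real n powr (- c\<^sub>0)"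
  let ?ev = "\<lambda>\<sigma>. exp (c1 * x) * \<rho> ^ l \<le> norm_ones_perp ((perm_mat n \<sigma> * Q) ^\<^sub>m l)"
  obtain E where E: "sparse n d (entries n Q) E \<rho>" "card E \<le> real n powr (1 - \<delta>)"
   using bistochastic_sparse[OF h(1-3) assms(3)] h(4) unfolding d \<rho> by blast
  interpret sparse n d "entries n Q" E \<rho> by (rule E(1))
  \<comment> \<open>A row of \<open>Q^T Q\<close> with \<open>d \<ge> 2\<close> nonzero entries has
    at least two columns.\<close>
  have n2: "2 \<le> n"
  proof -
   have "d \<le> card {..<n}"
   proof -
    have "\<exists>y. card {z. z < n \<and> (transpose_mat Q * Q) $$ (y, z) \<noteq> 0} = d"
    proof -
     have "d = Max ((\<lambda>x. card {z. z < n \<and> (transpose_mat Q * Q) $$ (x, z) \<noteq> 0}) ` {..<n})"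
      unfolding d norm_1_to_0_def using h(2) by (simp add: setcompr_eq_image lessThan_def)
     moreover have "(\<lambda>x. card {z. z < n \<and> (transpose_mat Q * Q) $$ (x, z) \<noteq> 0}) ` {..<n} \<noteq> {}" using n_pos by auto
     ultimately have "d \<in> (\<lambda>x. card {z. z < n \<and> (transpose_mat Q * Q) $$ (x, z) \<noteq> 0}) ` {..<n}"
      using Max_in[of "(\<lambda>x. card {z. z < n \<and> (transpose_mat Q * Q) $$ (x, z) \<noteq> 0}) ` {..<n}"] by simp
     then show ?thesis by auto
    qed
    then obtain y where y: "card {z. z < n \<and> (transpose_mat Q * Q) $$ (y, z) \<noteq> 0} = d" by blast
    have "card {z. z < n \<and> (transpose_mat Q * Q) $$ (y, z) \<noteq> 0} \<le> card {..<n}" by (rule card_mono) auto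
    then show ?thesis using y by simp
   qed
   then show ?thesis using h(4) by simp
  qed
  have ln0: "0 < ln (real n)" using n2 by simp
  have x: "0 < x" "x\<^sup>2 = ln n" unfolding x_def using ln0 by auto
  have d1: "1 < real d" using h(4) by simp
  have lnd: "0 < ln (real d)" using d1 by simp
  have nlow: "real n powr (- c\<^sub>0) \<le> ?rhs"
  proof -
   have "1 \<le> real d powr (real l + 50 * x)" using d1 x by (intro ge_one_powr_ge_zero) auto
   then have "1 * real n powr (- c\<^sub>0) \<le> ?rhs" by (rule mult_right_mono) simp
   then show ?thesis by simp
  qed
  have rhs: "?rhs = exp ((real l + 50 * x) * ln d - c\<^sub>0 * x\<^sup>2)"
   unfolding powr_def x(2) using d1 n2 by (simp add: exp_add[symmetric])
  have goal: "pr n ?ev \<le> ?rhs"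
  \<comment> \<open>A probability is at most 1, so only a right-hand side below 1 matters. This
    bounds both \<open>l * ln d\<close> and \<open>ln d\<close>.\<close>
  proof (cases "1 \<le> ?rhs")
   case True
   have "pr n ?ev \<le> pr n (\<lambda>_. True)" by (rule pr_mono) simp
   also have "\<dots> = 1" unfolding pr_def by simp
   finally show ?thesis using True by linarith
  next
   case False
   then have "exp ((real l + 50 * x) * ln d - c\<^sub>0 * x\<^sup>2) < exp 0" unfolding rhs by simp
   then have lt: "(real l + 50 * x) * ln d < c\<^sub>0 * x\<^sup>2" unfolding exp_less_cancel_iff by simp
   have p1: "0 \<le> real l * ln d" "0 \<le> 50 * x * ln d" using lnd x by auto
   have ld: "real l * ln d < c\<^sub>0 * x\<^sup>2" using lt p1 by (simp add: distrib_right)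
   \<comment> \<open>Here the term \<open>50 * sqrt (ln n)\<close> in the exponent of
     \<open>d\<close> is used: it forces \<open>ln d \<le> x\<close>.\<close>
   have "50 * x * ln d < c\<^sub>0 * x\<^sup>2" using lt p1 by (simp add: distrib_right)
   then have "x * (50 * ln d) < x * (c\<^sub>0 * x)" by (simp add: power2_eq_square mult_ac)
   then have "50 * ln d < c\<^sub>0 * x" using x(1) by (simp only: mult_less_cancel_left_pos)
   also have "\<dots> \<le> 1 * x" using assms x by (intro mult_right_mono) auto
   finally have dx: "ln d \<le> x" using lnd by simp
   have Pc: "(perm_mat n \<sigma> * Q) ^\<^sub>m l \<in> carrier_mat n n" for \<sigma>
    by (rule pow_carrier_mat, rule mult_carrier_mat[OF _ h(2)]) (simp add: perm_mat_def)
   have rl: "0 < \<rho> ^ l" using rho by simp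
   show ?thesis
   proof (cases "x0 \<le> x")
    \<comment> \<open>For small \<open>x\<close> the event is empty. The norm is at most 1, so by
      \<open>\<rho> \<ge> d powr (-1/2)\<close> the event would give
      \<open>exp (2 * c1 * x) \<le> d ^ l\<close>, which is below
      \<open>exp (c\<^sub>0 * x\<^sup>2)\<close>; this contradicts
      \<open>c1 \<ge> c\<^sub>0 * x0\<close>.\<close>
    case False
    have "pr n ?ev \<le> pr n (\<lambda>_. False)"
    proof (rule pr_mono)
     fix \<sigma> assume sg: "\<sigma> \<in> perms n" and ev: "?ev \<sigma>"
     interpret walks n d "entries n Q" E \<rho> \<sigma> 0
      by (intro walks.intro walks_axioms.intro sparse_axioms) (use sg in \<open>simp add: perms_def\<close>)
     have P: "(\<lambda>x z. entries n Q (\<sigma> x) z) = P" by (intro ext) (simp add: P_def)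
     have "opb n (mpw n P l) 1" by (rule opb_schur) (use mpw_P in auto)
     then have "opb n (\<lambda>i j. ((perm_mat n \<sigma> * Q) ^\<^sub>m l) $$ (i, j) - 0) 1"
      by (rule opb_cong[rotated]) (use perm_mult_power[OF h(2) perm] P in simp)
     then have "norm_ones_perp ((perm_mat n \<sigma> * Q) ^\<^sub>m l) \<le> 1" by (rule norm_ones_perp_le[OF n2 Pc])
     then have "exp (c1 * x) * \<rho> ^ l \<le> 1" using ev by linarith
     then have "(exp (c1 * x) * \<rho> ^ l)\<^sup>2 \<le> 1" using rl by (intro power_le_one) auto
     then have "exp (2 * c1 * x) * (\<rho> ^ l)\<^sup>2 \<le> 1" by (simp add: power_mult_distrib exp_of_nat_mult[symmetric] mult_ac)
     then have h1: "real d ^ l * (exp (2 * c1 * x) * (\<rho> ^ l)\<^sup>2) \<le> real d ^ l * 1" by (intro mult_left_mono) auto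
     have "exp (2 * c1 * x) * 1 \<le> exp (2 * c1 * x) * (real d ^ l * (\<rho> ^ l)\<^sup>2)"
      using rho_pow_d[of l] by (intro mult_left_mono) auto
     also have "\<dots> = real d ^ l * (exp (2 * c1 * x) * (\<rho> ^ l)\<^sup>2)" by (simp only: mult_ac)
     also have "\<dots> \<le> real d ^ l * 1" by (rule h1)
     finally have "exp (2 * c1 * x) \<le> real d ^ l" by simp
     also have "real d ^ l = exp (real l * ln d)" using d1 by (simp add: exp_of_nat_mult)
     finally have "2 * c1 * x \<le> real l * ln d" by simp
     then have "x * (2 * c1) < x * (c\<^sub>0 * x)" using ld by (simp add: power2_eq_square mult_ac)
     then have "2 * c1 < c\<^sub>0 * x" using x(1) by (simp only: mult_less_cancel_left_pos)
     also have "\<dots> \<le> c\<^sub>0 * max 0 x0" using False assms by (intro mult_left_mono) auto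
     also have "\<dots> \<le> c1" unfolding c1_def using pos by linarith
     finally show False using c1 by linarith
    qed
    also have "\<dots> = 0" unfolding pr_def by simp
    finally show ?thesis by (rule order_trans) simp
   next
    case True
    note lg = x0[OF True]
    define L where "L = nat \<lfloor>\<epsilon> * x\<^sup>2 / ln d\<rfloor>"
    note gp = good_prob[OF assms E(2), folded x_def \<epsilon>_def r0_def, OF dx lg, folded L_def k_def]
    have x1: "1 \<le> x" using lg unfolding large_def by blast
    \<comment> \<open>As \<open>L \<ge> 1\<close>, rounding down loses at most a factor 2; this is
      the 2 in the bound for the number of blocks.\<close>
    have Lge: "\<epsilon> * x\<^sup>2 / ln d \<le> 2 * real L"
    proof -
     have e0: "0 \<le> \<epsilon> * x\<^sup>2 / ln d" using eps lnd by simp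
     have "1 \<le> real L" using gp(2) by simp
     moreover have "\<epsilon> * x\<^sup>2 / ln d < real L + 1" unfolding L_def using e0 by linarith
     ultimately show ?thesis by linarith
    qed
    define q where "q = l div L"
    have qle: "real q \<le> 2 * c\<^sub>0 / \<epsilon>"
    proof -
     have "real q * real L \<le> real l" unfolding q_def of_nat_mult[symmetric] of_nat_le_iff by (rule div_times_less_eq_dividend)
     then have "real q * (2 * real L) \<le> 2 * real l" by simp
     moreover have "real q * (\<epsilon> * x\<^sup>2 / ln d) \<le> real q * (2 * real L)" using Lge by (intro mult_left_mono) auto
     ultimately have "real q * (\<epsilon> * x\<^sup>2 / ln d) \<le> 2 * real l" by linarith
     then have "real q * (\<epsilon> * x\<^sup>2) \<le> 2 * (real l * ln d)" using lnd by (simp add: divide_le_eq mult_ac)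
     then have "x\<^sup>2 * (real q * \<epsilon>) \<le> x\<^sup>2 * (2 * c\<^sub>0)" using ld by (simp add: mult_ac)
     moreover have "0 < x\<^sup>2" using x(1) by simp
     ultimately have "real q * \<epsilon> \<le> 2 * c\<^sub>0" by (rule mult_left_le_imp_le)
     then show ?thesis using eps by (simp add: le_divide_eq)
    qed
    have "pr n ?ev \<le> pr n (\<lambda>\<sigma>. \<exists>s. 0 < s \<and> s \<le> L \<and> \<not> opb n (Jn \<sigma> s) (exp (k * x) * \<rho> ^ s))"
    proof (rule pr_mono, rule ccontr)
     fix \<sigma> assume sg: "\<sigma> \<in> perms n" and ev: "?ev \<sigma>"
      and no: "\<not> (\<exists>s. 0 < s \<and> s \<le> L \<and> \<not> opb n (Jn \<sigma> s) (exp (k * x) * \<rho> ^ s))"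
     have perm: "\<sigma> permutes {..<n}" using sg unfolding perms_def by simp
     have C: "2 \<le> exp (k * x)"
     proof -
      have "1 \<le> k * x" using mult_mono[of 1 k 1 x] k20 x1 by simp
      then show ?thesis using exp_ge_add_one_self[of "k * x"] by linarith
     qed
     have "opb n (Jn \<sigma> (q * L + l mod L)) (exp (k * x) ^ Suc q * \<rho> ^ (q * L + l mod L))"
      by (rule block_bound[OF sg C gp(2)]) (use no gp(2) in auto)
     then have "opb n (Jn \<sigma> l) (exp (k * x) ^ Suc q * \<rho> ^ l)" unfolding q_def by simp
     then have "opb n (\<lambda>i j. ((perm_mat n \<sigma> * Q) ^\<^sub>m l) $$ (i, j) - 1 / n) (exp (k * x) ^ Suc q * \<rho> ^ l)"
      by (rule opb_cong[rotated]) (simp add: perm_mult_power[OF h(2) perm])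
     then have "norm_ones_perp ((perm_mat n \<sigma> * Q) ^\<^sub>m l) \<le> exp (k * x) ^ Suc q * \<rho> ^ l"
      by (rule norm_ones_perp_le[OF n2 Pc])
     then have "exp (c1 * x) * \<rho> ^ l \<le> exp (k * x) ^ Suc q * \<rho> ^ l" using ev by linarith
     then have "exp (c1 * x) \<le> exp (k * x) ^ Suc q" using rl by (simp only: mult_le_cancel_right_pos)
     also have "\<dots> = exp (real (Suc q) * (k * x))" by (rule exp_of_nat_mult[symmetric])
     finally have "x * c1 \<le> x * (k * (real q + 1))" by (simp add: mult_ac add.commute)
     then have "c1 \<le> k * (real q + 1)" using x(1) by (simp only: mult_le_cancel_left_pos)
     also have "\<dots> \<le> k * (2 * c\<^sub>0 / \<epsilon> + 1)" using qle k20 by (intro mult_left_mono) auto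
     finally show False using pos(2) unfolding c1_def by linarith
    qed
    also have "\<dots> \<le> real n powr (- c\<^sub>0)" by (rule gp(1))
    finally show ?thesis using nlow by linarith
   qed
  qed
  then show ?thesis unfolding prob_perms x_def by simp
 qed
 show ?thesis
 proof (intro exI[of _ c1] conjI allI)
  show "0 < c1" by (rule c1)
  fix n :: nat and Q :: "real mat" and l :: nat
  show "let d = norm_1_to_0 (transpose_mat Q * Q);
     \<rho> = max (hs_norm Q) (norm_1_to_inf \<delta> Q)
   in n \<ge> 1 \<longrightarrow> Q \<in> carrier_mat n n \<longrightarrow> bistochastic Q \<longrightarrow> d \<ge> 2 \<longrightarrow> l \<ge> 1 \<longrightarrow>
     measure_pmf.prob (pmf_of_set {\<sigma>. \<sigma> permutes {..<n}})
      {\<sigma>. let M = perm_mat n \<sigma>; P = M * Q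
        in norm_ones_perp (P ^\<^sub>m l) \<ge> exp (c1 * sqrt (ln (real n))) * \<rho> ^ l}
     \<le> real d powr (real l + 50 * sqrt (ln (real n))) * real n powr (- c\<^sub>0)"
   unfolding Let_def by (intro impI, rule main[OF _ _ _ _ _ refl refl], assumption+)
 qed
qed

end
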